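(* Let $n\ge 3$. The Zariski closure in $\mathbb{P}H^0(\mathbb{P}^n,\bigwedge^2T\mathbb{P}^n)$ of the set of diagonal Poisson structures on $\mathbb{P}^n$ is an irreducible component of $\mathrm{Poisson}(\mathbb{P}^n)$.
   Context: A Poisson structure on a complex manifold $X$ is a holomorphic bivector field $\Pi\in H^0(X,\bigwedge^2 TX)$ with vanishing Schouten bracket $[\Pi,\Pi]=0$. For a projective manifold $X$, $\mathrm{Poisson}(X)=\{\Pi\in\mathbb{P}H^0(X,\bigwedge^2TX)\mid[\Pi,\Pi]=0\}$, a Zariski closed subset of the projective space $\mathbb{P}H^0(X,\bigwedge^2TX)$ of nonzero bivector fields up to scalars. A diagonal Poisson structure on $\mathbb{P}^n$ is any Poisson structure which is projectively equivalent (i.e. equivalent under an automorphism of $\mathbb{P}^n$) to the extension to $\mathbb{P}^n$ of a bivector field of the form $\sum_{i<j}c_{ij}x_ix_j\frac{\partial}{\partial x_i}\wedge\frac{\partial}{\partial x_j}$, $c_{ij}\in\mathbb{C}$, written in affine coordinates $(x_1,\dots,x_n)$ on $\mathbb{C}^n\subset\mathbb{P}^n$. *)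

theory Defs
  imports "HOL-Analysis.Analysis" "HOL-Combinatorics.Transposition" "HOL-Library.Function_Algebras"
begin

section \<open>Irreducible components of topological spaces\<close>

definition irreducible_space :: "'a topology \<Rightarrow> bool" where
  "irreducible_space X \<longleftrightarrow> topspace X \<noteq> {} \<and>
     (\<forall>A B. closedin X A \<and> closedin X B \<and> A \<union> B = topspace X \<longrightarrow> A = topspace X \<or> B = topspace X)"

definition irreducible_component :: "'a topology \<Rightarrow> 'a set \<Rightarrow> bool" where
  "irreducible_component X C \<longleftrightarrow>
     C \<subseteq> topspace X \<and> irreducible_space (subtopology X C) \<and>
     (\<forall>D. C \<subseteq> D \<and> D \<subseteq> topspace X \<and> irreducible_space (subtopology X D) \<longrightarrow> D = C)"


section \<open>Projectivization and its Zariski topology\<close>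

text \<open>Throughout this section, \<open>V\<close> is a complex vector space given as a subset, closed under
  addition and under the scalar multiplication \<open>sc\<close>, of an additive group.\<close>

definition proj_class :: "(complex \<Rightarrow> 'a \<Rightarrow> 'a) \<Rightarrow> 'a \<Rightarrow> 'a set" where
  "proj_class sc v = {sc c v |c. c \<noteq> 0}"

definition projectivization :: "(complex \<Rightarrow> 'a \<Rightarrow> 'a) \<Rightarrow> 'a::zero set \<Rightarrow> 'a set set" where
  "projectivization sc V = proj_class sc ` (V - {0})"

text \<open>Coordinate-free polynomial functions on \<open>V\<close>: the algebra generated by the linear functionals.
  Only the values on \<open>V\<close> matter.\<close>

inductive_set polynomial_functions ::
    "(complex \<Rightarrow> 'a \<Rightarrow> 'a) \<Rightarrow> 'a::ab_group_add set \<Rightarrow> ('a \<Rightarrow> complex) set"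
  for sc :: "complex \<Rightarrow> 'a \<Rightarrow> 'a" and V :: "'a set" where
  const: "(\<lambda>_. a) \<in> polynomial_functions sc V"
| linear: "(\<And>u v. u \<in> V \<Longrightarrow> v \<in> V \<Longrightarrow> l (u + v) = l u + l v) \<Longrightarrow>
     (\<And>c v. v \<in> V \<Longrightarrow> l (sc c v) = c * l v) \<Longrightarrow> l \<in> polynomial_functions sc V"
| add: "p \<in> polynomial_functions sc V \<Longrightarrow> q \<in> polynomial_functions sc V \<Longrightarrow>
     (\<lambda>v. p v + q v) \<in> polynomial_functions sc V"
| mult: "p \<in> polynomial_functions sc V \<Longrightarrow> q \<in> polynomial_functions sc V \<Longrightarrow>
     (\<lambda>v. p v * q v) \<in> polynomial_functions sc V"

definition homogeneous_polynomials ::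
    "(complex \<Rightarrow> 'a \<Rightarrow> 'a) \<Rightarrow> 'a::ab_group_add set \<Rightarrow> ('a \<Rightarrow> complex) set" where
  "homogeneous_polynomials sc V =
     {p \<in> polynomial_functions sc V. \<exists>d. \<forall>c. \<forall>v\<in>V. p (sc c v) = c ^ d * p v}"

definition zero_locus ::
    "(complex \<Rightarrow> 'a \<Rightarrow> 'a) \<Rightarrow> 'a::ab_group_add set \<Rightarrow> ('a \<Rightarrow> complex) set \<Rightarrow> 'a set set" where
  "zero_locus sc V F = {proj_class sc v |v. v \<in> V - {0} \<and> (\<forall>p\<in>F. p v = 0)}"

text \<open>The complements of hypersurfaces form a base of the Zariski topology; lemma
  \<open>closedin_zariski\<close> below shows that the closed sets are the common zero loci of sets of
  homogeneous polynomials.\<close>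

definition zariski :: "(complex \<Rightarrow> 'a \<Rightarrow> 'a) \<Rightarrow> 'a::ab_group_add set \<Rightarrow> 'a set topology" where
  "zariski sc V = topology_generated_by
     {projectivization sc V - zero_locus sc V {p} |p. p \<in> homogeneous_polynomials sc V}"


lemma proj_class_eq_imp:
  assumes "vector_space sc" "proj_class sc v = proj_class sc w"
  shows "\<exists>c. c \<noteq> 0 \<and> v = sc c w"
proof -
  interpret vector_space sc by fact
  have "v \<in> proj_class sc v"
    unfolding proj_class_def by (auto intro: exI[of _ 1])
  then show ?thesis
    unfolding assms(2) by (auto simp: proj_class_def)
qed

lemma proj_class_in_zero_locus:
  assumes sc: "vector_space sc" and F: "F \<subseteq> homogeneous_polynomials sc V" and v: "v \<in> V - {0}"
  shows "proj_class sc v \<in> zero_locus sc V F \<longleftrightarrow> (\<forall>p\<in>F. p v = 0)"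
proof
  assume "proj_class sc v \<in> zero_locus sc V F"
  then obtain w where w: "w \<in> V - {0}" "proj_class sc v = proj_class sc w" "\<forall>p\<in>F. p w = 0"
    unfolding zero_locus_def by blast
  obtain c where c: "v = sc c w"
    using proj_class_eq_imp[OF sc w(2)] by blast
  show "\<forall>p\<in>F. p v = 0"
  proof
    fix p assume "p \<in> F"
    then obtain d where "\<forall>c. \<forall>v\<in>V. p (sc c v) = c ^ d * p v"
      using F unfolding homogeneous_polynomials_def by blast
    then show "p v = 0" using w \<open>p \<in> F\<close> c by auto
  qed
qed (use v in \<open>auto simp: zero_locus_def\<close>)

lemma homogeneous_polynomials_mult:
  assumes "p \<in> homogeneous_polynomials sc V" "q \<in> homogeneous_polynomials sc V"
  shows "(\<lambda>v. p v * q v) \<in> homogeneous_polynomials sc V"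
proof -
  obtain d e where "\<forall>c. \<forall>v\<in>V. p (sc c v) = c ^ d * p v" "\<forall>c. \<forall>v\<in>V. q (sc c v) = c ^ e * q v"
    using assms unfolding homogeneous_polynomials_def by blast
  then have "\<forall>c. \<forall>v\<in>V. p (sc c v) * q (sc c v) = c ^ (d + e) * (p v * q v)"
    by (simp add: power_add)
  then show ?thesis
    using assms unfolding homogeneous_polynomials_def by (blast intro: polynomial_functions.mult)
qed

lemma zero_locus_subset: "zero_locus sc V F \<subseteq> projectivization sc V"
  by (auto simp: zero_locus_def projectivization_def)

lemma zero_locus_Int:
  assumes "vector_space sc" "\<And>F. F \<in> \<F> \<Longrightarrow> F \<subseteq> homogeneous_polynomials sc V"
  shows "projectivization sc V \<inter> (\<Inter>F\<in>\<F>. zero_locus sc V F) = zero_locus sc V (\<Union>\<F>)"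
proof -
  have U: "\<Union>\<F> \<subseteq> homogeneous_polynomials sc V" using assms(2) by blast
  have "proj_class sc v \<in> zero_locus sc V F \<longleftrightarrow> (\<forall>p\<in>F. p v = 0)" if "v \<in> V - {0}" "F \<in> \<F>" for v F
    using proj_class_in_zero_locus[OF assms(1) assms(2)[OF that(2)] that(1)] .
  then have *: "(\<forall>F\<in>\<F>. proj_class sc v \<in> zero_locus sc V F) \<longleftrightarrow> proj_class sc v \<in> zero_locus sc V (\<Union>\<F>)"
    if "v \<in> V - {0}" for v
    using that by (simp add: proj_class_in_zero_locus[OF assms(1) U that])
  show ?thesis
  proof (rule set_eqI)
    fix S
    show "S \<in> projectivization sc V \<inter> (\<Inter>F\<in>\<F>. zero_locus sc V F) \<longleftrightarrow> S \<in> zero_locus sc V (\<Union>\<F>)"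
    proof (cases "S \<in> projectivization sc V")
      case True
      then obtain v where v: "S = proj_class sc v" "v \<in> V - {0}"
        unfolding projectivization_def by (rule imageE)
      show ?thesis using True *[OF v(2)] by (simp add: v(1))
    next
      case False
      then show ?thesis using zero_locus_subset[of sc V "\<Union>\<F>"] by blast
    qed
  qed
qed

lemma zero_locus_Un:
  assumes "vector_space sc" "F \<subseteq> homogeneous_polynomials sc V" "G \<subseteq> homogeneous_polynomials sc V"
  shows "zero_locus sc V F \<union> zero_locus sc V G = zero_locus sc V {\<lambda>v. p v * q v |p q. p \<in> F \<and> q \<in> G}"
    (is "?L = ?R")
proof -
  let ?H = "{\<lambda>v. p v * q v |p q. p \<in> F \<and> q \<in> G}"
  have H: "?H \<subseteq> homogeneous_polynomials sc V"
    using assms homogeneous_polynomials_mult by blast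
  have *: "proj_class sc v \<in> ?L \<longleftrightarrow> proj_class sc v \<in> ?R" if "v \<in> V - {0}" for v
  proof -
    have "(\<forall>p\<in>F. p v = 0) \<or> (\<forall>q\<in>G. q v = 0) \<longleftrightarrow> (\<forall>h\<in>?H. h v = 0)"
    proof
      assume h: "\<forall>h\<in>?H. h v = 0"
      have "p v * q v = 0" if "p \<in> F" "q \<in> G" for p q
        using h[rule_format, of "\<lambda>v. p v * q v"] that by blast
      then show "(\<forall>p\<in>F. p v = 0) \<or> (\<forall>q\<in>G. q v = 0)" by (meson mult_eq_0_iff)
    qed auto
    then show ?thesis
      unfolding Un_iff proj_class_in_zero_locus[OF assms(1) H that]
        proj_class_in_zero_locus[OF assms(1,2) that] proj_class_in_zero_locus[OF assms(1,3) that] .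
  qed
  have **: "S \<in> proj_class sc ` (V - {0})" if "S \<in> ?L \<or> S \<in> ?R" for S
    using that by (auto simp: zero_locus_def)
  show ?thesis
  proof (rule set_eqI)
    fix S
    show "S \<in> ?L \<longleftrightarrow> S \<in> ?R"
    proof (cases "S \<in> proj_class sc ` (V - {0})")
      case True
      then obtain v where "S = proj_class sc v" "v \<in> V - {0}" by (rule imageE)
      then show ?thesis using * by simp
    next
      case False
      then show ?thesis using ** by iprover
    qed
  qed
qed

lemma topspace_zariski: "topspace (zariski sc V) = projectivization sc V"
proof -
  let ?P = "projectivization sc V"
  have "(\<lambda>_. 1) \<in> homogeneous_polynomials sc V"
    unfolding homogeneous_polynomials_def by (auto intro: polynomial_functions.const exI[of _ 0])
  then have "?P - zero_locus sc V {\<lambda>_. 1} \<in> {?P - zero_locus sc V {p} |p. p \<in> homogeneous_polynomials sc V}"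
    (is "_ \<in> ?B") by blast
  moreover have "zero_locus sc V {\<lambda>_. 1} = {}" by (auto simp: zero_locus_def)
  ultimately show ?thesis
    unfolding zariski_def topology_generated_by_topspace
    by (intro equalityI Union_least) auto
qed

lemma closedin_zariski:
  assumes sc: "vector_space sc"
  shows "closedin (zariski sc V) S \<longleftrightarrow> (\<exists>F \<subseteq> homogeneous_polynomials sc V. S = zero_locus sc V F)"
proof
  let ?P = "projectivization sc V" and ?Z = "zero_locus sc V" and ?H = "homogeneous_polynomials sc V"
  let ?B = "{?P - ?Z {p} |p. p \<in> ?H}"
  have *: "\<exists>F \<subseteq> ?H. ?P - U = ?Z F" if "generate_topology_on ?B U" for U
    using that
  proof (induction rule: generate_topology_on.induct)
    case Empty
    have "?P - {} = ?Z {}" by (auto simp: zero_locus_def projectivization_def)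
    then show ?case by (intro exI[of _ "{}"] conjI) simp_all
  next
    case (Int a b)
    then obtain F G where FG: "F \<subseteq> ?H" "?P - a = ?Z F" "G \<subseteq> ?H" "?P - b = ?Z G" by blast
    have "?P - (a \<inter> b) = ?Z {\<lambda>v. p v * q v |p q. p \<in> F \<and> q \<in> G}"
      unfolding Diff_Int FG(2,4) by (rule zero_locus_Un[OF sc FG(1,3)])
    moreover have "{\<lambda>v. p v * q v |p q. p \<in> F \<and> q \<in> G} \<subseteq> ?H"
      using FG homogeneous_polynomials_mult by blast
    ultimately show ?case by (intro exI conjI)
  next
    case (UN K)
    then obtain F where F: "\<And>k. k \<in> K \<Longrightarrow> F k \<subseteq> ?H \<and> ?P - k = ?Z (F k)" by metis
    have "?P - \<Union>K = ?P \<inter> (\<Inter>k\<in>K. ?Z (F k))" using F by blast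
    also have "\<dots> = ?Z (\<Union>(F ` K))"
      by (subst zero_locus_Int[OF sc, symmetric]) (use F in \<open>auto simp: image_image\<close>)
    finally have "?P - \<Union>K = ?Z (\<Union>(F ` K))" .
    moreover have "\<Union>(F ` K) \<subseteq> ?H" using F by blast
    ultimately show ?case by (intro exI conjI)
  next
    case (Basis s)
    then obtain p where p: "p \<in> ?H" "s = ?P - ?Z {p}" by blast
    then have "?P - s = ?Z {p}" using zero_locus_subset[of sc V "{p}"] by blast
    then show ?case using p by blast
  qed
  assume "closedin (zariski sc V) S"
  then have "S \<subseteq> ?P" "openin (zariski sc V) (?P - S)"
    by (auto simp: closedin_def topspace_zariski)
  moreover from this have "?P - (?P - S) = S" by blast
  ultimately show "\<exists>F \<subseteq> ?H. S = ?Z F"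
    using *[of "?P - S"] unfolding zariski_def openin_topology_generated_by_iff by auto
next
  let ?P = "projectivization sc V" and ?Z = "zero_locus sc V" and ?H = "homogeneous_polynomials sc V"
  assume "\<exists>F \<subseteq> ?H. S = ?Z F"
  then obtain F where F: "F \<subseteq> ?H" "S = ?Z F" by blast
  have basic: "closedin (zariski sc V) (?Z {p})" if "p \<in> ?H" for p
    unfolding closedin_def topspace_zariski
    using that zero_locus_subset unfolding zariski_def
    by (auto intro!: topology_generated_by_Basis)
  have "S = ?P \<inter> (\<Inter>G\<in>(\<lambda>p. {p}) ` F. ?Z G)"
    unfolding F(2) by (subst zero_locus_Int[OF sc]) (use F(1) in auto)
  then have "S = \<Inter>(insert ?P ((\<lambda>p. ?Z {p}) ` F))" by simp
  moreover have "closedin (zariski sc V) (\<Inter>(insert ?P ((\<lambda>p. ?Z {p}) ` F)))"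
    using F(1) basic closedin_topspace[of "zariski sc V"]
    by (intro closedin_Inter) (auto simp: topspace_zariski)
  ultimately show "closedin (zariski sc V) S" by (simp only:)
qed


section \<open>Holomorphic functions on open subsets of complex n-space\<close>

text \<open>Complex differentiability at one point; holomorphy is this condition at all points of an open
  set, and is used only in that way.\<close>

definition holomorphic_at :: "(complex ^ 'n::finite \<Rightarrow> complex) \<Rightarrow> complex ^ 'n \<Rightarrow> bool" where
  "holomorphic_at f x \<longleftrightarrow>
     (\<exists>a :: complex ^ 'n. (f has_derivative (\<lambda>v. \<Sum>i\<in>UNIV. a $ i * v $ i)) (at x))"

definition partial_deriv :: "'n \<Rightarrow> (complex ^ 'n::finite \<Rightarrow> complex) \<Rightarrow> complex ^ 'n \<Rightarrow> complex" where
  "partial_deriv i f x = deriv (\<lambda>t. f (x + t *s axis i 1)) 0"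

definition complex_jacobian ::
    "(complex ^ 'n::finite \<Rightarrow> complex ^ 'n) \<Rightarrow> complex ^ 'n \<Rightarrow> complex ^ 'n ^ 'n" where
  "complex_jacobian g x = (\<chi> a i. partial_deriv i (\<lambda>y. g y $ a) x)"


section \<open>Complex projective space\<close>

text \<open>Homogeneous coordinates on the n-dimensional projective space, n being the cardinality of
  \<open>'n\<close>, are indexed by \<open>'n option\<close>, with \<open>None\<close> in the role of the index 0.\<close>

definition proj_space :: "(complex ^ 'n::finite option) set set" where
  "proj_space = projectivization (*s) UNIV"

text \<open>The inverse of the standard affine chart on the locus where the \<open>k\<close>-th homogeneous coordinate
  does not vanish: the \<open>k\<close>-th homogeneous coordinate is 1 and the others are the affine coordinates.
  The latter are indexed by \<open>'n\<close> in every chart; in the chart \<open>Some k\<close> the affine coordinate of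
  index \<open>k\<close> is the homogeneous coordinate of index \<open>None\<close>, whose place has become free.\<close>

definition affine_lift :: "'n option \<Rightarrow> complex ^ 'n::finite \<Rightarrow> complex ^ 'n option" where
  "affine_lift k x = (\<chi> j. case Transposition.transpose None k j of None \<Rightarrow> 1 | Some i \<Rightarrow> x $ i)"

definition affine_point :: "'n option \<Rightarrow> complex ^ 'n::finite \<Rightarrow> (complex ^ 'n option) set" where
  "affine_point k x = proj_class (*s) (affine_lift k x)"

text \<open>The expression in the charts \<open>k\<close> (source) and \<open>l\<close> (target) of a self-map of projective space;
  it is meaningful on the domain \<open>chart_domain f k l\<close>.\<close>

definition chart_expr ::
    "((complex ^ 'n::finite option) set \<Rightarrow> (complex ^ 'n option) set) \<Rightarrow> 'n option \<Rightarrow> 'n option \<Rightarrow>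
     complex ^ 'n \<Rightarrow> complex ^ 'n" where
  "chart_expr f k l x = inv (affine_point l) (f (affine_point k x))"

definition chart_domain ::
    "((complex ^ 'n::finite option) set \<Rightarrow> (complex ^ 'n option) set) \<Rightarrow> 'n option \<Rightarrow> 'n option \<Rightarrow>
     (complex ^ 'n) set" where
  "chart_domain f k l = {x. f (affine_point k x) \<in> range (affine_point l)}"

text \<open>Openness of the chart domains amounts to continuity of the map.\<close>

definition holomorphic_self_map ::
    "((complex ^ 'n::finite option) set \<Rightarrow> (complex ^ 'n option) set) \<Rightarrow> bool" where
  "holomorphic_self_map f \<longleftrightarrow> f ` proj_space \<subseteq> proj_space \<and>
     (\<forall>k l. open (chart_domain f k l) \<and>
        (\<forall>x\<in>chart_domain f k l. \<forall>a. holomorphic_at (\<lambda>y. chart_expr f k l y $ a) x))"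

definition proj_automorphism ::
    "((complex ^ 'n::finite option) set \<Rightarrow> (complex ^ 'n option) set) \<Rightarrow> bool" where
  "proj_automorphism f \<longleftrightarrow> bij_betw f proj_space proj_space \<and>
     holomorphic_self_map f \<and> holomorphic_self_map (inv_into proj_space f)"


section \<open>Bivector fields and Poisson structures on projective space\<close>

text \<open>A bivector field is given by its expressions in the affine charts. The skew-symmetric matrix
  \<open>b\<close> stands for the bivector \<open>\<Sum>i<j. b\<^sub>i\<^sub>j \<partial>\<^sub>i \<and> \<partial>\<^sub>j\<close> with respect to the coordinates of the chart;
  a linear map with matrix \<open>J\<close> sends it to \<open>J b J\<^sup>T\<close>.\<close>

type_synonym 'n bivector = "'n option \<Rightarrow> complex ^ 'n \<Rightarrow> complex ^ 'n ^ 'n"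

definition bivector_scale :: "complex \<Rightarrow> 'n::finite bivector \<Rightarrow> 'n bivector" where
  "bivector_scale c \<sigma> = (\<lambda>k x. \<chi> i j. c * \<sigma> k x $ i $ j)"

lemma vector_space_bivector_scale: "vector_space bivector_scale"
  by unfold_locales (auto simp: bivector_scale_def fun_eq_iff vec_eq_iff algebra_simps)

definition pushes_forward ::
    "((complex ^ 'n::finite option) set \<Rightarrow> (complex ^ 'n option) set) \<Rightarrow> 'n bivector \<Rightarrow> 'n bivector \<Rightarrow> bool" where
  "pushes_forward f \<sigma> \<tau> \<longleftrightarrow> (\<forall>k l. \<forall>x\<in>chart_domain f k l.
     \<tau> l (chart_expr f k l x) =
       complex_jacobian (chart_expr f k l) x ** \<sigma> k x ** transpose (complex_jacobian (chart_expr f k l) x))"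

text \<open>The space of global holomorphic bivector fields. The condition on the identity says that the
  local expressions are related by the coordinate changes, i.e. that they glue.\<close>

definition bivector_fields :: "'n::finite bivector set" where
  "bivector_fields = {\<sigma>.
     (\<forall>k x. transpose (\<sigma> k x) = - \<sigma> k x) \<and>
     (\<forall>k i j x. holomorphic_at (\<lambda>y. \<sigma> k y $ i $ j) x) \<and>
     pushes_forward id \<sigma> \<sigma>}"

text \<open>The coefficient of \<open>\<partial>\<^sub>i \<and> \<partial>\<^sub>j \<and> \<partial>\<^sub>m\<close> in the Schouten bracket of two bivector fields on complex
  n-space, normalized by
  \<open>[X\<^sub>1 \<and> X\<^sub>2, Y\<^sub>1 \<and> Y\<^sub>2] = \<Sum>a b. (-1)\<^sup>a\<^sup>+\<^sup>b [X\<^sub>a, Y\<^sub>b] \<and> X\<^sub>3\<^sub>-\<^sub>a \<and> Y\<^sub>3\<^sub>-\<^sub>b\<close>.\<close>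

definition schouten ::
    "(complex ^ 'n::finite \<Rightarrow> complex ^ 'n ^ 'n) \<Rightarrow> (complex ^ 'n \<Rightarrow> complex ^ 'n ^ 'n) \<Rightarrow>
     complex ^ 'n \<Rightarrow> 'n \<Rightarrow> 'n \<Rightarrow> 'n \<Rightarrow> complex" where
  "schouten P Q x i j m = (\<Sum>l\<in>UNIV.
       P x $ i $ l * partial_deriv l (\<lambda>y. Q y $ j $ m) x + Q x $ i $ l * partial_deriv l (\<lambda>y. P y $ j $ m) x
     + P x $ j $ l * partial_deriv l (\<lambda>y. Q y $ m $ i) x + Q x $ j $ l * partial_deriv l (\<lambda>y. P y $ m $ i) x
     + P x $ m $ l * partial_deriv l (\<lambda>y. Q y $ i $ j) x + Q x $ m $ l * partial_deriv l (\<lambda>y. P y $ i $ j) x)"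

definition is_poisson :: "'n::finite bivector \<Rightarrow> bool" where
  "is_poisson \<sigma> \<longleftrightarrow> \<sigma> \<in> bivector_fields \<and> (\<forall>k x i j m. schouten (\<sigma> k) (\<sigma> k) x i j m = 0)"

definition poisson_space :: "'n::finite bivector set set" where
  "poisson_space = {proj_class bivector_scale \<sigma> |\<sigma>. \<sigma> \<noteq> 0 \<and> is_poisson \<sigma>}"

text \<open>The bivector field \<open>\<Sum>i<j. c\<^sub>i\<^sub>j x\<^sub>i x\<^sub>j \<partial>\<^sub>i \<and> \<partial>\<^sub>j\<close> has as its coefficient matrix
  \<open>c\<^sub>i\<^sub>j x\<^sub>i x\<^sub>j\<close> with \<open>c\<close> extended skew-symmetrically to all pairs of indices.\<close>

definition extends_diagonal :: "'n::finite bivector \<Rightarrow> bool" where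
  "extends_diagonal \<sigma> \<longleftrightarrow> \<sigma> \<in> bivector_fields \<and>
     (\<exists>c :: complex ^ 'n ^ 'n. transpose c = - c \<and>
        (\<forall>x. \<sigma> None x = (\<chi> i j. c $ i $ j * x $ i * x $ j)))"

definition is_diagonal_poisson :: "'n::finite bivector \<Rightarrow> bool" where
  "is_diagonal_poisson \<tau> \<longleftrightarrow> is_poisson \<tau> \<and>
     (\<exists>f \<sigma>. proj_automorphism f \<and> extends_diagonal \<sigma> \<and> pushes_forward f \<sigma> \<tau>)"

definition diagonal_poisson_space :: "'n::finite bivector set set" where
  "diagonal_poisson_space = {proj_class bivector_scale \<tau> |\<tau>. \<tau> \<noteq> 0 \<and> is_diagonal_poisson \<tau>}"

definition bivector_zariski :: "'n::finite bivector set topology" where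
  "bivector_zariski = zariski bivector_scale bivector_fields"

end

theory Submission
  imports Defs "HOL-Complex_Analysis.Complex_Analysis" "HOL-Computational_Algebra.Polynomial"
begin

text \<open>
  Let \<open>n\<close> be the dimension, and call diagonal the classes of diagonal Poisson structures.  Every member of
  \<open>poisson_space\<close> satisfies the quadratic equations \<open>[\<sigma>, \<sigma>] = 0\<close>, so at a diagonal structure \<open>\<sigma>\<^sub>0\<close> its
  Zariski tangent space lies in the kernel of \<open>\<tau> \<mapsto> [\<sigma>\<^sub>0, \<tau>]\<close>.  For a generic diagonal \<open>\<sigma>\<^sub>0\<close> each element of
  this kernel is tangent to an arc of diagonal structures.  Hence near \<open>\<sigma>\<^sub>0\<close> there are no Poisson structures
  outside the closure of the diagonal ones, and this closure, being irreducible, is a component.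

  The passage from tangent vectors to components is \<open>irreducible_component_criterion\<close>.  A polynomial that
  vanishes on the arcs vanishes on the Poisson cone to every order at \<open>\<sigma>\<^sub>0\<close> (\<open>smooth_point\<close>), so Krull's
  intersection theorem (\<open>krull_intersection\<close>, with \<open>hilbert_basis\<close> behind it) gives a polynomial which is not
  zero at \<open>\<sigma>\<^sub>0\<close> and whose product with the given one vanishes on the whole cone.

  The kernel is computed on the torus of points with nonzero affine coordinates.  Growth estimates in the
  affine charts show that a global bivector field has the form \<open>\<Sum>u. x\<^sup>u B\<^sub>u\<close> with finitely many weights \<open>u\<close> and
  coefficients \<open>B\<^sub>u\<close> that are constant in the frame \<open>x\<^sub>i \<partial>\<^sub>i\<close> (\<open>bivector_structure\<close>).  If \<open>\<sigma>\<^sub>0\<close> has the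
  coefficient matrix \<open>c\<close>, its bracket with \<open>x\<^sup>u B\<^sub>u\<close> is \<open>x\<^sup>u v \<and> B\<^sub>u\<close> with \<open>v = c u\<close> up to a constant factor
  (\<open>schouten_diagonal\<close>).  So the kernel is spanned by weight vectors, and for a weight \<open>u \<noteq> 0\<close> the coefficient
  \<open>B\<^sub>u\<close> is divisible by \<open>v\<close>.  The weights that occur in global bivector fields and the genericity of \<open>c\<close> leave
  only the roots \<open>u = e\<^sub>d - e\<^sub>a\<close> of the projective linear group and one bivector for each of them
  (\<open>tangent_weight\<close>).  It is the Lie derivative of \<open>\<sigma>\<^sub>0\<close> along the vector field of an elementary matrix, and
  \<open>u = 0\<close> gives a change of \<open>c\<close>; both are tangent to arcs of diagonal structures (\<open>tangent_arc\<close>).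

  The definition of a diagonal structure allows all holomorphic automorphisms of projective space.
  By \<open>diagonal_poisson_iff\<close> the linear ones suffice: an automorphism carries global vector fields to
  global vector fields, these come from matrices (\<open>global_field_linear\<close>), and the image of the vector field
  of a diagonal matrix with distinct eigenvalues has only finitely many zeros, namely the images of the
  coordinate points; they span a frame in which the image of the whole diagonal structure is again diagonal.
  With linear coordinate changes \<open>g\<close> the diagonal structures are parametrized by pairs \<open>(g, c)\<close>, and
  irreducibility follows by joining two such pairs by a line (\<open>irreducible_diagonal_closure\<close>).
\<close>

no_notation fps_nth (infixl "$" 75)

section \<open>Noetherian rings and Krull's intersection theorem\<close>

definition is_subring :: "'a::comm_ring_1 set \<Rightarrow> bool" where
  "is_subring S \<longleftrightarrow> 0 \<in> S \<and> 1 \<in> S \<and> (\<forall>a\<in>S. \<forall>b\<in>S. a + b \<in> S \<and> a * b \<in> S \<and> - a \<in> S)"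

definition ideal_in :: "'a::comm_ring_1 set \<Rightarrow> 'a set \<Rightarrow> bool" where
  "ideal_in S J \<longleftrightarrow> J \<subseteq> S \<and> 0 \<in> J \<and> (\<forall>a\<in>J. \<forall>b\<in>J. a + b \<in> J) \<and> (\<forall>r\<in>S. \<forall>a\<in>J. r * a \<in> J)"

definition noetherian :: "'a::comm_ring_1 set \<Rightarrow> bool" where
  "noetherian S \<longleftrightarrow> (\<forall>J :: nat \<Rightarrow> 'a set. (\<forall>k. ideal_in S (J k)) \<and> (\<forall>k. J k \<subseteq> J (Suc k))
     \<longrightarrow> (\<exists>n. \<forall>m\<ge>n. J m = J n))"

definition polys_over :: "'a::comm_ring_1 set \<Rightarrow> 'a poly set" where
  "polys_over S = {p. \<forall>i. coeff p i \<in> S}"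

definition adjoin :: "'a::comm_ring_1 set \<Rightarrow> 'a \<Rightarrow> 'a set" where
  "adjoin S f = (\<lambda>p. poly p f) ` polys_over S"

lemma is_subring_sum:
  assumes "is_subring S" "\<And>i. i \<in> I \<Longrightarrow> f i \<in> S"
  shows "sum f I \<in> S"
  using assms(2) by (induction I rule: infinite_finite_induct) (use assms(1) in \<open>auto simp: is_subring_def\<close>)

lemma is_subring_diff: "is_subring S \<Longrightarrow> a \<in> S \<Longrightarrow> b \<in> S \<Longrightarrow> a - b \<in> S"
  unfolding is_subring_def by (metis add_uminus_conv_diff)

lemma polys_over_closed:
  assumes S: "is_subring S" and "p \<in> polys_over S" "q \<in> polys_over S"
  shows "p + q \<in> polys_over S" "p * q \<in> polys_over S" "- p \<in> polys_over S" "p - q \<in> polys_over S"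
proof -
  show "p + q \<in> polys_over S" "- p \<in> polys_over S" "p - q \<in> polys_over S"
    using assms is_subring_diff[OF S] by (auto simp: polys_over_def is_subring_def)
  show "p * q \<in> polys_over S"
    unfolding polys_over_def mem_Collect_eq coeff_mult
    by (intro allI is_subring_sum[OF S]) (use assms in \<open>auto simp: polys_over_def is_subring_def\<close>)
qed

lemma polys_over_pCons: "c \<in> S \<Longrightarrow> p \<in> polys_over S \<Longrightarrow> pCons c p \<in> polys_over S"
  by (auto simp: polys_over_def coeff_pCons split: nat.splits)

lemma polys_over_0: "is_subring S \<Longrightarrow> 0 \<in> polys_over S"
  by (simp add: polys_over_def is_subring_def)

lemma subset_adjoin:
  assumes "is_subring S"
  shows "S \<subseteq> adjoin S f"
proof
  fix c assume "c \<in> S"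
  then have "[:c:] \<in> polys_over S" by (intro polys_over_pCons polys_over_0 assms)
  then show "c \<in> adjoin S f" unfolding adjoin_def by (rule rev_image_eqI) simp
qed

lemma generator_in_adjoin:
  assumes "is_subring S"
  shows "f \<in> adjoin S f"
proof -
  have "[:0, 1:] \<in> polys_over S"
    using assms by (intro polys_over_pCons polys_over_0) (auto simp: is_subring_def)
  then show ?thesis unfolding adjoin_def by (rule rev_image_eqI) simp
qed

lemma is_subring_adjoin:
  assumes S: "is_subring S"
  shows "is_subring (adjoin S f)"
  unfolding is_subring_def
proof (intro conjI ballI)
  show "0 \<in> adjoin S f" "1 \<in> adjoin S f"
    using subset_adjoin[OF S] S unfolding is_subring_def by auto
  fix a b assume "a \<in> adjoin S f" "b \<in> adjoin S f"
  then obtain p q where pq: "p \<in> polys_over S" "a = poly p f" "q \<in> polys_over S" "b = poly q f"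
    unfolding adjoin_def by blast
  show "a + b \<in> adjoin S f" "a * b \<in> adjoin S f" "- a \<in> adjoin S f"
    unfolding adjoin_def pq(2,4)
    using polys_over_closed[OF S pq(1,3)] by (auto intro: rev_image_eqI)
qed

lemma adjoin_least:
  assumes "is_subring R" "S \<subseteq> R" "f \<in> R"
  shows "adjoin S f \<subseteq> R"
proof -
  have pow: "f ^ i \<in> R" for i
    by (induction i) (use assms in \<open>auto simp: is_subring_def\<close>)
  show ?thesis
    unfolding adjoin_def poly_altdef
  proof (intro image_subsetI is_subring_sum[OF assms(1)])
    fix p i assume "p \<in> polys_over S"
    then have "coeff p i \<in> R" using assms(2) by (auto simp: polys_over_def)
    then show "coeff p i * f ^ i \<in> R" using pow assms(1) by (auto simp: is_subring_def)
  qed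
qed

text \<open>As \<open>f\<close> may be algebraic over \<open>S\<close>, the leading coefficient belongs to a polynomial and not to its value;
  the coefficient may vanish.\<close>

definition leading_ideal :: "'a::comm_ring_1 set \<Rightarrow> 'a \<Rightarrow> nat \<Rightarrow> 'a set \<Rightarrow> 'a set" where
  "leading_ideal S f d J = {coeff p d |p. p \<in> polys_over S \<and> degree p \<le> d \<and> poly p f \<in> J}"

lemma ideal_in_leading_ideal:
  assumes S: "is_subring S" and J: "ideal_in (adjoin S f) J"
  shows "ideal_in S (leading_ideal S f d J)"
  unfolding ideal_in_def
proof (intro conjI ballI)
  show "leading_ideal S f d J \<subseteq> S" by (auto simp: leading_ideal_def polys_over_def)
  show "0 \<in> leading_ideal S f d J"
    unfolding leading_ideal_def
    using polys_over_0[OF S] J by (auto simp: ideal_in_def intro!: exI[of _ 0])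
next
  fix a b assume "a \<in> leading_ideal S f d J" "b \<in> leading_ideal S f d J"
  then obtain p q where
    "p \<in> polys_over S" "degree p \<le> d" "poly p f \<in> J" "a = coeff p d"
    "q \<in> polys_over S" "degree q \<le> d" "poly q f \<in> J" "b = coeff q d"
    unfolding leading_ideal_def by blast
  then show "a + b \<in> leading_ideal S f d J"
    unfolding leading_ideal_def mem_Collect_eq
    by (intro exI[of _ "p + q"])
       (use J in \<open>auto simp: ideal_in_def degree_add_le intro: polys_over_closed[OF S]\<close>)
next
  fix r a assume r: "r \<in> S" and "a \<in> leading_ideal S f d J"
  then obtain p where p: "p \<in> polys_over S" "degree p \<le> d" "poly p f \<in> J" "a = coeff p d"
    unfolding leading_ideal_def by blast
  have "smult r p \<in> polys_over S"
    using p(1) r S by (auto simp: polys_over_def is_subring_def)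
  moreover have "poly (smult r p) f \<in> J"
    using J p(3) r subset_adjoin[OF S, of f] by (auto simp: ideal_in_def)
  moreover have "degree (smult r p) \<le> d"
    using p(2) degree_smult_le[of r p] by simp
  ultimately show "r * a \<in> leading_ideal S f d J"
    unfolding leading_ideal_def mem_Collect_eq p(4)
    by (intro exI[of _ "smult r p"]) auto
qed

lemma leading_ideal_mono: "J \<subseteq> J' \<Longrightarrow> leading_ideal S f d J \<subseteq> leading_ideal S f d J'"
  unfolding leading_ideal_def by blast

lemma leading_ideal_Suc:
  assumes S: "is_subring S" and J: "ideal_in (adjoin S f) J"
  shows "leading_ideal S f d J \<subseteq> leading_ideal S f (Suc d) J"
proof
  fix a assume "a \<in> leading_ideal S f d J"
  then obtain p where p: "p \<in> polys_over S" "degree p \<le> d" "poly p f \<in> J" "a = coeff p d"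
    unfolding leading_ideal_def by blast
  have "pCons 0 p \<in> polys_over S" using p(1) S by (intro polys_over_pCons) (auto simp: is_subring_def)
  moreover have "degree (pCons 0 p) \<le> Suc d"
    using p(2) degree_pCons_le[of 0 p] by simp
  moreover have "poly (pCons 0 p) f \<in> J"
    using J p(3) generator_in_adjoin[OF S, of f] by (auto simp: ideal_in_def)
  ultimately show "a \<in> leading_ideal S f (Suc d) J"
    unfolding leading_ideal_def mem_Collect_eq p(4)
    by (intro exI[of _ "pCons 0 p"]) auto
qed

lemma ideal_eqI_leading_ideal:
  assumes S: "is_subring S" and J: "ideal_in (adjoin S f) J" "ideal_in (adjoin S f) J'" and "J \<subseteq> J'"
    and L: "\<And>d. leading_ideal S f d J' = leading_ideal S f d J"
  shows "J' = J"
proof -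
  have *: "poly p f \<in> J" if "p \<in> polys_over S" "p = 0 \<or> degree p < d" "poly p f \<in> J'" for p d
    using that
  proof (induction d arbitrary: p)
    case 0
    then show ?case using J by (auto simp: ideal_in_def)
  next
    case (Suc d)
    then have "coeff p d \<in> leading_ideal S f d J'"
      unfolding leading_ideal_def by force
    then obtain q where q: "q \<in> polys_over S" "degree q \<le> d" "poly q f \<in> J" "coeff p d = coeff q d"
      unfolding L unfolding leading_ideal_def by blast
    have "p - q = 0 \<or> degree (p - q) < d"
    proof (cases "p - q = 0")
      case False
      have "degree (p - q) \<le> d" using Suc.prems(2) q(2) by (intro degree_diff_le) auto
      moreover have "degree (p - q) \<noteq> d"
      proof
        assume "degree (p - q) = d"
        then have "coeff (p - q) (degree (p - q)) = 0" using q(4) by simp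
        then show False using False by (simp del: coeff_diff)
      qed
      ultimately show ?thesis by simp
    qed simp
    moreover have "poly (p - q) f \<in> J'"
    proof -
      have "- 1 \<in> adjoin S f" using is_subring_adjoin[OF S] by (auto simp: is_subring_def)
      then have "- 1 * poly q f \<in> J'" using q(3) \<open>J \<subseteq> J'\<close> J(2) unfolding ideal_in_def by blast
      then have "poly p f + - 1 * poly q f \<in> J'" using Suc.prems(3) J(2) unfolding ideal_in_def by blast
      then show ?thesis by simp
    qed
    ultimately have "poly (p - q) f \<in> J"
      using Suc.IH polys_over_closed(4)[OF S Suc.prems(1) q(1)] by blast
    then have "poly (p - q) f + poly q f \<in> J" using q(3) J(1) unfolding ideal_in_def by blast
    then show ?case by simp
  qed
  have "J' \<subseteq> J"
  proof
    fix a assume a: "a \<in> J'"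
    then obtain p where "p \<in> polys_over S" "a = poly p f"
      using J(2) unfolding ideal_in_def adjoin_def by blast
    then show "a \<in> J" using *[of p "Suc (degree p)"] a by simp
  qed
  then show ?thesis using \<open>J \<subseteq> J'\<close> by blast
qed

text \<open>Among comparable ideals of \<open>S[f]\<close> one is determined by its ideals of leading coefficients in the
  various degrees.  These are ideals of \<open>S\<close> that grow with the degree and along a chain of ideals, so that
  beyond some degree and some member of the chain none of them grows, and below this degree there are only
  finitely many of them to become stationary.\<close>

theorem hilbert_basis:
  assumes S: "is_subring S" and N: "noetherian S"
  shows "noetherian (adjoin S f)"
  unfolding noetherian_def
proof (intro allI impI, elim conjE)
  fix J assume J: "\<forall>k. ideal_in (adjoin S f) (J k)" and ch: "\<forall>k. J k \<subseteq> J (Suc k)"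
  let ?L = "leading_ideal S f"
  have mono: "J k \<subseteq> J m" if "k \<le> m" for k m
    using lift_Suc_mono_le[of J] ch that by blast
  have Lmono: "?L d (J k) \<subseteq> ?L d' (J m)" if "d \<le> d'" "k \<le> m" for d d' k m
  proof -
    have "?L d (J k) \<subseteq> ?L d' (J k)"
      using lift_Suc_mono_le[of "\<lambda>d. ?L d (J k)"] leading_ideal_Suc[OF S] J that(1) by blast
    then show ?thesis using leading_ideal_mono[OF mono[OF that(2)]] by blast
  qed
  have stab: "\<exists>n. \<forall>m\<ge>n. K m = K n" if "\<forall>k. ideal_in S (K k)" "\<forall>k. K k \<subseteq> K (Suc k)" for K
    using N that unfolding noetherian_def by blast
  have "\<exists>n. \<forall>m\<ge>n. ?L m (J m) = ?L n (J n)"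
    by (rule stab) (use J ideal_in_leading_ideal[OF S] Lmono in auto)
  then obtain n0 where n0: "\<forall>m\<ge>n0. ?L m (J m) = ?L n0 (J n0)" by blast
  have "\<exists>n. \<forall>m\<ge>n. ?L d (J m) = ?L d (J n)" for d
    by (rule stab) (use J ideal_in_leading_ideal[OF S] Lmono in auto)
  then obtain \<nu> where \<nu>: "\<And>d m. m \<ge> \<nu> d \<Longrightarrow> ?L d (J m) = ?L d (J (\<nu> d))" by metis
  define n where "n = Max (insert n0 (\<nu> ` {..<n0}))"
  have n: "n0 \<le> n" "\<And>d. d < n0 \<Longrightarrow> \<nu> d \<le> n" unfolding n_def by auto
  have "J m = J n" if "m \<ge> n" for m
  proof (rule ideal_eqI_leading_ideal[OF S])
    show "ideal_in (adjoin S f) (J n)" "ideal_in (adjoin S f) (J m)" "J n \<subseteq> J m"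
      using J mono that by auto
    show "?L d (J m) = ?L d (J n)" for d
    proof (cases "d < n0")
      case True
      then show ?thesis using \<nu>[of d m] \<nu>[of d n] n(2)[OF True] that by simp
    next
      case False
      have "?L d (J m) \<subseteq> ?L (max d m) (J (max d m))" by (rule Lmono) auto
      also have "\<dots> = ?L n0 (J n0)" by (rule n0[rule_format]) (use False in simp)
      also have "\<dots> \<subseteq> ?L d (J n)" using False n(1) by (intro Lmono) auto
      finally show ?thesis using Lmono[of d d n m] that by auto
    qed
  qed
  then show "\<exists>n. \<forall>m\<ge>n. J m = J n" by blast
qed

lemma finitely_generated_noetherian:
  assumes S: "is_subring S" "noetherian S" and "finite G"
  shows "\<exists>R. is_subring R \<and> noetherian R \<and> S \<union> G \<subseteq> R \<and> (\<forall>T. is_subring T \<and> S \<union> G \<subseteq> T \<longrightarrow> R \<subseteq> T)"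
  using \<open>finite G\<close>
proof induction
  case empty
  then show ?case using S by (intro exI[of _ S]) auto
next
  case (insert g G)
  from insert.IH obtain R where R0: "is_subring R \<and> noetherian R \<and> S \<union> G \<subseteq> R \<and>
      (\<forall>T. is_subring T \<and> S \<union> G \<subseteq> T \<longrightarrow> R \<subseteq> T)" by (rule exE)
  then have R: "is_subring R" "noetherian R" "S \<union> G \<subseteq> R" by simp_all
  have least: "R \<subseteq> T" if "is_subring T" "S \<union> G \<subseteq> T" for T using R0 that by simp
  show ?case
  proof (intro exI[of _ "adjoin R g"] conjI allI impI; (elim conjE)?)
    show "is_subring (adjoin R g)" "noetherian (adjoin R g)"
      using is_subring_adjoin hilbert_basis R(1,2) by auto
    show "S \<union> insert g G \<subseteq> adjoin R g"
      using subset_adjoin[OF R(1), of g] generator_in_adjoin[OF R(1), of g] R(3) by blast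
    fix T assume "is_subring T" "S \<union> insert g G \<subseteq> T"
    then show "adjoin R g \<subseteq> T" using least[of T] by (intro adjoin_least) simp_all
  qed
qed

lemma constants_noetherian:
  "is_subring (range (\<lambda>c (_::'b). c :: complex))" "noetherian (range (\<lambda>c (_::'b). c :: complex))"
proof -
  let ?S = "range (\<lambda>c (_::'b). c :: complex)"
  show "is_subring ?S"
    unfolding is_subring_def by (auto simp: fun_eq_iff image_iff)
  have dich: "J = {0} \<or> J = ?S" if J: "ideal_in ?S J" for J
  proof (cases "J = {0}")
    case False
    moreover have "0 \<in> J" using J by (auto simp: ideal_in_def)
    ultimately obtain a where "a \<in> J" "a \<noteq> 0" by blast
    then obtain c where c: "(\<lambda>_. c) \<in> J" "c \<noteq> 0"
      using J unfolding ideal_in_def by (auto simp: fun_eq_iff)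
    have "(\<lambda>_. d) \<in> J" for d
    proof -
      have "(\<lambda>_. d / c) * (\<lambda>_. c) \<in> J" using J c(1) unfolding ideal_in_def by blast
      moreover have "(\<lambda>_. d / c) * (\<lambda>_. c) = (\<lambda>_::'b. d)" using c(2) by (auto simp: fun_eq_iff)
      ultimately show ?thesis by simp
    qed
    then show ?thesis using J unfolding ideal_in_def by blast
  qed simp
  show "noetherian ?S"
    unfolding noetherian_def
  proof (intro allI impI, elim conjE)
    fix J assume J: "\<forall>k. ideal_in ?S (J k)" and ch: "\<forall>k. J k \<subseteq> J (Suc k)"
    have mono: "J k \<subseteq> J m" if "k \<le> m" for k m
      using lift_Suc_mono_le[of J] ch that by blast
    show "\<exists>n. \<forall>m\<ge>n. J m = J n"
    proof (cases "\<exists>n. J n = ?S")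
      case True
      then obtain n where n: "J n = ?S" by blast
      have "J m \<subseteq> ?S" for m using J unfolding ideal_in_def by blast
      then show ?thesis using mono n by (intro exI[of _ n]) fastforce
    next
      case False
      then have "J m = {0}" for m using dich J by blast
      then show ?thesis by blast
    qed
  qed
qed

text \<open>The powers of the ideal generated by finitely many functions \<open>y i\<close> in the algebra which they
  generate over the constants.\<close>

inductive_set function_algebra :: "('i \<Rightarrow> 'v \<Rightarrow> complex) \<Rightarrow> 'i set \<Rightarrow> ('v \<Rightarrow> complex) set"
  for y :: "'i \<Rightarrow> 'v \<Rightarrow> complex" and I :: "'i set" where
  const: "(\<lambda>_. c) \<in> function_algebra y I"
| gen: "i \<in> I \<Longrightarrow> y i \<in> function_algebra y I"
| add: "a \<in> function_algebra y I \<Longrightarrow> b \<in> function_algebra y I \<Longrightarrow> (\<lambda>v. a v + b v) \<in> function_algebra y I"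
| mult: "a \<in> function_algebra y I \<Longrightarrow> b \<in> function_algebra y I \<Longrightarrow> (\<lambda>v. a v * b v) \<in> function_algebra y I"

fun ideal_power :: "('i \<Rightarrow> 'v \<Rightarrow> complex) \<Rightarrow> 'i set \<Rightarrow> nat \<Rightarrow> ('v \<Rightarrow> complex) set" where
  "ideal_power y I 0 = function_algebra y I"
| "ideal_power y I (Suc k) = {\<lambda>v. \<Sum>i\<in>I. y i v * h i v |h. \<forall>i\<in>I. h i \<in> ideal_power y I k}"

lemma ideal_power_SucI:
  "(\<And>i. i \<in> I \<Longrightarrow> h i \<in> ideal_power y I k) \<Longrightarrow> (\<lambda>v. \<Sum>i\<in>I. y i v * h i v) \<in> ideal_power y I (Suc k)"
  by auto

lemma ideal_power_SucE:
  assumes "a \<in> ideal_power y I (Suc k)"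
  obtains h where "a = (\<lambda>v. \<Sum>i\<in>I. y i v * h i v)" "\<And>i. i \<in> I \<Longrightarrow> h i \<in> ideal_power y I k"
  using assms by auto

lemma ideal_power_add:
  "a \<in> ideal_power y I k \<Longrightarrow> b \<in> ideal_power y I k \<Longrightarrow> (\<lambda>v. a v + b v) \<in> ideal_power y I k"
proof (induction k arbitrary: a b)
  case 0
  then show ?case by (auto intro: function_algebra.add)
next
  case (Suc k)
  from Suc.prems(1) obtain g where g: "a = (\<lambda>v. \<Sum>i\<in>I. y i v * g i v)" "\<And>i. i \<in> I \<Longrightarrow> g i \<in> ideal_power y I k"
    by (rule ideal_power_SucE) blast
  from Suc.prems(2) obtain h where h: "b = (\<lambda>v. \<Sum>i\<in>I. y i v * h i v)" "\<And>i. i \<in> I \<Longrightarrow> h i \<in> ideal_power y I k"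
    by (rule ideal_power_SucE) blast
  have "(\<lambda>v. a v + b v) = (\<lambda>v. \<Sum>i\<in>I. y i v * (g i v + h i v))"
    by (simp add: g h sum.distrib algebra_simps)
  moreover have "\<dots> \<in> ideal_power y I (Suc k)"
    by (rule ideal_power_SucI) (use Suc.IH g h in blast)
  ultimately show ?case by simp
qed

lemma ideal_power_scale: "a \<in> ideal_power y I k \<Longrightarrow> b \<in> function_algebra y I \<Longrightarrow> (\<lambda>v. b v * a v) \<in> ideal_power y I k"
proof (induction k arbitrary: a)
  case 0
  then show ?case by (auto intro: function_algebra.mult)
next
  case (Suc k)
  from Suc.prems(1) obtain g where g: "a = (\<lambda>v. \<Sum>i\<in>I. y i v * g i v)" "\<And>i. i \<in> I \<Longrightarrow> g i \<in> ideal_power y I k"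
    by (rule ideal_power_SucE) blast
  have "(\<lambda>v. b v * a v) = (\<lambda>v. \<Sum>i\<in>I. y i v * (b v * g i v))"
    by (simp add: g sum_distrib_left algebra_simps)
  moreover have "\<dots> \<in> ideal_power y I (Suc k)"
    by (rule ideal_power_SucI) (use Suc g in blast)
  ultimately show ?case by simp
qed

lemma ideal_power_cmult: "a \<in> ideal_power y I k \<Longrightarrow> (\<lambda>v. c * a v) \<in> ideal_power y I k"
  using ideal_power_scale[of a y I k "\<lambda>_. c", OF _ function_algebra.const] .

lemma ideal_power_zero: "(\<lambda>_. 0) \<in> ideal_power y I k"
proof (induction k)
  case 0
  then show ?case by (simp add: function_algebra.const)
next
  case (Suc k)
  then show ?case using ideal_power_SucI[of I "\<lambda>_ _. 0" y k] by simp
qed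

lemma ideal_power_sum:
  "(\<And>j. j \<in> J \<Longrightarrow> f j \<in> ideal_power y I k) \<Longrightarrow> (\<lambda>v. \<Sum>j\<in>J. f j v) \<in> ideal_power y I k"
  by (induction J rule: infinite_finite_induct) (auto intro: ideal_power_zero ideal_power_add)

lemma ideal_power_mult:
  "a \<in> ideal_power y I j \<Longrightarrow> b \<in> ideal_power y I k \<Longrightarrow> (\<lambda>v. a v * b v) \<in> ideal_power y I (j + k)"
proof (induction j arbitrary: a)
  case 0
  then show ?case by (simp add: ideal_power_scale)
next
  case (Suc j)
  from Suc.prems(1) obtain g where g: "a = (\<lambda>v. \<Sum>i\<in>I. y i v * g i v)" "\<And>i. i \<in> I \<Longrightarrow> g i \<in> ideal_power y I j"
    by (rule ideal_power_SucE) blast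
  have "(\<lambda>v. a v * b v) = (\<lambda>v. \<Sum>i\<in>I. y i v * (g i v * b v))"
    by (simp add: g sum_distrib_left sum_distrib_right algebra_simps)
  moreover have "\<dots> \<in> ideal_power y I (Suc (j + k))"
    by (rule ideal_power_SucI) (use Suc g in blast)
  ultimately show ?case by simp
qed

lemma ideal_power_Suc_subset: "finite I \<Longrightarrow> ideal_power y I (Suc k) \<subseteq> ideal_power y I k"
proof (induction k)
  case 0
  show ?case
  proof
    fix a assume "a \<in> ideal_power y I (Suc 0)"
    then obtain g where g: "a = (\<lambda>v. \<Sum>i\<in>I. y i v * g i v)" "\<And>i. i \<in> I \<Longrightarrow> g i \<in> ideal_power y I 0"
      by (rule ideal_power_SucE) blast
    show "a \<in> ideal_power y I 0"
      unfolding g(1) using g(2)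
      by (intro ideal_power_sum) (auto intro: function_algebra.mult function_algebra.gen)
  qed
next
  case (Suc k)
  show ?case
  proof
    fix a assume "a \<in> ideal_power y I (Suc (Suc k))"
    then obtain g where g: "a = (\<lambda>v. \<Sum>i\<in>I. y i v * g i v)" "\<And>i. i \<in> I \<Longrightarrow> g i \<in> ideal_power y I (Suc k)"
      by (rule ideal_power_SucE) blast
    show "a \<in> ideal_power y I (Suc k)"
      unfolding g(1) by (rule ideal_power_SucI) (use g(2) Suc in blast)
  qed
qed

lemma ideal_power_antimono: "finite I \<Longrightarrow> j \<le> k \<Longrightarrow> ideal_power y I k \<subseteq> ideal_power y I j"
  using lift_Suc_antimono_le[of "ideal_power y I"] ideal_power_Suc_subset by metis

lemma generator_in_ideal:
  assumes "finite I" "i \<in> I"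
  shows "y i \<in> ideal_power y I 1"
proof -
  have "(\<lambda>v. \<Sum>j\<in>I. y j v * (if j = i then 1 else 0)) \<in> ideal_power y I (Suc 0)"
    by (rule ideal_power_SucI) (auto intro: function_algebra.const)
  then show ?thesis using assms by (simp add: if_distrib cong: if_cong)
qed

lemma ideal_power_1_vanish:
  "q \<in> ideal_power y I (Suc k) \<Longrightarrow> (\<And>i. i \<in> I \<Longrightarrow> y i v = 0) \<Longrightarrow> q v = 0"
  by (auto elim!: ideal_power_SucE simp del: ideal_power.simps)

text \<open>The elements of the Rees algebra, as functions of a point and of a grading variable.\<close>

definition rees :: "('i \<Rightarrow> 'v \<Rightarrow> complex) \<Rightarrow> 'i set \<Rightarrow> ('v \<times> complex \<Rightarrow> complex) set" where
  "rees y I = {\<lambda>(v, s). \<Sum>j\<le>n. r j v * s ^ j |n r. (\<forall>j. r j \<in> ideal_power y I j) \<and> (\<forall>j>n. r j = (\<lambda>_. 0))}"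

lemma reesI:
  assumes "\<And>j. r j \<in> ideal_power y I j" "\<And>j. j > n \<Longrightarrow> r j = (\<lambda>_. 0)"
    "\<And>v s. f (v, s) = (\<Sum>j\<le>n. r j v * s ^ j)"
  shows "f \<in> rees y I"
  unfolding rees_def mem_Collect_eq
  by (rule exI[of _ n], rule exI[of _ r]) (use assms in auto)

lemma reesE:
  assumes "f \<in> rees y I"
  obtains n r where "\<And>j. r j \<in> ideal_power y I j" "\<And>j. j > n \<Longrightarrow> r j = (\<lambda>_. 0)"
    "\<And>v s. f (v, s) = (\<Sum>j\<le>n. r j v * s ^ j)"
  using assms unfolding rees_def by auto

lemma rees_monomial:
  assumes "h \<in> ideal_power y I k"
  shows "(\<lambda>(v, s). h v * s ^ k) \<in> rees y I"
  by (rule reesI[of "\<lambda>j. if j = k then h else (\<lambda>_. 0)" _ _ k])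
     (use assms in \<open>auto simp: ideal_power_zero if_distrib if_distribR cong: if_cong\<close>)

lemma is_subring_rees:
  fixes y :: "'i \<Rightarrow> 'v \<Rightarrow> complex"
  shows "is_subring (rees y I)"
  unfolding is_subring_def
proof (intro conjI ballI)
  have c: "(\<lambda>_. c) \<in> rees y I" for c
    using rees_monomial[of "\<lambda>_. c" y I 0] by (simp add: function_algebra.const case_prod_beta')
  show "0 \<in> rees y I" "1 \<in> rees y I" using c[of 0] c[of 1] by (simp_all add: zero_fun_def one_fun_def)
  fix f g assume "f \<in> rees y I" "g \<in> rees y I"
  from this(1) obtain n a where a: "\<And>j. a j \<in> ideal_power y I j" "\<And>j. j > n \<Longrightarrow> a j = (\<lambda>_. 0)"
    "\<And>v s. f (v, s) = (\<Sum>j\<le>n. a j v * s ^ j)" by (rule reesE) blast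
  from \<open>g \<in> rees y I\<close> obtain m b where b: "\<And>j. b j \<in> ideal_power y I j" "\<And>j. j > m \<Longrightarrow> b j = (\<lambda>_. 0)"
    "\<And>v s. g (v, s) = (\<Sum>j\<le>m. b j v * s ^ j)" by (rule reesE) blast
  have extend: "(\<Sum>j\<le>N. r j v * s ^ j) = (\<Sum>j\<le>n. r j v * s ^ j)"
    if "n \<le> N" "\<And>j. j > n \<Longrightarrow> r j = (\<lambda>_. 0)" for N n r and s :: complex and v :: 'v
  proof (rule sum.mono_neutral_right)
    show "\<forall>j\<in>{..N} - {..n}. r j v * s ^ j = 0" using that(2) by simp
  qed (use that(1) in auto)
  show "f + g \<in> rees y I"
  proof (rule reesI[of "\<lambda>j v. a j v + b j v" _ _ "max n m"])
    show "(f + g) (v, s) = (\<Sum>j\<le>max n m. (a j v + b j v) * s ^ j)" for v s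
      using extend[of n "max n m" a v s] extend[of m "max n m" b v s] a b
      by (simp add: algebra_simps sum.distrib)
  qed (use a b in \<open>auto intro: ideal_power_add\<close>)
  show "f * g \<in> rees y I"
  proof (rule reesI[of "\<lambda>r v. \<Sum>k\<le>r. a k v * b (r - k) v" _ _ "n + m"])
    show "(\<lambda>v. \<Sum>k\<le>j. a k v * b (j - k) v) \<in> ideal_power y I j" for j
    proof (rule ideal_power_sum)
      fix k assume "k \<in> {..j}"
      then show "(\<lambda>v. a k v * b (j - k) v) \<in> ideal_power y I j"
        using ideal_power_mult[OF a(1)[of k] b(1)[of "j - k"]] by simp
    qed
    show "(\<lambda>v. \<Sum>k\<le>j. a k v * b (j - k) v) = (\<lambda>_. 0)" if "j > n + m" for j
    proof (rule HOL.ext, rule sum.neutral, rule ballI)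
      fix v k assume "k \<in> {..j}"
      show "a k v * b (j - k) v = 0"
      proof (cases "k > n")
        case False
        then have "j - k > m" using that by simp
        then show ?thesis using b(2) by simp
      qed (use a(2) in simp)
    qed
    show "(f * g) (v, s) = (\<Sum>j\<le>n + m. (\<Sum>k\<le>j. a k v * b (j - k) v) * s ^ j)" for v s
      using polynomial_product[of n "\<lambda>j. a j v" m "\<lambda>j. b j v" s] a b by simp
  qed
  show "- f \<in> rees y I"
  proof (rule reesI[of "\<lambda>j v. - 1 * a j v" _ _ n])
    show "(- f) (v, s) = (\<Sum>j\<le>n. - 1 * a j v * s ^ j)" for v s
      by (simp add: a(3) sum_negf)
  qed (use a in \<open>auto intro: ideal_power_cmult[of _ _ _ _ "-1", simplified]\<close>)
qed

text \<open>The function \<open>p\<close>, lying in every power of the ideal, is homogeneous of each degree at once in the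
  Rees algebra, which is noetherian.  So some \<open>p s\<^sup>k\<close> is a combination of lower \<open>p s\<^sup>j\<close>, and the components of
  the right degrees of the coefficients lie in the ideal.\<close>

theorem krull_intersection:
  fixes y :: "'i \<Rightarrow> 'v \<Rightarrow> complex"
  assumes I: "finite I" and p: "\<And>k. \<exists>h\<in>ideal_power y I k. \<forall>v\<in>K. h v = p v"
  shows "\<exists>q\<in>ideal_power y I 1. \<forall>v\<in>K. (1 - q v) * p v = 0"
proof -
  let ?c = "range (\<lambda>c (_::'v \<times> complex). c :: complex)"
  let ?G = "(\<lambda>i (v, s::complex). y i v) ` I \<union> (\<lambda>i (v, s::complex). y i v * s) ` I"
  have "finite ?G" using I by simp
  from finitely_generated_noetherian[OF constants_noetherian this]
  obtain R where R0: "is_subring R \<and> noetherian R \<and> ?c \<union> ?G \<subseteq> R \<and>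
      (\<forall>T. is_subring T \<and> ?c \<union> ?G \<subseteq> T \<longrightarrow> R \<subseteq> T)" by (rule exE)
  then have R: "is_subring R" "noetherian R" "?c \<union> ?G \<subseteq> R" by simp_all
  have "?c \<union> ?G \<subseteq> rees y I"
  proof -
    have "(\<lambda>_. c) \<in> rees y I" for c
      using rees_monomial[of "\<lambda>_. c" y I 0] by (simp add: function_algebra.const case_prod_beta')
    moreover have "(\<lambda>(v, s::complex). y i v) \<in> rees y I" if "i \<in> I" for i
      using rees_monomial[of "y i" y I 0] that by (simp add: function_algebra.gen)
    moreover have "(\<lambda>(v, s::complex). y i v * s) \<in> rees y I" if "i \<in> I" for i
      using rees_monomial[OF generator_in_ideal[OF I that, of y]] by (simp only: power_one_right)
    ultimately show ?thesis by auto
  qed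
  then have R_rees: "R \<subseteq> rees y I" using R0 is_subring_rees[of y I] by simp
  have Rc: "f + g \<in> R" "f * g \<in> R" if "f \<in> R" "g \<in> R" for f g
    using R(1) that unfolding is_subring_def by auto
  have alg: "(\<lambda>(v, s). a v) \<in> R" if "a \<in> function_algebra y I" for a
    using that
  proof induction
    case (const c)
    have "(\<lambda>_. c) \<in> R" using R(3) by blast
    then show ?case by (simp add: case_prod_beta')
  next
    case (gen i)
    then show ?case using R(3) by auto
  next
    case (add a b)
    then show ?case using Rc(1)[of "\<lambda>(v, s). a v" "\<lambda>(v, s). b v"] by (simp add: plus_fun_def case_prod_beta')
  next
    case (mult a b)
    then show ?case using Rc(2)[of "\<lambda>(v, s). a v" "\<lambda>(v, s). b v"] by (simp add: times_fun_def case_prod_beta')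
  qed
  have pow: "(\<lambda>(v, s). a v * s ^ k) \<in> R" if "a \<in> ideal_power y I k" for a k
    using that
  proof (induction k arbitrary: a)
    case 0
    then show ?case using alg by simp
  next
    case (Suc k)
    from Suc.prems obtain g where g: "a = (\<lambda>v. \<Sum>i\<in>I. y i v * g i v)" "\<And>i. i \<in> I \<Longrightarrow> g i \<in> ideal_power y I k"
      by (rule ideal_power_SucE) blast
    have "(\<Sum>i\<in>I. (\<lambda>(v, s). y i v * s) * (\<lambda>(v, s). g i v * s ^ k)) \<in> R"
      by (intro is_subring_sum[OF R(1)] Rc(2) Suc.IH g) (use R(3) in auto)
    moreover have "(\<Sum>i\<in>I. (\<lambda>(v, s). y i v * s) * (\<lambda>(v, s). g i v * s ^ k)) = (\<lambda>(v, s). a v * s ^ Suc k)"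
    proof -
      have "sum F I z = (\<Sum>i\<in>I. F i z)" for F :: "'i \<Rightarrow> 'v \<times> complex \<Rightarrow> complex" and z
        by (induction I rule: infinite_finite_induct) auto
      then show ?thesis by (auto simp: fun_eq_iff g sum_distrib_left sum_distrib_right algebra_simps intro!: sum.cong)
    qed
    ultimately show ?case by simp
  qed
  (* The chain of ideals of the Rees algebra restricted to \<open>K\<close> that are generated by
    \<open>p\<close>, \<open>s p\<close>, \<open>s\<^sup>2 p\<close>, ...  Where it becomes stationary, comparing
    the coefficients of the last power of \<open>s\<close> expresses \<open>p\<close> as a multiple of itself. *)
  define J where "J k = {a \<in> R. \<exists>c. (\<forall>j. c j \<in> R) \<and>
    (\<forall>v\<in>K. \<forall>s. a (v, s) = (\<Sum>j<k. c j (v, s) * (p v * s ^ j)))}" for k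
  have "ideal_in R (J k)" for k
    unfolding ideal_in_def
  proof (intro conjI ballI)
    have z: "0 \<in> R" using R(1) by (auto simp: is_subring_def)
    show "J k \<subseteq> R" "0 \<in> J k" using z unfolding J_def by (auto intro!: exI[of _ "\<lambda>_. 0"])
    fix a b assume "a \<in> J k" "b \<in> J k"
    then obtain c d where
      "a \<in> R" "\<forall>j. c j \<in> R" "\<forall>v\<in>K. \<forall>s. a (v, s) = (\<Sum>j<k. c j (v, s) * (p v * s ^ j))"
      "b \<in> R" "\<forall>j. d j \<in> R" "\<forall>v\<in>K. \<forall>s. b (v, s) = (\<Sum>j<k. d j (v, s) * (p v * s ^ j))"
      unfolding J_def by blast
    then show "a + b \<in> J k"
      unfolding J_def using Rc
      by (auto intro!: exI[of _ "\<lambda>j. c j + d j"] simp: sum.distrib algebra_simps)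
  next
    fix r a assume "r \<in> R" "a \<in> J k"
    then obtain c where
      "a \<in> R" "\<forall>j. c j \<in> R" "\<forall>v\<in>K. \<forall>s. a (v, s) = (\<Sum>j<k. c j (v, s) * (p v * s ^ j))"
      unfolding J_def by blast
    then show "r * a \<in> J k"
      unfolding J_def using Rc \<open>r \<in> R\<close>
      by (auto intro!: exI[of _ "\<lambda>j. r * c j"] simp: sum_distrib_left algebra_simps)
  qed
  moreover have "J k \<subseteq> J (Suc k)" for k
  proof
    fix a assume "a \<in> J k"
    then obtain c where c: "a \<in> R" "\<forall>j. c j \<in> R" "\<forall>v\<in>K. \<forall>s. a (v, s) = (\<Sum>j<k. c j (v, s) * (p v * s ^ j))"
      unfolding J_def by blast
    then show "a \<in> J (Suc k)"
      unfolding J_def using R(1) by (auto intro!: exI[of _ "c(k := 0)"] simp: is_subring_def)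
  qed
  ultimately obtain n where n: "J (Suc n) = J n"
    using R(2) unfolding noetherian_def by (metis le_SucI order_refl)
  obtain h where h: "h \<in> ideal_power y I n" "\<forall>v\<in>K. h v = p v" using p by blast
  have "(\<lambda>(v, s). h v * s ^ n) \<in> J (Suc n)"
    unfolding J_def mem_Collect_eq
  proof (intro conjI exI[of _ "\<lambda>j. if j = n then 1 else 0"] allI ballI)
    show "(\<lambda>(v, s). h v * s ^ n) \<in> R" using pow h(1) by simp
    show "(if j = n then 1 else 0) \<in> R" for j using R(1) by (auto simp: is_subring_def)
    show "(case (v, s) of (v, s) \<Rightarrow> h v * s ^ n) =
      (\<Sum>j<Suc n. (if j = n then 1 else 0) (v, s) * (p v * s ^ j))" if "v \<in> K" for v s
      using h(2) that by (simp add: if_distribR if_distrib cong: if_cong)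
  qed
  then have "(\<lambda>(v, s). h v * s ^ n) \<in> J n" using n by simp
  then obtain c where c: "\<forall>j. c j \<in> R"
      "\<forall>v\<in>K. \<forall>s. h v * s ^ n = (\<Sum>j<n. c j (v, s) * (p v * s ^ j))"
    unfolding J_def by auto
  have "\<exists>N r. (\<forall>l. r l \<in> ideal_power y I l) \<and> (\<forall>l>N. r l = (\<lambda>_. 0)) \<and>
      (\<forall>v s. c j (v, s) = (\<Sum>l\<le>N. r l v * s ^ l))" for j
  proof -
    have "c j \<in> rees y I" using c(1) R_rees by blast
    then show ?thesis by (elim reesE) blast
  qed
  then obtain N r where r: "\<And>j l. r j l \<in> ideal_power y I l" "\<And>j l. l > N j \<Longrightarrow> r j l = (\<lambda>_. 0)"
      "\<And>j v s. c j (v, s) = (\<Sum>l\<le>N j. r j l v * s ^ l)" by metis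
  define q where "q = (\<lambda>v. \<Sum>j<n. r j (n - j) v)"
  have "q \<in> ideal_power y I 1"
    unfolding q_def
  proof (rule ideal_power_sum)
    fix j assume "j \<in> {..<n}"
    then show "r j (n - j) \<in> ideal_power y I 1"
      using r(1)[of j "n - j"] ideal_power_antimono[OF I, of 1 "n - j"] by force
  qed
  moreover have "(1 - q v) * p v = 0" if v: "v \<in> K" for v
  proof -
    let ?P = "\<Sum>j<n. \<Sum>l\<le>N j. monom (r j l v * p v) (l + j)"
    have "poly (monom (p v) n) s = poly ?P s" for s
    proof -
      have "p v * s ^ n = (\<Sum>j<n. c j (v, s) * (p v * s ^ j))" using c(2) h(2) v by auto
      also have "\<dots> = poly ?P s"
        unfolding r(3)
        by (simp add: poly_sum poly_monom power_add sum_distrib_left sum_distrib_right algebra_simps)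
      finally show ?thesis by (simp add: poly_monom)
    qed
    then have "monom (p v) n = ?P" by (simp add: poly_eq_poly_eq_iff[symmetric] fun_eq_iff)
    then have "p v = coeff ?P n" by (metis coeff_monom)
    also have "\<dots> = (\<Sum>j<n. \<Sum>l\<le>N j. if l = n - j then r j l v * p v else 0)"
      unfolding coeff_sum coeff_monom by (intro sum.cong) auto
    also have "\<dots> = (\<Sum>j<n. r j (n - j) v * p v)"
    proof (rule sum.cong)
      fix j
      show "(\<Sum>l\<le>N j. if l = n - j then r j l v * p v else 0) = r j (n - j) v * p v"
        using r(2)[of j "n - j"] by (cases "n - j \<le> N j") auto
    qed simp
    also have "\<dots> = q v * p v" by (simp add: q_def sum_distrib_right)
    finally show ?thesis by (simp add: algebra_simps)
  qed
  ultimately show ?thesis by blast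
qed

section \<open>A criterion for irreducible components\<close>

fun form :: "'i set \<Rightarrow> nat \<Rightarrow> (('i \<Rightarrow> complex) \<Rightarrow> complex) set" where
  "form I 0 = range (\<lambda>c _. c)"
| "form I (Suc k) = {\<lambda>w. \<Sum>i\<in>I. w i * h i w |h. \<forall>i\<in>I. h i \<in> form I k}"

lemma form_SucI:
  "(\<And>i. i \<in> I \<Longrightarrow> h i \<in> form I k) \<Longrightarrow> (\<lambda>w. \<Sum>i\<in>I. w i * h i w) \<in> form I (Suc k)"
  by auto

lemma form_SucE:
  assumes "P \<in> form I (Suc k)"
  obtains h where "P = (\<lambda>w. \<Sum>i\<in>I. w i * h i w)" "\<And>i. i \<in> I \<Longrightarrow> h i \<in> form I k"
  using assms by auto

lemma function_algebra_value_split: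
  assumes I: "finite I" and "a \<in> function_algebra y I"
  shows "\<exists>c. (\<lambda>v. a v - c) \<in> ideal_power y I 1"
  using assms(2)
proof induction
  case (const c)
  then show ?case using ideal_power_zero[of y I 1] by (intro exI[of _ c]) simp
next
  case (gen i)
  then show ?case using generator_in_ideal[OF I, of i y] by (intro exI[of _ 0]) simp
next
  case (add a b)
  then obtain c d where "(\<lambda>v. a v - c) \<in> ideal_power y I 1" "(\<lambda>v. b v - d) \<in> ideal_power y I 1" by blast
  from ideal_power_add[OF this] show ?case by (intro exI[of _ "c + d"]) (simp only: algebra_simps)
next
  case (mult a b)
  then obtain c d where cd: "(\<lambda>v. a v - c) \<in> ideal_power y I 1" "(\<lambda>v. b v - d) \<in> ideal_power y I 1" by blast
  have "(\<lambda>v. a v * (b v - d) + d * (a v - c)) \<in> ideal_power y I 1"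
    by (rule ideal_power_add[OF ideal_power_scale[OF cd(2) mult.hyps(1)] ideal_power_cmult[OF cd(1)]])
  moreover have "(\<lambda>v. a v * (b v - d) + d * (a v - c)) = (\<lambda>v. a v * b v - c * d)"
    by (simp add: fun_eq_iff algebra_simps)
  ultimately show ?case by (intro exI[of _ "c * d"]) simp
qed

text \<open>Splitting off the values at the base point makes the elements of the \<open>k\<close>-th power of the ideal
  equal to forms of degree \<open>k\<close> in its generators, up to the next power.\<close>

lemma leading_form:
  assumes I: "finite I"
  shows "a \<in> ideal_power y I k \<Longrightarrow>
    \<exists>P\<in>form I k. (\<lambda>v. a v - P (\<lambda>i. y i v)) \<in> ideal_power y I (Suc k)"
proof (induction k arbitrary: a)
  case 0
  then have "a \<in> function_algebra y I" by simp
  from function_algebra_value_split[OF I this]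
  obtain c where c: "(\<lambda>v. a v - c) \<in> ideal_power y I (Suc 0)" unfolding One_nat_def by (rule exE)
  show ?case
    by (rule bexI[of _ "\<lambda>_. c"]) (use c in \<open>simp_all del: ideal_power.simps\<close>)
next
  case (Suc k)
  from Suc.prems obtain g where g: "a = (\<lambda>v. \<Sum>i\<in>I. y i v * g i v)" "\<And>i. i \<in> I \<Longrightarrow> g i \<in> ideal_power y I k"
    by (rule ideal_power_SucE) blast
  have "\<exists>P\<in>form I k. (\<lambda>v. g i v - P (\<lambda>i. y i v)) \<in> ideal_power y I (Suc k)" if "i \<in> I" for i
    by (rule Suc.IH[OF g(2)[OF that]])
  then obtain P where P: "\<And>i. i \<in> I \<Longrightarrow> P i \<in> form I k"
      "\<And>i. i \<in> I \<Longrightarrow> (\<lambda>v. g i v - P i (\<lambda>i. y i v)) \<in> ideal_power y I (Suc k)" by metis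
  have "(\<lambda>v. \<Sum>i\<in>I. y i v * (g i v - P i (\<lambda>i. y i v))) \<in> ideal_power y I (Suc (Suc k))"
    by (rule ideal_power_SucI[OF P(2)])
  moreover have "(\<lambda>v. \<Sum>i\<in>I. y i v * (g i v - P i (\<lambda>i. y i v))) =
      (\<lambda>v. a v - (\<Sum>i\<in>I. y i v * P i (\<lambda>i. y i v)))"
    by (simp add: g(1) algebra_simps sum_subtractf)
  ultimately show ?case using form_SucI[of I P k, OF P(1)] by (intro bexI) auto
qed

lemma form_in_ideal_power: "P \<in> form I k \<Longrightarrow> (\<lambda>v. P (\<lambda>i. y i v)) \<in> ideal_power y I k"
proof (induction k arbitrary: P)
  case 0
  then show ?case by (auto intro: function_algebra.const)
next
  case (Suc k)
  from Suc.prems obtain h where h: "P = (\<lambda>w. \<Sum>i\<in>I. w i * h i w)" "\<And>i. i \<in> I \<Longrightarrow> h i \<in> form I k"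
    by (rule form_SucE) blast
  show ?case unfolding h(1) by (rule ideal_power_SucI) (rule Suc.IH[OF h(2)])
qed

lemma form_subst:
  assumes I: "finite I"
    and z: "\<And>i. i \<in> I \<Longrightarrow> z i \<in> ideal_power y I 1"
    and near: "\<And>i. i \<in> I \<Longrightarrow> \<exists>r\<in>ideal_power y I 2. \<forall>v\<in>K. y i v - z i v = r v"
  shows "P \<in> form I k \<Longrightarrow>
    \<exists>r\<in>ideal_power y I (Suc k). \<forall>v\<in>K. P (\<lambda>i. y i v) - P (\<lambda>i. z i v) = r v"
proof (induction k arbitrary: P)
  case 0
  then show ?case using ideal_power_zero[of y I "Suc 0"] by auto
next
  case (Suc k)
  from Suc.prems obtain h where h: "P = (\<lambda>w. \<Sum>i\<in>I. w i * h i w)" "\<And>i. i \<in> I \<Longrightarrow> h i \<in> form I k"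
    by (rule form_SucE) blast
  have "\<exists>r\<in>ideal_power y I (Suc k). \<forall>v\<in>K. h i (\<lambda>i. y i v) - h i (\<lambda>i. z i v) = r v" if "i \<in> I" for i
    by (rule Suc.IH[OF h(2)[OF that]])
  then obtain r where r: "\<And>i. i \<in> I \<Longrightarrow> r i \<in> ideal_power y I (Suc k)"
     "\<And>i v. i \<in> I \<Longrightarrow> v \<in> K \<Longrightarrow> h i (\<lambda>i. y i v) - h i (\<lambda>i. z i v) = r i v" by metis
  obtain t where t: "\<And>i. i \<in> I \<Longrightarrow> t i \<in> ideal_power y I 2"
     "\<And>i v. i \<in> I \<Longrightarrow> v \<in> K \<Longrightarrow> y i v - z i v = t i v" using near by metis
  let ?r = "\<lambda>v. \<Sum>i\<in>I. t i v * h i (\<lambda>i. y i v) + z i v * r i v"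
  have r1: "?r \<in> ideal_power y I (Suc (Suc k))"
  proof (intro ideal_power_sum ideal_power_add)
    fix i assume i: "i \<in> I"
    show "(\<lambda>v. t i v * h i (\<lambda>i. y i v)) \<in> ideal_power y I (Suc (Suc k))"
      using ideal_power_mult[OF t(1)[OF i] form_in_ideal_power[OF h(2)[OF i], of y]]
      by (simp only: add_2_eq_Suc)
    show "(\<lambda>v. z i v * r i v) \<in> ideal_power y I (Suc (Suc k))"
      using ideal_power_mult[OF z[OF i] r(1)[OF i]] by (simp only: plus_1_eq_Suc)
  qed
  have r2: "P (\<lambda>i. y i v) - P (\<lambda>i. z i v) = ?r v" if "v \<in> K" for v
    unfolding h(1) sum_subtractf[symmetric]
  proof (rule sum.cong)
    fix i assume "i \<in> I"
    then show "y i v * h i (\<lambda>i. y i v) - z i v * h i (\<lambda>i. z i v) = t i v * h i (\<lambda>i. y i v) + z i v * r i v"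
      using that by (simp add: r(2)[symmetric] t(2)[symmetric] algebra_simps)
  qed simp
  show ?case by (rule bexI[of _ ?r, OF _ r1]) (intro ballI r2)
qed

lemma form_tendsto:
  "P \<in> form I k \<Longrightarrow> (\<And>i. i \<in> I \<Longrightarrow> (\<lambda>n. W n i) \<longlonglongrightarrow> w i) \<Longrightarrow> (\<lambda>n::nat. P (W n)) \<longlonglongrightarrow> P w"
proof (induction k arbitrary: P)
  case 0
  from 0(1) obtain c where "P = (\<lambda>_. c)" by auto
  then show ?case by simp
next
  case (Suc k)
  from Suc.prems(1) obtain h where h: "P = (\<lambda>w. \<Sum>i\<in>I. w i * h i w)" "\<And>i. i \<in> I \<Longrightarrow> h i \<in> form I k"
    by (rule form_SucE) blast
  show ?case unfolding h(1) by (intro tendsto_sum tendsto_mult Suc.prems(2) Suc.IH h(2))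
qed

lemma form_homogeneous: "P \<in> form I k \<Longrightarrow> P (\<lambda>i. s * w i) = s ^ k * P w"
proof (induction k arbitrary: P)
  case (Suc k)
  from Suc.prems(1) obtain h where h: "P = (\<lambda>w. \<Sum>i\<in>I. w i * h i w)" "\<And>i. i \<in> I \<Longrightarrow> h i \<in> form I k"
    by (rule form_SucE) blast
  show ?case unfolding h(1) sum_distrib_left
    by (rule sum.cong) (simp_all add: Suc.IH[OF h(2)] algebra_simps)
qed auto

text \<open>Elements of the \<open>k\<close>-th power vanish to order \<open>k\<close> along an arc.  Convergence of the quotient is all that
  is needed to see that elements of the next power contribute nothing to the limit.\<close>

lemma ideal_power_order_of_vanishing:
  assumes s: "s \<longlonglongrightarrow> 0" "\<And>n. s n \<noteq> 0" and \<gamma>: "\<And>i. i \<in> I \<Longrightarrow> (\<lambda>n. y i (\<gamma> n) / s n) \<longlonglongrightarrow> w i"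
  shows "a \<in> ideal_power y I k \<Longrightarrow> convergent (\<lambda>n::nat. a (\<gamma> n) / s n ^ k)"
proof (induction k arbitrary: a)
  case 0
  then have "a \<in> function_algebra y I" by simp
  then have "convergent (\<lambda>n. a (\<gamma> n))"
  proof induction
    case (gen i)
    have "(\<lambda>n. y i (\<gamma> n) / s n * s n) \<longlonglongrightarrow> w i * 0"
      by (intro tendsto_mult s \<gamma> gen)
    then show ?case using s(2) by (auto simp: convergent_def)
  qed (auto intro: convergent_const convergent_add convergent_mult)
  then show ?case by simp
next
  case (Suc k)
  from Suc.prems obtain g where g: "a = (\<lambda>v. \<Sum>i\<in>I. y i v * g i v)" "\<And>i. i \<in> I \<Longrightarrow> g i \<in> ideal_power y I k"
    by (rule ideal_power_SucE) blast
  have "convergent (\<lambda>n. \<Sum>i\<in>I. (y i (\<gamma> n) / s n) * (g i (\<gamma> n) / s n ^ k))"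
  proof (rule convergent_sum)
    fix i assume "i \<in> I"
    then show "convergent (\<lambda>n. (y i (\<gamma> n) / s n) * (g i (\<gamma> n) / s n ^ k))"
      using \<gamma> Suc.IH[OF g(2)] by (intro convergent_mult) (auto simp: convergent_def)
  qed
  then show ?case unfolding g(1) by (simp add: sum_divide_distrib)
qed

text \<open>Induction on the order of vanishing shows that \<open>p\<close> lies in all powers of the ideal of the base point, as
  functions on \<open>K\<close>; Krull's theorem turns this into vanishing of \<open>p\<close> on \<open>K\<close> near the base point.\<close>

theorem smooth_point:
  assumes I: "finite I" and p: "p \<in> function_algebra y I" and C: "C \<subseteq> K" "\<And>v. v \<in> C \<Longrightarrow> p v = 0"
    and z: "\<And>i. i \<in> I \<Longrightarrow> z i \<in> ideal_power y I 1"
    and near: "\<And>i. i \<in> I \<Longrightarrow> \<exists>r\<in>ideal_power y I 2. \<forall>v\<in>K. y i v - z i v = r v"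
    and arcs: "\<And>v. v \<in> K \<Longrightarrow> \<exists>\<gamma> s. (\<forall>n. \<gamma> n \<in> C \<and> s n \<noteq> 0) \<and> s \<longlonglongrightarrow> 0 \<and>
      (\<forall>i\<in>I. (\<lambda>n. y i (\<gamma> n) / s n) \<longlonglongrightarrow> z i v)"
  shows "\<exists>q\<in>ideal_power y I 1. \<forall>v\<in>K. (1 - q v) * p v = 0"
proof (rule krull_intersection[OF I])
  fix k show "\<exists>h\<in>ideal_power y I k. \<forall>v\<in>K. h v = p v"
  proof (induction k)
    case 0
    then show ?case using p by auto
  next
    case (Suc k)
    then obtain h where h: "h \<in> ideal_power y I k" "\<forall>v\<in>K. h v = p v" by blast
    obtain P where P: "P \<in> form I k" "(\<lambda>v. h v - P (\<lambda>i. y i v)) \<in> ideal_power y I (Suc k)"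
      using leading_form[OF I h(1)] by blast
    let ?r = "\<lambda>v. h v - P (\<lambda>i. y i v)"
    have Pz: "P (\<lambda>i. z i v) = 0" if v: "v \<in> K" for v
    proof -
      obtain \<gamma> s where \<gamma>: "\<forall>n. \<gamma> n \<in> C \<and> s n \<noteq> 0" "s \<longlonglongrightarrow> 0"
          "\<forall>i\<in>I. (\<lambda>n. y i (\<gamma> n) / s n) \<longlonglongrightarrow> z i v" using arcs[OF v] by blast
      have "convergent (\<lambda>n. ?r (\<gamma> n) / s n ^ Suc k)"
        by (rule ideal_power_order_of_vanishing[OF _ _ _ P(2)]) (use \<gamma> in auto)
      then obtain L where L: "(\<lambda>n. ?r (\<gamma> n) / s n ^ Suc k) \<longlonglongrightarrow> L" by (auto simp: convergent_def)
      have "(\<lambda>n. - (s n * (?r (\<gamma> n) / s n ^ Suc k))) \<longlonglongrightarrow> - (0 * L)"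
        by (intro tendsto_minus tendsto_mult \<gamma>(2) L)
      moreover have "- (s n * (?r (\<gamma> n) / s n ^ Suc k)) = P (\<lambda>i. y i (\<gamma> n) / s n)" for n
      proof -
        have "h (\<gamma> n) = 0" using h(2) C \<gamma>(1) by force
        moreover have "P (\<lambda>i. y i (\<gamma> n) / s n) = P (\<lambda>i. y i (\<gamma> n)) / s n ^ k"
          using form_homogeneous[OF P(1), of "inverse (s n)" "\<lambda>i. y i (\<gamma> n)"]
          by (simp add: field_simps)
        ultimately show ?thesis using \<gamma>(1) by (simp add: field_simps)
      qed
      ultimately have "(\<lambda>n. P (\<lambda>i. y i (\<gamma> n) / s n)) \<longlonglongrightarrow> 0" by simp
      moreover have "(\<lambda>n. P (\<lambda>i. y i (\<gamma> n) / s n)) \<longlonglongrightarrow> P (\<lambda>i. z i v)"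
        by (rule form_tendsto[OF P(1)]) (use \<gamma>(3) in auto)
      ultimately show ?thesis using LIMSEQ_unique by blast
    qed
    obtain r' where r': "r' \<in> ideal_power y I (Suc k)" "\<forall>v\<in>K. P (\<lambda>i. y i v) - P (\<lambda>i. z i v) = r' v"
      using form_subst[OF I z near P(1)] by blast
    show ?case
      by (rule bexI[OF _ ideal_power_add[OF P(2) r'(1)]]) (use r'(2) h(2) Pz in simp)
  qed
qed

text \<open>A vector space whose points are separated by finitely many linear coordinates.\<close>

locale coordinatized = vector_space sc
  for sc :: "complex \<Rightarrow> 'v::ab_group_add \<Rightarrow> 'v" +
  fixes V :: "'v set" and e :: "'i \<Rightarrow> 'v \<Rightarrow> complex" and I :: "'i set"
  assumes V_zero: "0 \<in> V" and V_add: "u \<in> V \<Longrightarrow> v \<in> V \<Longrightarrow> u + v \<in> V" and V_scale: "v \<in> V \<Longrightarrow> sc c v \<in> V"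
    and finite_I: "finite I"
    and e_add: "i \<in> I \<Longrightarrow> u \<in> V \<Longrightarrow> v \<in> V \<Longrightarrow> e i (u + v) = e i u + e i v"
    and e_scale: "i \<in> I \<Longrightarrow> v \<in> V \<Longrightarrow> e i (sc c v) = c * e i v"
    and e_separates: "v \<in> V \<Longrightarrow> (\<And>i. i \<in> I \<Longrightarrow> e i v = 0) \<Longrightarrow> v = 0"
begin

definition lin :: "('v \<Rightarrow> complex) \<Rightarrow> bool" where
  "lin l \<longleftrightarrow> (\<forall>u\<in>V. \<forall>v\<in>V. l (u + v) = l u + l v) \<and> (\<forall>c. \<forall>v\<in>V. l (sc c v) = c * l v)"

lemma lin_e: "i \<in> I \<Longrightarrow> lin (e i)"
  by (simp add: lin_def e_add e_scale)

lemma V_diff: "u \<in> V \<Longrightarrow> v \<in> V \<Longrightarrow> u - v \<in> V"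
  using V_add[OF _ V_scale[of v "-1"], of u] by (simp add: scale_minus_left)

lemma V_sum: "(\<And>a. a \<in> A \<Longrightarrow> w a \<in> V) \<Longrightarrow> (\<Sum>a\<in>A. w a) \<in> V"
  by (induction A rule: infinite_finite_induct) (auto intro: V_zero V_add)

lemma lin_0: "lin l \<Longrightarrow> l 0 = 0"
  unfolding lin_def using V_zero by (metis mult_zero_left scale_zero_right)

lemma lin_add: "lin l \<Longrightarrow> u \<in> V \<Longrightarrow> v \<in> V \<Longrightarrow> l (u + v) = l u + l v"
  by (simp add: lin_def)

lemma lin_scale: "lin l \<Longrightarrow> v \<in> V \<Longrightarrow> l (sc c v) = c * l v"
  by (simp add: lin_def)

lemma lin_diff: "lin l \<Longrightarrow> u \<in> V \<Longrightarrow> v \<in> V \<Longrightarrow> l (u - v) = l u - l v"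
  using lin_add[of l "u - v" v] V_diff[of u v] by simp

lemma lin_sum: "lin l \<Longrightarrow> (\<And>a. a \<in> A \<Longrightarrow> w a \<in> V) \<Longrightarrow> l (\<Sum>a\<in>A. sc (c a) (w a)) = (\<Sum>a\<in>A. c a * l (w a))"
proof (induction A rule: infinite_finite_induct)
  case (insert a A)
  have "(\<Sum>a\<in>A. sc (c a) (w a)) \<in> V" by (intro V_sum V_scale insert.prems) simp
  moreover have "l (\<Sum>a\<in>A. sc (c a) (w a)) = (\<Sum>a\<in>A. c a * l (w a))"
    by (rule insert.IH[OF insert.prems(1)]) (use insert.prems(2) in simp)
  ultimately show ?case
    using insert.hyps insert.prems by (simp add: lin_add lin_scale V_scale)
qed (auto simp: lin_0)

text \<open>A section of the map with components \<open>\<phi>\<close>, built without bases by adding one functional at a time.\<close>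

lemma pseudo_inverse:
  assumes "finite A" "\<And>a. a \<in> A \<Longrightarrow> lin (\<phi> a)"
  shows "\<exists>w. (\<forall>a. w a \<in> V) \<and> (\<forall>v\<in>V. \<forall>b\<in>A. \<phi> b (\<Sum>a\<in>A. sc (\<phi> a v) (w a)) = \<phi> b v)"
  using assms
proof (induction A)
  case empty
  then show ?case using V_zero by (intro exI[of _ "\<lambda>_. 0"]) auto
next
  case (insert b A)
  from insert.IH[OF insert.prems[OF insertI2]] obtain w where
    w0: "(\<forall>a. w a \<in> V) \<and> (\<forall>v\<in>V. \<forall>c\<in>A. \<phi> c (\<Sum>a\<in>A. sc (\<phi> a v) (w a)) = \<phi> c v)"
    by (rule exE)
  then have w: "w a \<in> V" "v \<in> V \<Longrightarrow> c \<in> A \<Longrightarrow> \<phi> c (\<Sum>a\<in>A. sc (\<phi> a v) (w a)) = \<phi> c v" for a v c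
    by simp_all
  have lb: "lin (\<phi> b)" and la: "\<And>a. a \<in> A \<Longrightarrow> lin (\<phi> a)" using insert.prems by auto
  let ?N = "{v \<in> V. \<forall>a\<in>A. \<phi> a v = 0}"
  show ?case
  proof (cases "\<exists>n\<in>?N. \<phi> b n \<noteq> 0")
    case True
    then obtain m where m: "m \<in> ?N" "\<phi> b m \<noteq> 0" by blast
    define n where "n = sc (1 / \<phi> b m) m"
    have n: "n \<in> V" "\<And>a. a \<in> A \<Longrightarrow> \<phi> a n = 0" "\<phi> b n = 1"
      unfolding n_def using m la lb by (auto simp: V_scale lin_def)
    define w' where "w' a = (if a = b then n else w a - sc (\<phi> b (w a)) n)" for a
    have eq: "(\<Sum>a\<in>insert b A. sc (\<phi> a v) (w' a)) = (\<Sum>a\<in>A. sc (\<phi> a v) (w a)) + sc (\<phi> b v - \<phi> b (\<Sum>a\<in>A. sc (\<phi> a v) (w a))) n" for v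
    proof -
      have "(\<Sum>a\<in>A. sc (\<phi> a v) (w' a)) = (\<Sum>a\<in>A. sc (\<phi> a v) (w a) - sc (\<phi> a v * \<phi> b (w a)) n)"
        by (rule sum.cong) (use insert.hyps in \<open>auto simp: w'_def scale_right_diff_distrib\<close>)
      also have "\<dots> = (\<Sum>a\<in>A. sc (\<phi> a v) (w a)) - sc (\<phi> b (\<Sum>a\<in>A. sc (\<phi> a v) (w a))) n"
        using w(1) by (simp add: sum_subtractf scale_sum_left lin_sum[OF lb])
      finally show ?thesis
        using insert.hyps by (simp add: w'_def scale_left_diff_distrib)
    qed
    have "\<phi> c (\<Sum>a\<in>insert b A. sc (\<phi> a v) (w' a)) = \<phi> c v" if "v \<in> V" "c \<in> insert b A" for v c
    proof -
      let ?S = "\<Sum>a\<in>A. sc (\<phi> a v) (w a)"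
      have S: "?S \<in> V" by (intro V_sum V_scale w)
      have "lin (\<phi> c)" using lb la that by auto
      then have "\<phi> c (?S + sc (\<phi> b v - \<phi> b ?S) n) = \<phi> c ?S + (\<phi> b v - \<phi> b ?S) * \<phi> c n"
        using S n(1) V_scale unfolding lin_def by auto
      then show ?thesis unfolding eq using that w(2)[OF that(1)] n by auto
    qed
    moreover have "w' a \<in> V" for a unfolding w'_def using n w by (auto intro: V_diff V_scale)
    ultimately show ?thesis by (intro exI[of _ w']) auto
  next
    case False
    define w' where "w' a = (if a = b then 0 else w a)" for a
    have eq: "(\<Sum>a\<in>insert b A. sc (\<phi> a v) (w' a)) = (\<Sum>a\<in>A. sc (\<phi> a v) (w a))" for v
    proof -
      have "(\<Sum>a\<in>A. sc (\<phi> a v) (w' a)) = (\<Sum>a\<in>A. sc (\<phi> a v) (w a))"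
        by (rule sum.cong) (use insert.hyps in \<open>auto simp: w'_def\<close>)
      then show ?thesis using insert.hyps by (simp add: w'_def)
    qed
    have "\<phi> b (\<Sum>a\<in>A. sc (\<phi> a v) (w a)) = \<phi> b v" if v: "v \<in> V" for v
    proof -
      let ?S = "\<Sum>a\<in>A. sc (\<phi> a v) (w a)"
      have S: "?S \<in> V" by (intro V_sum V_scale w)
      have "?S - v \<in> ?N" using S v w(2)[OF v] la by (auto simp: V_diff lin_diff)
      then have "\<phi> b (?S - v) = 0" using False by blast
      then show ?thesis using lin_diff[OF lb S v] by simp
    qed
    moreover have "w' a \<in> V" for a by (simp add: w'_def w V_zero)
    ultimately show ?thesis using w(2) by (intro exI[of _ w']) (auto simp: eq)
  qed
qed

lemma basis_expansion: "\<exists>w. (\<forall>i. w i \<in> V) \<and> (\<forall>v\<in>V. v = (\<Sum>i\<in>I. sc (e i v) (w i)))"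
proof -
  from pseudo_inverse[of I e, OF finite_I lin_e] obtain w where
    w0: "(\<forall>i. w i \<in> V) \<and> (\<forall>v\<in>V. \<forall>b\<in>I. e b (\<Sum>a\<in>I. sc (e a v) (w a)) = e b v)" by (rule exE)
  then have w: "w a \<in> V" "v \<in> V \<Longrightarrow> b \<in> I \<Longrightarrow> e b (\<Sum>a\<in>I. sc (e a v) (w a)) = e b v" for a v b
    by simp_all
  have "v = (\<Sum>i\<in>I. sc (e i v) (w i))" if "v \<in> V" for v
  proof -
    have S: "(\<Sum>i\<in>I. sc (e i v) (w i)) \<in> V" by (intro V_sum V_scale w)
    have "v - (\<Sum>i\<in>I. sc (e i v) (w i)) = 0"
      by (rule e_separates[OF V_diff[OF that S]]) (use w(2)[OF that] lin_diff[OF lin_e that S] in auto)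
    then show ?thesis by simp
  qed
  then show ?thesis using w(1) by (intro exI[of _ w]) simp
qed

lemma lin_expansion:
  assumes "lin l"
  shows "\<exists>\<alpha>. \<forall>v\<in>V. l v = (\<Sum>i\<in>I. \<alpha> i * e i v)"
proof -
  obtain w where w: "\<forall>i. w i \<in> V" "\<forall>v\<in>V. v = (\<Sum>i\<in>I. sc (e i v) (w i))"
    using basis_expansion by blast
  have "l v = (\<Sum>i\<in>I. l (w i) * e i v)" if "v \<in> V" for v
    by (subst w(2)[rule_format, OF that], subst lin_sum[OF assms w(1)[rule_format]]) (simp add: mult.commute)
  then show ?thesis by (intro exI[of _ "\<lambda>i. l (w i)"]) simp
qed

lemma function_algebra_polynomial:
  assumes "a \<in> function_algebra (\<lambda>i v. e i v - \<kappa> i) I"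
  shows "a \<in> polynomial_functions sc V"
  using assms
proof induction
  case (gen i)
  have "e i \<in> polynomial_functions sc V"
    by (rule polynomial_functions.linear) (use gen in \<open>auto simp: e_add e_scale\<close>)
  from polynomial_functions.add[OF this polynomial_functions.const[of "- \<kappa> i"]] show ?case by simp
qed (auto intro: polynomial_functions.intros)

lemma polynomial_function_algebra:
  assumes "p \<in> polynomial_functions sc V"
  shows "\<exists>a\<in>function_algebra (\<lambda>i v. e i v - \<kappa> i) I. \<forall>v\<in>V. a v = p v"
  using assms
proof induction
  case (const c)
  then show ?case by (intro bexI[of _ "\<lambda>_. c"]) (auto intro: function_algebra.const)
next
  case (linear l)
  have "lin l" unfolding lin_def using linear by simp
  then obtain \<alpha> where \<alpha>: "\<forall>v\<in>V. l v = (\<Sum>i\<in>I. \<alpha> i * e i v)" using lin_expansion by blast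
  let ?y = "\<lambda>i v. e i v - \<kappa> i"
  have "(\<lambda>v. \<Sum>i\<in>I. \<alpha> i * (?y i v + \<kappa> i)) \<in> ideal_power ?y I 0"
    by (intro ideal_power_sum ideal_power_cmult ideal_power_add)
      (auto intro: function_algebra.gen[of _ I ?y] function_algebra.const)
  then show ?case using \<alpha> by (intro bexI[of _ "\<lambda>v. \<Sum>i\<in>I. \<alpha> i * (?y i v + \<kappa> i)"]) auto
next
  case (add p q)
  then obtain a b where "a\<in>function_algebra (\<lambda>i v. e i v - \<kappa> i) I" "\<forall>v\<in>V. a v = p v"
    "b\<in>function_algebra (\<lambda>i v. e i v - \<kappa> i) I" "\<forall>v\<in>V. b v = q v" by blast
  then show ?case by (intro bexI[of _ "\<lambda>v. a v + b v"]) (auto intro: function_algebra.add)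
next
  case (mult p q)
  then obtain a b where "a\<in>function_algebra (\<lambda>i v. e i v - \<kappa> i) I" "\<forall>v\<in>V. a v = p v"
    "b\<in>function_algebra (\<lambda>i v. e i v - \<kappa> i) I" "\<forall>v\<in>V. b v = q v" by blast
  then show ?case by (intro bexI[of _ "\<lambda>v. a v * b v"]) (auto intro: function_algebra.mult)
qed

end

definition homogeneous_of_degree ::
    "(complex \<Rightarrow> 'a \<Rightarrow> 'a) \<Rightarrow> 'a::ab_group_add set \<Rightarrow> nat \<Rightarrow> ('a \<Rightarrow> complex) set" where
  "homogeneous_of_degree sc V d = {p \<in> polynomial_functions sc V. \<forall>c. \<forall>v\<in>V. p (sc c v) = c ^ d * p v}"

lemma homogeneous_of_degree_zero: "(\<lambda>_. 0) \<in> homogeneous_of_degree sc V d"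
  by (simp add: homogeneous_of_degree_def polynomial_functions.const)

lemma homogeneous_of_degree_sum:
  "(\<And>j. j \<in> J \<Longrightarrow> f j \<in> homogeneous_of_degree sc V d) \<Longrightarrow> (\<lambda>v. \<Sum>j\<in>J. f j v) \<in> homogeneous_of_degree sc V d"
proof (induction J rule: infinite_finite_induct)
  case (insert j J)
  then show ?case
    by (auto simp: homogeneous_of_degree_def algebra_simps intro: polynomial_functions.add)
qed (auto simp: homogeneous_of_degree_zero)

lemma homogeneous_of_degree_mult:
  "f \<in> homogeneous_of_degree sc V d \<Longrightarrow> g \<in> homogeneous_of_degree sc V d' \<Longrightarrow>
    (\<lambda>v. f v * g v) \<in> homogeneous_of_degree sc V (d + d')"
  by (auto simp: homogeneous_of_degree_def power_add algebra_simps intro: polynomial_functions.mult)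

lemma homogeneous_of_degree_subset: "homogeneous_of_degree sc V d \<subseteq> homogeneous_polynomials sc V"
  by (auto simp: homogeneous_of_degree_def homogeneous_polynomials_def)

text \<open>Homogeneous components are needed because only homogeneous polynomials define closed subsets of
  the projectivization.\<close>

lemma homogeneous_decomposition:
  assumes "p \<in> polynomial_functions sc V"
  shows "\<exists>n q. (\<forall>d. q d \<in> homogeneous_of_degree sc V d) \<and> (\<forall>d>n. q d = (\<lambda>_. 0)) \<and> (\<forall>v. p v = (\<Sum>d\<le>n. q d v))"
  using assms
proof induction
  case (const a)
  show ?case
    by (rule exI[of _ 0], rule exI[of _ "\<lambda>d. if d = 0 then (\<lambda>_. a) else (\<lambda>_. 0)"])
       (auto simp: homogeneous_of_degree_zero if_distribR cong: if_cong,
        auto simp: homogeneous_of_degree_def polynomial_functions.const)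
next
  case (linear l)
  have l1: "l \<in> homogeneous_of_degree sc V 1"
    unfolding homogeneous_of_degree_def using linear polynomial_functions.linear[of V l sc] by simp
  show ?case
  proof (rule exI[of _ "1::nat"], rule exI[of _ "\<lambda>d. if d = 1 then l else (\<lambda>_. 0)"], intro conjI allI)
    show "(if d = 1 then l else (\<lambda>_. 0)) \<in> homogeneous_of_degree sc V d" for d
      using l1 by (simp add: homogeneous_of_degree_zero)
  qed (simp_all add: if_distribR)
next
  case (add p q)
  then obtain n a m b where
    a: "\<And>d. a d \<in> homogeneous_of_degree sc V d" "\<And>d. d > n \<Longrightarrow> a d = (\<lambda>_. 0)" "\<And>v. p v = (\<Sum>d\<le>n. a d v)" and
    b: "\<And>d. b d \<in> homogeneous_of_degree sc V d" "\<And>d. d > m \<Longrightarrow> b d = (\<lambda>_. 0)" "\<And>v. q v = (\<Sum>d\<le>m. b d v)"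
    by metis
  have "(\<Sum>d\<le>N. r d v) = (\<Sum>d\<le>k. r d v)"
    if "k \<le> N" "\<And>d. d > k \<Longrightarrow> r d = (\<lambda>_. 0)" for N k and r :: "nat \<Rightarrow> 'a \<Rightarrow> complex" and v
    by (rule sum.mono_neutral_right) (use that in auto)
  from this[of n "max n m" a] this[of m "max n m" b] a(2) b(2)
  have "(\<Sum>d\<le>max n m. a d v) = (\<Sum>d\<le>n. a d v)" "(\<Sum>d\<le>max n m. b d v) = (\<Sum>d\<le>m. b d v)" for v
    by auto
  then show ?case
  proof (intro exI[of _ "max n m"] exI[of _ "\<lambda>d v. a d v + b d v"] conjI allI impI)
    show "(\<lambda>v. a d v + b d v) \<in> homogeneous_of_degree sc V d" for d
      using homogeneous_of_degree_sum[of "{0,1::nat}" "\<lambda>j. if j = 0 then a d else b d" sc V d] a(1) b(1) by simp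
  qed (use a b in \<open>auto simp: sum.distrib\<close>)
next
  case (mult p q)
  then obtain n a m b where
    a: "\<And>d. a d \<in> homogeneous_of_degree sc V d" "\<And>d. d > n \<Longrightarrow> a d = (\<lambda>_. 0)" "\<And>v. p v = (\<Sum>d\<le>n. a d v)" and
    b: "\<And>d. b d \<in> homogeneous_of_degree sc V d" "\<And>d. d > m \<Longrightarrow> b d = (\<lambda>_. 0)" "\<And>v. q v = (\<Sum>d\<le>m. b d v)"
    by metis
  show ?case
  proof (intro exI[of _ "n + m"] exI[of _ "\<lambda>d v. \<Sum>k\<le>d. a k v * b (d - k) v"] conjI allI impI)
    show "(\<lambda>v. \<Sum>k\<le>d. a k v * b (d - k) v) \<in> homogeneous_of_degree sc V d" for d
    proof (rule homogeneous_of_degree_sum)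
      fix k assume "k \<in> {..d}"
      then show "(\<lambda>v. a k v * b (d - k) v) \<in> homogeneous_of_degree sc V d"
        using homogeneous_of_degree_mult[OF a(1)[of k] b(1)[of "d - k"]] by simp
    qed
    show "(\<lambda>v. \<Sum>k\<le>d. a k v * b (d - k) v) = (\<lambda>_. 0)" if "d > n + m" for d
    proof (rule HOL.ext, rule sum.neutral, rule ballI)
      fix v k assume "k \<in> {..d}"
      show "a k v * b (d - k) v = 0"
      proof (cases "k > n")
        case False
        then have "d - k > m" using that by simp
        then show ?thesis using b(2) by simp
      qed (use a(2) in simp)
    qed
    show "p v * q v = (\<Sum>d\<le>n + m. \<Sum>k\<le>d. a k v * b (d - k) v)" for v
      using polynomial_product[of n "\<lambda>j. a j v" m "\<lambda>j. b j v" 1] a b by simp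
  qed
qed

context coordinatized
begin

text \<open>A quadratic map whose polarization at \<open>v\<^sub>0\<close> has a kernel which consists of vectors tangent
  to \<open>C\<close> at \<open>v\<^sub>0\<close> cuts out nothing but \<open>C\<close> near \<open>v\<^sub>0\<close>.\<close>

theorem locally_contained:
  fixes b :: "'a \<Rightarrow> 'v \<Rightarrow> 'v \<Rightarrow> complex"
  assumes A: "finite A" and bl: "\<And>a u. a \<in> A \<Longrightarrow> u \<in> V \<Longrightarrow> lin (b a u)"
    and bs: "\<And>a u v. a \<in> A \<Longrightarrow> u \<in> V \<Longrightarrow> v \<in> V \<Longrightarrow> b a u v = b a v u"
    and v0: "v0 \<in> K" and K: "K \<subseteq> V" "\<And>a v. a \<in> A \<Longrightarrow> v \<in> K \<Longrightarrow> b a v v = 0"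
    and p: "p \<in> polynomial_functions sc V" "C \<subseteq> K" "\<And>v. v \<in> C \<Longrightarrow> p v = 0"
    and arcs: "\<And>w. w \<in> V \<Longrightarrow> (\<forall>a\<in>A. b a v0 w = 0) \<Longrightarrow> \<exists>\<gamma> s. (\<forall>n. \<gamma> n \<in> C \<and> s n \<noteq> 0) \<and>
      s \<longlonglongrightarrow> 0 \<and> (\<forall>i\<in>I. (\<lambda>n::nat. (e i (\<gamma> n) - e i v0) / s n) \<longlonglongrightarrow> e i w)"
  shows "\<exists>q\<in>polynomial_functions sc V. q v0 = 1 \<and> (\<forall>v\<in>K. q v * p v = 0)"
proof -
  let ?y = "\<lambda>i v. e i v - e i v0"
  have v0V: "v0 \<in> V" using v0 K by blast
  have lin\<phi>: "lin (b a v0)" if "a \<in> A" for a using bl[OF that v0V] .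
  obtain w where w: "\<And>a. w a \<in> V"
      "\<And>v a'. v \<in> V \<Longrightarrow> a' \<in> A \<Longrightarrow> b a' v0 (\<Sum>a\<in>A. sc (b a v0 v) (w a)) = b a' v0 v"
    using pseudo_inverse[of A "\<lambda>a. b a v0", OF A lin\<phi>] by auto
  define \<pi> where "\<pi> v = v - (\<Sum>a\<in>A. sc (b a v0 v) (w a))" for v
  have SV: "(\<Sum>a\<in>A. sc (b a v0 v) (w a)) \<in> V" for v by (intro V_sum V_scale w)
  have \<pi>V: "\<pi> v \<in> V" if "v \<in> V" for v unfolding \<pi>_def by (intro V_diff that SV)
  have \<pi>0: "b a v0 (\<pi> v) = 0" if "v \<in> V" "a \<in> A" for v a
    unfolding \<pi>_def using lin_diff[OF lin\<phi>[OF that(2)] that(1) SV] w(2)[OF that] by simp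
  have e\<pi>: "e i (\<pi> v) = e i v - (\<Sum>a\<in>A. b a v0 v * e i (w a))" if "v \<in> V" "i \<in> I" for i v
    unfolding \<pi>_def lin_diff[OF lin_e[OF that(2)] that(1) SV] lin_sum[OF lin_e[OF that(2)] w(1)] ..
  have "lin (\<lambda>v. e i (\<pi> v))" if i: "i \<in> I" for i
    unfolding lin_def
  proof (intro conjI ballI allI)
    fix u v assume uv: "u \<in> V" "v \<in> V"
    show "e i (\<pi> (u + v)) = e i (\<pi> u) + e i (\<pi> v)"
      using uv by (simp add: e\<pi>[OF V_add[OF uv] i] e\<pi>[OF uv(1) i] e\<pi>[OF uv(2) i] e_add[OF i]
        lin_add[OF lin\<phi>] sum.distrib algebra_simps)
  next
    fix c v assume v: "v \<in> V"
    show "e i (\<pi> (sc c v)) = c * e i (\<pi> v)"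
      using v by (simp add: e\<pi>[OF V_scale[OF v] i] e\<pi>[OF v i] e_scale[OF i]
        lin_scale[OF lin\<phi>] sum_distrib_left algebra_simps)
  qed
  then have "\<forall>i\<in>I. \<exists>\<alpha>. \<forall>v\<in>V. e i (\<pi> v) = (\<Sum>j\<in>I. \<alpha> j * e j v)" using lin_expansion by blast
  then obtain \<alpha> where \<alpha>: "\<And>i v. i \<in> I \<Longrightarrow> v \<in> V \<Longrightarrow> e i (\<pi> v) = (\<Sum>j\<in>I. \<alpha> i j * e j v)" by metis
  define z where "z i v = (\<Sum>j\<in>I. \<alpha> i j * ?y j v)" for i v
  have z: "z i v = e i (\<pi> (v - v0))" if "i \<in> I" "v \<in> V" for i v
    unfolding z_def \<alpha>[OF that(1) V_diff[OF that(2) v0V]]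
    by (rule sum.cong) (use that v0V in \<open>auto simp: lin_diff lin_e\<close>)
  obtain x where x: "\<forall>i. x i \<in> V" "\<forall>v\<in>V. v = (\<Sum>i\<in>I. sc (e i v) (x i))"
    using basis_expansion by blast
  have xV: "x i \<in> V" for i using x(1) by blast
  have quadratic: "b a u u = (\<Sum>i\<in>I. e i u * (\<Sum>j\<in>I. e j u * b a (x j) (x i)))" if a: "a \<in> A" and u: "u \<in> V" for a u
  proof -
    have "b a u u = (\<Sum>i\<in>I. e i u * b a u (x i))"
      using lin_sum[where w = x and A = I and c = "\<lambda>i. e i u", OF bl[OF a u] xV] x(2)[rule_format, OF u] by simp
    also have "\<dots> = (\<Sum>i\<in>I. e i u * b a (x i) u)"
      using bs[OF a u x(1)[rule_format]] by simp
    also have "\<dots> = (\<Sum>i\<in>I. e i u * (\<Sum>j\<in>I. e j u * b a (x i) (x j)))"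
    proof (rule sum.cong)
      fix i
      have "b a (x i) u = (\<Sum>j\<in>I. e j u * b a (x i) (x j))"
        using lin_sum[where w = x and A = I and c = "\<lambda>j. e j u", OF bl[OF a xV] xV] x(2)[rule_format, OF u] by simp
      then show "e i u * b a (x i) u = e i u * (\<Sum>j\<in>I. e j u * b a (x i) (x j))" by simp
    qed simp
    finally show ?thesis using bs[OF a x(1)[rule_format] x(1)[rule_format]] by simp
  qed
  have quad_ideal: "\<exists>r\<in>ideal_power ?y I 2. \<forall>v\<in>V. b a (v - v0) (v - v0) = r v" if a: "a \<in> A" for a
  proof
    show "(\<lambda>v. \<Sum>i\<in>I. ?y i v * (\<Sum>j\<in>I. ?y j v * b a (x j) (x i))) \<in> ideal_power ?y I 2"
      unfolding numeral_2_eq_2 by (intro ideal_power_SucI) (simp add: function_algebra.const)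
    show "\<forall>v\<in>V. b a (v - v0) (v - v0) = (\<Sum>i\<in>I. ?y i v * (\<Sum>j\<in>I. ?y j v * b a (x j) (x i)))"
    proof
      fix v assume v: "v \<in> V"
      have "e i (v - v0) = ?y i v" if "i \<in> I" for i using lin_diff[OF lin_e[OF that] v v0V] .
      then show "b a (v - v0) (v - v0) = (\<Sum>i\<in>I. ?y i v * (\<Sum>j\<in>I. ?y j v * b a (x j) (x i)))"
        unfolding quadratic[OF a V_diff[OF v v0V]] by simp
    qed
  qed
  have tangent: "b a v0 (v - v0) = - 1/2 * b a (v - v0) (v - v0)" if a: "a \<in> A" and v: "v \<in> K" for a v
  proof -
    have vV: "v \<in> V" using v K by blast
    let ?d = "v - v0"
    have dV: "?d \<in> V" by (rule V_diff[OF vV v0V])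
    have "b a v ?d = b a v v - b a v v0" by (rule lin_diff[OF bl[OF a vV] vV v0V])
    moreover have "b a v0 ?d = b a v0 v - b a v0 v0" by (rule lin_diff[OF bl[OF a v0V] vV v0V])
    moreover have "b a ?d ?d = b a ?d v - b a ?d v0" by (rule lin_diff[OF bl[OF a dV] vV v0V])
    moreover have "b a ?d v = b a v ?d" "b a ?d v0 = b a v0 ?d" "b a v v0 = b a v0 v"
      using bs a vV v0V dV by auto
    ultimately show ?thesis using K(2)[OF a v] K(2)[OF a v0] by simp
  qed
  obtain p' where p': "p' \<in> function_algebra ?y I" "\<forall>v\<in>V. p' v = p v"
    using polynomial_function_algebra[OF p(1), of "\<lambda>i. e i v0"] by blast
  have "\<exists>q\<in>ideal_power ?y I 1. \<forall>v\<in>K. (1 - q v) * p' v = 0"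
  proof (rule smooth_point[OF finite_I p'(1) p(2)])
    show "p' v = 0" if "v \<in> C" for v using p p' K that by auto
    show "z i \<in> ideal_power ?y I 1" for i
      unfolding z_def
    proof (rule ideal_power_sum, rule ideal_power_cmult)
      fix j assume "j \<in> I"
      from generator_in_ideal[OF finite_I this, of ?y] show "(\<lambda>v. ?y j v) \<in> ideal_power ?y I 1" .
    qed
    show "\<exists>r\<in>ideal_power ?y I 2. \<forall>v\<in>K. ?y i v - z i v = r v" if i: "i \<in> I" for i
    proof -
      have "\<forall>a\<in>A. \<exists>r. r \<in> ideal_power ?y I 2 \<and> (\<forall>v\<in>V. b a (v - v0) (v - v0) = r v)"
        by (intro ballI, drule quad_ideal, erule bexE, rule exI, rule conjI)
      from bchoice[OF this] obtain r where
        r0: "\<forall>a\<in>A. r a \<in> ideal_power ?y I 2 \<and> (\<forall>v\<in>V. b a (v - v0) (v - v0) = r a v)" by (rule exE)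
      have r: "r a \<in> ideal_power ?y I 2" if "a \<in> A" for a using r0 that by blast
      have r': "b a (v - v0) (v - v0) = r a v" if "a \<in> A" "v \<in> V" for a v using r0 that by blast
      show ?thesis
      proof
        show "(\<lambda>v. \<Sum>a\<in>A. (- 1/2 * e i (w a)) * r a v) \<in> ideal_power ?y I 2"
          by (intro ideal_power_sum ideal_power_cmult r)
        show "\<forall>v\<in>K. ?y i v - z i v = (\<Sum>a\<in>A. (- 1/2 * e i (w a)) * r a v)"
        proof
          fix v assume v: "v \<in> K"
          then have vV: "v \<in> V" and dV: "v - v0 \<in> V" using K v0V V_diff by auto
          have "?y i v - z i v = (\<Sum>a\<in>A. b a v0 (v - v0) * e i (w a))"
            unfolding z[OF i vV] e\<pi>[OF dV i] using lin_diff[OF lin_e[OF i] vV v0V] by simp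
          also have "\<dots> = (\<Sum>a\<in>A. (- 1/2 * e i (w a)) * r a v)"
            by (rule sum.cong) (use tangent[OF _ v] r'[OF _ vV] in auto)
          finally show "?y i v - z i v = (\<Sum>a\<in>A. (- 1/2 * e i (w a)) * r a v)" .
        qed
      qed
    qed
    fix v assume v: "v \<in> K"
    then have vV: "v \<in> V" and dV: "v - v0 \<in> V" using K v0V V_diff by auto
    show "\<exists>\<gamma> s. (\<forall>n. \<gamma> n \<in> C \<and> s n \<noteq> 0) \<and> s \<longlonglongrightarrow> 0 \<and> (\<forall>i\<in>I. (\<lambda>n. ?y i (\<gamma> n) / s n) \<longlonglongrightarrow> z i v)"
      using arcs[OF \<pi>V[OF dV]] \<pi>0[OF dV] z[OF _ vV] by simp
  qed
  then obtain q where q: "q \<in> ideal_power ?y I 1" "\<forall>v\<in>K. (1 - q v) * p' v = 0" by blast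
  have "q \<in> ideal_power ?y I (Suc 0)" using q(1) unfolding One_nat_def .
  then have q0: "q v0 = 0" by (rule ideal_power_1_vanish) simp
  have "q \<in> function_algebra ?y I"
    using ideal_power_antimono[OF finite_I, of 0 1 ?y] q(1) by auto
  then have "(\<lambda>v. 1 + (- 1) * q v) \<in> function_algebra ?y I"
    by (intro function_algebra.add function_algebra.const function_algebra.mult)
  then have "(\<lambda>v. 1 + (- 1) * q v) \<in> polynomial_functions sc V"
    by (rule function_algebra_polynomial)
  moreover have "(1 + (- 1) * q v) * p v = 0" if "v \<in> K" for v
  proof -
    have "p' v = p v" using p'(2) K(1) that by blast
    then show ?thesis using q(2) that by auto
  qed
  ultimately show ?thesis
    using q0 by (intro bexI[of _ "\<lambda>v. 1 + (- 1) * q v"]) auto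
qed

text \<open>Let \<open>D\<close> be irreducible with \<open>C \<subseteq> D \<subseteq> P\<close>.  If \<open>p\<close> is homogeneous and vanishes on \<open>C\<close>, then the local
  statement gives a polynomial \<open>q\<close> with \<open>q v0 \<noteq> 0\<close> such that \<open>q p\<close> vanishes on \<open>P\<close>.  A homogeneous component
  of \<open>q\<close> has the same two properties, so \<open>D\<close> is covered by the zeros of this component and the zeros of \<open>p\<close>,
  and the former omit \<open>v0\<close>.\<close>

theorem irreducible_component_criterion:
  fixes b :: "'a \<Rightarrow> 'v \<Rightarrow> 'v \<Rightarrow> complex"
  assumes P: "P \<subseteq> projectivization sc V" and C: "C \<subseteq> P" "closedin (zariski sc V) C"
    and irr: "irreducible_space (subtopology (zariski sc V) C)"
    and A: "finite A" and bl: "\<And>a u. a \<in> A \<Longrightarrow> u \<in> V \<Longrightarrow> lin (b a u)"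
    and bs: "\<And>a u v. a \<in> A \<Longrightarrow> u \<in> V \<Longrightarrow> v \<in> V \<Longrightarrow> b a u v = b a v u"
    and v0: "v0 \<in> V - {0}" "proj_class sc v0 \<in> C"
    and F: "\<And>a v. a \<in> A \<Longrightarrow> v \<in> V - {0} \<Longrightarrow> proj_class sc v \<in> P \<Longrightarrow> b a v v = 0"
    and arcs: "\<And>w. w \<in> V \<Longrightarrow> (\<forall>a\<in>A. b a v0 w = 0) \<Longrightarrow> \<exists>\<gamma> s. (\<forall>n. \<gamma> n \<in> V - {0} \<and> proj_class sc (\<gamma> n) \<in> C \<and> s n \<noteq> 0) \<and>
      s \<longlonglongrightarrow> 0 \<and> (\<forall>i\<in>I. (\<lambda>n::nat. (e i (\<gamma> n) - e i v0) / s n) \<longlonglongrightarrow> e i w)"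
  shows "irreducible_component (subtopology (zariski sc V) P) C"
  unfolding irreducible_component_def
proof (intro conjI allI impI; (elim conjE)?)
  have vs: "vector_space sc" by (rule vector_space_axioms)
  have top: "topspace (subtopology (zariski sc V) P) = P"
    using P by (auto simp: topspace_zariski)
  show "C \<subseteq> topspace (subtopology (zariski sc V) P)" using C(1) top by simp
  have sub: "subtopology (subtopology (zariski sc V) P) D = subtopology (zariski sc V) D" if "D \<subseteq> P" for D
    using that by (simp add: subtopology_subtopology inf.absorb2)
  show "irreducible_space (subtopology (subtopology (zariski sc V) P) C)"
    using irr sub[OF C(1)] by simp
  fix D assume D: "C \<subseteq> D" "D \<subseteq> topspace (subtopology (zariski sc V) P)"
    "irreducible_space (subtopology (subtopology (zariski sc V) P) D)"
  have DP: "D \<subseteq> P" using D(2) top by simp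
  have Dirr: "irreducible_space (subtopology (zariski sc V) D)" using D(3) sub[OF DP] by simp
  have Dtop: "topspace (subtopology (zariski sc V) D) = D" using DP P by (auto simp: topspace_zariski)
  let ?K = "{v \<in> V - {0}. proj_class sc v \<in> D}"
  let ?C = "{v \<in> V - {0}. proj_class sc v \<in> C}"
  obtain E where E: "E \<subseteq> homogeneous_polynomials sc V" "C = zero_locus sc V E"
    using C(2) closedin_zariski[OF vs] by blast
  have "D \<subseteq> zero_locus sc V {p}" if p: "p \<in> E" for p
  proof -
    have pH: "p \<in> homogeneous_polynomials sc V" using p E by blast
    have pC: "p v = 0" if "v \<in> ?C" for v
      using that proj_class_in_zero_locus[OF vs E(1)] E(2) p by auto
    have "\<exists>q\<in>polynomial_functions sc V. q v0 = 1 \<and> (\<forall>v\<in>?K. q v * p v = 0)"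
    proof (rule locally_contained[where C = ?C and A = A and b = b])
      show "v0 \<in> ?K" "?C \<subseteq> ?K" using v0 D(1) by auto
      show "?K \<subseteq> V" by blast
      show "p \<in> polynomial_functions sc V" using pH by (simp add: homogeneous_polynomials_def)
      show "b a v v = 0" if "a \<in> A" "v \<in> ?K" for a v using F[OF that(1)] that(2) DP by blast
      show "\<exists>\<gamma> s. (\<forall>n. \<gamma> n \<in> ?C \<and> s n \<noteq> 0) \<and> s \<longlonglongrightarrow> 0 \<and>
        (\<forall>i\<in>I. (\<lambda>n::nat. (e i (\<gamma> n) - e i v0) / s n) \<longlonglongrightarrow> e i w)"
        if "w \<in> V" "\<forall>a\<in>A. b a v0 w = 0" for w using arcs[OF that] by auto
    qed (use A bl bs pC in auto)
    then obtain q where q: "q \<in> polynomial_functions sc V" "q v0 = 1" "\<And>v. v \<in> ?K \<Longrightarrow> q v * p v = 0"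
      by blast
    obtain n h where h: "\<And>d. h d \<in> homogeneous_of_degree sc V d" "\<And>v. q v = (\<Sum>d\<le>n. h d v)"
      using homogeneous_decomposition[OF q(1)] by blast
    obtain m where m: "\<And>c v. v \<in> V \<Longrightarrow> p (sc c v) = c ^ m * p v"
      using pH unfolding homogeneous_polynomials_def by blast
    have hp: "h d v * p v = 0" if v: "v \<in> ?K" and d: "d \<le> n" for v d
    proof (cases "p v = 0")
      case False
      have "(\<Sum>d\<le>n. h d v * c ^ d) = 0" if c: "c \<noteq> 0" for c
      proof -
        have "proj_class sc (sc c v) = proj_class sc v"
          unfolding proj_class_def
        proof (intro equalityI subsetI)
          fix u assume "u \<in> {sc k (sc c v) |k. k \<noteq> 0}"
          then obtain k where k: "k \<noteq> 0" "u = sc (k * c) v" by auto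
          then show "u \<in> {sc k v |k. k \<noteq> 0}" using c by (intro CollectI exI[of _ "k * c"]) simp
        next
          fix u assume "u \<in> {sc k v |k. k \<noteq> 0}"
          then obtain k where "k \<noteq> 0" "u = sc k v" by auto
          then show "u \<in> {sc k (sc c v) |k. k \<noteq> 0}" using c by (intro CollectI exI[of _ "k / c"]) simp
        qed
        then have "sc c v \<in> ?K" using v c V_scale by auto
        then have "q (sc c v) * (c ^ m * p v) = 0" using q(3) m v by fastforce
        then have "q (sc c v) = 0" using False c by simp
        moreover have "h d (sc c v) = h d v * c ^ d" for d
          using h(1)[of d] v by (simp add: homogeneous_of_degree_def)
        ultimately show ?thesis using h(2) by simp
      qed
      then have sub: "- {0} \<subseteq> {c. poly (\<Sum>d\<le>n. monom (h d v) d) c = 0}"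
        by (auto simp: poly_sum poly_monom)
      have "infinite (- {0::complex})" by (simp add: finite_compl infinite_UNIV_char_0)
      then have "(\<Sum>d\<le>n. monom (h d v) d) = 0"
        using sub poly_roots_finite finite_subset by blast
      then have "coeff (\<Sum>d\<le>n. monom (h d v) d) d = 0" by simp
      then show ?thesis using d by (simp add: coeff_sum)
    qed simp
    obtain d where d: "d \<le> n" "h d v0 \<noteq> 0"
      using h(2)[of v0] q(2) by (metis atMost_iff sum.neutral zero_neq_one)
    have hH: "h d \<in> homogeneous_polynomials sc V" using h(1) homogeneous_of_degree_subset by blast
    let ?Z = "\<lambda>f. zero_locus sc V {f}"
    have cl: "closedin (zariski sc V) (?Z f)" if "f \<in> homogeneous_polynomials sc V" for f
      using closedin_zariski[OF vs] that by blast
    have "D \<inter> ?Z (h d) = D \<or> D \<inter> ?Z p = D"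
    proof -
      have "S \<in> ?Z (h d) \<or> S \<in> ?Z p" if S: "S \<in> D" for S
      proof -
        obtain v where v: "v \<in> V - {0}" "S = proj_class sc v"
          using S DP P unfolding projectivization_def by blast
        then have "h d v = 0 \<or> p v = 0" using hp[of v d] d(1) S by auto
        then show ?thesis using v by (auto simp: zero_locus_def)
      qed
      then have "(D \<inter> ?Z (h d)) \<union> (D \<inter> ?Z p) = D" by blast
      moreover have "closedin (subtopology (zariski sc V) D) (D \<inter> ?Z (h d))"
        "closedin (subtopology (zariski sc V) D) (D \<inter> ?Z p)"
        using cl[OF hH] cl[OF pH] by (auto simp: closedin_subtopology)
      ultimately show ?thesis using Dirr unfolding irreducible_space_def Dtop by blast
    qed
    moreover have "proj_class sc v0 \<notin> ?Z (h d)"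
      using proj_class_in_zero_locus[OF vs _ v0(1), of "{h d}"] hH d(2) by auto
    ultimately show ?thesis using v0(2) D(1) by blast
  qed
  note DZ = this
  have "D \<subseteq> zero_locus sc V E"
  proof
    fix S assume S: "S \<in> D"
    then obtain v where v: "v \<in> V - {0}" "S = proj_class sc v"
      using DP P unfolding projectivization_def by blast
    have "p v = 0" if "p \<in> E" for p
      using DZ[OF that] S v proj_class_in_zero_locus[OF vs _ v(1), of "{p}"] E(1) that by auto
    then show "S \<in> zero_locus sc V E" using v by (auto simp: zero_locus_def)
  qed
  then show "D = C" using D(1) E(2) by simp
qed

end

section \<open>Polynomials in several variables\<close>

lemma avoid_hyperplanes:
  fixes f :: "'a \<Rightarrow> 'w::real_vector \<Rightarrow> 'b::real_vector"
  assumes "finite L" "\<And>a. a \<in> L \<Longrightarrow> linear (f a)" "\<And>a. a \<in> L \<Longrightarrow> \<exists>w. f a w \<noteq> 0"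
  shows "\<exists>w. \<forall>a\<in>L. f a w \<noteq> 0"
  using assms
proof (induction L)
  case (insert b L)
  then obtain w where w: "\<forall>a\<in>L. f a w \<noteq> 0" by auto
  obtain w' where w': "f b w' \<noteq> 0" using insert.prems(2) by auto
  have add: "f a (w + s *\<^sub>R w') = f a w + s *\<^sub>R f a w'" if "a \<in> insert b L" for a s
    using insert.prems(1)[OF that] by (simp add: linear_add linear_scale)
  show ?case
  proof (cases "f b w = 0")
    case True
    have bad: "finite {s. f a w + s *\<^sub>R f a w' = 0}" if a: "a \<in> L" for a
    proof (cases "\<exists>s. f a w + s *\<^sub>R f a w' = 0")
      case True
      then obtain s where s: "f a w + s *\<^sub>R f a w' = 0" by blast
      have "f a w' \<noteq> 0" using s w a by auto
      then have "{s. f a w + s *\<^sub>R f a w' = 0} \<subseteq> {s}"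
        using s by (auto simp: add_eq_0_iff) (metis scaleR_cancel_right)
      then show ?thesis using finite_subset by blast
    qed simp
    have "finite (insert 0 (\<Union>a\<in>L. {s. f a w + s *\<^sub>R f a w' = 0}))" using insert.hyps bad by auto
    then obtain s where s: "s \<notin> insert 0 (\<Union>a\<in>L. {s. f a w + s *\<^sub>R f a w' = 0})"
      using ex_new_if_finite[OF infinite_UNIV_char_0] by blast
    show ?thesis
      by (rule exI[of _ "w + s *\<^sub>R w'"]) (use s True w' add in auto)
  next
    case False
    then show ?thesis using w by (intro exI[of _ w]) auto
  qed
qed simp

definition torus :: "(complex ^ 'n::finite) set" where
  "torus = {x. \<forall>i. x $ i \<noteq> 0}"

definition laurent_monomial :: "('n::finite \<Rightarrow> int) \<Rightarrow> complex ^ 'n \<Rightarrow> complex" where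
  "laurent_monomial u x = (\<Prod>i\<in>UNIV. x $ i powi u i)"

lemma laurent_monomial_nonzero: "x \<in> torus \<Longrightarrow> laurent_monomial u x \<noteq> 0"
  by (simp add: torus_def laurent_monomial_def)

lemma laurent_monomial_add:
  "x \<in> torus \<Longrightarrow> laurent_monomial (\<lambda>i. u i + w i) x = laurent_monomial u x * laurent_monomial w x"
  by (simp add: torus_def laurent_monomial_def power_int_add prod.distrib)

lemma laurent_monomial_scale:
  "t \<noteq> 0 \<Longrightarrow> laurent_monomial u (t *s x) = t powi (\<Sum>i\<in>UNIV. u i) * laurent_monomial u x"
proof -
  assume t: "t \<noteq> 0"
  have "(\<Prod>i\<in>A. t powi u i) = t powi (\<Sum>i\<in>A. u i)" for A :: "'a set"
    by (induction A rule: infinite_finite_induct) (simp_all add: t power_int_add)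
  then show ?thesis
    by (simp add: laurent_monomial_def power_int_mult_distrib prod.distrib)
qed

text \<open>Along the powers of a point of the positive real torus whose logarithm separates the exponents,
  the monomials are geometric progressions with distinct ratios.  They are separated by the values of
  polynomials at these ratios, and powers up to the number of monomials suffice.\<close>

lemma laurent_monomials_test_set:
  fixes U :: "('n::finite \<Rightarrow> int) set"
  assumes U: "finite U"
  shows "\<exists>G. finite G \<and> G \<subseteq> torus \<and>
    (\<forall>c u. (\<forall>x\<in>G. (\<Sum>u\<in>U. c u * laurent_monomial u x) = 0) \<longrightarrow> u \<in> U \<longrightarrow> c u = (0::complex))"
proof -
  let ?f = "\<lambda>(u, w) (k :: real ^ 'n). \<Sum>i\<in>UNIV. k $ i * (u i - w i)"
  let ?L = "{(u, w) \<in> U \<times> U. u \<noteq> w}"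
  have "\<exists>k. \<forall>a\<in>?L. ?f a k \<noteq> 0"
  proof (rule avoid_hyperplanes)
    show "finite ?L" by (rule finite_subset[of _ "U \<times> U"]) (use U in auto)
    show "linear (?f a)" for a
      by (rule linearI) (auto simp: case_prod_beta algebra_simps sum.distrib sum_subtractf sum_distrib_left)
    fix a assume "a \<in> ?L"
    then obtain u w where a: "a = (u, w)" "u \<noteq> w" by auto
    then obtain j where "u j \<noteq> w j" by (auto simp: fun_eq_iff)
    then have "?f a (axis j 1) \<noteq> 0"
      by (auto simp: a axis_def if_distrib if_distribR cong: if_cong)
    then show "\<exists>k. ?f a k \<noteq> 0" by blast
  qed
  then obtain k where k: "\<forall>a\<in>?L. ?f a k \<noteq> 0" by blast
  define \<kappa> where "\<kappa> u = (\<Sum>i\<in>UNIV. k $ i * u i)" for u :: "'n \<Rightarrow> int"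
  have inj: "\<kappa> u \<noteq> \<kappa> w" if "u \<in> U" "w \<in> U" "u \<noteq> w" for u w
    using k that by (auto simp: \<kappa>_def algebra_simps sum_subtractf)
  define \<zeta> where "\<zeta> u = complex_of_real (exp (\<kappa> u))" for u
  have inj\<zeta>: "\<zeta> u \<noteq> \<zeta> w" if "u \<in> U" "w \<in> U" "u \<noteq> w" for u w
    using inj[OF that] by (simp add: \<zeta>_def)
  define X :: "nat \<Rightarrow> complex ^ 'n" where "X n = (\<chi> i. complex_of_real (exp (n * k $ i)))" for n
  have lm: "laurent_monomial u (X n) = \<zeta> u ^ n" for u n
  proof -
    have "laurent_monomial u (X n) = complex_of_real (\<Prod>i\<in>UNIV. exp (n * k $ i) powi u i)"
      by (simp add: laurent_monomial_def X_def)
    also have "(\<Prod>i\<in>UNIV. exp (n * k $ i) powi u i) = (\<Prod>i\<in>UNIV. exp (n * (k $ i * u i)))"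
      by (intro prod.cong refl) (simp add: exp_power_int mult_ac)
    also have "\<dots> = exp (n * \<kappa> u)" by (simp add: exp_sum[symmetric] \<kappa>_def sum_distrib_left)
    finally show ?thesis by (simp add: \<zeta>_def exp_of_nat_mult)
  qed
  show ?thesis
  proof (intro exI[of _ "X ` {..card U}"] conjI allI impI)
    show "X ` {..card U} \<subseteq> torus" by (auto simp: torus_def X_def)
    fix c u assume "\<forall>x\<in>X ` {..card U}. (\<Sum>u\<in>U. c u * laurent_monomial u x) = 0" and u: "u \<in> U"
    then have pw: "(\<Sum>u\<in>U. c u * \<zeta> u ^ n) = 0" if "n \<le> card U" for n using that by (simp add: lm)
    define p where "p = (\<Prod>w\<in>U - {u}. [:- \<zeta> w, 1:])"
    have p0: "poly p (\<zeta> w) = 0" if "w \<in> U - {u}" for w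
      unfolding p_def poly_prod using U that by (intro prod_zero) auto
    have p1: "poly p (\<zeta> u) \<noteq> 0"
      unfolding p_def poly_prod using U inj\<zeta> u by auto
    have "degree p \<le> (\<Sum>w\<in>U - {u}. degree [:- \<zeta> w, 1:])"
      unfolding p_def by (rule order_trans[OF degree_prod_sum_le]) (use U in \<open>auto simp: o_def\<close>)
    then have deg: "degree p \<le> card U" using card_Diff_subset[of "{u}" U] U u by simp
    have "(\<Sum>w\<in>U. c w * poly p (\<zeta> w)) = (\<Sum>w\<in>U. \<Sum>n\<le>degree p. coeff p n * (c w * \<zeta> w ^ n))"
      by (simp add: poly_altdef sum_distrib_left algebra_simps)
    also have "\<dots> = (\<Sum>n\<le>degree p. coeff p n * (\<Sum>w\<in>U. c w * \<zeta> w ^ n))"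
      by (subst sum.swap) (simp add: sum_distrib_left)
    also have "\<dots> = 0" using pw deg by (intro sum.neutral) auto
    finally have "(\<Sum>w\<in>U. c w * poly p (\<zeta> w)) = 0" .
    moreover have "(\<Sum>w\<in>U. c w * poly p (\<zeta> w)) = c u * poly p (\<zeta> u)"
      using U u p0 by (subst sum.remove[of U u]) auto
    ultimately show "c u = 0" using p1 by simp
  qed simp
qed

lemma laurent_monomials_independent:
  fixes U :: "('n::finite \<Rightarrow> int) set"
  assumes U: "finite U" and z: "\<And>x. x \<in> torus \<Longrightarrow> (\<Sum>u\<in>U. c u * laurent_monomial u x) = 0" and u: "u \<in> U"
  shows "c u = 0"
proof -
  obtain G :: "(complex ^ 'n) set" where G: "finite G \<and> G \<subseteq> torus \<and>
    (\<forall>c u. (\<forall>x\<in>G. (\<Sum>u\<in>U. c u * laurent_monomial u x) = 0) \<longrightarrow> u \<in> U \<longrightarrow> c u = (0::complex))"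
    using laurent_monomials_test_set[OF U] by (rule exE)
  have "G \<subseteq> torus" using G by simp
  then have "\<forall>x\<in>G. (\<Sum>u\<in>U. c u * laurent_monomial u x) = 0" using z by auto
  moreover have "(\<forall>x\<in>G. (\<Sum>u\<in>U. c u * laurent_monomial u x) = 0) \<longrightarrow> u \<in> U \<longrightarrow> c u = 0"
    by (rule spec[OF spec[OF conjunct2[OF conjunct2[OF G]], of c], of u])
  ultimately show ?thesis using u by simp
qed

lemma laurent_growth_univariate:
  fixes a :: "int \<Rightarrow> complex"
  assumes K: "finite K" and g: "\<And>t. norm t \<ge> 1 \<Longrightarrow> norm (\<Sum>k\<in>K. a k * t powi k) \<le> A * norm t powi d"
    and k: "k \<in> K" "k > d"
  shows "a k = 0"
proof -
  define N where "N = Max (insert (nat (- d)) ((\<lambda>k. nat (- k)) ` K))"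
  have N: "nat (- k) \<le> N" "nat (- d) \<le> N" if "k \<in> K" for k unfolding N_def using K that by auto
  have NK: "0 \<le> k + N" if "k \<in> K" for k using N(1)[OF that] by linarith
  have Nd: "0 \<le> d + N" using N(2)[OF k(1)] by linarith
  define P where "P = (\<Sum>k\<in>K. monom (a k) (nat (k + N)))"
  have PF: "poly P t = t ^ N * (\<Sum>k\<in>K. a k * t powi k)" if "t \<noteq> 0" for t
  proof -
    have "t ^ nat (k + N) = t ^ N * t powi k" if "k \<in> K" for k
    proof -
      have "t ^ nat (k + N) = t powi (k + int N)" using NK[OF that] by (simp add: power_int_def)
      then show ?thesis using \<open>t \<noteq> 0\<close> by (simp add: power_int_add mult.commute)
    qed
    then show ?thesis by (simp add: P_def poly_sum poly_monom sum_distrib_left algebra_simps)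
  qed
  have bound: "norm (poly P t) \<le> A * norm t ^ nat (d + N)" if "1 \<le> norm t" for t
  proof -
    have "t \<noteq> 0" using that by auto
    then have "norm (poly P t) \<le> norm t ^ N * (A * norm t powi d)"
      unfolding PF[OF \<open>t \<noteq> 0\<close>] norm_mult norm_power using g[OF that] by (intro mult_left_mono) auto
    also have "\<dots> = A * norm t powi (d + N)" using \<open>t \<noteq> 0\<close> by (simp add: power_int_add algebra_simps)
    also have "norm t powi (d + N) = norm t ^ nat (d + N)" using Nd by (simp add: power_int_def)
    finally show ?thesis .
  qed
  have hol: "poly P holomorphic_on UNIV" by (intro holomorphic_intros)
  define b where "b = (\<lambda>k. (deriv ^^ k) (poly P) 0 / fact k)"
  have "poly P t = (\<Sum>k\<le>nat (d + N). b k * t ^ k)" for t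
    unfolding b_def by (rule Liouville_polynomial[OF hol bound])
  then have "poly P t = poly (\<Sum>k\<le>nat (d + N). monom (b k) k) t" for t
    by (simp add: poly_sum poly_monom)
  then have "P = (\<Sum>k\<le>nat (d + N). monom (b k) k)" by (simp add: poly_eq_poly_eq_iff[symmetric] fun_eq_iff)
  then have "coeff P (nat (k + N)) = 0" using k(2) Nd by (simp add: coeff_sum)
  moreover have "coeff P (nat (k + N)) = (\<Sum>l\<in>K. if l = k then a l else 0)"
    unfolding P_def coeff_sum
    by (intro sum.cong) (use NK k in \<open>auto simp: nat_eq_iff\<close>)
  ultimately show ?thesis using K k(1) by simp
qed

lemma laurent_growth:
  fixes U :: "('n::finite \<Rightarrow> int) set"
  assumes U: "finite U" and u: "u \<in> U" "(\<Sum>i\<in>UNIV. u i) > d"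
    and g: "\<And>x. x \<in> torus \<Longrightarrow> \<exists>A. \<forall>t. norm t \<ge> 1 \<longrightarrow>
      norm (\<Sum>u\<in>U. c u * laurent_monomial u (t *s x)) \<le> A * norm t powi d"
  shows "c u = 0"
proof -
  let ?s = "\<lambda>u :: 'n \<Rightarrow> int. \<Sum>i\<in>UNIV. u i"
  let ?K = "?s ` U" and ?U = "{w \<in> U. ?s w = ?s u}"
  have "(\<Sum>w\<in>?U. c w * laurent_monomial w x) = 0" if x: "x \<in> torus" for x
  proof -
    obtain A where A: "\<And>t. norm t \<ge> 1 \<Longrightarrow>
      norm (\<Sum>u\<in>U. c u * laurent_monomial u (t *s x)) \<le> A * norm t powi d" using g[OF x] by blast
    define a where "a k = (\<Sum>w\<in>{w\<in>U. ?s w = k}. c w * laurent_monomial w x)" for k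
    have eq: "(\<Sum>u\<in>U. c u * laurent_monomial u (t *s x)) = (\<Sum>k\<in>?K. a k * t powi k)" if "t \<noteq> 0" for t
    proof -
      have "(\<Sum>u\<in>U. c u * laurent_monomial u (t *s x)) = (\<Sum>u\<in>U. c u * laurent_monomial u x * t powi ?s u)"
        using that by (simp add: laurent_monomial_scale algebra_simps)
      also have "\<dots> = (\<Sum>k\<in>?K. \<Sum>w\<in>{w\<in>U. ?s w = k}. c w * laurent_monomial w x * t powi ?s w)"
        by (rule sum.image_gen[OF U])
      also have "\<dots> = (\<Sum>k\<in>?K. a k * t powi k)"
        unfolding a_def sum_distrib_right by (intro sum.cong) auto
      finally show ?thesis .
    qed
    have "a (?s u) = 0"
    proof (rule laurent_growth_univariate)
      show "norm (\<Sum>k\<in>?K. a k * t powi k) \<le> A * norm t powi d" if "norm t \<ge> 1" for t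
      proof -
        have "t \<noteq> 0" using that by auto
        then show ?thesis using eq[of t] A[OF that] by simp
      qed
    qed (use U u in auto)
    then show ?thesis by (simp add: a_def)
  qed
  then show ?thesis
    by (rule laurent_monomials_independent[of ?U c u, rotated]) (use U u in auto)
qed

definition coord_update :: "complex ^ 'n::finite \<Rightarrow> 'n \<Rightarrow> complex \<Rightarrow> complex ^ 'n" where
  "coord_update x i t = (\<chi> j. if j = i then t else x $ j)"

definition lagrange_basis :: "nat \<Rightarrow> nat \<Rightarrow> complex poly" where
  "lagrange_basis d r = (\<Prod>s\<in>{1..Suc d} - {r}. smult (1 / (of_nat r - of_nat s)) [:- of_nat s, 1:])"

lemma lagrange_interpolation:
  assumes "degree p \<le> d"
  shows "poly p x = (\<Sum>r\<in>{1..Suc d}. poly (lagrange_basis d r) x * poly p (of_nat r))"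
proof -
  let ?q = "\<Sum>r\<in>{1..Suc d}. smult (poly p (of_nat r)) (lagrange_basis d r)"
  have deg: "degree (lagrange_basis d r) \<le> d" if "r \<in> {1..Suc d}" for r
  proof -
    have "degree (lagrange_basis d r) \<le> (\<Sum>s\<in>{1..Suc d} - {r}. degree (smult (1 / (of_nat r - of_nat s)) [:- of_nat s, 1:: complex:]))"
      unfolding lagrange_basis_def by (rule order_trans[OF degree_prod_sum_le]) (auto simp: o_def)
    also have "\<dots> \<le> (\<Sum>s\<in>{1..Suc d} - {r}. 1)"
      by (rule sum_mono, rule order_trans[OF degree_smult_le]) simp
    finally show ?thesis using that by simp
  qed
  have delta: "poly (lagrange_basis d r) (of_nat s) = (if r = s then 1 else 0)"
    if "r \<in> {1..Suc d}" "s \<in> {1..Suc d}" for r s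
  proof (cases "r = s")
    case True
    have "poly (lagrange_basis d r) (of_nat s) = 1"
      unfolding lagrange_basis_def poly_prod True
    proof (rule prod.neutral, rule ballI)
      fix k assume "k \<in> {1..Suc d} - {s}"
      then have "of_nat s - of_nat k \<noteq> (0 :: complex)" by simp
      moreover have "poly (smult (1 / a) [:- c, 1:]) b = (b - c) / a" for a b c :: complex
        by (simp add: diff_divide_distrib)
      ultimately show "poly (smult (1 / (of_nat s - of_nat k)) [:- of_nat k, 1:]) (of_nat s :: complex) = 1"
        by simp
    qed
    then show ?thesis using True by simp
  next
    case False
    then have "poly (lagrange_basis d r) (of_nat s) = 0"
      unfolding lagrange_basis_def poly_prod using that by (intro prod_zero) auto
    then show ?thesis using False by simp
  qed
  have "p = ?q"
  proof (rule poly_eqI_degree[of "of_nat ` {1..Suc d}"])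
    have card: "card (of_nat ` {1..Suc d} :: complex set) = Suc d"
      by (subst card_image) (auto simp: inj_on_def)
    show "degree p < card (of_nat ` {1..Suc d} :: complex set)" using assms card by simp
    have "degree ?q \<le> d"
      by (rule degree_sum_le) (use deg degree_smult_le in \<open>auto intro: order_trans\<close>)
    then show "degree ?q < card (of_nat ` {1..Suc d} :: complex set)" using card by simp
    fix y :: complex assume "y \<in> of_nat ` {1..Suc d}"
    then obtain s where s: "s \<in> {1..Suc d}" "y = of_nat s" by blast
    have "poly ?q y = (\<Sum>r\<in>{1..Suc d}. poly p (of_nat r) * (if r = s then 1 else 0))"
      unfolding poly_sum s(2) by (rule sum.cong) (use delta s in auto)
    also have "\<dots> = poly p y" using s by (simp add: if_distrib cong: if_cong)
    finally show "poly p y = poly ?q y" by simp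
  qed
  then have "poly p x = poly ?q x" by simp
  then show ?thesis by (simp add: poly_sum algebra_simps)
qed

definition polynomial_growth :: "nat \<Rightarrow> (complex ^ 'n::finite \<Rightarrow> complex) \<Rightarrow> bool" where
  "polynomial_growth d f \<longleftrightarrow> (\<forall>x i. (\<lambda>t. f (coord_update x i t)) holomorphic_on UNIV) \<and>
     (\<exists>A. \<forall>x. norm (f x) \<le> A * (1 + norm x) ^ d)"

lemma norm_axis: "norm (axis i (a::complex)) = norm a"
  by (simp add: norm_vec_def L2_set_def axis_def if_distrib if_distribR cong: if_cong)

lemma norm_coord_update: "norm (coord_update x i t) \<le> norm x + norm (x $ i) + norm t"
proof -
  have "coord_update x i t = x + axis i (t - x $ i)"
    by (simp add: coord_update_def vec_eq_iff axis_def)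
  then have "norm (coord_update x i t) \<le> norm x + norm (t - x $ i)"
    using norm_triangle_ineq[of x "axis i (t - x $ i)"] by (simp add: norm_axis)
  also have "\<dots> \<le> norm x + (norm t + norm (x $ i))" by (intro add_left_mono norm_triangle_ineq4)
  finally show ?thesis by simp
qed

text \<open>One variable at a time, Liouville's theorem makes the function a polynomial of bounded degree, which
  is given by Lagrange interpolation at the points 1, 2, ...\<close>

lemma polynomial_growth_interpolation:
  fixes f :: "complex ^ 'n::finite \<Rightarrow> complex"
  assumes f: "polynomial_growth d f"
  shows "f (coord_update x i t) = (\<Sum>r\<in>{1..Suc d}. poly (lagrange_basis d r) t * f (coord_update x i (of_nat r)))"
proof -
  let ?g = "\<lambda>t. f (coord_update x i t)"
  have hol: "?g holomorphic_on UNIV" using f by (auto simp: polynomial_growth_def)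
  obtain A where A: "\<And>x. norm (f x) \<le> A * (1 + norm x) ^ d" using f by (auto simp: polynomial_growth_def)
  have A0: "A \<ge> 0" using A[of 0] norm_ge_zero[of "f 0"] by (simp del: norm_ge_zero)
  let ?c = "2 + norm x + norm (x $ i)"
  have "norm (?g t) \<le> A * ?c ^ d * norm t ^ d" if "1 \<le> norm t" for t
  proof -
    have "1 + norm (coord_update x i t) \<le> 1 + norm x + norm (x $ i) + norm t"
      using norm_coord_update[of x i t] by simp
    also have "\<dots> \<le> (1 + norm x + norm (x $ i)) * norm t + norm t"
      using that mult_left_mono[OF that, of "1 + norm x + norm (x $ i)"] by simp
    also have "\<dots> = ?c * norm t" by (simp add: algebra_simps)
    finally have "(1 + norm (coord_update x i t)) ^ d \<le> (?c * norm t) ^ d" by (intro power_mono) auto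
    then have "A * (1 + norm (coord_update x i t)) ^ d \<le> A * (?c * norm t) ^ d" using A0 by (rule mult_left_mono)
    then show ?thesis using A[of "coord_update x i t"] by (simp add: power_mult_distrib mult_ac)
  qed
  from Liouville_polynomial[OF hol this]
  have "\<exists>b. \<forall>t. ?g t = (\<Sum>k\<le>d. b k * t ^ k)" by (intro exI allI)
  then obtain b where b: "\<And>t. ?g t = (\<Sum>k\<le>d. b k * t ^ k)" by blast
  define p where "p = (\<Sum>k\<le>d. monom (b k) k)"
  have p: "?g t = poly p t" for t
    unfolding b p_def by (simp add: poly_sum poly_monom)
  have "degree p \<le> d"
    unfolding p_def by (rule degree_sum_le) (auto intro: order_trans[OF degree_monom_le])
  from lagrange_interpolation[OF this] show ?thesis unfolding p .
qed

text \<open>Uniqueness in the interpolation formula; it provides finitely many linear coordinates on spaces of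
  functions of bounded growth.\<close>

lemma polynomial_growth_grid:
  fixes f :: "complex ^ 'n::finite \<Rightarrow> complex"
  assumes f: "polynomial_growth d f"
    and z: "\<And>x. (\<And>i. x $ i \<in> of_nat ` {1..Suc d}) \<Longrightarrow> f x = 0"
  shows "f x = 0"
proof -
  have "\<forall>x. (\<forall>i. i \<notin> S \<longrightarrow> x $ i \<in> of_nat ` {1..Suc d}) \<longrightarrow> f x = 0" if "finite S" for S
    using that
  proof (induction S)
    case empty
    then show ?case using z by auto
  next
    case (insert i S)
    show ?case
    proof (intro allI impI)
      fix x :: "complex ^ 'n" assume x: "\<forall>j. j \<notin> insert i S \<longrightarrow> x $ j \<in> of_nat ` {1..Suc d}"
      have x': "x = coord_update x i (x $ i)" by (simp add: coord_update_def vec_eq_iff)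
      have "f (coord_update x i (of_nat r)) = 0" if "r \<in> {1..Suc d}" for r
        by (rule insert.IH[rule_format]) (use x that in \<open>auto simp: coord_update_def\<close>)
      then show "f x = 0"
        by (subst x', subst polynomial_growth_interpolation[OF f]) simp
    qed
  qed
  from this[of UNIV] show ?thesis by simp
qed

definition is_polynomial :: "(complex ^ 'n::finite \<Rightarrow> complex) \<Rightarrow> bool" where
  "is_polynomial f \<longleftrightarrow> (\<exists>M c. finite M \<and> (\<forall>m\<in>M. \<forall>i. 0 \<le> m i) \<and> (\<forall>m. m \<notin> M \<longrightarrow> c m = 0) \<and>
     f = (\<lambda>x. \<Sum>m\<in>M. c m * laurent_monomial m x))"

lemma is_polynomial_const: "is_polynomial (\<lambda>_. a)"
  unfolding is_polynomial_def
  by (rule exI[of _ "{\<lambda>_. 0}"], rule exI[of _ "\<lambda>m. if m = (\<lambda>_. 0) then a else 0"])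
     (simp add: laurent_monomial_def)

lemma is_polynomial_cmult: "is_polynomial f \<Longrightarrow> is_polynomial (\<lambda>x. a * f x)"
  unfolding is_polynomial_def
  by (elim exE, rule_tac x = M in exI, rule_tac x = "\<lambda>m. a * c m" in exI) (auto simp: sum_distrib_left algebra_simps)

lemma is_polynomial_add:
  assumes "is_polynomial f" "is_polynomial g"
  shows "is_polynomial (\<lambda>x. f x + g x)"
proof -
  obtain M c where M: "finite M" "\<forall>m\<in>M. \<forall>i. 0 \<le> m i" "\<forall>m. m \<notin> M \<longrightarrow> c m = 0"
    "f = (\<lambda>x. \<Sum>m\<in>M. c m * laurent_monomial m x)" using assms(1) unfolding is_polynomial_def by blast
  obtain N b where N: "finite N" "\<forall>m\<in>N. \<forall>i. 0 \<le> m i" "\<forall>m. m \<notin> N \<longrightarrow> b m = 0"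
    "g = (\<lambda>x. \<Sum>m\<in>N. b m * laurent_monomial m x)" using assms(2) unfolding is_polynomial_def by blast
  have "(\<Sum>m\<in>M. c m * laurent_monomial m x) = (\<Sum>m\<in>M \<union> N. c m * laurent_monomial m x)" for x
    by (rule sum.mono_neutral_left) (use M N in auto)
  moreover have "(\<Sum>m\<in>N. b m * laurent_monomial m x) = (\<Sum>m\<in>M \<union> N. b m * laurent_monomial m x)" for x
    by (rule sum.mono_neutral_left) (use M N in auto)
  ultimately show ?thesis
    unfolding is_polynomial_def M(4) N(4) using M N
    by (intro exI[of _ "M \<union> N"] exI[of _ "\<lambda>m. c m + b m"]) (auto simp: algebra_simps sum.distrib)
qed

lemma is_polynomial_coord:
  fixes f :: "complex ^ 'n::finite \<Rightarrow> complex"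
  assumes "is_polynomial f"
  shows "is_polynomial (\<lambda>x. x $ i * f x)"
proof -
  obtain M c where M: "finite M" "\<forall>m\<in>M. \<forall>i. 0 \<le> m i" "\<forall>m. m \<notin> M \<longrightarrow> c m = 0"
    "f = (\<lambda>x. \<Sum>m\<in>M. c m * laurent_monomial m x)" using assms(1) unfolding is_polynomial_def by blast
  let ?s = "\<lambda>m :: 'n \<Rightarrow> int. m(i := m i + 1)"
  have inj: "inj_on ?s M"
    by (rule inj_onI) (metis add_right_cancel fun_upd_same fun_upd_triv fun_upd_upd)
  have lm: "laurent_monomial (?s m) x = x $ i * laurent_monomial m x" if "m \<in> M" for m x
  proof -
    have "laurent_monomial (?s m) x = x $ i powi (m i + 1) * (\<Prod>j\<in>UNIV - {i}. x $ j powi m j)"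
      unfolding laurent_monomial_def by (subst prod.remove[of UNIV i]) auto
    also have "x $ i powi (m i + 1) = x $ i * x $ i powi m i"
      using M(2) that by (subst power_int_add_1) (auto dest!: bspec spec[of _ i])
    finally show ?thesis
      unfolding laurent_monomial_def by (subst (2) prod.remove[of UNIV i]) (auto simp: algebra_simps)
  qed
  show ?thesis
    unfolding is_polynomial_def
  proof (intro exI[of _ "?s ` M"] exI[of _ "\<lambda>m. c (m(i := m i - 1))"] conjI)
    show "finite (?s ` M)" using M by simp
    show "\<forall>m\<in>?s ` M. \<forall>j. 0 \<le> m j" using M(2) by auto
    show "\<forall>m. m \<notin> ?s ` M \<longrightarrow> c (m(i := m i - 1)) = 0"
    proof (intro allI impI)
      fix m assume m: "m \<notin> ?s ` M"
      have "m = ?s (m(i := m i - 1))" by simp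
      then have "m(i := m i - 1) \<notin> M" using m by blast
      then show "c (m(i := m i - 1)) = 0" using M(3) by blast
    qed
    show "(\<lambda>x. x $ i * f x) = (\<lambda>x. \<Sum>m\<in>?s ` M. c (m(i := m i - 1)) * laurent_monomial m x)"
    proof
      fix x
      have "(\<Sum>m\<in>?s ` M. c (m(i := m i - 1)) * laurent_monomial m x) = (\<Sum>m\<in>M. c m * laurent_monomial (?s m) x)"
        by (subst sum.reindex[OF inj]) simp
      also have "\<dots> = x $ i * f x"
        unfolding M(4) sum_distrib_left by (intro sum.cong) (auto simp: lm)
      finally show "x $ i * f x = (\<Sum>m\<in>?s ` M. c (m(i := m i - 1)) * laurent_monomial m x)" ..
    qed
  qed
qed

lemma is_polynomial_poly_coord: "is_polynomial f \<Longrightarrow> is_polynomial (\<lambda>x. poly p (x $ i) * f x)"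
proof (induction p)
  case 0
  then show ?case using is_polynomial_const[of 0] by simp
next
  case (pCons a p)
  have "is_polynomial (\<lambda>x. a * f x + x $ i * (poly p (x $ i) * f x))"
    by (intro is_polynomial_add is_polynomial_cmult is_polynomial_coord pCons)
  then show ?case by (simp add: algebra_simps)
qed

lemma is_polynomial_sum: "(\<And>j. j \<in> J \<Longrightarrow> is_polynomial (f j)) \<Longrightarrow> is_polynomial (\<lambda>x. \<Sum>j\<in>J. f j x)"
  by (induction J rule: infinite_finite_induct) (auto intro: is_polynomial_const is_polynomial_add)

theorem liouville_several_variables:
  fixes f :: "complex ^ 'n::finite \<Rightarrow> complex"
  assumes f: "polynomial_growth d f"
  shows "is_polynomial f"
proof -
  have "\<forall>\<rho>. is_polynomial (\<lambda>x. f (\<chi> j. if j \<in> S then x $ j else \<rho> j))" if "finite S" for S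
    using that
  proof (induction S)
    case empty
    then show ?case by (simp add: is_polynomial_const)
  next
    case (insert i S)
    show ?case
    proof
      fix \<rho>
      have "f (\<chi> j. if j \<in> insert i S then x $ j else \<rho> j) =
        (\<Sum>r\<in>{1..Suc d}. poly (lagrange_basis d r) (x $ i) * f (\<chi> j. if j \<in> S then x $ j else (\<rho>(i := of_nat r)) j))" for x
      proof -
        have e1: "(\<chi> j. if j \<in> insert i S then x $ j else \<rho> j) =
            coord_update (\<chi> j. if j \<in> S then x $ j else \<rho> j) i (x $ i)"
          by (simp add: coord_update_def vec_eq_iff)
        have e2: "coord_update (\<chi> j. if j \<in> S then x $ j else \<rho> j) i t =
            (\<chi> j. if j \<in> S then x $ j else (\<rho>(i := t)) j)" for t
          using insert.hyps by (simp add: coord_update_def vec_eq_iff)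
        show ?thesis by (subst e1, subst polynomial_growth_interpolation[OF f]) (simp only: e2)
      qed
      note eq = this
      have "is_polynomial (\<lambda>x. \<Sum>r\<in>{1..Suc d}. poly (lagrange_basis d r) (x $ i) *
          f (\<chi> j. if j \<in> S then x $ j else (\<rho>(i := of_nat r)) j))"
        by (intro is_polynomial_sum is_polynomial_poly_coord insert.IH[rule_format])
      then show "is_polynomial (\<lambda>x. f (\<chi> j. if j \<in> insert i S then x $ j else \<rho> j))" by (simp only: eq)
    qed
  qed
  from this[of UNIV] show ?thesis by simp
qed

section \<open>Projective linear maps and linear vector fields\<close>

subsection \<open>Derivatives\<close>

definition complex_linear :: "(complex ^ 'n::finite \<Rightarrow> complex) \<Rightarrow> bool" where
  "complex_linear D \<longleftrightarrow> (\<forall>u v. D (u + v) = D u + D v) \<and> (\<forall>c v. D (c *s v) = c * D v)"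

lemma complex_linear_expand:
  assumes "complex_linear D"
  shows "D v = (\<Sum>i\<in>UNIV. D (axis i 1) * v $ i)"
proof -
  have z: "D 0 = 0" using assms unfolding complex_linear_def by (metis mult_zero_left vector_smult_lzero)
  have s: "D (\<Sum>i\<in>A. f i) = (\<Sum>i\<in>A. D (f i))" for A and f :: "'a \<Rightarrow> complex ^ 'a"
    by (induction A rule: infinite_finite_induct) (use assms z in \<open>auto simp: complex_linear_def\<close>)
  have "v = (\<Sum>i\<in>UNIV. v $ i *s axis i 1)"
    by (simp add: vec_eq_iff axis_def if_distrib cong: if_cong)
  then have "D v = D (\<Sum>i\<in>UNIV. v $ i *s axis i 1)" by simp
  also have "\<dots> = (\<Sum>i\<in>UNIV. D (axis i 1) * v $ i)"
    unfolding s using assms by (simp add: complex_linear_def mult.commute)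
  finally show ?thesis .
qed

lemma complex_linear_sum_coeffs: "complex_linear (\<lambda>v. \<Sum>i\<in>UNIV. a i * v $ i)"
  by (simp add: complex_linear_def sum.distrib sum_distrib_left algebra_simps)

lemma holomorphic_at_iff:
  "holomorphic_at f x \<longleftrightarrow> (\<exists>D. complex_linear D \<and> (f has_derivative D) (at x))"
proof
  assume "holomorphic_at f x"
  then show "\<exists>D. complex_linear D \<and> (f has_derivative D) (at x)"
    unfolding holomorphic_at_def using complex_linear_sum_coeffs by blast
next
  assume "\<exists>D. complex_linear D \<and> (f has_derivative D) (at x)"
  then obtain D where D: "complex_linear D" "(f has_derivative D) (at x)" by blast
  have "D = (\<lambda>v. \<Sum>i\<in>UNIV. (\<chi> i. D (axis i 1)) $ i * v $ i)"
    by (rule HOL.ext, subst complex_linear_expand[OF D(1)]) simp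
  then show "holomorphic_at f x" unfolding holomorphic_at_def using D(2) by (intro exI) (erule subst)
qed

lemma holomorphic_atI: "(f has_derivative D) (at x) \<Longrightarrow> complex_linear D \<Longrightarrow> holomorphic_at f x"
  unfolding holomorphic_at_iff by blast

lemma has_field_derivative_line:
  assumes "(f has_derivative D) (at (x + t0 *s v))" "complex_linear D"
  shows "((\<lambda>t. f (x + t *s v)) has_field_derivative D v) (at t0)"
proof -
  have lin: "((\<lambda>t. x + t *s v) has_derivative (\<lambda>t. t *s v)) (at t0)"
  proof -
    have "bounded_linear (\<lambda>t::complex. t *s v)"
      unfolding linear_conv_bounded_linear[symmetric]
      by (rule linearI) (simp_all add: vec_eq_iff algebra_simps)
    then show ?thesis by (auto intro!: derivative_eq_intros bounded_linear_imp_has_derivative)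
  qed
  have "((\<lambda>t. f (x + t *s v)) has_derivative (\<lambda>t. D (t *s v))) (at t0)"
    by (rule has_derivative_compose[OF lin assms(1)])
  then show ?thesis
    unfolding has_field_derivative_def using assms(2) by (simp add: complex_linear_def mult.commute[of _ "D v"] fun_eq_iff cong: if_cong)
qed

lemma partial_deriv_eq:
  assumes "(f has_derivative D) (at x)" "complex_linear D"
  shows "partial_deriv i f x = D (axis i 1)"
  unfolding partial_deriv_def
  by (rule DERIV_imp_deriv, rule has_field_derivative_line) (use assms in auto)

lemma holomorphic_at_derivative:
  assumes "holomorphic_at f x"
  shows "(f has_derivative (\<lambda>v. \<Sum>i\<in>UNIV. partial_deriv i f x * v $ i)) (at x)"
proof -
  obtain D where D: "complex_linear D" "(f has_derivative D) (at x)" using assms holomorphic_at_iff by blast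
  have "D = (\<lambda>v. \<Sum>i\<in>UNIV. partial_deriv i f x * v $ i)"
    by (rule HOL.ext, subst complex_linear_expand[OF D(1)]) (simp add: partial_deriv_eq[OF D(2,1)])
  then show ?thesis using D(2) by (simp only:)
qed

lemma partial_deriv_add:
  assumes "holomorphic_at f x" "holomorphic_at g x"
  shows "partial_deriv i (\<lambda>y. f y + g y) x = partial_deriv i f x + partial_deriv i g x"
    "partial_deriv i (\<lambda>y. c * f y) x = c * partial_deriv i f x"
proof -
  obtain D where D: "complex_linear D" "(f has_derivative D) (at x)" using assms holomorphic_at_iff by blast
  obtain E where E: "complex_linear E" "(g has_derivative E) (at x)" using assms holomorphic_at_iff by blast
  have "partial_deriv i (\<lambda>y. f y + g y) x = D (axis i 1) + E (axis i 1)"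
    by (rule partial_deriv_eq[of _ "\<lambda>v. D v + E v", OF has_derivative_add[OF D(2) E(2)]])
       (use D E in \<open>simp add: complex_linear_def algebra_simps\<close>)
  then show "partial_deriv i (\<lambda>y. f y + g y) x = partial_deriv i f x + partial_deriv i g x"
    by (simp add: partial_deriv_eq[OF D(2,1)] partial_deriv_eq[OF E(2,1)])
  have "partial_deriv i (\<lambda>y. c * f y) x = c * D (axis i 1)"
    by (rule partial_deriv_eq[of _ "\<lambda>v. c * D v", OF has_derivative_mult_right[OF D(2)]])
       (use D in \<open>simp add: complex_linear_def algebra_simps\<close>)
  then show "partial_deriv i (\<lambda>y. c * f y) x = c * partial_deriv i f x"
    by (simp add: partial_deriv_eq[OF D(2,1)])
qed

lemma holomorphic_at_add: "holomorphic_at f x \<Longrightarrow> holomorphic_at g x \<Longrightarrow> holomorphic_at (\<lambda>y. f y + g y) x"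
  and holomorphic_at_cmult: "holomorphic_at f x \<Longrightarrow> holomorphic_at (\<lambda>y. c * f y) x"
  unfolding holomorphic_at_iff
  by (elim exE conjE, rule exI, rule conjI[rotated], rule has_derivative_add, assumption, assumption,
      simp add: complex_linear_def algebra_simps)
     (elim exE conjE, rule exI, rule conjI[rotated], rule has_derivative_mult_right, assumption,
      simp add: complex_linear_def algebra_simps)

lemma holomorphic_at_mult: "holomorphic_at f x \<Longrightarrow> holomorphic_at g x \<Longrightarrow> holomorphic_at (\<lambda>y. f y * g y) x"
  unfolding holomorphic_at_iff
  by (elim exE conjE, rule exI, rule conjI[rotated], rule has_derivative_mult, assumption, assumption,
      simp add: complex_linear_def algebra_simps)

lemma holomorphic_at_const: "holomorphic_at (\<lambda>y. c) x"
  unfolding holomorphic_at_iff by (rule exI[of _ "\<lambda>_. 0"]) (simp add: complex_linear_def)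

lemma holomorphic_at_sum: "(\<And>j. j \<in> J \<Longrightarrow> holomorphic_at (f j) x) \<Longrightarrow> holomorphic_at (\<lambda>y. \<Sum>j\<in>J. f j y) x"
  by (induction J rule: infinite_finite_induct) (auto intro: holomorphic_at_const holomorphic_at_add)

lemma complex_jacobian_mult:
  assumes "\<And>a. ((\<lambda>y. F y $ a) has_derivative D a) (at x)" "\<And>a. complex_linear (D a)"
  shows "(complex_jacobian F x *v w) $ a = D a w"
proof -
  have "(complex_jacobian F x *v w) $ a = (\<Sum>i\<in>UNIV. D a (axis i 1) * w $ i)"
    by (simp add: matrix_vector_mult_def complex_jacobian_def partial_deriv_eq[OF assms])
  then show ?thesis unfolding complex_linear_expand[OF assms(2), symmetric] .
qed

subsection \<open>Charts\<close>

definition chart_index :: "'n option \<Rightarrow> 'n \<Rightarrow> 'n option" where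
  "chart_index k i = Transposition.transpose None k (Some i)"

lemma chart_index_cases:
  assumes "j \<noteq> k" obtains i where "j = chart_index k i"
proof -
  have "Transposition.transpose None k j \<noteq> None" using assms by (cases k) (auto simp: Transposition.transpose_def split: if_splits)
  then obtain i where "Transposition.transpose None k j = Some i" by auto
  then have "j = chart_index k i" unfolding chart_index_def by (metis transpose_involutory)
  then show ?thesis by (rule that)
qed

lemma chart_index_None [simp]: "chart_index None i = Some i"
  by (simp add: chart_index_def)

lemma affine_lift_base [simp]: "affine_lift k x $ k = 1"
  by (simp add: affine_lift_def)

lemma affine_lift_index [simp]: "affine_lift k x $ chart_index k i = x $ i"
  by (simp add: affine_lift_def chart_index_def)

lemma affine_lift_None: "affine_lift None x $ Some i = x $ i"
  using affine_lift_index[of None x i] by simp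

lemma affine_lift_nonzero: "affine_lift k x \<noteq> 0"
  using affine_lift_base[of k x] by (metis zero_index zero_neq_one)

text \<open>The derivative of \<open>affine_lift k\<close>.\<close>

definition linear_lift :: "'n option \<Rightarrow> complex ^ 'n::finite \<Rightarrow> complex ^ 'n option" where
  "linear_lift k v = (\<chi> j. case Transposition.transpose None k j of None \<Rightarrow> 0 | Some i \<Rightarrow> v $ i)"

lemma linear_lift_base [simp]: "linear_lift k v $ k = 0"
  by (simp add: linear_lift_def)

lemma linear_lift_index [simp]: "linear_lift k v $ chart_index k i = v $ i"
  by (simp add: linear_lift_def chart_index_def)

lemma vec_chart_eqI:
  assumes "u $ k = v $ k" "\<And>i. u $ chart_index k i = v $ chart_index k i"
  shows "u = v"
  unfolding vec_eq_iff using assms chart_index_cases by metis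

lemma linear_lift_add: "linear_lift k (u + v) = linear_lift k u + linear_lift k v"
  by (rule vec_chart_eqI[of _ k]) simp_all

lemma linear_lift_scale: "linear_lift k (c *s u) = c *s linear_lift k u"
  by (rule vec_chart_eqI[of _ k]) simp_all

lemma affine_lift_eq: "affine_lift k x = affine_lift k 0 + linear_lift k x"
  by (rule vec_chart_eqI[of _ k]) simp_all

lemma lift_component_derivative:
  "((\<lambda>x. (g *v affine_lift k x) $ j) has_derivative (\<lambda>v. (g *v linear_lift k v) $ j)) (at x)"
proof -
  have "bounded_linear (\<lambda>v. (g *v linear_lift k v) $ j)"
    unfolding linear_conv_bounded_linear[symmetric]
  proof (rule linearI)
    fix c :: real and v
    have "linear_lift k (c *\<^sub>R v) = c *\<^sub>R linear_lift k v"
      by (rule vec_chart_eqI[of _ k]) simp_all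
    moreover have "(g *v (c *\<^sub>R w)) $ j = c *\<^sub>R ((g *v w) $ j)" for w
      by (simp add: matrix_vector_mult_def scaleR_sum_right)
    ultimately show "(g *v linear_lift k (c *\<^sub>R v)) $ j = c *\<^sub>R (g *v linear_lift k v) $ j" by simp
  qed (simp add: linear_lift_add matrix_vector_right_distrib)
  then have "((\<lambda>x. (g *v affine_lift k 0) $ j + (g *v linear_lift k x) $ j) has_derivative
      (\<lambda>v. (g *v linear_lift k v) $ j)) (at x)"
    by (auto intro!: derivative_eq_intros bounded_linear_imp_has_derivative)
  then show ?thesis by (subst affine_lift_eq) (simp add: matrix_vector_right_distrib)
qed

lemma matrix_vector_scale: "(g :: complex ^ 'm ^ 'l) *v (c *s v) = c *s (g *v v)"
  by (simp add: vec_eq_iff matrix_vector_mult_def sum_distrib_left mult_ac)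

lemma complex_linear_lift: "complex_linear (\<lambda>v. (g *v linear_lift k v) $ j)"
  by (simp add: complex_linear_def linear_lift_add linear_lift_scale matrix_vector_right_distrib
      matrix_vector_scale)

definition dehomogenize :: "'n option \<Rightarrow> complex ^ 'n::finite option \<Rightarrow> complex ^ 'n" where
  "dehomogenize l z = (\<chi> i. z $ chart_index l i / z $ l)"

lemma affine_lift_dehomogenize:
  "z $ l \<noteq> 0 \<Longrightarrow> affine_lift l (dehomogenize l z) = (1 / z $ l) *s z"
  by (rule vec_chart_eqI[of _ l]) (simp_all add: dehomogenize_def)

lemma dehomogenize_affine_lift [simp]: "dehomogenize k (affine_lift k x) = x"
  by (simp add: dehomogenize_def)

lemma proj_class_scale: "c \<noteq> 0 \<Longrightarrow> proj_class (*s) (c *s v) = proj_class (*s) (v :: complex ^ 'm)"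
proof -
  assume c: "c \<noteq> 0"
  show ?thesis
    unfolding proj_class_def
  proof (intro equalityI subsetI)
    fix u assume "u \<in> {k *s (c *s v) |k. k \<noteq> 0}"
    then obtain k where "k \<noteq> 0" "u = (k * c) *s v" by (auto simp: vector_smult_assoc)
    then show "u \<in> {k *s v |k. k \<noteq> 0}" using c by (intro CollectI exI[of _ "k * c"]) simp
  next
    fix u assume "u \<in> {k *s v |k. k \<noteq> 0}"
    then obtain k where "k \<noteq> 0" "u = k *s v" by auto
    then show "u \<in> {k *s (c *s v) |k. k \<noteq> 0}"
      using c by (intro CollectI exI[of _ "k / c"]) (simp add: vector_smult_assoc)
  qed
qed

lemma proj_class_eqE:
  assumes "proj_class (*s) u = proj_class (*s) (v :: complex ^ 'm)"
  obtains c where "c \<noteq> 0" "u = c *s v"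
  using proj_class_eq_imp[OF vec.vector_space_axioms assms] by blast

lemma affine_point_dehomogenize: "z $ l \<noteq> 0 \<Longrightarrow> affine_point l (dehomogenize l z) = proj_class (*s) z"
  unfolding affine_point_def by (simp add: affine_lift_dehomogenize proj_class_scale)

lemma affine_point_inj: "inj (affine_point l)"
proof (rule injI)
  fix x y assume "affine_point l x = affine_point l y"
  then obtain c where c: "c \<noteq> 0" "affine_lift l x = c *s affine_lift l y"
    unfolding affine_point_def by (rule proj_class_eqE)
  from arg_cong[OF this(2), of "\<lambda>z. z $ l"] have "c = 1" by simp
  then have "affine_lift l x = affine_lift l y" using c by simp
  from arg_cong[OF this, of "dehomogenize l"] show "x = y" by simp
qed

lemma inv_affine_point: "z $ l \<noteq> 0 \<Longrightarrow> inv (affine_point l) (proj_class (*s) z) = dehomogenize l z"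
  using affine_point_dehomogenize[of z l] inv_f_f[OF affine_point_inj] by metis

lemma in_range_affine_point: "proj_class (*s) z \<in> range (affine_point l) \<longleftrightarrow> z $ l \<noteq> 0"
proof
  assume "proj_class (*s) z \<in> range (affine_point l)"
  then obtain x where "proj_class (*s) z = proj_class (*s) (affine_lift l x)" unfolding affine_point_def by blast
  then obtain c where "c \<noteq> 0" "z = c *s affine_lift l x" by (rule proj_class_eqE)
  then show "z $ l \<noteq> 0" by simp
next
  assume "z $ l \<noteq> 0"
  then show "proj_class (*s) z \<in> range (affine_point l)"
    using affine_point_dehomogenize by (metis rangeI)
qed

lemma proj_space_cases:
  assumes "S \<in> proj_space" obtains k x where "S = affine_point k x"
proof -
  obtain z where z: "z \<noteq> 0" "S = proj_class (*s) z"
    using assms unfolding proj_space_def projectivization_def by blast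
  then obtain k where "z $ k \<noteq> 0" by (auto simp: vec_eq_iff)
  then have "S = affine_point k (dehomogenize k z)" using z affine_point_dehomogenize by metis
  then show ?thesis by (rule that)
qed

lemma affine_point_in_proj_space: "affine_point k x \<in> proj_space"
  unfolding affine_point_def proj_space_def projectivization_def using affine_lift_nonzero by blast

definition proj_linear :: "complex ^ 'm ^ 'm \<Rightarrow> (complex ^ 'm::finite) set \<Rightarrow> (complex ^ 'm) set" where
  "proj_linear g S = (\<lambda>v. g *v v) ` S"

lemma proj_linear_class: "proj_linear g (proj_class (*s) v) = proj_class (*s) (g *v v)"
proof -
  have img: "proj_class (*s) u = (\<lambda>c. c *s u) ` (- {0})" for u :: "complex ^ 'a"
    unfolding proj_class_def by auto
  show ?thesis by (simp add: proj_linear_def img image_image matrix_vector_scale)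
qed

lemma proj_linear_one: "proj_linear (mat 1) = id"
  by (simp add: fun_eq_iff proj_linear_def)

lemma chart_domain_proj_linear:
  "x \<in> chart_domain (proj_linear g) k l \<longleftrightarrow> (g *v affine_lift k x) $ l \<noteq> 0"
  unfolding chart_domain_def affine_point_def mem_Collect_eq proj_linear_class in_range_affine_point ..

lemma chart_expr_proj_linear:
  assumes "(g *v affine_lift k x) $ l \<noteq> 0"
  shows "chart_expr (proj_linear g) k l x = dehomogenize l (g *v affine_lift k x)"
  unfolding chart_expr_def affine_point_def[of k x] proj_linear_class by (rule inv_affine_point[OF assms])

lemma open_chart_domain: "open {x. (g *v affine_lift k x) $ l \<noteq> 0}"
proof -
  have "isCont (\<lambda>x. (g *v affine_lift k x) $ l) x" for x
    by (rule has_derivative_continuous[OF lift_component_derivative])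
  from continuous_open_vimage[OF _ this, of "- {0}"] show ?thesis
    by (simp add: vimage_def open_Compl)
qed

lemma chart_expr_derivative:
  assumes nz: "(g *v affine_lift k x) $ l \<noteq> 0"
  defines "z \<equiv> g *v affine_lift k x"
  shows "((\<lambda>y. chart_expr (proj_linear g) k l y $ a) has_derivative
    (\<lambda>v. ((g *v linear_lift k v) $ chart_index l a * z $ l - z $ chart_index l a * (g *v linear_lift k v) $ l) / (z $ l * z $ l))) (at x)"
proof -
  have "((\<lambda>y. (g *v affine_lift k y) $ chart_index l a / (g *v affine_lift k y) $ l) has_derivative
    (\<lambda>v. ((g *v linear_lift k v) $ chart_index l a * z $ l - z $ chart_index l a * (g *v linear_lift k v) $ l) / (z $ l * z $ l))) (at x)"
    unfolding z_def by (rule has_derivative_divide'[OF lift_component_derivative lift_component_derivative nz])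
  then show ?thesis
    by (rule has_derivative_transform_within_open[OF _ open_chart_domain[of g k l]])
       (use nz in \<open>auto simp: chart_expr_proj_linear dehomogenize_def\<close>)
qed

lemma chart_expr_complex_linear:
  "complex_linear (\<lambda>v. ((g *v linear_lift k v) $ i * a - b * (g *v linear_lift k v) $ l) / c)"
  using complex_linear_lift[of g k i] complex_linear_lift[of g k l]
  by (simp add: complex_linear_def algebra_simps add_divide_distrib diff_divide_distrib)

subsection \<open>Linear vector fields\<close>

text \<open>The vector field on projective space induced by the matrix \<open>X\<close>: the projection of the linear field
  \<open>z \<mapsto> X z\<close> along the Euler field \<open>z\<close> to the affine hyperplane of the chart.\<close>

definition linear_field :: "complex ^ 'n option ^ 'n option \<Rightarrow> 'n option \<Rightarrow> complex ^ 'n::finite \<Rightarrow> complex ^ 'n" where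
  "linear_field X k x = (\<chi> i. (X *v affine_lift k x) $ chart_index k i - x $ i * (X *v affine_lift k x) $ k)"

lemma linear_lift_linear_field:
  "linear_lift k (linear_field X k x) = X *v affine_lift k x - (X *v affine_lift k x) $ k *s affine_lift k x"
  by (rule vec_chart_eqI[of _ k]) (simp_all add: linear_field_def)

lemma linear_field_pushforward:
  assumes g: "h ** g = mat 1" and nz: "(g *v affine_lift k x) $ l \<noteq> 0"
  shows "complex_jacobian (chart_expr (proj_linear g) k l) x *v linear_field X k x =
    linear_field (g ** X ** h) l (chart_expr (proj_linear g) k l x)"
proof -
  define z where "z = affine_lift k x"
  define w where "w = g *v z"
  have w0: "w $ l \<noteq> 0" using nz by (simp add: w_def z_def)
  have hg: "h *v w = z" unfolding w_def by (simp add: matrix_vector_mul_assoc g)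
  have y: "chart_expr (proj_linear g) k l x = dehomogenize l w"
    using chart_expr_proj_linear[OF nz] by (simp add: w_def z_def)
  have lift: "affine_lift l (dehomogenize l w) = (1 / w $ l) *s w" by (rule affine_lift_dehomogenize[OF w0])
  have Y: "(g ** X ** h) *v ((1 / w $ l) *s w) = (1 / w $ l) *s (g *v (X *v z))"
    by (simp add: matrix_vector_scale matrix_vector_mul_assoc[symmetric] hg)
  have gl: "g *v linear_lift k (linear_field X k x) = g *v (X *v z) - (X *v z) $ k *s w"
    unfolding linear_lift_linear_field z_def[symmetric] w_def
    by (simp add: matrix_vector_mult_diff_distrib matrix_vector_scale)
  show ?thesis
  proof (rule vec_eq_iff[THEN iffD2], rule allI)
    fix a
    let ?u = "g *v (X *v z)" and ?c = "(X *v z) $ k" and ?i = "chart_index l a"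
    have "(complex_jacobian (chart_expr (proj_linear g) k l) x *v linear_field X k x) $ a =
      ((?u $ ?i - ?c * w $ ?i) * w $ l - w $ ?i * (?u $ l - ?c * w $ l)) / (w $ l * w $ l)"
      by (subst complex_jacobian_mult[OF chart_expr_derivative[OF nz] chart_expr_complex_linear])
         (simp add: gl z_def[symmetric] w_def[symmetric])
    also have "\<dots> = ?u $ ?i / w $ l - w $ ?i / w $ l * (?u $ l / w $ l)"
      using w0 by (simp add: field_simps)
    also have "\<dots> = linear_field (g ** X ** h) l (dehomogenize l w) $ a"
      unfolding linear_field_def lift Y by (simp add: dehomogenize_def)
    finally show "(complex_jacobian (chart_expr (proj_linear g) k l) x *v linear_field X k x) $ a =
      linear_field (g ** X ** h) l (chart_expr (proj_linear g) k l x) $ a" unfolding y .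
  qed
qed

lemma linear_field_derivative:
  "((\<lambda>y. linear_field X k y $ i) has_derivative (\<lambda>v. (X *v linear_lift k v) $ chart_index k i -
     (x $ i * (X *v linear_lift k v) $ k + v $ i * (X *v affine_lift k x) $ k))) (at x)"
proof -
  have "((\<lambda>y. y $ i) has_derivative (\<lambda>v. v $ i)) (at x)"
    by (rule bounded_linear_imp_has_derivative[OF bounded_linear_vec_nth])
  from has_derivative_diff[OF lift_component_derivative has_derivative_mult[OF this lift_component_derivative]]
  show ?thesis by (simp add: linear_field_def)
qed

lemma complex_linear_field_derivative:
  "complex_linear (\<lambda>v. (X *v linear_lift k v) $ j - (a * (X *v linear_lift k v) $ k + v $ i * b))"
  using complex_linear_lift[of X k j] complex_linear_lift[of X k k]
  by (simp add: complex_linear_def algebra_simps)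

lemma holomorphic_linear_field: "holomorphic_at (\<lambda>y. linear_field X k y $ i) x"
  by (rule holomorphic_atI[OF linear_field_derivative complex_linear_field_derivative])

text \<open>The bracket of two induced fields is induced by the commutator of the matrices, up to sign.\<close>

lemma linear_field_commute:
  assumes "X ** Y = Y ** X"
  shows "(\<Sum>l\<in>UNIV. linear_field X k x $ l * partial_deriv l (\<lambda>y. linear_field Y k y $ i) x) =
    (\<Sum>l\<in>UNIV. linear_field Y k x $ l * partial_deriv l (\<lambda>y. linear_field X k y $ i) x)"
proof -
  let ?z = "affine_lift k x"
  have along: "(\<Sum>l\<in>UNIV. linear_field X k x $ l * partial_deriv l (\<lambda>y. linear_field Y k y $ i) x) =
    (Y *v (X *v ?z)) $ chart_index k i - (X *v ?z) $ k * (Y *v ?z) $ chart_index k i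
    - (x $ i * ((Y *v (X *v ?z)) $ k - (X *v ?z) $ k * (Y *v ?z) $ k) +
       ((X *v ?z) $ chart_index k i - x $ i * (X *v ?z) $ k) * (Y *v ?z) $ k)" for X Y
  proof -
    let ?D = "\<lambda>v. (Y *v linear_lift k v) $ chart_index k i -
       (x $ i * (Y *v linear_lift k v) $ k + v $ i * (Y *v ?z) $ k)"
    have "(\<Sum>l\<in>UNIV. linear_field X k x $ l * partial_deriv l (\<lambda>y. linear_field Y k y $ i) x) =
       (\<Sum>l\<in>UNIV. ?D (axis l 1) * linear_field X k x $ l)"
      by (simp add: partial_deriv_eq[OF linear_field_derivative complex_linear_field_derivative] mult.commute)
    also have "\<dots> = ?D (linear_field X k x)"
      by (rule complex_linear_expand[OF complex_linear_field_derivative, symmetric])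
    finally show ?thesis
      unfolding linear_lift_linear_field
      by (simp add: matrix_vector_mult_diff_distrib matrix_vector_scale linear_field_def)
  qed
  have "Y *v (X *v ?z) = X *v (Y *v ?z)" by (simp add: matrix_vector_mul_assoc assms)
  then show ?thesis unfolding along by (simp add: algebra_simps)
qed

section \<open>Bivector fields built from linear vector fields\<close>

lemma partial_deriv_mult:
  assumes "holomorphic_at f x" "holomorphic_at g x"
  shows "partial_deriv i (\<lambda>y. f y * g y) x = f x * partial_deriv i g x + partial_deriv i f x * g x"
proof -
  obtain D where D: "complex_linear D" "(f has_derivative D) (at x)" using assms holomorphic_at_iff by blast
  obtain E where E: "complex_linear E" "(g has_derivative E) (at x)" using assms holomorphic_at_iff by blast
  have "partial_deriv i (\<lambda>y. f y * g y) x = f x * E (axis i 1) + D (axis i 1) * g x"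
    by (rule partial_deriv_eq[of _ "\<lambda>v. f x * E v + D v * g x", OF has_derivative_mult[OF D(2) E(2)]])
       (use D E in \<open>simp add: complex_linear_def algebra_simps\<close>)
  then show ?thesis by (simp add: partial_deriv_eq[OF D(2,1)] partial_deriv_eq[OF E(2,1)])
qed

lemma partial_deriv_const: "partial_deriv i (\<lambda>y. c) x = 0"
  by (simp add: partial_deriv_def)

lemma partial_deriv_sum:
  assumes "\<And>j. j \<in> J \<Longrightarrow> holomorphic_at (f j) x"
  shows "partial_deriv i (\<lambda>y. \<Sum>j\<in>J. f j y) x = (\<Sum>j\<in>J. partial_deriv i (f j) x)"
  using assms
proof (induction J rule: infinite_finite_induct)
  case (insert j J)
  then show ?case
    by (simp add: partial_deriv_add(1) holomorphic_at_sum)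
qed (simp_all add: partial_deriv_const)

lemma double_sum_UNIV:
  "(\<Sum>a\<in>UNIV. \<Sum>b\<in>UNIV. f a b) = (\<Sum>(a, b)\<in>UNIV. f a b)"
  by (simp add: sum.cartesian_product)

lemma double_sum_product:
  fixes A :: "'a \<Rightarrow> 'b \<Rightarrow> 'r::comm_semiring_0"
  shows "(\<Sum>a\<in>I. \<Sum>b\<in>J. A a b) * (\<Sum>p\<in>K. \<Sum>q\<in>L. B p q) =
    (\<Sum>a\<in>I. \<Sum>b\<in>J. \<Sum>p\<in>K. \<Sum>q\<in>L. A a b * B p q)"
  by (unfold sum_distrib_right, unfold sum_distrib_left, rule refl)

text \<open>Bivectors built from pairwise commuting vector fields \<open>v\<close> satisfy the Jacobi identity; \<open>w a b\<close>
  is the derivative of \<open>v b\<close> along \<open>v a\<close>.\<close>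

lemma commuting_jacobi:
  fixes c :: "'a::finite \<Rightarrow> 'a \<Rightarrow> complex" and v :: "'a \<Rightarrow> 'n \<Rightarrow> complex" and w :: "'a \<Rightarrow> 'a \<Rightarrow> 'n \<Rightarrow> complex"
  assumes c: "\<And>a b. c b a = - c a b" and w: "\<And>a b i. w b a i = w a b i"
  defines "Q \<equiv> \<lambda>i j m. \<Sum>(a, b, p, q)\<in>UNIV. c a b * c p q * (v a i * (w b p j * v q m + v p j * w b q m))"
  shows "Q i j m + Q j m i + Q m i j = 0"
proof -
  define T where "T i j m = (\<Sum>(a, b, p, q)\<in>UNIV. c a b * c p q * (v a i * w b p j * v q m))" for i j m
  have "(\<Sum>(a, b, p, q)\<in>UNIV. c a b * c p q * (v a i * v p j * w b q m)) =
      (\<Sum>(a, b, p, q)\<in>UNIV. - (c a b * c p q * (v a i * w b p m * v q j)))" for i j m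
  proof (rule sum.reindex_bij_witness[where i = "\<lambda>(a, b, p, q). (a, b, q, p)" and j = "\<lambda>(a, b, p, q). (a, b, q, p)"])
    fix x :: "'a \<times> 'a \<times> 'a \<times> 'a"
    obtain a b p q where x: "x = (a, b, p, q)" by (cases x)
    show "(case case x of (a, b, p, q) \<Rightarrow> (a, b, q, p) of (a, b, p, q) \<Rightarrow> - (c a b * c p q * (v a i * w b p m * v q j))) =
        (case x of (a, b, p, q) \<Rightarrow> c a b * c p q * (v a i * v p j * w b q m))"
      unfolding x using c[of p q] by simp
  qed auto
  then have Q: "Q i j m = T i j m - T i m j" for i j m
    unfolding Q_def T_def by (simp add: case_prod_beta algebra_simps sum.distrib sum_negf)
  have T: "T i j m = T m j i" for i j m
    unfolding T_def
  proof (rule sum.reindex_bij_witness[where i = "\<lambda>(a, b, p, q). (q, p, b, a)" and j = "\<lambda>(a, b, p, q). (q, p, b, a)"])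
    fix x :: "'a \<times> 'a \<times> 'a \<times> 'a"
    obtain a b p q where x: "x = (a, b, p, q)" by (cases x)
    show "(case case x of (a, b, p, q) \<Rightarrow> (q, p, b, a) of (a, b, p, q) \<Rightarrow> c a b * c p q * (v a m * w b p j * v q i)) =
        (case x of (a, b, p, q) \<Rightarrow> c a b * c p q * (v a i * w b p j * v q m))"
      unfolding x using c[of p q] c[of a b] w[of b p j] by simp
  qed auto
  show ?thesis unfolding Q using T[of i j m] T[of j m i] T[of m i j] by simp
qed

definition field_bivector :: "complex ^ 'n ^ 'n \<Rightarrow> ('n \<Rightarrow> complex ^ 'n option ^ 'n option) \<Rightarrow> 'n::finite bivector" where
  "field_bivector c X = (\<lambda>k x. \<chi> i j. \<Sum>a\<in>UNIV. \<Sum>b\<in>UNIV.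
     c $ a $ b * (linear_field (X a) k x $ i * linear_field (X b) k x $ j))"

lemma congruence_sum:
  fixes M :: "complex ^ 'n ^ 'm"
  shows "M ** (\<chi> i j. \<Sum>a\<in>UNIV. \<Sum>b\<in>UNIV. c a b * (u a $ i * u' b $ j)) ** transpose M =
    (\<chi> i j. \<Sum>a\<in>UNIV. \<Sum>b\<in>UNIV. c a b * ((M *v u a) $ i * (M *v u' b) $ j))"
proof (rule vec_eq_iff[THEN iffD2], rule allI, rule vec_eq_iff[THEN iffD2], rule allI)
  fix i j
  let ?s = "\<lambda>a b p q. M $ i $ p * M $ j $ q * (c a b * (u a $ p * u' b $ q))"
  have "(M ** (\<chi> i j. \<Sum>a\<in>UNIV. \<Sum>b\<in>UNIV. c a b * (u a $ i * u' b $ j)) ** transpose M) $ i $ j =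
    (\<Sum>q\<in>UNIV. \<Sum>p\<in>UNIV. \<Sum>a\<in>UNIV. \<Sum>b\<in>UNIV. ?s a b p q)"
    by (simp add: matrix_matrix_mult_def transpose_def sum_distrib_left sum_distrib_right algebra_simps)
  also have "\<dots> = (\<Sum>(q, p, a, b)\<in>UNIV. ?s a b p q)"
    by (simp add: double_sum_UNIV case_prod_beta)
  also have "\<dots> = (\<Sum>(a, b, p, q)\<in>UNIV. ?s a b p q)"
    by (rule sum.reindex_bij_witness[where i = "\<lambda>(a, b, p, q). (q, p, a, b)" and j = "\<lambda>(q, p, a, b). (a, b, p, q)"]) auto
  also have "\<dots> = (\<Sum>a\<in>UNIV. \<Sum>b\<in>UNIV. \<Sum>p\<in>UNIV. \<Sum>q\<in>UNIV. ?s a b p q)"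
    by (simp add: double_sum_UNIV case_prod_beta)
  also have "\<dots> = (\<Sum>a\<in>UNIV. \<Sum>b\<in>UNIV. c a b * ((M *v u a) $ i * (M *v u' b) $ j))"
  proof (intro sum.cong refl)
    fix a b
    have "(M *v u a) $ i * (M *v u' b) $ j = (\<Sum>p\<in>UNIV. \<Sum>q\<in>UNIV. M $ i $ p * u a $ p * (M $ j $ q * u' b $ q))"
      unfolding matrix_vector_mult_def by (simp only: vec_lambda_beta sum_product)
    then show "(\<Sum>p\<in>UNIV. \<Sum>q\<in>UNIV. ?s a b p q) = c a b * ((M *v u a) $ i * (M *v u' b) $ j)"
      by (simp add: sum_distrib_left mult_ac)
  qed
  finally show "(M ** (\<chi> i j. \<Sum>a\<in>UNIV. \<Sum>b\<in>UNIV. c a b * (u a $ i * u' b $ j)) ** transpose M) $ i $ j =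
    (\<chi> i j. \<Sum>a\<in>UNIV. \<Sum>b\<in>UNIV. c a b * ((M *v u a) $ i * (M *v u' b) $ j)) $ i $ j" by simp
qed

lemma field_bivector_pushforward:
  assumes "h ** g = mat 1"
  shows "pushes_forward (proj_linear g) (field_bivector c X) (field_bivector c (\<lambda>a. g ** X a ** h))"
  unfolding pushes_forward_def chart_domain_proj_linear field_bivector_def congruence_sum
proof (intro allI ballI)
  fix k l and x :: "complex ^ 'a"
  assume "x \<in> chart_domain (proj_linear g) k l"
  then have nz: "(g *v affine_lift k x) $ l \<noteq> 0" by (simp add: chart_domain_proj_linear)
  show "(\<chi> i j. \<Sum>a\<in>UNIV. \<Sum>b\<in>UNIV. c $ a $ b *
      (linear_field (g ** X a ** h) l (chart_expr (proj_linear g) k l x) $ i *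
       linear_field (g ** X b ** h) l (chart_expr (proj_linear g) k l x) $ j)) =
    (\<chi> i j. \<Sum>a\<in>UNIV. \<Sum>b\<in>UNIV. c $ a $ b *
      ((complex_jacobian (chart_expr (proj_linear g) k l) x *v linear_field (X a) k x) $ i *
       (complex_jacobian (chart_expr (proj_linear g) k l) x *v linear_field (X b) k x) $ j))"
    unfolding linear_field_pushforward[OF assms nz] ..
qed

lemma skew_entry: "transpose c = - c \<Longrightarrow> c $ b $ a = - (c $ a $ b :: complex)"
  by (drule arg_cong[of _ _ "\<lambda>m. m $ a $ b"]) (simp add: transpose_def)

lemma field_bivector_skew:
  assumes "transpose c = - c"
  shows "transpose (field_bivector c X k x) = - field_bivector c X k x"
proof (rule vec_eq_iff[THEN iffD2], rule allI, rule vec_eq_iff[THEN iffD2], rule allI)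
  fix i j
  have "(\<Sum>a\<in>UNIV. \<Sum>b\<in>UNIV. c $ a $ b * (linear_field (X a) k x $ j * linear_field (X b) k x $ i)) =
    (\<Sum>b\<in>UNIV. \<Sum>a\<in>UNIV. - (c $ b $ a * (linear_field (X b) k x $ i * linear_field (X a) k x $ j)))"
    by (subst sum.swap, intro sum.cong refl, subst skew_entry[OF assms]) (simp add: mult_ac)
  then show "transpose (field_bivector c X k x) $ i $ j = (- field_bivector c X k x) $ i $ j"
    by (simp add: transpose_def field_bivector_def sum_negf)
qed

lemma holomorphic_field_bivector: "holomorphic_at (\<lambda>y. field_bivector c X k y $ i $ j) x"
  unfolding field_bivector_def
  by (simp, intro holomorphic_at_sum holomorphic_at_cmult holomorphic_at_mult holomorphic_linear_field)

lemma field_bivector_in_bivector_fields: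
  assumes "transpose c = - c"
  shows "field_bivector c X \<in> bivector_fields"
  unfolding bivector_fields_def mem_Collect_eq
proof (intro conjI allI)
  show "pushes_forward id (field_bivector c X) (field_bivector c X)"
    using field_bivector_pushforward[of "mat 1" "mat 1" c X] by (simp add: proj_linear_one)
qed (rule field_bivector_skew[OF assms] holomorphic_field_bivector)+

text \<open>Commuting matrices induce commuting vector fields, and bivectors with constant coefficients in
  commuting fields have vanishing Schouten bracket.\<close>

lemma is_poisson_field_bivector:
  assumes c: "transpose c = - c" and X: "\<And>a b. X a ** X b = X b ** X a"
  shows "is_poisson (field_bivector c X)"
  unfolding is_poisson_def
proof (intro conjI allI)
  show "field_bivector c X \<in> bivector_fields" by (rule field_bivector_in_bivector_fields[OF c])
  fix k x i j m
  let ?P = "field_bivector c X k"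
  let ?v = "\<lambda>a i. linear_field (X a) k x $ i"
  let ?dv = "\<lambda>l a i. partial_deriv l (\<lambda>y. linear_field (X a) k y $ i) x"
  define w where "w a b i = (\<Sum>l\<in>UNIV. ?v a l * ?dv l b i)" for a b i
  have wsym: "w b a i = w a b i" for a b i
    unfolding w_def by (rule linear_field_commute[OF X])
  have dP: "partial_deriv l (\<lambda>y. ?P y $ j $ m) x =
    (\<Sum>p\<in>UNIV. \<Sum>q\<in>UNIV. c $ p $ q * (?v p j * ?dv l q m + ?dv l p j * ?v q m))" for l j m
    unfolding field_bivector_def
    by (simp add: partial_deriv_sum partial_deriv_add(2) partial_deriv_mult holomorphic_at_sum
       holomorphic_at_cmult holomorphic_at_mult holomorphic_linear_field
       partial_deriv_add(2)[OF _ holomorphic_at_const[of 0]])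
  define Q where "Q i j m = (\<Sum>(a, b, p, q)\<in>UNIV. c $ a $ b * c $ p $ q *
      (?v a i * (w b p j * ?v q m + ?v p j * w b q m)))" for i j m
  have PQ: "(\<Sum>l\<in>UNIV. ?P x $ i $ l * partial_deriv l (\<lambda>y. ?P y $ j $ m) x) = Q i j m" for i j m
  proof -
    let ?s = "\<lambda>l a b p q. c $ a $ b * c $ p $ q * (?v a i * ?v b l * (?v p j * ?dv l q m + ?dv l p j * ?v q m))"
    have "(\<Sum>l\<in>UNIV. ?P x $ i $ l * partial_deriv l (\<lambda>y. ?P y $ j $ m) x) =
      (\<Sum>l\<in>UNIV. \<Sum>a\<in>UNIV. \<Sum>b\<in>UNIV. \<Sum>p\<in>UNIV. \<Sum>q\<in>UNIV. ?s l a b p q)"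
      unfolding dP by (simp add: field_bivector_def double_sum_product mult_ac)
    also have "\<dots> = (\<Sum>(l, a, b, p, q)\<in>UNIV. ?s l a b p q)"
      by (simp add: double_sum_UNIV case_prod_beta)
    also have "\<dots> = (\<Sum>((a, b, p, q), l)\<in>UNIV. ?s l a b p q)"
      by (rule sum.reindex_bij_witness[where i = "\<lambda>((a, b, p, q), l). (l, a, b, p, q)" and j = "\<lambda>(l, a, b, p, q). ((a, b, p, q), l)"]) auto
    also have "\<dots> = (\<Sum>(a, b, p, q)\<in>UNIV. \<Sum>l\<in>UNIV. ?s l a b p q)"
      using double_sum_UNIV[of "\<lambda>(a, b, p, q) l. ?s l a b p q"] by (simp add: case_prod_beta)
    also have "\<dots> = Q i j m"
      unfolding Q_def w_def
      by (rule sum.cong)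
         (auto simp: sum_distrib_left sum_distrib_right sum.distrib algebra_simps)
    finally show ?thesis .
  qed
  have "Q i j m + Q j m i + Q m i j = 0"
    unfolding Q_def by (rule commuting_jacobi, rule skew_entry[OF c], rule wsym)
  moreover have "schouten ?P ?P x i j m = 2 * (Q i j m + Q j m i + Q m i j)"
    unfolding schouten_def PQ[symmetric] by (simp add: sum.distrib sum_distrib_left algebra_simps)
  ultimately show "schouten ?P ?P x i j m = 0" by simp
qed

section \<open>Linear automorphisms and diagonal Poisson structures\<close>

lemma holomorphic_self_map_cong:
  assumes "\<And>S. S \<in> proj_space \<Longrightarrow> f S = g S" and "holomorphic_self_map g"
  shows "holomorphic_self_map f"
proof -
  have "f (affine_point k x) = g (affine_point k x)" for k x
    by (rule assms(1)[OF affine_point_in_proj_space])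
  then have "chart_domain f = chart_domain g" "chart_expr f = chart_expr g"
    by (simp_all add: chart_domain_def chart_expr_def fun_eq_iff)
  moreover have "f ` proj_space = g ` proj_space" using assms(1) by (rule image_cong[OF refl])
  ultimately show ?thesis using assms(2) by (simp add: holomorphic_self_map_def)
qed

lemma proj_linear_in_proj_space:
  assumes "h ** g = mat 1" "S \<in> proj_space"
  shows "proj_linear g S \<in> proj_space"
proof -
  obtain z where z: "z \<noteq> 0" "S = proj_class (*s) z"
    using assms(2) unfolding proj_space_def projectivization_def by blast
  have "h *v (g *v z) = z" by (simp add: matrix_vector_mul_assoc assms(1))
  then have "g *v z \<noteq> 0" using z(1) by auto
  then show ?thesis unfolding z(2) proj_linear_class proj_space_def projectivization_def by blast
qed

lemma holomorphic_proj_linear: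
  assumes "h ** g = mat 1"
  shows "holomorphic_self_map (proj_linear g)"
  unfolding holomorphic_self_map_def
proof (intro conjI allI ballI)
  show "proj_linear g ` proj_space \<subseteq> proj_space" using proj_linear_in_proj_space[OF assms] by blast
  fix k l
  have "chart_domain (proj_linear g) k l = {x. (g *v affine_lift k x) $ l \<noteq> 0}"
    using chart_domain_proj_linear by blast
  then show "open (chart_domain (proj_linear g) k l)" using open_chart_domain by simp
  fix x a assume "x \<in> chart_domain (proj_linear g) k l"
  then show "holomorphic_at (\<lambda>y. chart_expr (proj_linear g) k l y $ a) x"
    unfolding chart_domain_proj_linear
    by (intro holomorphic_atI[OF chart_expr_derivative chart_expr_complex_linear])
qed

lemma proj_linear_inverse: "h ** g = mat 1 \<Longrightarrow> proj_linear h (proj_linear g S) = S"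
  by (simp add: proj_linear_def image_image matrix_vector_mul_assoc)

lemma proj_automorphism_proj_linear:
  assumes hg: "h ** g = mat 1" and gh: "g ** h = mat 1"
  shows "proj_automorphism (proj_linear g)"
  unfolding proj_automorphism_def
proof (intro conjI)
  show bij: "bij_betw (proj_linear g) proj_space proj_space"
    by (rule bij_betw_byWitness[where f' = "proj_linear h"])
       (use proj_linear_inverse[OF hg] proj_linear_inverse[OF gh]
         proj_linear_in_proj_space[OF hg] proj_linear_in_proj_space[OF gh] in auto)
  show "holomorphic_self_map (proj_linear g)" by (rule holomorphic_proj_linear[OF hg])
  show "holomorphic_self_map (inv_into proj_space (proj_linear g))"
  proof (rule holomorphic_self_map_cong[OF _ holomorphic_proj_linear[OF gh]])
    fix S :: "(complex ^ 'a option) set" assume S: "S \<in> proj_space"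
    have "inv_into proj_space (proj_linear g) (proj_linear g (proj_linear h S)) = proj_linear h S"
      by (rule inv_into_f_f[OF bij_betw_imp_inj_on[OF bij] proj_linear_in_proj_space[OF gh S]])
    then show "inv_into proj_space (proj_linear g) S = proj_linear h S"
      by (simp add: proj_linear_inverse[OF gh])
  qed
qed

definition diag_unit :: "'n \<Rightarrow> complex ^ 'n ^ 'n::finite" where
  "diag_unit a = (\<chi> i j. if i = a \<and> j = a then 1 else 0)"

lemma diag_unit_mult: "(diag_unit a *v z) $ i = (if i = a then z $ a else 0)"
  by (simp add: diag_unit_def matrix_vector_mult_def if_distribR if_distrib cong: if_cong)

text \<open>The bivector field \<open>\<Sum>i<j. c\<^sub>i\<^sub>j x\<^sub>i x\<^sub>j \<partial>\<^sub>i \<and> \<partial>\<^sub>j\<close> is a combination of the fields \<open>x\<^sub>i \<partial>\<^sub>i\<close> that are induced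
  by the diagonal matrix units; the linear coordinate change \<open>g\<close> with inverse \<open>h\<close> conjugates these matrices.\<close>

definition diagonal_bivector ::
    "complex ^ 'n option ^ 'n option \<Rightarrow> complex ^ 'n option ^ 'n option \<Rightarrow> complex ^ 'n ^ 'n \<Rightarrow> 'n::finite bivector" where
  "diagonal_bivector g h c = field_bivector c (\<lambda>a. g ** diag_unit (Some a) ** h)"

lemma sum_sum_delta:
  fixes c :: "'a::finite \<Rightarrow> 'b::finite \<Rightarrow> complex"
  shows "(\<Sum>a\<in>UNIV. \<Sum>b\<in>UNIV. c a b * ((if i = a then p else 0) * (if j = b then q else 0))) = c i j * (p * q)"
proof -
  have "(\<Sum>b\<in>UNIV. c a b * ((if i = a then p else 0) * (if j = b then q else 0))) =
      (if i = a then c a j * (p * q) else 0)" for a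
  proof -
    have "(\<Sum>b\<in>UNIV. c a b * ((if i = a then p else 0) * (if j = b then q else 0))) =
        (\<Sum>b\<in>UNIV. if j = b then (if i = a then c a b * (p * q) else 0) else 0)"
      by (rule sum.cong) auto
    then show ?thesis by simp
  qed
  then show ?thesis by simp
qed

lemma diagonal_bivector_one_None:
  "diagonal_bivector (mat 1) (mat 1) c None x = (\<chi> i j. c $ i $ j * x $ i * x $ j)"
proof -
  have f: "linear_field (diag_unit (Some a)) None x $ i = (if i = a then x $ i else 0)" for a i
    by (simp add: linear_field_def diag_unit_mult affine_lift_None)
  show ?thesis
    by (simp add: diagonal_bivector_def field_bivector_def f sum_sum_delta mult.assoc)
qed

lemma is_diagonal_poisson_diagonal_bivector:
  assumes hg: "h ** g = mat 1" and gh: "g ** h = mat 1" and c: "transpose c = - c"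
  shows "is_diagonal_poisson (diagonal_bivector g h c)"
  unfolding is_diagonal_poisson_def
proof (intro conjI exI)
  have cancel: "h ** (g ** Z) = Z" for Z by (simp add: matrix_mul_assoc hg)
  have du: "diag_unit a ** diag_unit b = diag_unit b ** diag_unit a" for a b :: "'a option"
    unfolding matrix_eq by (simp add: matrix_vector_mul_assoc[symmetric] vec_eq_iff diag_unit_mult)
  show "is_poisson (diagonal_bivector g h c)"
    unfolding diagonal_bivector_def
  proof (rule is_poisson_field_bivector[OF c])
    fix a b
    have "(g ** diag_unit (Some a) ** h) ** (g ** diag_unit (Some b) ** h) =
      g ** (diag_unit (Some a) ** diag_unit (Some b)) ** h" for a b
      by (simp add: matrix_mul_assoc[symmetric] cancel)
    then show "(g ** diag_unit (Some a) ** h) ** (g ** diag_unit (Some b) ** h) =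
      (g ** diag_unit (Some b) ** h) ** (g ** diag_unit (Some a) ** h)" using du by metis
  qed
  show "proj_automorphism (proj_linear g)" by (rule proj_automorphism_proj_linear[OF hg gh])
  show "extends_diagonal (field_bivector c (\<lambda>a. diag_unit (Some a)))"
    unfolding extends_diagonal_def
    using field_bivector_in_bivector_fields[OF c] diagonal_bivector_one_None[of c] c
    by (auto simp: diagonal_bivector_def)
  show "pushes_forward (proj_linear g) (field_bivector c (\<lambda>a. diag_unit (Some a))) (diagonal_bivector g h c)"
    unfolding diagonal_bivector_def by (rule field_bivector_pushforward[OF hg])
qed

section \<open>Global vector fields and bivector fields\<close>

subsection \<open>Transition to another chart\<close>

definition chart_swap :: "'n \<Rightarrow> complex ^ 'n::finite \<Rightarrow> complex ^ 'n" where
  "chart_swap m x = (\<chi> a. if a = m then 1 / x $ m else x $ a / x $ m)"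

lemma chart_swap_involution: "x $ m \<noteq> 0 \<Longrightarrow> chart_swap m (chart_swap m x) = x"
  by (simp add: chart_swap_def vec_eq_iff)

lemma chart_index_Some: "chart_index (Some m) a = (if a = m then None else Some a)"
  by (simp add: chart_index_def Transposition.transpose_def)

lemma in_chart_domain_Some: "x \<in> chart_domain id None (Some m) \<longleftrightarrow> x $ m \<noteq> 0"
  using chart_domain_proj_linear[of x "mat 1" None "Some m"] by (simp add: proj_linear_one affine_lift_None)

lemma affine_lift_None_None: "affine_lift None x $ None = 1"
  by (rule affine_lift_base)

lemma chart_expr_id_Some: "x $ m \<noteq> 0 \<Longrightarrow> chart_expr id None (Some m) x = chart_swap m x"
  using chart_expr_proj_linear[of "mat 1" None x "Some m"]
  by (simp add: proj_linear_one affine_lift_None dehomogenize_def chart_swap_def vec_eq_iff chart_index_Some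
      affine_lift_None_None)

lemma linear_lift_None: "linear_lift None v $ Some i = v $ i" "linear_lift None v $ None = 0"
  using linear_lift_index[of None v i] linear_lift_base[of None v] by simp_all

lemma jacobian_id_Some:
  assumes "x $ m \<noteq> 0"
  shows "(complex_jacobian (chart_expr id None (Some m)) x *v v) $ a =
    (if a = m then - (v $ m / (x $ m)\<^sup>2) else (v $ a * x $ m - x $ a * v $ m) / (x $ m)\<^sup>2)"
proof -
  have nz: "(mat 1 *v affine_lift None x) $ Some m \<noteq> 0" using assms by (simp add: affine_lift_None)
  show ?thesis
    unfolding proj_linear_one[symmetric]
    by (subst complex_jacobian_mult[OF chart_expr_derivative[OF nz] chart_expr_complex_linear])
       (simp add: chart_index_Some affine_lift_None linear_lift_None affine_lift_None_None power2_eq_square)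
qed

lemma congruence_entry:
  fixes M :: "complex ^ 'n ^ 'm"
  shows "(M ** S ** transpose M) $ a $ b = (M *v (\<chi> p. (M *v (S $ p)) $ b)) $ a"
proof -
  have "(M ** S ** transpose M) $ a $ b = (\<Sum>q\<in>UNIV. \<Sum>p\<in>UNIV. M $ a $ p * S $ p $ q * M $ b $ q)"
    by (simp add: matrix_matrix_mult_def transpose_def sum_distrib_right)
  also have "\<dots> = (\<Sum>p\<in>UNIV. \<Sum>q\<in>UNIV. M $ a $ p * S $ p $ q * M $ b $ q)" by (rule sum.swap)
  finally show ?thesis by (simp add: matrix_vector_mult_def sum_distrib_left mult_ac)
qed

lemma bivector_transition:
  assumes \<tau>: "\<tau> \<in> bivector_fields" and x: "x $ m \<noteq> 0"
  shows "a \<noteq> m \<Longrightarrow> \<tau> None x $ a $ m = - ((x $ m) ^ 3 * \<tau> (Some m) (chart_swap m x) $ a $ m)"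
    and "a \<noteq> m \<Longrightarrow> b \<noteq> m \<Longrightarrow> x $ m * \<tau> None x $ a $ b - x $ b * \<tau> None x $ a $ m - x $ a * \<tau> None x $ m $ b =
      (x $ m) ^ 3 * \<tau> (Some m) (chart_swap m x) $ a $ b"
    and "(\<And>a b. \<tau> None x $ a $ b = 0) \<Longrightarrow> \<tau> (Some m) (chart_swap m x) $ a $ b = 0"
proof -
  let ?J = "complex_jacobian (chart_expr id None (Some m)) x" and ?S = "\<tau> None x"
  have skew: "?S $ m $ m = 0"
  proof -
    have "transpose ?S = - ?S" using \<tau> by (simp add: bivector_fields_def)
    from skew_entry[OF this, of m m] show ?thesis by simp
  qed
  have "pushes_forward id \<tau> \<tau>" using \<tau> by (simp add: bivector_fields_def)
  moreover have "x \<in> chart_domain id None (Some m)" by (simp add: in_chart_domain_Some x)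
  ultimately have "\<tau> (Some m) (chart_expr id None (Some m) x) = ?J ** ?S ** transpose ?J"
    unfolding pushes_forward_def by blast
  then have "\<tau> (Some m) (chart_swap m x) = ?J ** ?S ** transpose ?J"
    unfolding chart_expr_id_Some[OF x] .
  then have eq: "\<tau> (Some m) (chart_swap m x) $ a $ b = (?J *v (\<chi> p. (?J *v (?S $ p)) $ b)) $ a" for a b
    by (simp only: congruence_entry)
  show "?S $ a $ m = - ((x $ m) ^ 3 * \<tau> (Some m) (chart_swap m x) $ a $ m)" if "a \<noteq> m"
    unfolding eq jacobian_id_Some[OF x] using that x skew by (simp add: field_simps power2_eq_square power3_eq_cube)
  show "x $ m * ?S $ a $ b - x $ b * ?S $ a $ m - x $ a * ?S $ m $ b =
      (x $ m) ^ 3 * \<tau> (Some m) (chart_swap m x) $ a $ b" if "a \<noteq> m" "b \<noteq> m"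
    unfolding eq jacobian_id_Some[OF x] using that x skew by (simp add: field_simps power2_eq_square power3_eq_cube)
  show "\<tau> (Some m) (chart_swap m x) $ a $ b = 0" if "\<And>a b. \<tau> None x $ a $ b = 0"
    unfolding eq jacobian_id_Some[OF x] using that by simp
qed

subsection \<open>Growth\<close>

lemma coord_update_line: "coord_update x i t = (x - x $ i *s axis i 1) + t *s axis i 1"
  by (auto simp: coord_update_def vec_eq_iff axis_def)

lemma holomorphic_at_line:
  assumes "\<And>x. holomorphic_at f x"
  shows "(\<lambda>t. f (coord_update x i t)) holomorphic_on UNIV"
  unfolding coord_update_line holomorphic_on_def field_differentiable_def
proof
  fix t0
  obtain D where "complex_linear D" "(f has_derivative D) (at ((x - x $ i *s axis i 1) + t0 *s axis i 1))"
    using assms holomorphic_at_iff by blast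
  from has_field_derivative_line[OF this(2,1)]
  show "\<exists>f'. ((\<lambda>t. f (x - x $ i *s axis i 1 + t *s axis i 1)) has_field_derivative f') (at t0 within UNIV)" by auto
qed

lemma holomorphic_at_locally_bounded:
  assumes "\<And>x. holomorphic_at f x"
  shows "\<exists>A. \<forall>x. norm x \<le> R \<longrightarrow> norm (f x) \<le> A"
proof -
  have "isCont f x" for x
    using assms[of x] has_derivative_continuous unfolding holomorphic_at_iff by blast
  then have "continuous_on (cball 0 R) f" by (simp add: continuous_at_imp_continuous_on)
  then have "compact (f ` cball 0 R)" by (rule compact_continuous_image) simp
  then have "bounded (f ` cball 0 R)" by (rule compact_imp_bounded)
  then obtain A where "\<forall>y\<in>f ` cball 0 R. norm y \<le> A" by (auto simp: bounded_iff)
  then show ?thesis by (intro exI[of _ A]) auto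
qed

lemma norm_le_polydisc:
  fixes x :: "complex ^ 'n::finite" and r :: real
  assumes "\<And>i. norm (x $ i) \<le> r"
  shows "norm x \<le> CARD('n) * r"
proof -
  have "norm x \<le> (\<Sum>i\<in>UNIV. norm (x $ i))" unfolding norm_vec_def by (rule L2_set_le_sum) simp
  also have "\<dots> \<le> (\<Sum>i\<in>(UNIV :: 'n set). r)" by (rule sum_mono) (rule assms)
  finally show ?thesis by simp
qed

text \<open>It suffices to bound a function where one coordinate dominates the others, and that
  coordinate is at least 1 in absolute value.\<close>

lemma growth_from_charts:
  fixes f :: "complex ^ 'n::finite \<Rightarrow> complex"
  assumes hol: "\<And>x i. (\<lambda>t. f (coord_update x i t)) holomorphic_on UNIV"
    and bounded: "\<And>R. \<exists>A. \<forall>x. norm x \<le> R \<longrightarrow> norm (f x) \<le> A"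
    and B: "\<And>m x. norm (x $ m) \<ge> 1 \<Longrightarrow> norm (chart_swap m x) \<le> CARD('n) \<Longrightarrow>
      (\<And>i. norm (x $ i) \<le> norm (x $ m)) \<Longrightarrow> norm (f x) \<le> B * norm (x $ m) ^ d"
  shows "polynomial_growth d f"
  unfolding polynomial_growth_def
proof (intro conjI allI hol)
  obtain A where A: "\<And>x. norm x \<le> CARD('n) \<Longrightarrow> norm (f x) \<le> A" using bounded by metis
  have "norm (f x) \<le> (max A 0 + max B 0) * (1 + norm x) ^ d" for x
  proof -
    obtain m where m: "\<And>i. norm (x $ i) \<le> norm (x $ m)"
    proof -
      have "Max (range (\<lambda>i. norm (x $ i))) \<in> range (\<lambda>i. norm (x $ i))" by (rule Max_in) auto
      then obtain m where "Max (range (\<lambda>i. norm (x $ i))) = norm (x $ m)" by (rule imageE)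
      then have "norm (x $ i) \<le> norm (x $ m)" for i
        using Max_ge[of "range (\<lambda>i. norm (x $ i))" "norm (x $ i)"] by simp
      then show ?thesis by (rule that)
    qed
    have one: "1 \<le> (1 + norm x) ^ d" by simp
    show ?thesis
    proof (cases "norm (x $ m) \<ge> 1")
      case True
      have "norm (chart_swap m x $ i) \<le> 1" for i
        using m[of i] True by (auto simp: chart_swap_def norm_divide divide_le_eq)
      then have "norm (chart_swap m x) \<le> CARD('n)" using norm_le_polydisc[of "chart_swap m x" 1] by simp
      then have "norm (f x) \<le> B * norm (x $ m) ^ d" using B True m by blast
      also have "\<dots> \<le> max B 0 * norm (x $ m) ^ d" by (rule mult_right_mono) auto
      also have "\<dots> \<le> max B 0 * (1 + norm x) ^ d"
        by (intro mult_left_mono power_mono order_trans[OF Finite_Cartesian_Product.norm_nth_le]) auto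
      also have "\<dots> \<le> (max A 0 + max B 0) * (1 + norm x) ^ d" by (rule mult_right_mono) auto
      finally show ?thesis .
    next
      case False
      then have "norm (x $ i) \<le> 1" for i using m[of i] by simp
      then have "norm x \<le> CARD('n)" using norm_le_polydisc[of x 1] by simp
      then have "norm (f x) \<le> (max A 0 + max B 0) * 1" using A[of x] by simp
      also have "\<dots> \<le> (max A 0 + max B 0) * (1 + norm x) ^ d" by (rule mult_left_mono[OF one]) simp
      finally show ?thesis .
    qed
  qed
  then show "\<exists>A. \<forall>x. norm (f x) \<le> A * (1 + norm x) ^ d" by blast
qed

lemma growth_along_ray:
  assumes "polynomial_growth d f"
  shows "\<exists>A. \<forall>t. norm t \<ge> 1 \<longrightarrow> norm (f (t *s x)) \<le> A * norm t ^ d"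
proof -
  obtain A where A: "\<And>x. norm (f x) \<le> A * (1 + norm x) ^ d" using assms unfolding polynomial_growth_def by blast
  have A0: "A \<ge> 0" using A[of 0] norm_ge_zero[of "f 0"] by (simp del: norm_ge_zero)
  have "norm (f (t *s x)) \<le> A * (1 + norm x) ^ d * norm t ^ d" if t: "norm t \<ge> 1" for t
  proof -
    have "norm (t *s x) = norm t * norm x"
      by (simp add: norm_vec_def norm_mult L2_set_right_distrib)
    then have "(1 + norm (t *s x)) ^ d \<le> ((1 + norm x) * norm t) ^ d"
      using t by (intro power_mono) (auto simp: algebra_simps)
    then have "A * (1 + norm (t *s x)) ^ d \<le> A * ((1 + norm x) * norm t) ^ d" by (rule mult_left_mono[OF _ A0])
    then show ?thesis using A[of "t *s x"] by (simp add: power_mult_distrib mult_ac)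
  qed
  then show ?thesis by blast
qed

lemma zero_by_line:
  assumes "(\<lambda>t. f (coord_update y m t)) holomorphic_on UNIV" "\<And>x. x $ m \<noteq> 0 \<Longrightarrow> f x = 0"
  shows "f y = (0::complex)"
proof -
  have "continuous_on UNIV (\<lambda>t. f (coord_update y m t))" using assms(1) by (rule holomorphic_on_imp_continuous_on)
  then have "isCont (\<lambda>t. f (coord_update y m t)) (y $ m)" by (simp add: continuous_on_eq_continuous_at)
  then have "((\<lambda>t. f (coord_update y m t)) \<longlongrightarrow> f (coord_update y m (y $ m))) (at (y $ m))" by (simp add: isCont_def)
  moreover have "eventually (\<lambda>t. f (coord_update y m t) = 0) (at (y $ m))"
  proof (cases "y $ m = 0")
    case True
    then show ?thesis using assms(2) by (auto simp: eventually_at_filter coord_update_def)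
  next
    case False
    have "eventually (\<lambda>t. t \<noteq> 0) (at (y $ m))"
      using False by (intro eventually_neq_at_within)
    then show ?thesis by (rule eventually_mono) (use assms(2) in \<open>auto simp: coord_update_def\<close>)
  qed
  then have "((\<lambda>t. f (coord_update y m t)) \<longlongrightarrow> 0) (at (y $ m))" by (rule tendsto_eventually)
  ultimately have "f (coord_update y m (y $ m)) = 0" using tendsto_unique[OF trivial_limit_at] by blast
  moreover have "coord_update y m (y $ m) = y" by (simp add: coord_update_def vec_eq_iff)
  ultimately show ?thesis by simp
qed

text \<open>Where \<open>x $ m\<close> dominates the other coordinates, the point stays bounded in the chart \<open>Some m\<close>, and the
  transition to this chart costs at most the third power of \<open>x $ m\<close>.\<close>

lemma bivector_growth:
  fixes \<tau> :: "'n::finite bivector"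
  assumes \<tau>: "\<tau> \<in> bivector_fields"
  shows "polynomial_growth 3 (\<lambda>x. \<tau> None x $ a $ b)"
proof -
  have hol: "holomorphic_at (\<lambda>y. \<tau> k y $ i $ j) x" for k i j x using \<tau> by (simp add: bivector_fields_def)
  have skew: "\<tau> k x $ j $ i = - \<tau> k x $ i $ j" for k x i j
    by (rule skew_entry) (use \<tau> in \<open>simp add: bivector_fields_def\<close>)
  have "\<forall>k i j. \<exists>A. \<forall>x. norm x \<le> CARD('n) \<longrightarrow> norm (\<tau> k x $ i $ j) \<le> A"
    using holomorphic_at_locally_bounded[OF hol] by blast
  then obtain A where A0: "\<forall>k i j x. norm x \<le> CARD('n) \<longrightarrow> norm (\<tau> k x $ i $ j) \<le> A k i j" by metis
  then have A: "norm x \<le> CARD('n) \<Longrightarrow> norm (\<tau> k x $ i $ j) \<le> A k i j" for k i j x by blast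
  define B where "B = Max (insert 0 (range (\<lambda>(k, i, j). A k i j)))"
  have AB: "norm (\<tau> k x $ i $ j) \<le> B" if "norm x \<le> CARD('n)" for k i j x
  proof -
    have "A k i j \<in> insert 0 (range (\<lambda>(k, i, j). A k i j))" by (auto intro: image_eqI[of _ _ "(k, i, j)"])
    then have "A k i j \<le> B" unfolding B_def by (intro Max_ge) auto
    then show ?thesis using A[OF that, of k i j] by simp
  qed
  have B0: "B \<ge> 0" unfolding B_def by simp
  show ?thesis
  proof (rule growth_from_charts[where B = "3 * B"])
    show "(\<lambda>t. \<tau> None (coord_update x i t) $ a $ b) holomorphic_on UNIV" for x i
      by (rule holomorphic_at_line[OF hol])
    show "\<exists>A. \<forall>x. norm x \<le> R \<longrightarrow> norm (\<tau> None x $ a $ b) \<le> A" for R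
      by (rule holomorphic_at_locally_bounded[OF hol])
    fix m and x :: "complex ^ 'n" assume x: "1 \<le> norm (x $ m)" "norm (chart_swap m x) \<le> CARD('n)" "\<And>i. norm (x $ i) \<le> norm (x $ m)"
    have xm: "x $ m \<noteq> 0" using x(1) by auto
    have col: "norm (\<tau> None x $ i $ m) \<le> B * norm (x $ m) ^ 3" for i
    proof (cases "i = m")
      case True
      then show ?thesis using skew[of None x m m] B0 by simp
    next
      case False
      have "norm (\<tau> None x $ i $ m) = norm (x $ m) ^ 3 * norm (\<tau> (Some m) (chart_swap m x) $ i $ m)"
        by (subst bivector_transition(1)[OF \<tau> xm False]) (simp add: norm_mult norm_power)
      also have "\<dots> \<le> norm (x $ m) ^ 3 * B" by (intro mult_left_mono AB x(2)) simp
      finally show ?thesis by (simp add: mult.commute)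
    qed
    have row: "norm (\<tau> None x $ m $ i) \<le> B * norm (x $ m) ^ 3" for i
      using col[of i] skew[of None x m i] by simp
    show "norm (\<tau> None x $ a $ b) \<le> 3 * B * norm (x $ m) ^ 3"
    proof (cases "a = m \<or> b = m")
      case True
      have "B * norm (x $ m) ^ 3 \<le> 3 * B * norm (x $ m) ^ 3" using B0 by (intro mult_right_mono) auto
      then show ?thesis using True col[of a] row[of b] by auto
    next
      case False
      let ?N = "norm (x $ m)"
      have "x $ m * \<tau> None x $ a $ b = (x $ m) ^ 3 * \<tau> (Some m) (chart_swap m x) $ a $ b
          + x $ b * \<tau> None x $ a $ m + x $ a * \<tau> None x $ m $ b"
        using bivector_transition(2)[OF \<tau> xm, of a b] False by (simp add: algebra_simps)
      then have "norm (x $ m * \<tau> None x $ a $ b) \<le> norm ((x $ m) ^ 3 * \<tau> (Some m) (chart_swap m x) $ a $ b)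
          + norm (x $ b * \<tau> None x $ a $ m) + norm (x $ a * \<tau> None x $ m $ b)"
        by (metis norm_triangle_ineq norm_triangle_le add_right_mono order_refl)
      also have "\<dots> \<le> ?N ^ 3 * B + ?N * (B * ?N ^ 3) + ?N * (B * ?N ^ 3)"
        unfolding norm_mult norm_power
        by (intro add_mono mult_mono col row x(3) AB x(2)) (use B0 in auto)
      also have "?N ^ 3 * B \<le> ?N * (B * ?N ^ 3)"
        using mult_right_mono[OF x(1), of "B * ?N ^ 3"] B0 by (simp add: mult_ac)
      finally have "?N * norm (\<tau> None x $ a $ b) \<le> ?N * (3 * B * ?N ^ 3)"
        by (simp add: norm_mult algebra_simps)
      then show ?thesis using xm by (simp add: mult_le_cancel_left)
    qed
  qed
qed

text \<open>Each component has growth of order 3, so four values in each variable determine it.\<close>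

lemma bivector_zeroI:
  assumes \<tau>: "\<tau> \<in> bivector_fields" and grid: "\<And>x a b. (\<And>i. x $ i \<in> of_nat ` {1..4}) \<Longrightarrow> \<tau> None x $ a $ b = 0"
  shows "\<tau> = 0"
proof -
  have None: "\<tau> None x $ a $ b = 0" for x a b
    by (rule polynomial_growth_grid[OF bivector_growth[OF \<tau>]]) (use grid in \<open>simp add: eval_nat_numeral\<close>)
  have "\<tau> (Some m) y $ a $ b = 0" for m y a b
  proof (rule zero_by_line[where f = "\<lambda>y. \<tau> (Some m) y $ a $ b"])
    show "(\<lambda>t. \<tau> (Some m) (coord_update y m t) $ a $ b) holomorphic_on UNIV"
      by (rule holomorphic_at_line) (use \<tau> in \<open>simp add: bivector_fields_def\<close>)
    fix x :: "complex ^ 'a" assume x: "x $ m \<noteq> 0"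
    then have "chart_swap m x $ m \<noteq> 0" by (simp add: chart_swap_def)
    from bivector_transition(3)[OF \<tau> this None] show "\<tau> (Some m) x $ a $ b = 0"
      by (simp add: chart_swap_involution[OF x])
  qed
  then have "\<tau> k y = 0" for k y using None by (cases k) (simp_all add: vec_eq_iff)
  then show ?thesis by (simp add: fun_eq_iff)
qed

subsection \<open>Expansion in characters of the torus\<close>

definition unit_weight :: "'n \<Rightarrow> 'n \<Rightarrow> int" where
  "unit_weight a = (\<lambda>i. if i = a then 1 else 0)"

lemma laurent_monomial_unit: "laurent_monomial (unit_weight a) x = x $ a"
  by (simp add: laurent_monomial_def unit_weight_def if_distrib cong: if_cong)

lemma sum_unit_weight: "(\<Sum>i\<in>(UNIV :: 'n::finite set). unit_weight a i) = 1"
  by (simp add: unit_weight_def)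

lemma common_laurent_expansion:
  fixes f :: "'k::finite \<Rightarrow> complex ^ 'n::finite \<Rightarrow> complex" and s :: "'k \<Rightarrow> 'n \<Rightarrow> int"
  assumes f: "\<And>i. is_polynomial (f i)"
  shows "\<exists>U B. finite U \<and> (\<forall>u. u \<notin> U \<longrightarrow> B u = (\<lambda>_. 0)) \<and>
    (\<forall>x\<in>torus. \<forall>i. f i x = laurent_monomial (s i) x * (\<Sum>u\<in>U. B u i * laurent_monomial u x)) \<and>
    (\<forall>u i j. B u i \<noteq> 0 \<longrightarrow> 0 \<le> u j + s i j)"
proof -
  have "\<forall>i. \<exists>M c. finite M \<and> (\<forall>m\<in>M. \<forall>j. 0 \<le> m j) \<and> (\<forall>m. m \<notin> M \<longrightarrow> c m = 0) \<and>
     f i = (\<lambda>x. \<Sum>m\<in>M. c m * laurent_monomial m x)" using f unfolding is_polynomial_def by blast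
  from choice[OF this] obtain M where "\<forall>i. \<exists>c. finite (M i) \<and> (\<forall>m\<in>M i. \<forall>j. 0 \<le> m j) \<and> (\<forall>m. m \<notin> M i \<longrightarrow> c m = 0) \<and>
     f i = (\<lambda>x. \<Sum>m\<in>M i. c m * laurent_monomial m x)" by (rule exE)
  from choice[OF this] obtain c where Mc: "\<forall>i. finite (M i) \<and> (\<forall>m\<in>M i. \<forall>j. 0 \<le> m j) \<and> (\<forall>m. m \<notin> M i \<longrightarrow> c i m = 0) \<and>
     f i = (\<lambda>x. \<Sum>m\<in>M i. c i m * laurent_monomial m x)" by (rule exE)
  let ?sh = "\<lambda>i m j. m j - s i j"
  define U where "U = (\<Union>i. ?sh i ` M i)"
  define B where "B u i = c i (\<lambda>j. u j + s i j)" for u i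
  have out: "u \<in> ?sh i ` M i" if "B u i \<noteq> 0" for u i
  proof -
    have "(\<lambda>j. u j + s i j) \<in> M i" using that Mc unfolding B_def by blast
    then show ?thesis by (rule rev_image_eqI) simp
  qed
  have finU: "finite U" unfolding U_def using Mc by auto
  have B0: "B u = (\<lambda>_. 0)" if "u \<notin> U" for u
    using out[of u] that unfolding U_def by (auto simp: fun_eq_iff)
  have nn: "0 \<le> u j + s i j" if "B u i \<noteq> 0" for u i j
    using out[OF that] Mc by auto
  have ex: "f i x = laurent_monomial (s i) x * (\<Sum>u\<in>U. B u i * laurent_monomial u x)" if x: "x \<in> torus" for i x
  proof -
    have inj: "inj_on (?sh i) (M i)" by (rule inj_onI) (auto simp: fun_eq_iff)
    have "(\<Sum>u\<in>U. B u i * laurent_monomial u x) = (\<Sum>u\<in>?sh i ` M i. B u i * laurent_monomial u x)"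
      by (rule sum.mono_neutral_right[OF finU]) (use out in \<open>auto simp: U_def\<close>)
    also have "\<dots> = (\<Sum>m\<in>M i. c i m * laurent_monomial (?sh i m) x)"
      by (subst sum.reindex[OF inj]) (simp add: B_def)
    finally have "laurent_monomial (s i) x * (\<Sum>u\<in>U. B u i * laurent_monomial u x) =
        (\<Sum>m\<in>M i. c i m * (laurent_monomial (s i) x * laurent_monomial (?sh i m) x))"
      by (simp add: sum_distrib_left mult_ac)
    also have "\<dots> = (\<Sum>m\<in>M i. c i m * laurent_monomial m x)"
      by (simp add: laurent_monomial_add[OF x, symmetric])
    finally show ?thesis using Mc by simp
  qed
  show ?thesis using finU B0 ex nn by (intro exI[of _ U] exI[of _ B]) simp
qed

lemma laurent_growth_shift:
  fixes U :: "('n::finite \<Rightarrow> int) set"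
  assumes U: "finite U" and u: "u \<in> U" "(\<Sum>i\<in>UNIV. u i) > int d - e"
    and s: "(\<Sum>i\<in>UNIV. s i) = e"
    and F: "\<And>x. x \<in> torus \<Longrightarrow> F x = laurent_monomial s x * (\<Sum>u\<in>U. c u * laurent_monomial u x)"
    and g: "\<And>x. x \<in> torus \<Longrightarrow> \<exists>A. \<forall>t. norm t \<ge> 1 \<longrightarrow> norm (F (t *s x)) \<le> A * norm t ^ d"
  shows "c u = 0"
proof (rule laurent_growth[OF U u])
  fix x :: "complex ^ 'n" assume x: "x \<in> torus"
  obtain A where A: "\<And>t. norm t \<ge> 1 \<Longrightarrow> norm (F (t *s x)) \<le> A * norm t ^ d" using g[OF x] by blast
  let ?l = "norm (laurent_monomial s x)"
  have l: "?l > 0" using laurent_monomial_nonzero[OF x] by simp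
  have "norm (\<Sum>u\<in>U. c u * laurent_monomial u (t *s x)) \<le> A / ?l * norm t powi (int d - e)" if t: "norm t \<ge> 1" for t
  proof -
    have t0: "t \<noteq> 0" using t by auto
    have tx: "t *s x \<in> torus" using x t0 by (simp add: torus_def)
    have "norm (F (t *s x)) = norm t powi e * ?l * norm (\<Sum>u\<in>U. c u * laurent_monomial u (t *s x))"
      unfolding F[OF tx] norm_mult laurent_monomial_scale[OF t0] s by (simp add: norm_power_int)
    with A[OF t] have "norm t powi e * ?l * norm (\<Sum>u\<in>U. c u * laurent_monomial u (t *s x)) \<le> A * norm t ^ d" by simp
    then have "norm (\<Sum>u\<in>U. c u * laurent_monomial u (t *s x)) \<le> A * norm t ^ d / (norm t powi e * ?l)"
      using l t0 by (simp add: field_simps)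
    also have "\<dots> = A / ?l * norm t powi (int d - e)"
      using t0 by (simp add: power_int_diff)
    finally show ?thesis .
  qed
  then show "\<exists>A. \<forall>t. norm t \<ge> 1 \<longrightarrow>
      norm (\<Sum>u\<in>U. c u * laurent_monomial u (t *s x)) \<le> A * norm t powi (int d - e)" by blast
qed

lemma chart_swap_ray_bounded:
  fixes x :: "complex ^ 'n::finite"
  assumes "x $ m \<noteq> 0"
  shows "\<exists>R. \<forall>t. norm t \<ge> 1 \<longrightarrow> norm (chart_swap m (t *s x)) \<le> R"
proof -
  define r where "r = Max (insert (1 / norm (x $ m)) (range (\<lambda>a. norm (x $ a / x $ m))))"
  have "norm (chart_swap m (t *s x)) \<le> CARD('n) * r" if t: "norm t \<ge> 1" for t
  proof (rule norm_le_polydisc)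
    fix a
    have t0: "t \<noteq> 0" using t by auto
    have r1: "1 / norm (x $ m) \<le> r" unfolding r_def by (rule Max_ge) auto
    have r2: "norm (x $ a / x $ m) \<le> r" unfolding r_def by (rule Max_ge) auto
    have "1 / (norm t * norm (x $ m)) \<le> 1 / norm (x $ m)"
      using mult_right_mono[OF t, of "norm (x $ m)"] t0 assms by (intro divide_left_mono) auto
    then show "norm (chart_swap m (t *s x) $ a) \<le> r"
      using r1 r2 t0 by (auto simp: chart_swap_def norm_divide norm_mult)
  qed
  then show ?thesis by blast
qed

lemma unit_weight_pair_sum: "(\<Sum>i\<in>(UNIV :: 'n::finite set). unit_weight a i + unit_weight b i) = 2"
  by (simp add: sum.distrib sum_unit_weight)

text \<open>Boundedness in the affine charts bounds the exponents.  Holomorphy in the chart \<open>None\<close> bounds them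
  below.  Along rays to infinity the transition to another chart bounds the total degree, and in the top
  degree it leaves only multiples of the Euler field, which is the additive relation in the last clause.\<close>

theorem bivector_structure:
  fixes \<tau> :: "'n::finite bivector"
  assumes \<tau>: "\<tau> \<in> bivector_fields"
  shows "\<exists>U B. finite U \<and> (\<forall>u a b. u \<notin> U \<longrightarrow> B u a b = 0) \<and>
    (\<forall>x\<in>torus. \<forall>a b. \<tau> None x $ a $ b = x $ a * x $ b * (\<Sum>u\<in>U. B u a b * laurent_monomial u x)) \<and>
    (\<forall>u a b. B u b a = - B u a b) \<and>
    (\<forall>u a b i. B u a b \<noteq> 0 \<longrightarrow> 0 \<le> u i + (unit_weight a i + unit_weight b i)) \<and>
    (\<forall>u a b. B u a b \<noteq> 0 \<longrightarrow> (\<Sum>i\<in>UNIV. u i) \<le> 1) \<and>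
    (\<forall>u a b m. (\<Sum>i\<in>UNIV. u i) = 1 \<longrightarrow> B u a b = B u m b + B u a m)"
proof -
  let ?s = "\<lambda>(a, b) i. unit_weight a i + unit_weight b i"
  have "\<exists>U B. finite U \<and> (\<forall>u. u \<notin> U \<longrightarrow> B u = (\<lambda>_. 0)) \<and>
    (\<forall>x\<in>torus. \<forall>p. (case p of (a, b) \<Rightarrow> \<lambda>x. \<tau> None x $ a $ b) x = laurent_monomial (?s p) x * (\<Sum>u\<in>U. B u p * laurent_monomial u x)) \<and>
    (\<forall>u p j. B u p \<noteq> 0 \<longrightarrow> 0 \<le> u j + ?s p j)"
    by (rule common_laurent_expansion) (auto intro: liouville_several_variables[OF bivector_growth[OF \<tau>]])
  then obtain U B' where UB: "finite U" "\<forall>u. u \<notin> U \<longrightarrow> B' u = (\<lambda>_. 0)"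
    "\<forall>x\<in>torus. \<forall>p. (case p of (a, b) \<Rightarrow> \<lambda>x. \<tau> None x $ a $ b) x = laurent_monomial (?s p) x * (\<Sum>u\<in>U. B' u p * laurent_monomial u x)"
    "\<forall>u p j. B' u p \<noteq> 0 \<longrightarrow> 0 \<le> u j + ?s p j" by blast
  define B where "B u a b = B' u (a, b)" for u a b
  have out: "B u a b = 0" if "u \<notin> U" for u a b using UB(2) that by (simp add: B_def)
  have ex0: "\<tau> None x $ a $ b = laurent_monomial (?s (a, b)) x * (\<Sum>u\<in>U. B u a b * laurent_monomial u x)" if "x \<in> torus" for x a b
    using UB(3)[rule_format, OF that, of "(a, b)"] by (simp add: B_def)
  have ex: "\<tau> None x $ a $ b = x $ a * x $ b * (\<Sum>u\<in>U. B u a b * laurent_monomial u x)" if "x \<in> torus" for x a b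
    using ex0[OF that, of a b] by (simp add: laurent_monomial_add[OF that] laurent_monomial_unit)
  have nn: "0 \<le> u i + (unit_weight a i + unit_weight b i)" if "B u a b \<noteq> 0" for u a b i
    using UB(4)[rule_format, of u "(a, b)" i] that by (simp add: B_def)
  have skew\<tau>: "\<tau> k x $ j $ i = - \<tau> k x $ i $ j" for k x i j
    by (rule skew_entry) (use \<tau> in \<open>simp add: bivector_fields_def\<close>)
  have skew: "B u b a = - B u a b" for u a b
  proof (cases "u \<in> U")
    case True
    have "B u b a + B u a b = 0"
    proof (rule laurent_monomials_independent[OF UB(1) _ True, where c = "\<lambda>u. B u b a + B u a b"])
      fix x :: "complex ^ 'n" assume x: "x \<in> torus"
      have "x $ a * x $ b * (\<Sum>u\<in>U. (B u b a + B u a b) * laurent_monomial u x) =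
          \<tau> None x $ b $ a + \<tau> None x $ a $ b"
        unfolding ex[OF x] by (simp add: sum.distrib algebra_simps)
      also have "\<dots> = 0" using skew\<tau>[of None x b a] by simp
      finally have "x $ a * x $ b * (\<Sum>u\<in>U. (B u b a + B u a b) * laurent_monomial u x) = 0" .
      then show "(\<Sum>u\<in>U. (B u b a + B u a b) * laurent_monomial u x) = 0" using x by (simp add: torus_def)
    qed
    then show ?thesis by (simp add: eq_neg_iff_add_eq_0)
  qed (simp add: out)
  have deg: "(\<Sum>i\<in>UNIV. u i) \<le> 1" if B: "B u a b \<noteq> 0" for u a b
  proof (rule ccontr)
    assume "\<not> (\<Sum>i\<in>UNIV. u i) \<le> 1"
    then have "B u a b = 0"
      using B out by (intro laurent_growth_shift[OF UB(1), where d = 3 and e = 2 and s = "?s (a, b)" and c = "\<lambda>u. B u a b"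
        and F = "\<lambda>x. \<tau> None x $ a $ b"])
        (auto simp: ex0 unit_weight_pair_sum growth_along_ray[OF bivector_growth[OF \<tau>]])
    then show False using B by simp
  qed
  have top: "B u a b = B u m b + B u a m" if u1: "(\<Sum>i\<in>UNIV. u i) = 1" for u a b m
  proof (cases "a = m \<or> b = m \<or> u \<notin> U")
    case True
    have "B u m m = 0" using skew[of u m m] by simp
    then show ?thesis using True out by auto
  next
    case False
    let ?F = "\<lambda>x. x $ m * \<tau> None x $ a $ b - x $ b * \<tau> None x $ a $ m - x $ a * \<tau> None x $ m $ b"
    let ?t = "\<lambda>i. unit_weight m i + (unit_weight a i + unit_weight b i)"
    have "B u a b - B u a m - B u m b = 0"
    proof (rule laurent_growth_shift[OF UB(1), where d = 3 and e = 3 and s = ?t and c = "\<lambda>u. B u a b - B u a m - B u m b" and F = ?F])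
      show "u \<in> U" using False by simp
      show "(\<Sum>i\<in>UNIV. u i) > int 3 - 3" using u1 by simp
      show "(\<Sum>i\<in>UNIV. ?t i) = 3" by (simp add: sum.distrib sum_unit_weight)
      fix x :: "complex ^ 'n" assume x: "x \<in> torus"
      show "?F x = laurent_monomial ?t x * (\<Sum>u\<in>U. (B u a b - B u a m - B u m b) * laurent_monomial u x)"
        unfolding ex[OF x] laurent_monomial_add[OF x] laurent_monomial_unit
        by (simp add: sum_subtractf sum.distrib algebra_simps)
      have xm: "x $ m \<noteq> 0" using x by (simp add: torus_def)
      obtain R where R: "\<And>t. norm t \<ge> 1 \<Longrightarrow> norm (chart_swap m (t *s x)) \<le> R"
        using chart_swap_ray_bounded[OF xm] by blast
      have "\<exists>A. \<forall>y. norm y \<le> R \<longrightarrow> norm (\<tau> (Some m) y $ a $ b) \<le> A"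
        by (rule holomorphic_at_locally_bounded) (use \<tau> in \<open>simp add: bivector_fields_def\<close>)
      then obtain A where A: "\<And>y. norm y \<le> R \<Longrightarrow> norm (\<tau> (Some m) y $ a $ b) \<le> A" by blast
      have "norm (?F (t *s x)) \<le> norm (x $ m) ^ 3 * A * norm t ^ 3" if t: "norm t \<ge> 1" for t
      proof -
        have tm: "(t *s x) $ m \<noteq> 0" using t xm by auto
        have "norm (?F (t *s x)) = norm (((t *s x) $ m) ^ 3 * \<tau> (Some m) (chart_swap m (t *s x)) $ a $ b)"
          by (subst bivector_transition(2)[OF \<tau> tm]) (use False in auto)
        also have "\<dots> \<le> norm (((t *s x) $ m) ^ 3) * A"
          unfolding norm_mult by (intro mult_left_mono A R t) simp
        finally show ?thesis by (simp add: norm_mult norm_power power_mult_distrib mult_ac)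
      qed
      then show "\<exists>A. \<forall>t. norm t \<ge> 1 \<longrightarrow> norm (?F (t *s x)) \<le> A * norm t ^ 3" by blast
    qed
    then show ?thesis by (simp add: algebra_simps)
  qed
  show ?thesis
    by (rule exI[of _ U], rule exI[of _ B], intro conjI ballI allI impI)
       (rule UB(1), erule out, erule ex, rule skew, erule nn, erule deg, erule top)
qed

subsection \<open>Vector fields\<close>

text \<open>Vector fields that need only be separately holomorphic and locally bounded in each chart: this is what
  is available for the image of a vector field under an automorphism before it is known to be linear.\<close>

definition global_field :: "('n option \<Rightarrow> complex ^ 'n::finite \<Rightarrow> complex ^ 'n) \<Rightarrow> bool" where
  "global_field \<eta> \<longleftrightarrow> (\<forall>k x i a. (\<lambda>t. \<eta> k (coord_update x i t) $ a) holomorphic_on UNIV) \<and>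
    (\<forall>k a R. \<exists>A. \<forall>x. norm x \<le> R \<longrightarrow> norm (\<eta> k x $ a) \<le> A) \<and>
    (\<forall>m x. x $ m \<noteq> 0 \<longrightarrow> \<eta> (Some m) (chart_swap m x) =
       complex_jacobian (chart_expr id None (Some m)) x *v \<eta> None x)"

lemma global_linear_field: "global_field (linear_field X)"
  unfolding global_field_def
proof (intro conjI allI impI)
  show "(\<lambda>t. linear_field X k (coord_update x i t) $ a) holomorphic_on UNIV" for k x i a
    by (rule holomorphic_at_line[OF holomorphic_linear_field])
  show "\<exists>A. \<forall>x. norm x \<le> R \<longrightarrow> norm (linear_field X k x $ a) \<le> A" for k a R
    by (rule holomorphic_at_locally_bounded[OF holomorphic_linear_field])
  fix m and x :: "complex ^ 'a" assume x: "x $ m \<noteq> 0"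
  have "(mat 1 *v affine_lift None x) $ Some m \<noteq> 0" using x by (simp add: affine_lift_None)
  from linear_field_pushforward[OF _ this, of "mat 1" X]
  show "linear_field X (Some m) (chart_swap m x) =
       complex_jacobian (chart_expr id None (Some m)) x *v linear_field X None x"
    by (simp add: proj_linear_one chart_expr_id_Some[OF x])
qed

lemma global_field_transition:
  assumes \<eta>: "global_field \<eta>" and x: "x $ m \<noteq> 0"
  shows "\<eta> None x $ m = - ((x $ m)\<^sup>2 * \<eta> (Some m) (chart_swap m x) $ m)"
    and "a \<noteq> m \<Longrightarrow> x $ m * \<eta> None x $ a - x $ a * \<eta> None x $ m = (x $ m)\<^sup>2 * \<eta> (Some m) (chart_swap m x) $ a"
proof -
  have eq: "\<eta> (Some m) (chart_swap m x) = complex_jacobian (chart_expr id None (Some m)) x *v \<eta> None x"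
    using \<eta> x by (simp add: global_field_def)
  show "\<eta> None x $ m = - ((x $ m)\<^sup>2 * \<eta> (Some m) (chart_swap m x) $ m)"
    unfolding eq jacobian_id_Some[OF x] using x by simp
  show "x $ m * \<eta> None x $ a - x $ a * \<eta> None x $ m = (x $ m)\<^sup>2 * \<eta> (Some m) (chart_swap m x) $ a" if "a \<noteq> m"
    unfolding eq jacobian_id_Some[OF x] using x that by (simp add: mult_ac)
qed

lemma global_field_growth:
  fixes \<eta> :: "'n option \<Rightarrow> complex ^ 'n::finite \<Rightarrow> complex ^ 'n"
  assumes \<eta>: "global_field \<eta>"
  shows "polynomial_growth 2 (\<lambda>x. \<eta> None x $ a)"
proof -
  have "\<forall>k i. \<exists>A. \<forall>x. norm x \<le> CARD('n) \<longrightarrow> norm (\<eta> k x $ i) \<le> A"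
    using \<eta> unfolding global_field_def by blast
  then obtain A where A0: "\<forall>k i x. norm x \<le> CARD('n) \<longrightarrow> norm (\<eta> k x $ i) \<le> A k i" by metis
  then have A: "norm x \<le> CARD('n) \<Longrightarrow> norm (\<eta> k x $ i) \<le> A k i" for k i x by blast
  define B where "B = Max (insert 0 (range (\<lambda>(k, i). A k i)))"
  have AB: "norm (\<eta> k x $ i) \<le> B" if "norm x \<le> CARD('n)" for k i x
  proof -
    have "A k i \<in> insert 0 (range (\<lambda>(k, i). A k i))" by (auto intro: image_eqI[of _ _ "(k, i)"])
    then have "A k i \<le> B" unfolding B_def by (intro Max_ge) auto
    then show ?thesis using A[OF that, of k i] by simp
  qed
  have B0: "B \<ge> 0" unfolding B_def by simp
  show ?thesis
  proof (rule growth_from_charts[where B = "2 * B"])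
    show "(\<lambda>t. \<eta> None (coord_update x i t) $ a) holomorphic_on UNIV" for x i
      using \<eta> by (simp add: global_field_def)
    show "\<exists>A. \<forall>x. norm x \<le> R \<longrightarrow> norm (\<eta> None x $ a) \<le> A" for R
      using \<eta> by (simp add: global_field_def)
    fix m and x :: "complex ^ 'n"
    assume x: "1 \<le> norm (x $ m)" "norm (chart_swap m x) \<le> CARD('n)" "\<And>i. norm (x $ i) \<le> norm (x $ m)"
    have xm: "x $ m \<noteq> 0" using x(1) by auto
    let ?N = "norm (x $ m)"
    have main: "norm (\<eta> None x $ m) \<le> ?N\<^sup>2 * B"
      by (subst global_field_transition(1)[OF \<eta> xm])
         (simp add: norm_mult norm_power mult_left_mono AB x(2))
    show "norm (\<eta> None x $ a) \<le> 2 * B * ?N\<^sup>2"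
    proof (cases "a = m")
      case True
      have "?N\<^sup>2 * B \<le> 2 * B * ?N\<^sup>2" using B0 by simp
      from order_trans[OF main this] show ?thesis unfolding True .
    next
      case False
      have "x $ m * \<eta> None x $ a = (x $ m)\<^sup>2 * \<eta> (Some m) (chart_swap m x) $ a + x $ a * \<eta> None x $ m"
        using global_field_transition(2)[OF \<eta> xm False] by (simp add: algebra_simps)
      then have "norm (x $ m * \<eta> None x $ a) \<le> norm ((x $ m)\<^sup>2 * \<eta> (Some m) (chart_swap m x) $ a) + norm (x $ a * \<eta> None x $ m)"
        by (simp add: norm_triangle_ineq)
      also have "\<dots> \<le> ?N\<^sup>2 * B + ?N * (?N\<^sup>2 * B)"
        unfolding norm_mult norm_power
        by (intro add_mono mult_mono main x(3) AB x(2)) (use B0 in auto)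
      also have "\<dots> \<le> ?N * (?N\<^sup>2 * B) + ?N * (?N\<^sup>2 * B)"
        by (rule add_right_mono) (use mult_right_mono[OF x(1), of "?N\<^sup>2 * B"] B0 in \<open>simp only: mult_1 mult_nonneg_nonneg zero_le_power2\<close>)
      finally have "?N * norm (\<eta> None x $ a) \<le> ?N * (2 * B * ?N\<^sup>2)"
        by (simp add: norm_mult algebra_simps)
      then show ?thesis using xm by (simp add: mult_le_cancel_left)
    qed
  qed
qed

lemma global_field_eqI:
  fixes \<eta> \<theta> :: "'n option \<Rightarrow> complex ^ 'n::finite \<Rightarrow> complex ^ 'n"
  assumes \<eta>: "global_field \<eta>" and \<theta>: "global_field \<theta>" and eq: "\<And>x. x \<in> torus \<Longrightarrow> \<eta> None x = \<theta> None x"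
  shows "\<eta> = \<theta>"
proof -
  have None: "\<eta> None x = \<theta> None x" for x
  proof -
    have "\<eta> None x $ a - \<theta> None x $ a = 0" for a
    proof (rule polynomial_growth_grid[where f = "\<lambda>x. \<eta> None x $ a - \<theta> None x $ a" and d = 2])
      obtain A where A: "\<And>x. norm (\<eta> None x $ a) \<le> A * (1 + norm x) ^ 2"
        using global_field_growth[OF \<eta>] unfolding polynomial_growth_def by blast
      obtain B where B: "\<And>x. norm (\<theta> None x $ a) \<le> B * (1 + norm x) ^ 2"
        using global_field_growth[OF \<theta>] unfolding polynomial_growth_def by blast
      have "norm (\<eta> None x $ a - \<theta> None x $ a) \<le> (A + B) * (1 + norm x) ^ 2" for x
        using norm_triangle_ineq4[of "\<eta> None x $ a" "\<theta> None x $ a"] A[of x] B[of x] by (simp add: algebra_simps)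
      moreover have "(\<lambda>t. \<eta> None (coord_update x i t) $ a - \<theta> None (coord_update x i t) $ a) holomorphic_on UNIV" for x i
        using \<eta> \<theta> by (intro holomorphic_on_diff) (auto simp: global_field_def)
      ultimately show "polynomial_growth 2 (\<lambda>x. \<eta> None x $ a - \<theta> None x $ a)"
        unfolding polynomial_growth_def by blast
      fix x :: "complex ^ 'n" assume x: "\<And>i. x $ i \<in> of_nat ` {1..Suc 2}"
      have "x $ i \<noteq> 0" for i using x[of i] by auto
      then show "\<eta> None x $ a - \<theta> None x $ a = 0" using eq by (simp add: torus_def)
    qed
    then show ?thesis by (simp add: vec_eq_iff)
  qed
  have "\<eta> (Some m) y $ a - \<theta> (Some m) y $ a = 0" for m y a
  proof (rule zero_by_line[where f = "\<lambda>y. \<eta> (Some m) y $ a - \<theta> (Some m) y $ a"])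
    show "(\<lambda>t. \<eta> (Some m) (coord_update y m t) $ a - \<theta> (Some m) (coord_update y m t) $ a) holomorphic_on UNIV"
      using \<eta> \<theta> by (intro holomorphic_on_diff) (auto simp: global_field_def)
    fix x :: "complex ^ 'n" assume x: "x $ m \<noteq> 0"
    then have x': "chart_swap m x $ m \<noteq> 0" by (simp add: chart_swap_def)
    have "\<eta> (Some m) x = \<theta> (Some m) x"
      using \<eta> \<theta> x' None chart_swap_involution[OF x] unfolding global_field_def by metis
    then show "\<eta> (Some m) x $ a - \<theta> (Some m) x $ a = 0" by simp
  qed
  then have "\<eta> k y = \<theta> k y" for k y using None by (cases k) (simp_all add: vec_eq_iff)
  then show ?thesis by (simp add: fun_eq_iff)
qed

text \<open>The weights of the homogeneous coordinates, normalized by the index \<open>None\<close>.\<close>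

definition coord_weight :: "'n option \<Rightarrow> 'n \<Rightarrow> int" where
  "coord_weight c = (case c of None \<Rightarrow> (\<lambda>_. 0) | Some i \<Rightarrow> unit_weight i)"

lemma laurent_monomial_coord_weight: "laurent_monomial (coord_weight c) x = affine_lift None x $ c"
  by (cases c) (simp_all add: coord_weight_def laurent_monomial_unit affine_lift_None affine_lift_None_None,
     simp add: laurent_monomial_def)

lemma coord_weight_inj: "coord_weight c = coord_weight d \<Longrightarrow> c = d"
proof -
  assume eq: "coord_weight c = coord_weight d"
  have "coord_weight c i = (if c = Some i then 1 else 0)" for c and i :: 'a
    by (cases c) (auto simp: coord_weight_def unit_weight_def)
  then have iff: "c = Some i \<longleftrightarrow> d = Some i" for i
    using fun_cong[OF eq, of i] by (simp split: if_splits)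
  show "c = d" by (metis iff not_None_eq)
qed

lemma sum_coord_weight: "(\<Sum>i\<in>(UNIV :: 'n::finite set). coord_weight c i) = (if c = None then 0 else 1)"
  by (cases c) (simp_all add: coord_weight_def sum_unit_weight)

lemma sum_option: "(\<Sum>c\<in>UNIV. f c) = f None + (\<Sum>i\<in>(UNIV :: 'n::finite set). f (Some i) :: complex)"
  by (simp add: UNIV_option_conv sum.reindex)

text \<open>As for bivector fields, the charts leave as possible weights only those of the induced fields of
  elementary matrices; a suitable matrix is then read off from the coefficients.\<close>

theorem global_field_linear:
  fixes \<eta> :: "'n option \<Rightarrow> complex ^ 'n::finite \<Rightarrow> complex ^ 'n"
  assumes \<eta>: "global_field \<eta>" and n: "CARD('n) \<ge> 2"
  shows "\<exists>Y. \<eta> = linear_field Y"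
proof -
  have "\<exists>U B. finite U \<and> (\<forall>u. u \<notin> U \<longrightarrow> B u = (\<lambda>_. 0)) \<and>
    (\<forall>x\<in>torus. \<forall>a. \<eta> None x $ a = laurent_monomial (unit_weight a) x * (\<Sum>u\<in>U. B u a * laurent_monomial u x)) \<and>
    (\<forall>u a j. B u a \<noteq> 0 \<longrightarrow> 0 \<le> u j + unit_weight a j)"
    by (rule common_laurent_expansion[where f = "\<lambda>a x. \<eta> None x $ a" and s = unit_weight])
       (auto intro: liouville_several_variables[OF global_field_growth[OF \<eta>]])
  then obtain U B where UB: "finite U" "\<forall>u. u \<notin> U \<longrightarrow> B u = (\<lambda>_. 0)"
    "\<forall>x\<in>torus. \<forall>a. \<eta> None x $ a = laurent_monomial (unit_weight a) x * (\<Sum>u\<in>U. B u a * laurent_monomial u x)"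
    "\<forall>u a j. B u a \<noteq> 0 \<longrightarrow> 0 \<le> u j + unit_weight a j" by blast
  have ex: "\<eta> None x $ a = x $ a * (\<Sum>u\<in>U. B u a * laurent_monomial u x)" if "x \<in> torus" for x a
    using UB(3) that by (simp add: laurent_monomial_unit)
  have deg: "(\<Sum>i\<in>UNIV. u i) \<le> 1" if B: "B u a \<noteq> 0" for u a
  proof (rule ccontr)
    assume "\<not> (\<Sum>i\<in>UNIV. u i) \<le> 1"
    then have "B u a = 0"
      using B UB(2) by (intro laurent_growth_shift[OF UB(1), where d = 2 and e = 1 and s = "unit_weight a" and c = "\<lambda>u. B u a"
        and F = "\<lambda>x. \<eta> None x $ a"])
        (auto simp: UB(3) sum_unit_weight growth_along_ray[OF global_field_growth[OF \<eta>]])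
    then show False using B by simp
  qed
  have top: "B u a = B u m" if u1: "(\<Sum>i\<in>UNIV. u i) = 1" for u a m
  proof (cases "a = m \<or> u \<notin> U")
    case True
    then show ?thesis using UB(2) by auto
  next
    case False
    let ?F = "\<lambda>x. x $ m * \<eta> None x $ a - x $ a * \<eta> None x $ m"
    let ?t = "\<lambda>i. unit_weight m i + unit_weight a i"
    have "B u a - B u m = 0"
    proof (rule laurent_growth_shift[OF UB(1), where d = 2 and e = 2 and s = ?t and c = "\<lambda>u. B u a - B u m" and F = ?F])
      show "u \<in> U" using False by simp
      show "(\<Sum>i\<in>UNIV. u i) > int 2 - 2" using u1 by simp
      show "(\<Sum>i\<in>UNIV. ?t i) = 2" by (rule unit_weight_pair_sum)
      fix x :: "complex ^ 'n" assume x: "x \<in> torus"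
      show "?F x = laurent_monomial ?t x * (\<Sum>u\<in>U. (B u a - B u m) * laurent_monomial u x)"
        unfolding ex[OF x] laurent_monomial_add[OF x] laurent_monomial_unit
        by (simp add: sum_subtractf sum.distrib algebra_simps)
      have xm: "x $ m \<noteq> 0" using x by (simp add: torus_def)
      obtain R where R: "\<And>t. norm t \<ge> 1 \<Longrightarrow> norm (chart_swap m (t *s x)) \<le> R"
        using chart_swap_ray_bounded[OF xm] by blast
      have "\<exists>A. \<forall>y. norm y \<le> R \<longrightarrow> norm (\<eta> (Some m) y $ a) \<le> A"
        using \<eta> unfolding global_field_def by blast
      then obtain A where A: "\<And>y. norm y \<le> R \<Longrightarrow> norm (\<eta> (Some m) y $ a) \<le> A" by blast
      have "norm (?F (t *s x)) \<le> norm (x $ m) ^ 2 * A * norm t ^ 2" if t: "norm t \<ge> 1" for t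
      proof -
        have tm: "(t *s x) $ m \<noteq> 0" using t xm by auto
        have "norm (?F (t *s x)) = norm (((t *s x) $ m)\<^sup>2 * \<eta> (Some m) (chart_swap m (t *s x)) $ a)"
          by (subst global_field_transition(2)[OF \<eta> tm]) (use False in auto)
        also have "\<dots> \<le> norm (((t *s x) $ m)\<^sup>2) * A"
          unfolding norm_mult by (intro mult_left_mono A R t) simp
        finally show ?thesis by (simp add: norm_mult norm_power power_mult_distrib mult_ac)
      qed
      then show "\<exists>A. \<forall>t. norm t \<ge> 1 \<longrightarrow> norm (?F (t *s x)) \<le> A * norm t ^ 2" by blast
    qed
    then show ?thesis by simp
  qed
  let ?w = "\<lambda>a c i. coord_weight c i - unit_weight a i"
  have supp: "u \<in> range (?w a) \<union> range unit_weight" if B: "B u a \<noteq> 0" for u a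
  proof -
    have nn: "0 \<le> u j + unit_weight a j" for j using UB(4) B by blast
    show ?thesis
    proof (cases "(\<Sum>i\<in>UNIV. u i) = 1")
      case True
      have pos: "0 \<le> u j" for j
      proof -
        obtain b where b: "b \<noteq> j"
        proof -
          have "\<not> UNIV \<subseteq> {j}" using n card_mono[of "{j}" UNIV] by fastforce
          then show ?thesis using that by blast
        qed
        have "B u b \<noteq> 0" using top[OF True, of a b] B by simp
        then have "0 \<le> u j + unit_weight b j" using UB(4) by blast
        then show ?thesis using b by (simp add: unit_weight_def)
      qed
      obtain c where c: "u c \<noteq> 0" using True by force
      have "u = unit_weight c"
      proof
        fix i
        have s: "(\<Sum>i\<in>UNIV. u i) = u c + (\<Sum>i\<in>UNIV - {c}. u i)" by (rule sum.remove) auto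
        have nnr: "0 \<le> (\<Sum>i\<in>UNIV - {c}. u i)" by (rule sum_nonneg) (rule pos)
        have uc: "u c = 1" "(\<Sum>i\<in>UNIV - {c}. u i) = 0" using s nnr pos[of c] c True by linarith+
        have "u i = 0" if "i \<noteq> c"
          using sum_nonneg_eq_0_iff[of "UNIV - {c}" u] uc(2) pos that by auto
        then show "u i = unit_weight c i" using uc by (auto simp: unit_weight_def)
      qed
      then show ?thesis by blast
    next
      case False
      then have le: "(\<Sum>i\<in>UNIV. u i) \<le> 0" using deg[OF B] by simp
      define q where "q i = u i + unit_weight a i" for i
      have q: "0 \<le> q i" for i unfolding q_def by (rule nn)
      have qs: "(\<Sum>i\<in>UNIV. q i) \<le> 1" unfolding q_def using le by (simp add: sum.distrib sum_unit_weight)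
      have "\<exists>c. q = coord_weight c"
      proof (cases "\<forall>i. q i = 0")
        case True
        then show ?thesis by (intro exI[of _ None]) (auto simp: coord_weight_def)
      next
        case False
        then obtain c where c: "q c \<noteq> 0" by blast
        have s: "(\<Sum>i\<in>UNIV. q i) = q c + (\<Sum>i\<in>UNIV - {c}. q i)" by (rule sum.remove) auto
        have nnr: "0 \<le> (\<Sum>i\<in>UNIV - {c}. q i)" by (rule sum_nonneg) (rule q)
        have qc: "q c = 1" "(\<Sum>i\<in>UNIV - {c}. q i) = 0" using s nnr q[of c] c qs by linarith+
        have "q i = 0" if "i \<noteq> c" for i
          using sum_nonneg_eq_0_iff[of "UNIV - {c}" q] qc(2) q that by auto
        then show ?thesis using qc by (intro exI[of _ "Some c"]) (auto simp: coord_weight_def unit_weight_def)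
      qed
      then obtain c where "q = coord_weight c" by blast
      then have "u = ?w a c" unfolding q_def by (auto simp: fun_eq_iff) (metis add_diff_cancel_right')
      then show ?thesis by blast
    qed
  qed
  obtain a0 :: 'n where True by simp
  define Y :: "complex ^ 'n option ^ 'n option" where
    "Y = (\<chi> r c. case r of None \<Rightarrow> (case c of None \<Rightarrow> 0 | Some j \<Rightarrow> - B (unit_weight j) a0) | Some a \<Rightarrow> B (?w a c) a)"
  have "\<eta> None x = linear_field Y None x" if x: "x \<in> torus" for x
  proof (rule vec_eq_iff[THEN iffD2], rule allI)
    fix a
    let ?z = "affine_lift None x"
    let ?f = "\<lambda>u. B u a * laurent_monomial u x"
    have disj: "range (?w a) \<inter> range unit_weight = {}"
    proof -
      have ne: "(\<Sum>i\<in>UNIV. ?w a c i) \<noteq> (\<Sum>i\<in>UNIV. unit_weight j i)" for c and j :: 'n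
        by (simp add: sum_subtractf sum_coord_weight sum_unit_weight)
      have "?w a c \<noteq> unit_weight j" for c and j :: 'n
        using ne[of c j] by (metis (mono_tags))
      then show ?thesis by blast
    qed
    have inj1: "inj (?w a)"
      by (rule injI, rule coord_weight_inj) (auto simp: fun_eq_iff)
    have inj2: "inj (unit_weight :: 'n \<Rightarrow> 'n \<Rightarrow> int)"
      by (rule injI) (auto simp: unit_weight_def fun_eq_iff split: if_splits)
    have "(\<Sum>u\<in>U. ?f u) = (\<Sum>u\<in>U \<union> (range (?w a) \<union> range unit_weight). ?f u)"
      by (rule sum.mono_neutral_left) (simp_all add: UB(1,2))
    also have "\<dots> = (\<Sum>u\<in>range (?w a) \<union> range unit_weight. ?f u)"
    proof (rule sum.mono_neutral_right)
      show "\<forall>u\<in>U \<union> (range (?w a) \<union> range unit_weight) - (range (?w a) \<union> range unit_weight). ?f u = 0"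
        using supp by fastforce
    qed (simp_all add: UB(1))
    also have "\<dots> = (\<Sum>u\<in>range (?w a). ?f u) + (\<Sum>u\<in>range unit_weight. ?f u)"
      by (rule sum.union_disjoint) (use disj in auto)
    also have "\<dots> = (\<Sum>c\<in>UNIV. ?f (?w a c)) + (\<Sum>j\<in>UNIV. ?f (unit_weight j))"
      by (simp only: sum.reindex[OF inj1] sum.reindex[OF inj2] o_def)
    finally have "\<eta> None x $ a = (\<Sum>c\<in>UNIV. B (?w a c) a * (x $ a * laurent_monomial (?w a c) x)) +
        x $ a * (\<Sum>j\<in>UNIV. B (unit_weight j) a * x $ j)"
      unfolding ex[OF x] by (simp add: algebra_simps sum_distrib_left laurent_monomial_unit)
    also have "(\<lambda>c. x $ a * laurent_monomial (?w a c) x) = (\<lambda>c. ?z $ c)"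
      using laurent_monomial_add[OF x, of "unit_weight a" "?w a c" for c, symmetric]
      by (simp add: laurent_monomial_unit laurent_monomial_coord_weight fun_eq_iff)
    also have "(\<Sum>c\<in>UNIV. B (?w a c) a * ?z $ c) = (Y *v ?z) $ Some a"
      by (simp add: matrix_vector_mult_def Y_def)
    also have "(\<Sum>j\<in>UNIV. B (unit_weight j) a * x $ j) = - (Y *v ?z) $ None"
      using top[OF sum_unit_weight, of _ a a0]
      by (simp add: matrix_vector_mult_def Y_def sum_option affine_lift_None sum_negf)
    finally show "\<eta> None x $ a = linear_field Y None x $ a"
      by (simp add: linear_field_def)
  qed
  then have "\<eta> = linear_field Y" by (rule global_field_eqI[OF \<eta> global_linear_field])
  then show ?thesis by blast
qed

section \<open>Vector fields under holomorphic automorphisms\<close>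

lemma vec_has_derivative:
  fixes F :: "'v::real_normed_vector \<Rightarrow> complex ^ 'm::finite"
  assumes "\<And>a. ((\<lambda>x. F x $ a) has_derivative D a) (at x)"
  shows "(F has_derivative (\<lambda>v. \<chi> a. D a v)) (at x)"
proof -
  have bl: "bounded_linear (\<lambda>c::complex. axis a c :: complex ^ 'm)" for a
    unfolding linear_conv_bounded_linear[symmetric]
    by (rule linearI) (auto simp: axis_def vec_eq_iff)
  have sum_axis: "(\<Sum>a\<in>UNIV. axis a (w a)) = (\<chi> a. w a)" for w :: "'m \<Rightarrow> complex"
    by (simp add: vec_eq_iff axis_def if_distribR cong: if_cong)
  have "((\<lambda>x. \<Sum>a\<in>UNIV. axis a (F x $ a)) has_derivative (\<lambda>v. \<Sum>a\<in>UNIV. axis a (D a v))) (at x)"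
    by (intro has_derivative_sum bounded_linear.has_derivative[OF bl] assms)
  then show ?thesis unfolding sum_axis by (simp add: vec_lambda_eta)
qed

lemma jacobian_has_derivative:
  assumes "\<And>a. holomorphic_at (\<lambda>y. F y $ a) x"
  shows "(F has_derivative (\<lambda>v. complex_jacobian F x *v v)) (at x)"
proof -
  have "(F has_derivative (\<lambda>v. \<chi> a. \<Sum>i\<in>UNIV. partial_deriv i (\<lambda>y. F y $ a) x * v $ i)) (at x)"
    by (rule vec_has_derivative) (rule holomorphic_at_derivative[OF assms])
  then show ?thesis by (simp add: complex_jacobian_def matrix_vector_mult_def)
qed

lemma complex_linear_matrix: "complex_linear (\<lambda>v. (M *v v) $ a)"
  by (simp add: complex_linear_def matrix_vector_right_distrib matrix_vector_scale)

lemma holomorphic_at_compose: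
  fixes F :: "complex ^ 'n::finite \<Rightarrow> complex ^ 'n"
  assumes F: "\<And>a. holomorphic_at (\<lambda>y. F y $ a) x" and G: "holomorphic_at G (F x)"
  shows "holomorphic_at (\<lambda>y. G (F y)) x"
proof -
  obtain D where D: "complex_linear D" "(G has_derivative D) (at (F x))" using G holomorphic_at_iff by blast
  have "((\<lambda>y. G (F y)) has_derivative (\<lambda>v. D (complex_jacobian F x *v v))) (at x)"
    by (rule has_derivative_compose[OF jacobian_has_derivative[OF F] D(2)])
  moreover have "complex_linear (\<lambda>v. D (complex_jacobian F x *v v))"
    using D(1) by (simp add: complex_linear_def matrix_vector_right_distrib matrix_vector_scale)
  ultimately show ?thesis by (rule holomorphic_atI)
qed

lemma jacobian_chain:
  assumes F: "\<And>a. holomorphic_at (\<lambda>y. F y $ a) x" and G: "\<And>a. holomorphic_at (\<lambda>y. G y $ a) (F x)"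
    and S: "open S" "x \<in> S" "\<And>y. y \<in> S \<Longrightarrow> G (F y) = H y"
  shows "complex_jacobian H x *v v = complex_jacobian G (F x) *v (complex_jacobian F x *v v)"
proof (rule vec_eq_iff[THEN iffD2], rule allI)
  fix a
  have "((\<lambda>y. G (F y)) has_derivative (\<lambda>v. complex_jacobian G (F x) *v (complex_jacobian F x *v v))) (at x)"
    by (rule has_derivative_compose[OF jacobian_has_derivative[OF F] jacobian_has_derivative[OF G]])
  then have "(H has_derivative (\<lambda>v. complex_jacobian G (F x) *v (complex_jacobian F x *v v))) (at x)"
    by (rule has_derivative_transform_within_open[OF _ S])
  then have D: "((\<lambda>y. H y $ a) has_derivative (\<lambda>v. (complex_jacobian G (F x) *v (complex_jacobian F x *v v)) $ a)) (at x)" for a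
    by (rule bounded_linear.has_derivative[OF bounded_linear_vec_nth])
  show "(complex_jacobian H x *v v) $ a = (complex_jacobian G (F x) *v (complex_jacobian F x *v v)) $ a"
    by (rule complex_jacobian_mult[OF D]) (simp add: matrix_vector_mul_assoc complex_linear_matrix)
qed

subsection \<open>Derivatives of holomorphic functions of several variables\<close>

text \<open>A derivative that depends on a parameter is a uniform limit of difference quotients, which are
  holomorphic in the parameter; the Cauchy estimate makes the limit uniform.\<close>

lemma deriv_parameter_holomorphic:
  fixes G :: "complex \<Rightarrow> complex \<Rightarrow> complex"
  assumes r: "r > 0" and S: "open S"
    and t: "\<And>s. s \<in> S \<Longrightarrow> (\<lambda>t. G t s) holomorphic_on ball 0 r"
    and s: "\<And>t. norm t < r \<Longrightarrow> G t holomorphic_on S"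
    and M: "\<And>t s. norm t < r \<Longrightarrow> s \<in> S \<Longrightarrow> norm (G t s) \<le> M"
  shows "(\<lambda>s. deriv (\<lambda>t. G t s) 0) holomorphic_on S"
proof -
  define q where "q = r / 4"
  have q: "q > 0" "2 * q < r" using r by (auto simp: q_def)
  have taylor: "norm (G z s - (G 0 s + deriv (\<lambda>t. G t s) 0 * z)) \<le> 2 * M / q\<^sup>2 * norm z ^ 2"
    if "s \<in> S" "norm z \<le> q" for z s
  proof -
    let ?g = "\<lambda>t. G t s"
    have hol: "?g holomorphic_on ball 0 r" by (rule t[OF that(1)])
    have sub: "cball 0 q \<subseteq> ball 0 r" using q by auto
    have "norm ((deriv ^^ 0) ?g z - (\<Sum>i\<le>1. (deriv ^^ i) ?g 0 * (z - 0) ^ i / fact i)) \<le>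
      2 * M / q\<^sup>2 * norm (z - 0) ^ Suc 1 / fact 1"
    proof (rule field_Taylor[of "cball 0 q"])
      fix i x assume "x \<in> cball (0::complex) q"
      then show "((deriv ^^ i) ?g has_field_derivative (deriv ^^ Suc i) ?g x) (at x within cball 0 q)"
        using has_field_derivative_higher_deriv[OF hol open_ball, of x i] sub has_field_derivative_at_within by blast
    next
      fix x :: complex assume x: "x \<in> cball 0 q"
      have sub': "cball x q \<subseteq> ball 0 r"
      proof
        fix y assume "y \<in> cball x q"
        then have "norm (y - x) \<le> q" by (simp add: dist_norm norm_minus_commute)
        then have "norm y \<le> norm x + q" using norm_triangle_sub[of y x] by linarith
        then show "y \<in> ball 0 r" using x q by simp
      qed
      have "norm ((deriv ^^ 2) ?g x) \<le> fact 2 * M / q ^ 2"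
      proof (rule Cauchy_inequality[OF _ _ q(1)])
        show "?g holomorphic_on ball x q" by (rule holomorphic_on_subset[OF hol]) (use sub' in auto)
        show "continuous_on (cball x q) ?g"
          by (rule continuous_on_subset[OF holomorphic_on_imp_continuous_on[OF hol] sub'])
        fix y assume "norm (x - y) = q"
        then have "y \<in> cball x q" by (simp add: dist_norm)
        then have "norm y < r" using sub' by auto
        then show "norm (?g y) \<le> M" by (rule M[OF _ that(1)])
      qed
      then show "norm ((deriv ^^ Suc 1) ?g x) \<le> 2 * M / q\<^sup>2" by (simp add: numeral_2_eq_2)
    qed (use that q in auto)
    then show ?thesis by (simp add: power2_eq_square)
  qed
  obtain N :: nat where N: "N > 0" "1 / N < q" using q(1) using ex_inverse_of_nat_less[OF q(1)] by (auto simp: inverse_eq_divide)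
  define h where "h n = (1 :: complex) / of_nat (n + N)" for n
  have h: "h n \<noteq> 0" "norm (h n) \<le> q" for n
  proof -
    show "h n \<noteq> 0" unfolding h_def using N(1) of_nat_eq_0_iff[of "n + N", where 'a = complex] by (simp del: of_nat_add of_nat_eq_0_iff)
    have "norm (h n) = 1 / real (n + N)" by (simp add: h_def norm_divide del: of_nat_add)
    also have "\<dots> \<le> 1 / real N" using N(1) by (intro divide_left_mono) auto
    finally show "norm (h n) \<le> q" using N(2) by simp
  qed
  have hlim: "(\<lambda>n. 2 * M / q\<^sup>2 * norm (h n)) \<longlonglongrightarrow> 0"
  proof -
    have "(\<lambda>n. 1 / real (n + N)) \<longlonglongrightarrow> 0" using LIMSEQ_ignore_initial_segment[OF lim_inverse_n', of N] by (simp add: inverse_eq_divide)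
    moreover have "norm (h n) = 1 / real (n + N)" for n by (simp add: h_def norm_divide del: of_nat_add)
    ultimately have "(\<lambda>n. norm (h n)) \<longlonglongrightarrow> 0" by simp
    then show ?thesis using tendsto_mult_left[of "\<lambda>n. norm (h n)" 0 sequentially "2 * M / q\<^sup>2"] by simp
  qed
  show ?thesis
  proof (rule holomorphic_uniform_sequence[OF S, where f = "\<lambda>n s. (G (h n) s - G 0 s) / h n"])
    show "(\<lambda>s. (G (h n) s - G 0 s) / h n) holomorphic_on S" for n
    proof -
      have "norm (h n) < r" "norm (0::complex) < r" using h(2)[of n] q r by auto
      then have "G (h n) holomorphic_on S" "G 0 holomorphic_on S" by (auto intro: s)
      then show ?thesis by (intro holomorphic_intros h(1))
    qed
    fix x assume "x \<in> S"
    then obtain d where d: "d > 0" "cball x d \<subseteq> S" using S open_contains_cball by blast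
    have "uniform_limit (cball x d) (\<lambda>n s. (G (h n) s - G 0 s) / h n) (\<lambda>s. deriv (\<lambda>t. G t s) 0) sequentially"
    proof (rule uniform_limitI)
      fix e :: real assume "e > 0"
      then have "\<forall>\<^sub>F n in sequentially. 2 * M / q\<^sup>2 * norm (h n) < e" using hlim by (rule order_tendstoD(2)[rotated])
      then show "\<forall>\<^sub>F n in sequentially. \<forall>s\<in>cball x d. dist ((G (h n) s - G 0 s) / h n) (deriv (\<lambda>t. G t s) 0) < e"
      proof (rule eventually_mono, intro ballI)
        fix n s assume n: "2 * M / q\<^sup>2 * norm (h n) < e" and "s \<in> cball x d"
        then have s: "s \<in> S" using d by blast
        have "(G (h n) s - G 0 s) / h n - deriv (\<lambda>t. G t s) 0 = (G (h n) s - (G 0 s + deriv (\<lambda>t. G t s) 0 * h n)) / h n"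
          using h(1)[of n] by (simp add: field_simps)
        then have "dist ((G (h n) s - G 0 s) / h n) (deriv (\<lambda>t. G t s) 0) =
            norm (G (h n) s - (G 0 s + deriv (\<lambda>t. G t s) 0 * h n)) / norm (h n)"
          by (simp add: dist_norm norm_divide)
        also have "\<dots> \<le> (2 * M / q\<^sup>2 * norm (h n) ^ 2) / norm (h n)"
          by (intro divide_right_mono taylor[OF s h(2)]) simp
        also have "\<dots> = 2 * M / q\<^sup>2 * norm (h n)" using h(1)[of n] by (simp add: power2_eq_square)
        finally show "dist ((G (h n) s - G 0 s) / h n) (deriv (\<lambda>t. G t s) 0) < e" using n by simp
      qed
    qed
    then show "\<exists>d>0. cball x d \<subseteq> S \<and> uniform_limit (cball x d) (\<lambda>n s. (G (h n) s - G 0 s) / h n) (\<lambda>s. deriv (\<lambda>t. G t s) 0) sequentially"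
      using d by blast
  qed
qed

lemma holomorphic_on_line:
  assumes "\<And>s. s \<in> S \<Longrightarrow> holomorphic_at f (coord_update y i s)"
  shows "(\<lambda>s. f (coord_update y i s)) holomorphic_on S"
  unfolding coord_update_line holomorphic_on_def field_differentiable_def
proof
  fix s assume "s \<in> S"
  then obtain D where "complex_linear D" "(f has_derivative D) (at ((y - y $ i *s axis i 1) + s *s axis i 1))"
    using assms holomorphic_at_iff unfolding coord_update_line by blast
  from has_field_derivative_line[OF this(2,1)]
  show "\<exists>f'. ((\<lambda>t. f (y - y $ i *s axis i 1 + t *s axis i 1)) has_field_derivative f') (at s within S)"
    using has_field_derivative_at_within by blast
qed

lemma norm_axis_scale: "norm (t *s axis i 1 :: complex ^ 'n::finite) = norm t"
proof -
  have "t *s axis i 1 = (axis i t :: complex ^ 'n)" by (auto simp: vec_eq_iff axis_def)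
  then show ?thesis by (simp add: norm_axis)
qed

text \<open>Complex differentiability at the points of an open set says nothing directly about the partial
  derivatives, whose holomorphy in each variable separately comes from the one-variable Cauchy theory.\<close>

lemma partial_deriv_local:
  fixes F :: "complex ^ 'n::finite \<Rightarrow> complex" and e :: "complex ^ 'n \<Rightarrow> complex ^ 'n"
  assumes \<Omega>: "open \<Omega>" "\<And>x. x \<in> \<Omega> \<Longrightarrow> holomorphic_at F x"
    and W: "open W" "\<And>y a. y \<in> W \<Longrightarrow> holomorphic_at (\<lambda>y. e y $ a) y" "\<And>y. y \<in> W \<Longrightarrow> e y \<in> \<Omega>"
    and y0: "y0 \<in> W"
  shows "\<exists>\<delta>>0. \<exists>M. ball y0 \<delta> \<subseteq> W \<and> (\<forall>y\<in>ball y0 \<delta>. norm (partial_deriv i F (e y)) \<le> M) \<and>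
    (\<forall>y1 j S. open S \<and> (\<forall>s\<in>S. coord_update y1 j s \<in> ball y0 \<delta>) \<longrightarrow>
       (\<lambda>s. partial_deriv i F (e (coord_update y1 j s))) holomorphic_on S)"
proof -
  obtain R where R: "R > 0" "cball (e y0) R \<subseteq> \<Omega>" using \<Omega>(1) W(3)[OF y0] open_contains_cball by blast
  define r where "r = R / 2"
  have r: "r > 0" "cball (e y0) (2 * r) \<subseteq> \<Omega>" using R by (auto simp: r_def)
  have "continuous_on (cball (e y0) (2 * r)) F"
  proof (rule continuous_at_imp_continuous_on, rule ballI)
    fix x assume "x \<in> cball (e y0) (2 * r)"
    then have "holomorphic_at F x" using r \<Omega> by blast
    then show "isCont F x" unfolding holomorphic_at_iff using has_derivative_continuous by blast
  qed
  then have "bounded (F ` cball (e y0) (2 * r))" by (intro compact_imp_bounded compact_continuous_image) auto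
  then obtain M where "\<forall>z\<in>F ` cball (e y0) (2 * r). norm z \<le> M" unfolding bounded_iff by blast
  then have M: "norm (F x) \<le> M" if "x \<in> cball (e y0) (2 * r)" for x using that by blast
  have "isCont e y0" by (rule has_derivative_continuous[OF jacobian_has_derivative[OF W(2)[OF y0]]])
  then obtain d where d: "d > 0" "\<And>y. dist y y0 < d \<Longrightarrow> dist (e y) (e y0) < r"
    unfolding continuous_at_eps_delta using r(1) by blast
  obtain d' where d': "d' > 0" "ball y0 d' \<subseteq> W" using W(1) y0 open_contains_ball by blast
  define \<delta> where "\<delta> = min d d'"
  have near: "e y + t *s axis i 1 \<in> cball (e y0) (2 * r)" if "y \<in> ball y0 \<delta>" "norm t < r" for y t
  proof -
    have "dist (e y) (e y0) < r" using that(1) d(2)[of y] by (simp add: \<delta>_def dist_commute)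
    moreover have "dist (e y + t *s axis i 1) (e y) < r" using that(2) by (simp add: dist_norm norm_axis_scale)
    ultimately have "dist (e y + t *s axis i 1) (e y0) < 2 * r" using dist_triangle[of "e y + t *s axis i 1" "e y0" "e y"] by linarith
    then show ?thesis by (simp add: dist_commute)
  qed
  have tline: "(\<lambda>t. F (e y + t *s axis i 1)) holomorphic_on ball 0 r" if y: "y \<in> ball y0 \<delta>" for y
    unfolding holomorphic_on_def field_differentiable_def
  proof
    fix t :: complex assume "t \<in> ball 0 r"
    then have "holomorphic_at F (e y + t *s axis i 1)" using near[OF y, of t] r(2) \<Omega>(2) by auto
    then obtain D where "complex_linear D" "(F has_derivative D) (at (e y + t *s axis i 1))"
      using holomorphic_at_iff by blast
    from has_field_derivative_line[OF this(2,1)]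
    show "\<exists>f'. ((\<lambda>t. F (e y + t *s axis i 1)) has_field_derivative f') (at t within ball 0 r)"
      using has_field_derivative_at_within by blast
  qed
  have sub: "ball y0 \<delta> \<subseteq> W" using d'(2) by (auto simp: \<delta>_def)
  have bound: "norm (partial_deriv i F (e y)) \<le> M / (r / 2)" if y: "y \<in> ball y0 \<delta>" for y
  proof -
    have "norm ((deriv ^^ 1) (\<lambda>t. F (e y + t *s axis i 1)) 0) \<le> fact 1 * M / (r / 2) ^ 1"
    proof (rule Cauchy_inequality)
      have sub: "cball 0 (r / 2) \<subseteq> ball (0::complex) r" using r(1) by auto
      show "(\<lambda>t. F (e y + t *s axis i 1)) holomorphic_on ball 0 (r / 2)"
        by (rule holomorphic_on_subset[OF tline[OF y]]) (use sub in auto)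
      show "continuous_on (cball 0 (r / 2)) (\<lambda>t. F (e y + t *s axis i 1))"
        by (rule continuous_on_subset[OF holomorphic_on_imp_continuous_on[OF tline[OF y]] sub])
      show "0 < r / 2" using r by simp
      fix t :: complex assume "norm (0 - t) = r / 2"
      then have "norm t < r" using r by simp
      then show "norm (F (e y + t *s axis i 1)) \<le> M" by (intro M near y)
    qed
    then show ?thesis by (simp add: partial_deriv_def)
  qed
  have lines: "(\<lambda>s. partial_deriv i F (e (coord_update y1 j s))) holomorphic_on S"
    if S: "open S" "\<forall>s\<in>S. coord_update y1 j s \<in> ball y0 \<delta>" for y1 j S
    unfolding partial_deriv_def
  proof (rule deriv_parameter_holomorphic[OF r(1) S(1)])
    show "(\<lambda>t. F (e (coord_update y1 j s) + t *s axis i 1)) holomorphic_on ball 0 r" if "s \<in> S" for s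
      using tline S(2) that by blast
    show "norm (F (e (coord_update y1 j s) + t *s axis i 1)) \<le> M" if "norm t < r" "s \<in> S" for t s
      using S(2) that by (intro M near) auto
    show "(\<lambda>s. F (e (coord_update y1 j s) + t *s axis i 1)) holomorphic_on S" if t: "norm t < r" for t
    proof (rule holomorphic_on_line[where f = "\<lambda>y. F (e y + t *s axis i 1)"])
      fix s assume "s \<in> S"
      then have y: "coord_update y1 j s \<in> ball y0 \<delta>" using S(2) by blast
      show "holomorphic_at (\<lambda>y. F (e y + t *s axis i 1)) (coord_update y1 j s)"
      proof (rule holomorphic_at_compose[where F = "\<lambda>y. e y + t *s axis i 1"])
        show "holomorphic_at F (e (coord_update y1 j s) + t *s axis i 1)" using near[OF y t] r(2) \<Omega>(2) by blast
        fix a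
        have "holomorphic_at (\<lambda>y. e y $ a) (coord_update y1 j s)" using W(2) sub y by blast
        then have "holomorphic_at (\<lambda>y. e y $ a + (t *s axis i 1 :: complex ^ 'n) $ a) (coord_update y1 j s)"
          by (intro holomorphic_at_add holomorphic_at_const)
        then show "holomorphic_at (\<lambda>y. (e y + t *s axis i 1) $ a) (coord_update y1 j s)" by simp
      qed
    qed
  qed
  have "\<delta> > 0" using d d' by (simp add: \<delta>_def)
  then show ?thesis
    using sub bound lines by (intro exI[of _ \<delta>] exI[of _ "M / (r / 2)"] conjI ballI allI impI) auto
qed

subsection \<open>The pushforward of a linear field is linear\<close>

text \<open>Together with local boundedness, holomorphy in each variable is stable under sums and products and
  suffices for Liouville's theorem.\<close>

definition locally_separately_holomorphic :: "(complex ^ 'n::finite \<Rightarrow> complex) \<Rightarrow> complex ^ 'n \<Rightarrow> bool" where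
  "locally_separately_holomorphic P y0 \<longleftrightarrow> (\<exists>\<delta>>0. \<exists>M. (\<forall>y\<in>ball y0 \<delta>. norm (P y) \<le> M) \<and>
    (\<forall>y1 j S. open S \<and> (\<forall>s\<in>S. coord_update y1 j s \<in> ball y0 \<delta>) \<longrightarrow>
       (\<lambda>s. P (coord_update y1 j s)) holomorphic_on S))"

lemma lshI:
  assumes "\<delta> > 0" "\<And>y. y \<in> ball y0 \<delta> \<Longrightarrow> norm (P y) \<le> M"
    "\<And>y1 j S. open S \<Longrightarrow> (\<And>s. s \<in> S \<Longrightarrow> coord_update y1 j s \<in> ball y0 \<delta>) \<Longrightarrow>
      (\<lambda>s. P (coord_update y1 j s)) holomorphic_on S"
  shows "locally_separately_holomorphic P y0"
  unfolding locally_separately_holomorphic_def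
  by (rule exI[of _ \<delta>], intro conjI exI[of _ M] ballI allI impI) (use assms in auto)

lemma lshE:
  assumes "locally_separately_holomorphic P y0"
  obtains \<delta> M where "\<delta> > 0" "\<And>y. y \<in> ball y0 \<delta> \<Longrightarrow> norm (P y) \<le> M"
    "\<And>y1 j S. open S \<Longrightarrow> (\<And>s. s \<in> S \<Longrightarrow> coord_update y1 j s \<in> ball y0 \<delta>) \<Longrightarrow>
      (\<lambda>s. P (coord_update y1 j s)) holomorphic_on S"
proof -
  from assms obtain \<delta> M where *: "\<delta> > 0" "\<forall>y\<in>ball y0 \<delta>. norm (P y) \<le> M"
    "\<forall>y1 j S. open S \<and> (\<forall>s\<in>S. coord_update y1 j s \<in> ball y0 \<delta>) \<longrightarrow> (\<lambda>s. P (coord_update y1 j s)) holomorphic_on S"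
    unfolding locally_separately_holomorphic_def by blast
  show ?thesis by (rule that[of \<delta> M]) (use * in blast)+
qed

lemma lsh_shrink:
  assumes "locally_separately_holomorphic P y0" "locally_separately_holomorphic Q y0"
    and bound: "\<And>M N y. norm (P y) \<le> M \<Longrightarrow> norm (Q y) \<le> N \<Longrightarrow> norm (R y) \<le> C M N"
    and hol: "\<And>S h. (\<lambda>s. P (h s)) holomorphic_on S \<Longrightarrow> (\<lambda>s. Q (h s)) holomorphic_on S \<Longrightarrow>
      (\<lambda>s. R (h s)) holomorphic_on S"
  shows "locally_separately_holomorphic R y0"
proof -
  obtain \<delta> M where P: "\<delta> > 0" "\<And>y. y \<in> ball y0 \<delta> \<Longrightarrow> norm (P y) \<le> M"
    "\<And>y1 j S. open S \<Longrightarrow> (\<And>s. s \<in> S \<Longrightarrow> coord_update y1 j s \<in> ball y0 \<delta>) \<Longrightarrow>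
      (\<lambda>s. P (coord_update y1 j s)) holomorphic_on S" by (rule lshE[OF assms(1)]) blast
  obtain \<epsilon> N where Q: "\<epsilon> > 0" "\<And>y. y \<in> ball y0 \<epsilon> \<Longrightarrow> norm (Q y) \<le> N"
    "\<And>y1 j S. open S \<Longrightarrow> (\<And>s. s \<in> S \<Longrightarrow> coord_update y1 j s \<in> ball y0 \<epsilon>) \<Longrightarrow>
      (\<lambda>s. Q (coord_update y1 j s)) holomorphic_on S" by (rule lshE[OF assms(2)]) blast
  show ?thesis
  proof (rule lshI[of "min \<delta> \<epsilon>"])
    show "min \<delta> \<epsilon> > 0" using P(1) Q(1) by simp
    show "norm (R y) \<le> C M N" if "y \<in> ball y0 (min \<delta> \<epsilon>)" for y
      using that by (intro bound P(2) Q(2)) auto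
    show "(\<lambda>s. R (coord_update y1 j s)) holomorphic_on S"
      if "open S" "\<And>s. s \<in> S \<Longrightarrow> coord_update y1 j s \<in> ball y0 (min \<delta> \<epsilon>)" for y1 j S
      by (rule hol[where h = "coord_update y1 j"], rule P(3)[OF that(1)], use that(2) in force,
          rule Q(3)[OF that(1)], use that(2) in force)
  qed
qed

lemma lsh_mult:
  assumes "locally_separately_holomorphic P y0" "locally_separately_holomorphic Q y0"
  shows "locally_separately_holomorphic (\<lambda>y. P y * Q y) y0"
proof (rule lsh_shrink[OF assms])
  fix M N y assume "norm (P y) \<le> M" "norm (Q y) \<le> N"
  then show "norm (P y * Q y) \<le> M * N"
    unfolding norm_mult by (intro mult_mono) (auto intro: order_trans[OF norm_ge_zero])
qed (rule holomorphic_on_mult)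

lemma lsh_add:
  assumes "locally_separately_holomorphic P y0" "locally_separately_holomorphic Q y0"
  shows "locally_separately_holomorphic (\<lambda>y. P y + Q y) y0"
proof (rule lsh_shrink[OF assms])
  fix M N y assume "norm (P y) \<le> M" "norm (Q y) \<le> N"
  then show "norm (P y + Q y) \<le> M + N" by (rule norm_add_rule_thm)
qed (rule holomorphic_on_add)

lemma lsh_zero: "locally_separately_holomorphic (\<lambda>y. 0) y0"
  by (rule lshI[of 1 _ _ 0]) auto

lemma lsh_sum:
  "(\<And>i. i \<in> I \<Longrightarrow> locally_separately_holomorphic (P i) y0) \<Longrightarrow> locally_separately_holomorphic (\<lambda>y. \<Sum>i\<in>I. P i y) y0"
  by (induction I rule: infinite_finite_induct) (auto intro: lsh_zero lsh_add)

lemma lsh_cong: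
  assumes "locally_separately_holomorphic P y0" "open W" "y0 \<in> W" "\<And>y. y \<in> W \<Longrightarrow> Q y = P y"
  shows "locally_separately_holomorphic Q y0"
proof -
  obtain \<delta> M where P: "\<delta> > 0" "\<And>y. y \<in> ball y0 \<delta> \<Longrightarrow> norm (P y) \<le> M"
    "\<And>y1 j S. open S \<Longrightarrow> (\<And>s. s \<in> S \<Longrightarrow> coord_update y1 j s \<in> ball y0 \<delta>) \<Longrightarrow>
      (\<lambda>s. P (coord_update y1 j s)) holomorphic_on S" by (rule lshE[OF assms(1)]) blast
  obtain \<epsilon> where e: "\<epsilon> > 0" "ball y0 \<epsilon> \<subseteq> W" using assms(2,3) open_contains_ball by blast
  have sub: "y \<in> ball y0 \<delta>" "y \<in> W" if "y \<in> ball y0 (min \<delta> \<epsilon>)" for y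
    using that e(2) by (auto simp: subset_iff)
  show ?thesis
  proof (rule lshI[of "min \<delta> \<epsilon>"])
    show "min \<delta> \<epsilon> > 0" using P(1) e(1) by simp
    show "norm (Q y) \<le> M" if "y \<in> ball y0 (min \<delta> \<epsilon>)" for y
      using P(2)[OF sub(1)[OF that]] assms(4)[OF sub(2)[OF that]] by simp
    show "(\<lambda>s. Q (coord_update y1 j s)) holomorphic_on S"
      if S: "open S" "\<And>s. s \<in> S \<Longrightarrow> coord_update y1 j s \<in> ball y0 (min \<delta> \<epsilon>)" for y1 j S
    proof -
      have "(\<lambda>s. P (coord_update y1 j s)) holomorphic_on S" by (rule P(3)[OF S(1)]) (rule sub(1)[OF S(2)])
      then show ?thesis
        by (rule holomorphic_transform) (simp add: assms(4)[OF sub(2)[OF S(2)]])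
    qed
  qed
qed

lemma lsh_holomorphic:
  assumes "open W" "y0 \<in> W" "\<And>y. y \<in> W \<Longrightarrow> holomorphic_at P y"
  shows "locally_separately_holomorphic P y0"
proof -
  have "isCont P y0" using assms(2,3) holomorphic_at_iff has_derivative_continuous by blast
  then obtain d where d: "d > 0" "\<And>y. dist y y0 < d \<Longrightarrow> dist (P y) (P y0) < 1"
    unfolding continuous_at_eps_delta using zero_less_one by blast
  obtain \<epsilon> where e: "\<epsilon> > 0" "ball y0 \<epsilon> \<subseteq> W" using assms(1,2) open_contains_ball by blast
  show ?thesis
  proof (rule lshI[of "min d \<epsilon>"])
    show "min d \<epsilon> > 0" using d(1) e(1) by simp
    show "norm (P y) \<le> norm (P y0) + 1" if "y \<in> ball y0 (min d \<epsilon>)" for y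
    proof -
      have "dist (P y) (P y0) < 1" using d(2)[of y] that by (simp add: dist_commute)
      then show ?thesis using norm_triangle_sub[of "P y" "P y0"] by (simp add: dist_norm)
    qed
    show "(\<lambda>s. P (coord_update y1 j s)) holomorphic_on S"
      if "open S" "\<And>s. s \<in> S \<Longrightarrow> coord_update y1 j s \<in> ball y0 (min d \<epsilon>)" for y1 j S
    proof (rule holomorphic_on_line)
      fix s assume "s \<in> S"
      then have "coord_update y1 j s \<in> ball y0 \<epsilon>" using that(2) by force
      then show "holomorphic_at P (coord_update y1 j s)" using e(2) by (intro assms(3)) blast
    qed
  qed
qed

lemma lsh_entire:
  assumes "\<And>y. locally_separately_holomorphic P y"
  shows "(\<lambda>t. P (coord_update x i t)) holomorphic_on UNIV" "\<exists>A. \<forall>x. norm x \<le> R \<longrightarrow> norm (P x) \<le> A"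
proof -
  show "(\<lambda>t. P (coord_update x i t)) holomorphic_on UNIV"
    unfolding holomorphic_on_def
  proof
    fix t0
    obtain \<delta> where P: "\<delta> > 0"
      "\<forall>y1 j S. open S \<and> (\<forall>s\<in>S. coord_update y1 j s \<in> ball (coord_update x i t0) \<delta>) \<longrightarrow> (\<lambda>s. P (coord_update y1 j s)) holomorphic_on S"
      using assms[of "coord_update x i t0"] unfolding locally_separately_holomorphic_def by blast
    have "dist (coord_update x i t0) (coord_update x i s) = norm (t0 - s)" for s
    proof -
      have "coord_update x i t0 - coord_update x i s = (t0 - s) *s axis i 1"
        by (auto simp: vec_eq_iff coord_update_def axis_def)
      then show ?thesis by (simp only: dist_norm norm_axis_scale)
    qed
    then have "\<forall>s\<in>ball t0 \<delta>. coord_update x i s \<in> ball (coord_update x i t0) \<delta>" by (simp add: dist_norm)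
    then have "(\<lambda>s. P (coord_update x i s)) holomorphic_on ball t0 \<delta>" using P(2) open_ball by blast
    then show "(\<lambda>t. P (coord_update x i t)) field_differentiable at t0 within UNIV"
      using holomorphic_on_imp_differentiable_at[of _ "ball t0 \<delta>" t0] P(1) by simp
  qed
  have "\<forall>y. \<exists>p. fst p > 0 \<and> (\<forall>z\<in>ball y (fst p). norm (P z) \<le> snd p)"
    using assms unfolding locally_separately_holomorphic_def by (metis fst_conv snd_conv)
  then obtain p where p: "\<forall>y. fst (p y) > 0 \<and> (\<forall>z\<in>ball y (fst (p y)). norm (P z) \<le> snd (p y))"
    using choice by metis
  have "x \<in> ball x (fst (p x))" for x using p by simp
  then have cover: "cball 0 R \<subseteq> (\<Union>y\<in>UNIV. ball y (fst (p y)))" by blast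
  obtain C where "C \<subseteq> UNIV" and C: "finite C" "cball 0 R \<subseteq> (\<Union>y\<in>C. ball y (fst (p y)))"
    by (rule compactE_image[OF compact_cball _ cover]) simp
  have "norm (P x) \<le> Max (insert 0 (snd ` p ` C))" if x: "norm x \<le> R" for x
  proof -
    obtain y where y: "y \<in> C" "x \<in> ball y (fst (p y))" using subsetD[OF C(2), of x] x by (auto simp del: mem_ball)
    then have "norm (P x) \<le> snd (p y)" using p by blast
    also have "\<dots> \<le> Max (insert 0 (snd ` p ` C))" using C(1) y(1) by (intro Max_ge) auto
    finally show ?thesis .
  qed
  then show "\<exists>A. \<forall>x. norm x \<le> R \<longrightarrow> norm (P x) \<le> A" by blast
qed

lemma holomorphic_chart_expr:
  assumes "holomorphic_self_map f"
  shows "open (chart_domain f k l)" "x \<in> chart_domain f k l \<Longrightarrow> holomorphic_at (\<lambda>y. chart_expr f k l y $ a) x"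
  using assms unfolding holomorphic_self_map_def by auto

lemma affine_point_chart_expr:
  "x \<in> chart_domain f k l \<Longrightarrow> affine_point l (chart_expr f k l x) = f (affine_point k x)"
  unfolding chart_domain_def chart_expr_def by (simp add: f_inv_into_f)

lemma chart_exprI:
  assumes "f (affine_point k x) = affine_point l y"
  shows "x \<in> chart_domain f k l" "chart_expr f k l x = y"
  using assms inv_f_f[OF affine_point_inj, of l y] by (simp_all add: chart_domain_def chart_expr_def)

lemma holomorphic_id: "holomorphic_self_map (id :: (complex ^ 'n::finite option) set \<Rightarrow> _)"
  using holomorphic_proj_linear[of "mat 1" "mat 1 :: complex ^ 'n option ^ 'n option"] by (simp add: proj_linear_one)

lemma linear_field_id:
  assumes "x \<in> chart_domain id k l"
  shows "complex_jacobian (chart_expr id k l) x *v linear_field X k x = linear_field X l (chart_expr id k l x)"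
proof -
  have "(mat 1 *v affine_lift k x) $ l \<noteq> 0"
    using assms chart_domain_proj_linear[of x "mat 1" k l] by (simp add: proj_linear_one)
  from linear_field_pushforward[OF _ this, of "mat 1" X] show ?thesis by (simp add: proj_linear_one)
qed

locale automorphism =
  fixes f :: "(complex ^ 'n::finite option) set \<Rightarrow> (complex ^ 'n option) set"
  assumes automorphism: "proj_automorphism f"
begin

abbreviation "g \<equiv> inv_into proj_space f"

lemma f_holomorphic: "holomorphic_self_map f" and g_holomorphic: "holomorphic_self_map g"
  and f_bij: "bij_betw f proj_space proj_space"
  using automorphism by (auto simp: proj_automorphism_def)

lemma g_f: "g (f (affine_point k x)) = affine_point k x"
  by (rule inv_into_f_f[OF bij_betw_imp_inj_on[OF f_bij] affine_point_in_proj_space])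

lemma f_g: "f (g (affine_point k x)) = affine_point k x"
  by (rule f_inv_into_f) (use f_bij affine_point_in_proj_space in \<open>simp add: bij_betw_def\<close>)

lemma source_point: "\<exists>k x. f (affine_point k x) = affine_point l y"
proof -
  have "affine_point l y \<in> f ` proj_space" using f_bij affine_point_in_proj_space by (simp add: bij_betw_def)
  then obtain p where "p \<in> proj_space" "affine_point l y = f p" by blast
  then show ?thesis using proj_space_cases[of p] by metis
qed

lemma source_change:
  assumes x: "affine_point k x = affine_point k' x'" and d: "x \<in> chart_domain f k l"
  shows "complex_jacobian (chart_expr f k l) x *v linear_field X k x =
    complex_jacobian (chart_expr f k' l) x' *v linear_field X k' x'"
proof -
  have id: "x \<in> chart_domain id k k'" "chart_expr id k k' x = x'"
    using chart_exprI[of id k x k' x'] x by simp_all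
  have d': "x' \<in> chart_domain f k' l" using d x by (simp add: chart_domain_def)
  have "complex_jacobian (chart_expr f k l) x *v linear_field X k x =
    complex_jacobian (chart_expr f k' l) (chart_expr id k k' x) *v (complex_jacobian (chart_expr id k k') x *v linear_field X k x)"
  proof (rule jacobian_chain[OF holomorphic_chart_expr(2)[OF holomorphic_id id(1)] _ holomorphic_chart_expr(1)[OF holomorphic_id] id(1)])
    show "holomorphic_at (\<lambda>y. chart_expr f k' l y $ a) (chart_expr id k k' x)" for a
      unfolding id(2) by (rule holomorphic_chart_expr(2)[OF f_holomorphic d'])
    fix y assume "y \<in> chart_domain id k k'"
    from affine_point_chart_expr[OF this]
    show "chart_expr f k' l (chart_expr id k k' y) = chart_expr f k l y" by (simp add: chart_expr_def[of f])
  qed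
  then show ?thesis by (simp add: linear_field_id[OF id(1)] id(2))
qed

definition push :: "complex ^ 'n option ^ 'n option \<Rightarrow> 'n option \<Rightarrow> complex ^ 'n \<Rightarrow> complex ^ 'n" where
  "push X l y = (let (k, x) = (SOME (k, x). f (affine_point k x) = affine_point l y)
     in complex_jacobian (chart_expr f k l) x *v linear_field X k x)"

lemma push_eq:
  assumes "f (affine_point k x) = affine_point l y"
  shows "push X l y = complex_jacobian (chart_expr f k l) x *v linear_field X k x"
proof -
  obtain k' x' where k': "(SOME (k, x). f (affine_point k x) = affine_point l y) = (k', x')" by force
  have "case (k', x') of (k, x) \<Rightarrow> f (affine_point k x) = affine_point l y"
    unfolding k'[symmetric] by (rule someI[of _ "(k, x)"]) (use assms in simp)
  then have e: "f (affine_point k' x') = affine_point l y" by simp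
  have "affine_point k' x' = affine_point k x" using g_f assms e by metis
  from source_change[OF this chart_exprI(1)[of f k' x' l y, OF e]] show ?thesis by (simp add: push_def k')
qed

text \<open>The chart expressions of the image are made from partial derivatives of the automorphism, and
  different charts of the source give the same vector by the chain rule.\<close>

lemma push_global: "global_field (push X)"
  unfolding global_field_def
proof (intro conjI allI impI)
  have lsh: "locally_separately_holomorphic (\<lambda>y. push X l y $ a) y0" for l a y0
  proof -
    obtain k0 x0 where k0: "f (affine_point k0 x0) = affine_point l y0" using source_point by blast
    let ?e = "chart_expr g l k0" and ?F = "chart_expr f k0 l"
    let ?W = "chart_domain g l k0" and ?O = "chart_domain f k0 l"
    have "g (affine_point l y0) = affine_point k0 x0" using g_f[of k0 x0] k0 by simp
    from chart_exprI(1)[of g l y0 k0 x0, OF this] have y0: "y0 \<in> ?W" .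
    have src: "f (affine_point k0 (?e y)) = affine_point l y" if "y \<in> ?W" for y
      unfolding affine_point_chart_expr[OF that] f_g ..
    have eO: "?e y \<in> ?O" if "y \<in> ?W" for y
      by (rule chart_exprI(1)[of f k0 "?e y" l y, OF src[OF that]])
    have he: "holomorphic_at (\<lambda>y. ?e y $ b) y" if "y \<in> ?W" for y b
      by (rule holomorphic_chart_expr(2)[OF g_holomorphic that])
    show ?thesis
    proof (rule lsh_cong[OF _ holomorphic_chart_expr(1)[OF g_holomorphic] y0])
      show "push X l y $ a = (\<Sum>i\<in>UNIV. partial_deriv i (\<lambda>x. ?F x $ a) (?e y) * linear_field X k0 (?e y) $ i)"
        if "y \<in> ?W" for y
        unfolding push_eq[OF src[OF that]] by (simp add: matrix_vector_mult_def complex_jacobian_def)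
      show "locally_separately_holomorphic (\<lambda>y. \<Sum>i\<in>UNIV. partial_deriv i (\<lambda>x. ?F x $ a) (?e y) * linear_field X k0 (?e y) $ i) y0"
      proof (intro lsh_sum lsh_mult)
        fix i
        show "locally_separately_holomorphic (\<lambda>y. partial_deriv i (\<lambda>x. ?F x $ a) (?e y)) y0"
          using partial_deriv_local[where F = "\<lambda>x. ?F x $ a" and i = i, OF holomorphic_chart_expr(1)[OF f_holomorphic]
              holomorphic_chart_expr(2)[OF f_holomorphic] holomorphic_chart_expr(1)[OF g_holomorphic] he eO y0]
          unfolding locally_separately_holomorphic_def by blast
        show "locally_separately_holomorphic (\<lambda>y. linear_field X k0 (?e y) $ i) y0"
          by (rule lsh_holomorphic[OF holomorphic_chart_expr(1)[OF g_holomorphic] y0])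
             (rule holomorphic_at_compose[OF he holomorphic_linear_field])
      qed
    qed
  qed
  show "(\<lambda>t. push X k (coord_update x i t) $ a) holomorphic_on UNIV" for k x i a
    by (rule lsh_entire(1)[OF lsh])
  show "\<exists>A. \<forall>x. norm x \<le> R \<longrightarrow> norm (push X k x $ a) \<le> A" for k a R
    by (rule lsh_entire(2)[OF lsh])
  fix m and y :: "complex ^ 'n" assume y: "y $ m \<noteq> 0"
  obtain k x where k: "f (affine_point k x) = affine_point None y" using source_point by blast
  have d: "x \<in> chart_domain f k None" and ex: "chart_expr f k None x = y" using chart_exprI[of f k x None y, OF k] by auto
  have idd: "y \<in> chart_domain id None (Some m)" using y by (simp add: in_chart_domain_Some)
  have "affine_point (Some m) (chart_swap m y) = affine_point None y"
    using affine_point_chart_expr[OF idd] by (simp add: chart_expr_id_Some[OF y])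
  then have k': "f (affine_point k x) = affine_point (Some m) (chart_swap m y)" using k by simp
  have "complex_jacobian (chart_expr f k (Some m)) x *v linear_field X k x =
    complex_jacobian (chart_expr id None (Some m)) (chart_expr f k None x) *v
      (complex_jacobian (chart_expr f k None) x *v linear_field X k x)"
  proof (rule jacobian_chain[OF holomorphic_chart_expr(2)[OF f_holomorphic d] _ holomorphic_chart_expr(1)[OF f_holomorphic] d])
    show "holomorphic_at (\<lambda>y. chart_expr id None (Some m) y $ a) (chart_expr f k None x)" for a
      unfolding ex by (rule holomorphic_chart_expr(2)[OF holomorphic_id idd])
    fix y' assume "y' \<in> chart_domain f k None"
    from affine_point_chart_expr[OF this]
    show "chart_expr id None (Some m) (chart_expr f k None y') = chart_expr f k (Some m) y'"
      by (simp add: chart_expr_def[of id] chart_expr_def[of f k "Some m"])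
  qed
  then show "push X (Some m) (chart_swap m y) = complex_jacobian (chart_expr id None (Some m)) y *v push X None y"
    unfolding push_eq[OF k'] push_eq[OF k] ex .
qed

theorem pushes_linear_field:
  assumes "CARD('n) \<ge> 2"
  shows "\<exists>Y. \<forall>k l. \<forall>x\<in>chart_domain f k l.
    complex_jacobian (chart_expr f k l) x *v linear_field X k x = linear_field Y l (chart_expr f k l x)"
proof -
  obtain Y where Y: "push X = linear_field Y" using global_field_linear[OF push_global assms] by blast
  show ?thesis
    by (rule exI[of _ Y]) (metis Y push_eq affine_point_chart_expr)
qed

lemma jacobian_injective:
  assumes d: "x \<in> chart_domain f k l" and z: "complex_jacobian (chart_expr f k l) x *v v = 0"
  shows "v = 0"
proof -
  have d': "chart_expr f k l x \<in> chart_domain g l k"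
    by (rule chart_exprI(1)[where y = x]) (simp add: affine_point_chart_expr[OF d] g_f)
  have "complex_jacobian (\<lambda>y. y) x *v v = complex_jacobian (chart_expr g l k) (chart_expr f k l x) *v
     (complex_jacobian (chart_expr f k l) x *v v)"
  proof (rule jacobian_chain[OF holomorphic_chart_expr(2)[OF f_holomorphic d] holomorphic_chart_expr(2)[OF g_holomorphic d']
        holomorphic_chart_expr(1)[OF f_holomorphic] d])
    fix y assume y: "y \<in> chart_domain f k l"
    show "chart_expr g l k (chart_expr f k l y) = y"
      by (rule chart_exprI(2)) (simp add: affine_point_chart_expr[OF y] g_f)
  qed
  moreover have "complex_jacobian (\<lambda>y. y) x *v v = v"
  proof (rule vec_eq_iff[THEN iffD2], rule allI)
    fix a
    have "((\<lambda>y. y $ a) has_derivative (\<lambda>v. v $ a)) (at x)" for a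
      by (rule bounded_linear_imp_has_derivative[OF bounded_linear_vec_nth])
    then show "(complex_jacobian (\<lambda>y. y) x *v v) $ a = v $ a"
      by (rule complex_jacobian_mult) (simp add: complex_linear_def)
  qed
  ultimately show ?thesis by (simp add: z)
qed

end

subsection \<open>Diagonal Poisson structures up to linear automorphisms\<close>

definition field_zeros :: "complex ^ 'm ^ 'm \<Rightarrow> (complex ^ 'm::finite) set set" where
  "field_zeros X = {proj_class (*s) z |z. z \<noteq> 0 \<and> (\<exists>\<mu>. X *v z = \<mu> *s z)}"

lemma linear_lift_eq_0: "linear_lift k v = 0 \<longleftrightarrow> v = 0"
proof
  assume "linear_lift k v = 0"
  then have "linear_lift k v $ chart_index k i = 0" for i by simp
  then show "v = 0" by (simp add: vec_eq_iff)
next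
  assume "v = 0"
  then show "linear_lift k v = 0" by (intro vec_chart_eqI[of _ k]) simp_all
qed

lemma affine_point_in_field_zeros: "affine_point k x \<in> field_zeros X \<longleftrightarrow> linear_field X k x = 0"
proof
  assume "affine_point k x \<in> field_zeros X"
  then obtain z \<mu> where z: "affine_point k x = proj_class (*s) z" "X *v z = \<mu> *s z"
    unfolding field_zeros_def by blast
  from z(1) obtain c where c: "c \<noteq> 0" "affine_lift k x = c *s z" unfolding affine_point_def by (rule proj_class_eqE)
  have "X *v affine_lift k x = \<mu> *s affine_lift k x"
    unfolding c(2) by (simp add: matrix_vector_scale z(2) vector_smult_assoc mult.commute)
  then have "linear_lift k (linear_field X k x) = 0" unfolding linear_lift_linear_field by simp
  then show "linear_field X k x = 0" by (simp add: linear_lift_eq_0)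
next
  assume "linear_field X k x = 0"
  then have "linear_lift k (linear_field X k x) = 0" by (simp add: linear_lift_eq_0)
  then have "X *v affine_lift k x = (X *v affine_lift k x) $ k *s affine_lift k x"
    unfolding linear_lift_linear_field by simp
  then show "affine_point k x \<in> field_zeros X"
    unfolding field_zeros_def affine_point_def using affine_lift_nonzero by blast
qed

lemma field_zeros_eigenvector:
  assumes "proj_class (*s) z \<in> field_zeros X"
  shows "\<exists>\<mu>. X *v z = \<mu> *s z"
proof -
  obtain w \<mu> where w: "proj_class (*s) z = proj_class (*s) w" "X *v w = \<mu> *s w"
    using assms unfolding field_zeros_def by blast
  from w(1) obtain c where "c \<noteq> 0" "z = c *s w" by (rule proj_class_eqE)
  then have "X *v z = \<mu> *s z" by (simp add: matrix_vector_scale w(2) vector_smult_assoc mult.commute)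
  then show ?thesis by blast
qed

text \<open>The derivative of an automorphism is injective, so it takes zeros of a field to zeros of its image and
  nothing else.\<close>

lemma (in automorphism) image_field_zeros:
  assumes Y: "\<And>k l x. x \<in> chart_domain f k l \<Longrightarrow>
    complex_jacobian (chart_expr f k l) x *v linear_field X k x = linear_field Y l (chart_expr f k l x)"
  shows "f ` field_zeros X = field_zeros Y"
proof -
  have iff: "f (affine_point k x) \<in> field_zeros Y \<longleftrightarrow> affine_point k x \<in> field_zeros X" for k x
  proof -
    have "f (affine_point k x) \<in> proj_space"
      using f_bij affine_point_in_proj_space by (auto simp: bij_betw_def)
    then obtain l y where y: "f (affine_point k x) = affine_point l y" using proj_space_cases by metis
    have d: "x \<in> chart_domain f k l" "chart_expr f k l x = y" using chart_exprI[of f k x l y, OF y] by auto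
    have "linear_field Y l y = 0 \<longleftrightarrow> linear_field X k x = 0"
      using Y[OF d(1)] jacobian_injective[OF d(1)] d(2) by (metis matrix_vector_mult_0_right)
    then show ?thesis unfolding y affine_point_in_field_zeros .
  qed
  have sub: "field_zeros Z \<subseteq> proj_space" for Z :: "complex ^ 'n option ^ 'n option"
    unfolding field_zeros_def proj_space_def projectivization_def by blast
  show ?thesis
  proof (intro equalityI subsetI)
    fix p assume "p \<in> f ` field_zeros X"
    then obtain q where q: "q \<in> field_zeros X" "p = f q" by blast
    then obtain k x where "q = affine_point k x" using sub proj_space_cases by blast
    then show "p \<in> field_zeros Y" using iff q by simp
  next
    fix p assume p: "p \<in> field_zeros Y"
    then obtain l y where y: "p = affine_point l y" using sub proj_space_cases by blast
    obtain k x where k: "f (affine_point k x) = affine_point l y" using source_point by blast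
    have "f (affine_point k x) \<in> field_zeros Y" unfolding k using p y by simp
    then have "affine_point k x \<in> field_zeros X" using iff by blast
    then show "p \<in> f ` field_zeros X" using k y by blast
  qed
qed

lemma matrix_vector_sum: "(A :: complex ^ 'n ^ 'm) *v (\<Sum>i\<in>I. w i) = (\<Sum>i\<in>I. A *v w i)"
  by (induction I rule: infinite_finite_induct) (simp_all add: matrix_vector_right_distrib)

lemma eigenvectors_independent:
  fixes q :: "'i::finite \<Rightarrow> complex ^ 'm::finite"
  assumes q: "\<And>a. q a \<noteq> 0" "\<And>a. Y *v q a = \<mu> a *s q a" and \<mu>: "inj \<mu>"
    and z: "(\<Sum>a\<in>UNIV. c a *s q a) = 0"
  shows "c b = 0"
proof -
  have pow: "(\<Sum>a\<in>UNIV. (c a * \<mu> a ^ n) *s q a) = 0" for n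
  proof (induction n)
    case (Suc n)
    have "(\<Sum>a\<in>UNIV. (c a * \<mu> a ^ Suc n) *s q a) = Y *v (\<Sum>a\<in>UNIV. (c a * \<mu> a ^ n) *s q a)"
      by (simp add: matrix_vector_sum matrix_vector_scale q(2) vector_smult_assoc mult_ac)
    then show ?case using Suc by simp
  qed (use z in simp)
  have ev: "(\<Sum>a\<in>UNIV. (c a * poly p (\<mu> a)) *s q a) = 0" for p
  proof (rule vec_eq_iff[THEN iffD2], rule allI)
    fix i
    have "(\<Sum>a\<in>UNIV. (c a * poly p (\<mu> a)) *s q a) $ i =
        (\<Sum>a\<in>UNIV. \<Sum>n\<le>degree p. coeff p n * (c a * \<mu> a ^ n * q a $ i))"
      by (simp add: poly_altdef sum_distrib_left sum_distrib_right mult_ac)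
    also have "\<dots> = (\<Sum>n\<le>degree p. coeff p n * (\<Sum>a\<in>UNIV. (c a * \<mu> a ^ n) *s q a) $ i)"
      by (subst sum.swap) (simp add: sum_distrib_left)
    finally show "(\<Sum>a\<in>UNIV. (c a * poly p (\<mu> a)) *s q a) $ i = 0 $ i" by (simp add: pow)
  qed
  define p where "p = (\<Prod>a\<in>UNIV - {b}. [:- \<mu> a, 1:])"
  have p0: "poly p (\<mu> a) = 0" if "a \<noteq> b" for a
    unfolding p_def poly_prod using that by (intro prod_zero) auto
  have p1: "poly p (\<mu> b) \<noteq> 0"
    unfolding p_def poly_prod using \<mu> by (auto simp: inj_def)
  have "(\<Sum>a\<in>UNIV. (c a * poly p (\<mu> a)) *s q a) = (c b * poly p (\<mu> b)) *s q b"
    by (subst sum.remove[of UNIV b]) (auto simp: p0)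
  then have "(c b * poly p (\<mu> b)) *s q b = 0" using ev[of p] by simp
  then show ?thesis using p1 q(1) by (auto simp: vec_eq_iff)
qed

text \<open>Two eigenlines with the same eigenvalue span a plane of eigenvectors, which is a projective line of
  zeros.\<close>

lemma finite_field_zeros_distinct_eigenvalues:
  fixes q :: "'i \<Rightarrow> complex ^ 'm::finite"
  assumes fin: "finite (field_zeros Y)" and q: "\<And>a. q a \<noteq> 0" "\<And>a. Y *v q a = \<mu> a *s q a"
    and inj: "inj (\<lambda>a. proj_class (*s) (q a))"
  shows "inj \<mu>"
proof (rule injI, rule ccontr)
  fix a b assume ab: "\<mu> a = \<mu> b" "a \<noteq> b"
  have indep: "\<alpha> = 0 \<and> \<beta> = 0" if s: "\<alpha> *s q a + \<beta> *s q b = 0" for \<alpha> \<beta>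
  proof (cases "\<alpha> = 0")
    case True
    then show ?thesis using s q(1)[of b] by (auto simp: vec_eq_iff)
  next
    case False
    have "q a = (1 / \<alpha>) *s (\<alpha> *s q a)" using False by (simp add: vector_smult_assoc)
    also have "\<alpha> *s q a = (- \<beta>) *s q b" using s by (simp add: eq_neg_iff_add_eq_0 vec_eq_iff)
    finally have qa: "q a = (- \<beta> / \<alpha>) *s q b" by (simp add: vector_smult_assoc)
    then have "- \<beta> / \<alpha> \<noteq> 0" using q(1)[of a] by auto
    then have "proj_class (*s) (q a) = proj_class (*s) (q b)" unfolding qa by (rule proj_class_scale)
    then show ?thesis using inj ab(2) by (simp add: inj_def)
  qed
  let ?w = "\<lambda>s::complex. q a + s *s q b"
  have "inj (\<lambda>s. proj_class (*s) (?w s))"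
  proof (rule injI)
    fix s t assume "proj_class (*s) (?w s) = proj_class (*s) (?w t)"
    then obtain c where "c \<noteq> 0" "?w s = c *s ?w t" by (rule proj_class_eqE)
    then have "(1 - c) *s q a + (s - c * t) *s q b = 0" by (simp add: vec_eq_iff algebra_simps)
    then show "s = t" using indep[of "1 - c" "s - c * t"] by simp
  qed
  moreover have "range (\<lambda>s. proj_class (*s) (?w s)) \<subseteq> field_zeros Y"
  proof (rule image_subsetI)
    fix s
    have "?w s \<noteq> 0" using indep[of 1 s] by auto
    moreover have "Y *v ?w s = \<mu> a *s ?w s"
      by (simp add: matrix_vector_right_distrib matrix_vector_scale q(2) ab(1) vec_eq_iff algebra_simps)
    ultimately show "proj_class (*s) (?w s) \<in> field_zeros Y" unfolding field_zeros_def by blast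
  qed
  ultimately show False
    using fin finite_subset range_inj_infinite infinite_UNIV_char_0 finite_imageD by blast
qed

lemma linear_field_combination:
  fixes P :: "'n::finite option \<Rightarrow> complex ^ 'n option ^ 'n option"
  assumes "\<And>z. Y *v z = (\<Sum>c\<in>UNIV. \<nu> c *s (P c *v z))" and "\<And>z. (\<Sum>c\<in>UNIV. P c *v z) = z"
  shows "linear_field Y k x = (\<Sum>a\<in>UNIV. (\<nu> (Some a) - \<nu> None) *s linear_field (P (Some a)) k x)"
proof (rule vec_eq_iff[THEN iffD2], rule allI)
  fix i
  let ?z = "affine_lift k x" and ?l = "\<lambda>c. linear_field (P c) k x $ i"
  have Y: "linear_field Y k x $ i = (\<Sum>c\<in>UNIV. \<nu> c * ?l c)"
    by (simp add: linear_field_def assms(1) sum_distrib_left sum_subtractf algebra_simps)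
  have "(\<Sum>c\<in>UNIV. ?l c) = (\<Sum>c\<in>UNIV. P c *v ?z) $ chart_index k i - x $ i * (\<Sum>c\<in>UNIV. P c *v ?z) $ k"
    by (simp add: linear_field_def sum_distrib_left sum_subtractf)
  also have "\<dots> = 0" by (simp add: assms(2))
  finally have "?l None = - (\<Sum>a\<in>UNIV. ?l (Some a))" unfolding sum_option by (simp add: eq_neg_iff_add_eq_0)
  then show "linear_field Y k x $ i = (\<Sum>a\<in>UNIV. (\<nu> (Some a) - \<nu> None) *s linear_field (P (Some a)) k x) $ i"
    unfolding Y sum_option by (simp add: sum_distrib_left sum_subtractf algebra_simps sum_negf)
qed

lemma field_bivector_recombine:
  fixes \<nu> :: "'n::finite \<Rightarrow> 'n \<Rightarrow> complex"
  assumes "\<And>k x b. linear_field (Y b) k x = (\<Sum>a\<in>UNIV. \<nu> b a *s linear_field (P a) k x)"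
  shows "field_bivector c Y = field_bivector (\<chi> p q. \<Sum>a\<in>UNIV. \<Sum>b\<in>UNIV. c $ a $ b * (\<nu> a p * \<nu> b q)) P"
proof -
  have "(\<Sum>a\<in>UNIV. \<Sum>b\<in>UNIV. c $ a $ b * ((\<Sum>p\<in>UNIV. \<nu> a p * u p) * (\<Sum>q\<in>UNIV. \<nu> b q * w q))) =
    (\<Sum>p\<in>UNIV. \<Sum>q\<in>UNIV. (\<Sum>a\<in>UNIV. \<Sum>b\<in>UNIV. c $ a $ b * (\<nu> a p * \<nu> b q)) * (u p * w q))" for u w :: "'n \<Rightarrow> complex"
  proof -
    let ?s = "\<lambda>a b p q. c $ a $ b * (\<nu> a p * \<nu> b q) * (u p * w q)"
    have "(\<Sum>a\<in>UNIV. \<Sum>b\<in>UNIV. c $ a $ b * ((\<Sum>p\<in>UNIV. \<nu> a p * u p) * (\<Sum>q\<in>UNIV. \<nu> b q * w q))) =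
      (\<Sum>a\<in>UNIV. \<Sum>b\<in>UNIV. \<Sum>p\<in>UNIV. \<Sum>q\<in>UNIV. ?s a b p q)"
    proof (intro sum.cong refl)
      fix a b
      have "(\<Sum>p\<in>UNIV. \<nu> a p * u p) * (\<Sum>q\<in>UNIV. \<nu> b q * w q) = (\<Sum>p\<in>UNIV. \<Sum>q\<in>UNIV. \<nu> a p * u p * (\<nu> b q * w q))"
        by (rule sum_product)
      then show "c $ a $ b * ((\<Sum>p\<in>UNIV. \<nu> a p * u p) * (\<Sum>q\<in>UNIV. \<nu> b q * w q)) = (\<Sum>p\<in>UNIV. \<Sum>q\<in>UNIV. ?s a b p q)"
        by (simp add: sum_distrib_left mult_ac)
    qed
    also have "\<dots> = (\<Sum>(a, b, p, q)\<in>UNIV. ?s a b p q)" by (simp add: double_sum_UNIV case_prod_beta)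
    also have "\<dots> = (\<Sum>(p, q, a, b)\<in>UNIV. ?s a b p q)"
      by (rule sum.reindex_bij_witness[where i = "\<lambda>(p, q, a, b). (a, b, p, q)" and j = "\<lambda>(a, b, p, q). (p, q, a, b)"]) auto
    also have "\<dots> = (\<Sum>p\<in>UNIV. \<Sum>q\<in>UNIV. \<Sum>a\<in>UNIV. \<Sum>b\<in>UNIV. ?s a b p q)" by (simp add: double_sum_UNIV case_prod_beta)
    also have "\<dots> = (\<Sum>p\<in>UNIV. \<Sum>q\<in>UNIV. (\<Sum>a\<in>UNIV. \<Sum>b\<in>UNIV. c $ a $ b * (\<nu> a p * \<nu> b q)) * (u p * w q))"
      by (simp only: sum_distrib_right)
    finally show ?thesis .
  qed
  then show ?thesis by (simp add: field_bivector_def fun_eq_iff vec_eq_iff assms)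
qed

lemma recombine_skew:
  fixes c :: "complex ^ 'n ^ 'n::finite"
  assumes "transpose c = - c"
  shows "transpose (\<chi> p q. \<Sum>a\<in>UNIV. \<Sum>b\<in>UNIV. c $ a $ b * (\<nu> a p * \<nu> b q)) =
    - (\<chi> p q. \<Sum>a\<in>UNIV. \<Sum>b\<in>UNIV. c $ a $ b * (\<nu> a p * \<nu> b q))"
proof (rule vec_eq_iff[THEN iffD2], rule allI, rule vec_eq_iff[THEN iffD2], rule allI)
  fix p q
  have "(\<Sum>a\<in>UNIV. \<Sum>b\<in>UNIV. c $ a $ b * (\<nu> a q * \<nu> b p)) = (\<Sum>b\<in>UNIV. \<Sum>a\<in>UNIV. - (c $ b $ a * (\<nu> b p * \<nu> a q)))"
    by (subst sum.swap, intro sum.cong refl, subst skew_entry[OF assms]) (simp add: mult_ac)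
  then show "transpose (\<chi> p q. \<Sum>a\<in>UNIV. \<Sum>b\<in>UNIV. c $ a $ b * (\<nu> a p * \<nu> b q)) $ p $ q =
    (- (\<chi> p q. \<Sum>a\<in>UNIV. \<Sum>b\<in>UNIV. c $ a $ b * (\<nu> a p * \<nu> b q))) $ p $ q"
    by (simp add: transpose_def sum_negf)
qed

lemma bivector_fields_diff:
  assumes "\<sigma> \<in> bivector_fields" "\<tau> \<in> bivector_fields"
  shows "\<sigma> - \<tau> \<in> bivector_fields"
proof -
  have m: "M ** (A - B) ** N = M ** A ** N - M ** B ** N" for M A B N :: "complex ^ 'a ^ 'a"
    by (simp add: matrix_matrix_mult_def vec_eq_iff sum_subtractf algebra_simps sum_distrib_left sum_distrib_right)
  have t: "transpose (A - B) = transpose A - transpose B" for A B :: "complex ^ 'a ^ 'a"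
    by (simp add: transpose_def vec_eq_iff)
  have h: "holomorphic_at (\<lambda>y. f y - g y) x" if "holomorphic_at f x" "holomorphic_at g x" for f g and x :: "complex ^ 'a"
    using holomorphic_at_add[OF that(1) holomorphic_at_cmult[OF that(2), of "-1"]] by simp
  show ?thesis
    using assms unfolding bivector_fields_def pushes_forward_def by (auto simp: m t h)
qed

lemma bivector_eqI:
  assumes "\<sigma> \<in> bivector_fields" "\<tau> \<in> bivector_fields" "\<And>x. \<sigma> None x = \<tau> None x"
  shows "\<sigma> = \<tau>"
  using bivector_zeroI[OF bivector_fields_diff[OF assms(1,2)]] assms(3) by simp

text \<open>The field induced by a diagonal matrix with distinct eigenvalues has the coordinate points as its
  only zeros.  So the matrix of its image has only finitely many eigenlines, and the images of the coordinate
  points are among them.  The fields of the diagonal matrix units vanish at the coordinate points as well, so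
  that their images are diagonal in the frame of these eigenlines.\<close>

theorem diagonal_poisson_iff:
  fixes \<tau> :: "'n::finite bivector"
  assumes n: "CARD('n) \<ge> 2"
  shows "is_diagonal_poisson \<tau> \<longleftrightarrow>
    (\<exists>g h c. h ** g = mat 1 \<and> g ** h = mat 1 \<and> transpose c = - c \<and> \<tau> = diagonal_bivector g h c)"
proof
  assume "is_diagonal_poisson \<tau>"
  then obtain f \<sigma> where \<tau>: "is_poisson \<tau>" and f: "proj_automorphism f" and \<sigma>: "extends_diagonal \<sigma>"
    and push: "pushes_forward f \<sigma> \<tau>" unfolding is_diagonal_poisson_def by blast
  interpret automorphism f by unfold_locales (rule f)
  obtain c :: "complex ^ 'n ^ 'n" where c: "transpose c = - c" "\<And>x. \<sigma> None x = (\<chi> i j. c $ i $ j * x $ i * x $ j)"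
    and \<sigma>V: "\<sigma> \<in> bivector_fields" using \<sigma> unfolding extends_diagonal_def by blast
  have \<sigma>_eq: "\<sigma> = field_bivector c (\<lambda>a. diag_unit (Some a))"
  proof (rule bivector_eqI[OF \<sigma>V field_bivector_in_bivector_fields[OF c(1)]])
    show "\<sigma> None x = field_bivector c (\<lambda>a. diag_unit (Some a)) None x" for x
      using diagonal_bivector_one_None[of c x] c(2) by (simp add: diagonal_bivector_def)
  qed
  obtain \<theta> :: "'n option \<Rightarrow> nat" where \<theta>: "inj \<theta>" using finite_imp_inj_to_nat_seg[of "UNIV :: 'n option set"] by auto
  define H :: "complex ^ 'n option ^ 'n option" where "H = (\<chi> i j. if i = j then of_nat (\<theta> i) else 0)"
  have Hv: "(H *v z) $ i = of_nat (\<theta> i) * z $ i" for z i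
  proof -
    have "(H *v z) $ i = (\<Sum>j\<in>UNIV. if i = j then of_nat (\<theta> j) * z $ j else 0)"
      unfolding matrix_vector_mult_def H_def vec_lambda_beta by (rule sum.cong) auto
    then show ?thesis by simp
  qed
  obtain YH where YH: "\<And>k l x. x \<in> chart_domain f k l \<Longrightarrow>
    complex_jacobian (chart_expr f k l) x *v linear_field H k x = linear_field YH l (chart_expr f k l x)"
    using pushes_linear_field[OF n, of H] by blast
  have "\<forall>b. \<exists>Y. \<forall>k l. \<forall>x\<in>chart_domain f k l.
    complex_jacobian (chart_expr f k l) x *v linear_field (diag_unit b) k x = linear_field Y l (chart_expr f k l x)"
    using pushes_linear_field[OF n] by blast
  from choice[OF this] obtain Y where "\<forall>b. \<forall>k l. \<forall>x\<in>chart_domain f k l.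
    complex_jacobian (chart_expr f k l) x *v linear_field (diag_unit b) k x = linear_field (Y b) l (chart_expr f k l x)"
    by (rule exE)
  then have Y: "complex_jacobian (chart_expr f k l) x *v linear_field (diag_unit b) k x = linear_field (Y b) l (chart_expr f k l x)"
    if "x \<in> chart_domain f k l" for b k l x using that by blast
  have zH: "field_zeros YH = f ` field_zeros H" by (rule image_field_zeros[OF YH, symmetric])
  have zY: "field_zeros (Y b) = f ` field_zeros (diag_unit b)" for b by (rule image_field_zeros[OF Y, symmetric])
  let ?e = "\<lambda>a. axis a 1 :: complex ^ 'n option"
  have e0: "?e a \<noteq> 0" for a by (simp add: axis_eq_0_iff)
  have e_proj: "proj_class (*s) (?e a) \<in> proj_space" for a
    unfolding proj_space_def projectivization_def using e0 by blast
  have He: "H *v ?e a = of_nat (\<theta> a) *s ?e a" for a by (auto simp: vec_eq_iff Hv axis_def)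
  have de: "diag_unit b *v ?e a = (if a = b then 1 else 0) *s ?e a" for a b
    by (auto simp: vec_eq_iff diag_unit_mult axis_def)
  have eH: "proj_class (*s) (?e a) \<in> field_zeros H" for a unfolding field_zeros_def using He e0 by blast
  have eD: "proj_class (*s) (?e a) \<in> field_zeros (diag_unit b)" for a b unfolding field_zeros_def using de e0 by blast
  have "field_zeros H \<subseteq> range (\<lambda>a. proj_class (*s) (?e a))"
  proof
    fix p assume "p \<in> field_zeros H"
    then obtain z \<mu> where z: "p = proj_class (*s) z" "z \<noteq> 0" "H *v z = \<mu> *s z" unfolding field_zeros_def by blast
    obtain a where a: "z $ a \<noteq> 0" using z(2) by (auto simp: vec_eq_iff)
    have comp: "of_nat (\<theta> i) * z $ i = \<mu> * z $ i" for i using arg_cong[OF z(3), of "\<lambda>v. v $ i"] by (simp add: Hv)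
    have "z $ i = 0" if "i \<noteq> a" for i
      using comp[of i] comp[of a] a that \<theta> by (auto simp: inj_def)
    then have "z = z $ a *s ?e a" by (auto simp: vec_eq_iff axis_def)
    then have "p = proj_class (*s) (?e a)" using z(1) proj_class_scale[OF a, of "?e a"] by simp
    then show "p \<in> range (\<lambda>a. proj_class (*s) (?e a))" by blast
  qed
  then have "finite (field_zeros H)" by (rule finite_subset) simp
  then have fin: "finite (field_zeros YH)" unfolding zH by (rule finite_imageI)
  have "\<forall>a. \<exists>z. z \<noteq> 0 \<and> f (proj_class (*s) (?e a)) = proj_class (*s) z"
  proof
    fix a
    have "f (proj_class (*s) (?e a)) \<in> proj_space" using f_bij e_proj by (auto simp: bij_betw_def)
    then show "\<exists>z. z \<noteq> 0 \<and> f (proj_class (*s) (?e a)) = proj_class (*s) z"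
      unfolding proj_space_def projectivization_def by blast
  qed
  from choice[OF this] obtain q where q: "\<And>a. q a \<noteq> 0" "\<And>a. f (proj_class (*s) (?e a)) = proj_class (*s) (q a)"
    by blast
  have "proj_class (*s) (q a) \<in> field_zeros YH" for a unfolding zH q(2)[symmetric] by (rule imageI[OF eH])
  then have "\<forall>a. \<exists>\<mu>. YH *v q a = \<mu> *s q a" using field_zeros_eigenvector by blast
  from choice[OF this] obtain \<mu> where \<mu>: "\<And>a. YH *v q a = \<mu> a *s q a" by blast
  have "proj_class (*s) (q a) \<in> field_zeros (Y b)" for a b unfolding zY q(2)[symmetric] by (rule imageI[OF eD])
  then have ev: "\<exists>n. Y b *v q a = n *s q a" for a b by (rule field_zeros_eigenvector)
  define \<nu> where "\<nu> b a = (SOME n. Y b *v q a = n *s q a)" for b a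
  have \<nu>: "Y b *v q a = \<nu> b a *s q a" for a b unfolding \<nu>_def by (rule someI_ex[OF ev])
  have "inj (\<lambda>a. proj_class (*s) (q a))"
  proof (rule injI)
    fix a b assume "proj_class (*s) (q a) = proj_class (*s) (q b)"
    then have "f (proj_class (*s) (?e a)) = f (proj_class (*s) (?e b))" unfolding q(2) .
    then have "proj_class (*s) (?e a) = proj_class (*s) (?e b)"
      by (rule inj_onD[OF bij_betw_imp_inj_on[OF f_bij] _ e_proj e_proj])
    then obtain s where "s \<noteq> 0" "?e a = s *s ?e b" by (rule proj_class_eqE)
    from this(2) have "?e a $ a = (s *s ?e b) $ a" by simp
    then show "a = b" by (auto simp: axis_def split: if_splits)
  qed
  from finite_field_zeros_distinct_eigenvalues[OF fin q(1) \<mu> this] have inj\<mu>: "inj \<mu>" .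
  define g where "g = (\<chi> i a. q a $ i)"
  have gv: "g *v v = (\<Sum>a\<in>UNIV. v $ a *s q a)" for v
    by (simp add: vec_eq_iff g_def matrix_vector_mult_def mult.commute)
  have "\<forall>v. g *v v = 0 \<longrightarrow> v = 0"
    using eigenvectors_independent[OF q(1) \<mu> inj\<mu>] by (simp add: gv vec_eq_iff)
  then obtain h where hg: "h ** g = mat 1" using matrix_left_invertible_ker by blast
  then have gh: "g ** h = mat 1" using matrix_left_right_inverse by blast
  let ?P = "\<lambda>c. g ** diag_unit c ** h"
  have Pz: "?P c *v z = (h *v z) $ c *s q c" for c z
  proof -
    have "diag_unit c *v w = w $ c *s ?e c" for w by (auto simp: vec_eq_iff diag_unit_mult axis_def)
    moreover have "g *v ?e c = q c" by (simp add: gv axis_def if_distrib if_distribR vec_eq_iff cong: if_cong)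
    ultimately show ?thesis by (simp add: matrix_vector_mul_assoc[symmetric] matrix_vector_scale)
  qed
  have zexp: "z = (\<Sum>c\<in>UNIV. (h *v z) $ c *s q c)" for z
    unfolding gv[symmetric] by (simp add: matrix_vector_mul_assoc gh)
  have "linear_field (Y b) k x = (\<Sum>a\<in>UNIV. (\<nu> b (Some a) - \<nu> b None) *s linear_field (?P (Some a)) k x)" for b k x
  proof (rule linear_field_combination)
    show "(\<Sum>c\<in>UNIV. ?P c *v z) = z" for z unfolding Pz by (rule zexp[symmetric])
    show "Y b *v z = (\<Sum>c\<in>UNIV. \<nu> b c *s (?P c *v z))" for z
      by (subst zexp[of z]) (simp add: matrix_vector_sum matrix_vector_scale \<nu> Pz vector_smult_assoc mult.commute)
  qed
  note comb = this
  let ?c = "\<chi> p q. \<Sum>a\<in>UNIV. \<Sum>b\<in>UNIV. c $ a $ b * ((\<nu> (Some a) (Some p) - \<nu> (Some a) None) * (\<nu> (Some b) (Some q) - \<nu> (Some b) None))"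
  have rec: "field_bivector c (\<lambda>a. Y (Some a)) = diagonal_bivector g h ?c"
    unfolding diagonal_bivector_def by (rule field_bivector_recombine[where \<nu> = "\<lambda>b a. \<nu> (Some b) (Some a) - \<nu> (Some b) None"]) (rule comb)
  have "\<tau> = field_bivector c (\<lambda>a. Y (Some a))"
  proof (rule bivector_eqI[OF _ field_bivector_in_bivector_fields[OF c(1)]])
    show "\<tau> \<in> bivector_fields" using \<tau> by (simp add: is_poisson_def)
    fix y
    obtain k x where k: "f (affine_point k x) = affine_point None y" using source_point by blast
    have d: "x \<in> chart_domain f k None" "chart_expr f k None x = y" using chart_exprI[of f k x None y, OF k] by auto
    have "\<tau> None (chart_expr f k None x) = complex_jacobian (chart_expr f k None) x ** \<sigma> k x **
        transpose (complex_jacobian (chart_expr f k None) x)"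
      using push d(1) unfolding pushes_forward_def by blast
    also have "\<dots> = field_bivector c (\<lambda>a. Y (Some a)) None (chart_expr f k None x)"
      unfolding \<sigma>_eq field_bivector_def congruence_sum Y[OF d(1)] ..
    finally show "\<tau> None y = field_bivector c (\<lambda>a. Y (Some a)) None y" by (simp add: d(2))
  qed
  then have "\<tau> = diagonal_bivector g h ?c" using rec by simp
  then show "\<exists>g h c. h ** g = mat 1 \<and> g ** h = mat 1 \<and> transpose c = - c \<and> \<tau> = diagonal_bivector g h c"
    by (intro exI conjI) (rule hg, rule gh, rule recombine_skew[OF c(1)], assumption)
next
  assume "\<exists>g h c. h ** g = mat 1 \<and> g ** h = mat 1 \<and> transpose c = - c \<and> \<tau> = diagonal_bivector g h c"
  then show "is_diagonal_poisson \<tau>"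
    by (elim exE conjE) (simp add: is_diagonal_poisson_diagonal_bivector)
qed

section \<open>Infinitesimal deformations of a generic diagonal Poisson structure\<close>

text \<open>A finite set that contains all weights of global bivector fields.\<close>

definition admissible_weights :: "('n::finite \<Rightarrow> int) set" where
  "admissible_weights = {u. \<forall>i. -1 \<le> u i \<and> u i \<le> int CARD('n) + 1}"

lemma finite_admissible_weights: "finite (admissible_weights :: ('n::finite \<Rightarrow> int) set)"
proof (rule finite_subset)
  show "admissible_weights \<subseteq> PiE UNIV (\<lambda>_ :: 'n. {-1..int CARD('n) + 1})"
    by (auto simp: admissible_weights_def)
  show "finite (PiE UNIV (\<lambda>_ :: 'n. {-1..int CARD('n) + 1}))" by (rule finite_PiE) simp_all
qed

definition contract :: "complex ^ 'n ^ 'n \<Rightarrow> ('n::finite \<Rightarrow> int) \<Rightarrow> 'n \<Rightarrow> complex" where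
  "contract c u l = (\<Sum>j\<in>UNIV. c $ l $ j * of_int (u j))"

text \<open>The two kinds of nonvanishing that are used to solve \<open>v \<and> B\<^sub>u = 0\<close>: \<open>contract c u\<close> is the vector \<open>v\<close>.\<close>

definition generic :: "complex ^ 'n ^ 'n \<Rightarrow> bool" where
  "generic c \<longleftrightarrow> (\<forall>u\<in>admissible_weights. \<forall>i l. u i = -1 \<longrightarrow> l \<noteq> i \<longrightarrow> contract c u l \<noteq> 0 \<and>
     (\<forall>l'. l' \<noteq> i \<longrightarrow> l' \<noteq> l \<longrightarrow> contract c u l \<noteq> contract c u l'))"

definition skew_part :: "real ^ 'n ^ 'n \<Rightarrow> complex ^ 'n ^ 'n" where
  "skew_part w = (\<chi> i j. complex_of_real (w $ i $ j - w $ j $ i))"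

lemma contract_skew_part_unit:
  fixes i l l' :: "'n::finite"
  assumes "l \<noteq> i"
  defines "w \<equiv> (\<chi> p q. if p = l \<and> q = i then 1 else 0) :: real ^ 'n ^ 'n"
  shows "contract (skew_part w) u l = of_int (u i)"
    and "l' \<noteq> i \<Longrightarrow> l' \<noteq> l \<Longrightarrow> contract (skew_part w) u l' = 0"
proof -
  have of_bool: "complex_of_real ((if a then 1 else 0) - (if b then 1 else 0)) = (if a then 1 else 0) - (if b then 1 else 0)" for a b
    by (cases a; cases b) simp_all
  have e: "skew_part w $ p $ j = (if p = l \<and> j = i then 1 else 0) - (if j = l \<and> p = i then 1 else 0)" for p j
    unfolding skew_part_def w_def vec_lambda_beta by (rule of_bool)
  have "contract (skew_part w) u l = (\<Sum>j\<in>UNIV. if j = i then of_int (u j) else 0)"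
    unfolding contract_def by (rule sum.cong) (simp_all add: e assms(1))
  then show "contract (skew_part w) u l = of_int (u i)" by simp
  show "contract (skew_part w) u l' = 0" if "l' \<noteq> i" "l' \<noteq> l"
    unfolding contract_def by (intro sum.neutral) (simp add: e that)
qed

text \<open>Genericity excludes finitely many hyperplanes in the space of real skew matrices, and none of them is
  the whole space: the entry \<open>c $ l $ i\<close> can be varied alone.\<close>

lemma generic_exists: "\<exists>c :: complex ^ 'n ^ 'n::finite. transpose c = - c \<and> generic c"
proof -
  let ?f = "\<lambda>(u, l, l', s) w. contract (skew_part w) u l - (if s then contract (skew_part w) u l' else 0)"
  let ?L = "{(u, l, l', s). u \<in> admissible_weights \<and> (\<exists>i. u i = -1 \<and> l \<noteq> i \<and> l' \<noteq> i) \<and> (s \<longrightarrow> l \<noteq> l')} :: (('n \<Rightarrow> int) \<times> 'n \<times> 'n \<times> bool) set"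
  have "\<exists>w. \<forall>a\<in>?L. ?f a w \<noteq> 0"
  proof (rule avoid_hyperplanes)
    show "finite ?L"
      by (rule finite_subset[of _ "admissible_weights \<times> UNIV"]) (auto simp: finite_admissible_weights)
    have lc: "contract (skew_part (v + w)) u l = contract (skew_part v) u l + contract (skew_part w) u l"
      "contract (skew_part (r *\<^sub>R v)) u l = r *\<^sub>R contract (skew_part v) u l" for v w u l r
      by (simp_all add: contract_def skew_part_def algebra_simps sum.distrib sum_subtractf scaleR_sum_right
          scaleR_conv_of_real[where 'a = complex] sum_distrib_left)
    show "linear (?f a)" for a
    proof (rule linearI)
      show "?f a (v + w) = ?f a v + ?f a w" for v w by (cases a) (simp add: lc)
      show "?f a (r *\<^sub>R v) = r *\<^sub>R ?f a v" for r v by (cases a) (simp add: lc scaleR_diff_right)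
    qed
    fix a assume aL: "a \<in> ?L"
    obtain u l l' s where a: "a = (u, l, l', s)" by (rule prod_cases4)
    have "(u, l, l', s) \<in> ?L" using aL unfolding a .
    then have ex: "\<exists>i. u i = -1 \<and> l \<noteq> i \<and> l' \<noteq> i" and s: "s \<longrightarrow> l \<noteq> l'" by simp_all
    from ex obtain i where "u i = -1 \<and> l \<noteq> i \<and> l' \<noteq> i" by (rule exE)
    then have i: "u i = -1" "l \<noteq> i" "l' \<noteq> i" by - (erule conjE | assumption)+
    define w :: "real ^ 'n ^ 'n" where "w = (\<chi> p q. if p = l \<and> q = i then 1 else 0)"
    have 1: "contract (skew_part w) u l = -1"
      unfolding w_def contract_skew_part_unit(1)[OF i(2)] i(1) by simp
    have 2: "(if s then contract (skew_part w) u l' else 0) = 0"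
    proof (cases s)
      case True
      then have "l' \<noteq> l" using s by auto
      then show ?thesis using contract_skew_part_unit(2)[OF i(2,3)] unfolding w_def by simp
    qed simp
    have "?f a w = -1" unfolding a prod.case 1 2 by simp
    then have "?f a w \<noteq> 0" by simp
    then show "\<exists>w. ?f a w \<noteq> 0" by (rule exI)
  qed
  then obtain w where w: "\<forall>a\<in>?L. ?f a w \<noteq> 0" by blast
  have "transpose (skew_part w) = - skew_part w" by (simp add: skew_part_def transpose_def vec_eq_iff)
  moreover have "generic (skew_part w)"
    unfolding generic_def
  proof (intro ballI allI impI conjI)
    fix u :: "'n \<Rightarrow> int" and i l assume u: "u \<in> admissible_weights" "u i = -1" "l \<noteq> i"
    show "contract (skew_part w) u l \<noteq> 0" using bspec[OF w, of "(u, l, l, False)"] u by auto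
    fix l' assume "l' \<noteq> i" "l' \<noteq> l"
    then show "contract (skew_part w) u l \<noteq> contract (skew_part w) u l'" using bspec[OF w, of "(u, l, l', True)"] u by auto
  qed
  ultimately show ?thesis by blast
qed

text \<open>The logarithmic vector field of the homogeneous coordinate \<open>c\<close> in affine coordinates.\<close>

definition log_vector :: "'n option \<Rightarrow> 'n \<Rightarrow> complex" where
  "log_vector c a = (case c of None \<Rightarrow> -1 | Some i \<Rightarrow> if a = i then 1 else 0)"

definition root_weight :: "'n option \<Rightarrow> 'n option \<Rightarrow> 'n \<Rightarrow> int" where
  "root_weight a c = (\<lambda>i. coord_weight c i - coord_weight a i)"

lemma coord_weight_apply: "coord_weight c i = (if c = Some i then 1 else 0)"
  by (cases c) (auto simp: coord_weight_def unit_weight_def)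

text \<open>In homogeneous coordinates the weight becomes a vector of sum 0 with all entries at least -1.  It has an
  entry -1; if this is the only one, then the others are nonnegative with sum 1.\<close>

lemma weight_cases:
  fixes u :: "'n::finite \<Rightarrow> int"
  assumes ge: "\<And>i. u i \<ge> -1" and le: "(\<Sum>i\<in>UNIV. u i) \<le> 1" and nz: "u \<noteq> (\<lambda>_. 0)"
  shows "(\<exists>a c. a \<noteq> c \<and> u = root_weight a c) \<or> (\<exists>i j. i \<noteq> j \<and> u i = -1 \<and> u j = -1) \<or>
    (\<exists>i. u i = -1 \<and> (\<Sum>i\<in>UNIV. u i) = 1)"
proof -
  (* The exponents of the homogeneous coordinates. *)
  define h where "h c = (case c of None \<Rightarrow> - (\<Sum>i\<in>UNIV. u i) | Some i \<Rightarrow> u i)" for c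
  have hs: "(\<Sum>c\<in>UNIV. h c) = 0"
    by (simp add: UNIV_option_conv sum.reindex h_def)
  have hge: "h c \<ge> -1" for c using ge le by (cases c) (auto simp: h_def)
  have "\<exists>a. h a = -1"
  proof (rule ccontr)
    assume "\<nexists>a. h a = -1"
    have h0: "h c \<ge> 0" for c
    proof -
      have "h c \<noteq> -1" using \<open>\<nexists>a. h a = -1\<close> by simp
      then show ?thesis using hge[of c] by linarith
    qed
    have "\<forall>c\<in>UNIV. h c = 0" using hs h0 by (subst sum_nonneg_eq_0_iff[symmetric]) simp_all
    then have hz: "h c = 0" for c by simp
    have "u i = 0" for i using hz[of "Some i"] by (simp add: h_def)
    then have "u = (\<lambda>_. 0)" by (rule HOL.ext)
    then show False using nz by simp
  qed
  then obtain a where a: "h a = -1" by blast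
  show ?thesis
  proof (cases "\<exists>b. b \<noteq> a \<and> h b = -1")
    case True
    then obtain b where b: "b \<noteq> a" "h b = -1" by (elim exE conjE)
    show ?thesis
    proof (cases a)
      case None
      then obtain i where "b = Some i" using b(1) by (cases b) simp_all
      then have "u i = -1 \<and> (\<Sum>i\<in>UNIV. u i) = 1" using None a b(2) by (simp add: h_def)
      then show ?thesis by (intro disjI2 exI)
    next
      case (Some i)
      then have i: "u i = -1" using a by (simp add: h_def)
      show ?thesis
      proof (cases b)
        case None
        then have "u i = -1 \<and> (\<Sum>i\<in>UNIV. u i) = 1" using i b(2) by (simp add: h_def)
        then show ?thesis by (intro disjI2 exI)
      next
        case (Some j)
        then have "i \<noteq> j \<and> u i = -1 \<and> u j = -1" using i b \<open>a = Some i\<close> by (simp add: h_def)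
        then have "\<exists>i j. i \<noteq> j \<and> u i = -1 \<and> u j = -1" by (intro exI)
        then show ?thesis by (intro disjI2 disjI1)
      qed
    qed
  next
    case False
    have h0: "h c \<ge> 0" if "c \<noteq> a" for c
    proof -
      have "h c \<noteq> -1" using False that by blast
      then show ?thesis using hge[of c] by linarith
    qed
    have s: "(\<Sum>c\<in>UNIV - {a}. h c) = 1" using hs a by (simp add: sum.remove[of UNIV a])
    have "\<exists>c\<in>UNIV - {a}. h c \<noteq> 0"
    proof (rule ccontr)
      assume "\<not> (\<exists>c\<in>UNIV - {a}. h c \<noteq> 0)"
      then have "(\<Sum>c\<in>UNIV - {a}. h c) = 0" by (intro sum.neutral) simp
      then show False using s by simp
    qed
    then obtain c where c: "c \<noteq> a" "h c \<noteq> 0" by (elim bexE) simp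
    have "(\<Sum>c\<in>UNIV - {a}. h c) = h c + (\<Sum>d\<in>UNIV - {a} - {c}. h d)" using c by (simp add: sum.remove)
    moreover have "(\<Sum>d\<in>UNIV - {a} - {c}. h d) \<ge> 0" by (rule sum_nonneg) (use h0 in auto)
    ultimately have hc: "h c = 1" "(\<Sum>d\<in>UNIV - {a} - {c}. h d) = 0" using s c h0[of c] by linarith+
    have "\<forall>d\<in>UNIV - {a} - {c}. h d = 0"
      using hc(2) h0 by (subst sum_nonneg_eq_0_iff[symmetric]) simp_all
    then have hd: "h d = 0" if "d \<noteq> a" "d \<noteq> c" for d using that by simp
    have "u i = root_weight a c i" for i
    proof -
      have "u i = h (Some i)" by (simp add: h_def)
      also have "\<dots> = root_weight a c i"
      proof (cases "Some i = a")
        case True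
        then show ?thesis using a c(1) by (simp add: root_weight_def coord_weight_apply)
      next
        case F: False
        show ?thesis
        proof (cases "Some i = c")
          case True
          then show ?thesis using hc(1) c(1) by (simp add: root_weight_def coord_weight_apply)
        next
          case False
          then show ?thesis using hd[OF F False] F by (auto simp: root_weight_def coord_weight_apply)
        qed
      qed
      finally show ?thesis .
    qed
    then have "u = root_weight a c" by (rule HOL.ext)
    moreover have "a \<noteq> c" using c(1) by simp
    ultimately have "\<exists>a c. a \<noteq> c \<and> u = root_weight a c" by (intro exI conjI)
    then show ?thesis by (rule disjI1)
  qed
qed

lemma root_weight_admissible: "root_weight a c \<in> admissible_weights"
  by (auto simp: admissible_weights_def root_weight_def coord_weight_apply)

lemma root_weight_inj:
  assumes "a \<noteq> c" "root_weight a c = root_weight a' c'" "a' \<noteq> c'"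
  shows "a = a' \<and> c = c'"
proof -
  have e: "(if c = Some i then 1 else 0) - (if a = Some i then 1 else 0 :: int) =
      (if c' = Some i then 1 else 0) - (if a' = Some i then 1 else 0)" for i
    using fun_cong[OF assms(2), of i] by (simp add: root_weight_def coord_weight_apply)
  have "a = Some i \<longleftrightarrow> a' = Some i" "c = Some i \<longleftrightarrow> c' = Some i" for i
    using e[of i] assms(1,3) by (auto split: if_splits)
  then show ?thesis by (metis not_None_eq)
qed

lemma bivector_weight_admissible:
  fixes B :: "'n::finite \<Rightarrow> 'n \<Rightarrow> complex" and u :: "'n \<Rightarrow> int"
  assumes skew: "\<And>a b. B b a = - B a b" and nn: "\<And>a b i. B a b \<noteq> 0 \<Longrightarrow> 0 \<le> u i + (unit_weight a i + unit_weight b i)"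
    and deg: "\<And>a b. B a b \<noteq> 0 \<Longrightarrow> (\<Sum>i\<in>UNIV. u i) \<le> 1" and Bnz: "B a0 b0 \<noteq> 0"
  shows "u \<in> admissible_weights"
proof -
  have ge: "u i \<ge> -1" for i
  proof -
    have "a0 \<noteq> b0"
    proof
      assume "a0 = b0"
      then have "B a0 b0 = - B a0 b0" using skew[of a0 b0] by simp
      then show False using Bnz by simp
    qed
    then show ?thesis using nn[OF Bnz, of i] by (auto simp: unit_weight_def split: if_splits)
  qed
  have le: "(\<Sum>i\<in>UNIV. u i) \<le> 1" by (rule deg[OF Bnz])
  show ?thesis
    unfolding admissible_weights_def
  proof (intro CollectI allI conjI ge)
    fix i
    have "(\<Sum>i\<in>UNIV. u i) = u i + (\<Sum>j\<in>UNIV - {i}. u j)" by (simp add: sum.remove)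
    moreover have "(\<Sum>j\<in>UNIV - {i}. u j) \<ge> (\<Sum>j\<in>UNIV - {i}. -1)" by (rule sum_mono) (rule ge)
    moreover have "(\<Sum>j\<in>UNIV - {i}. - 1 :: int) \<ge> - int CARD('n)" by simp
    ultimately show "u i \<le> int CARD('n) + 1" using le by linarith
  qed
qed

text \<open>If \<open>u i = -1\<close>, then regularity along \<open>x $ i = 0\<close> makes \<open>B\<close> divisible by the \<open>i\<close>-th basis vector, and
  for total degree 1 the same holds with the hyperplane at infinity and the vector \<open>(-1, ..., -1)\<close>.  Two such
  divisibilities determine \<open>B\<close> up to a factor, and then \<open>v \<and> B = 0\<close> forces \<open>B = 0\<close> as \<open>v\<close> is generic; a third
  index is needed here.  With one of them, \<open>B\<close> is divisible by that vector and by \<open>v\<close>, so it is a multiple of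
  their product, and the weight is a root.\<close>

theorem tangent_weight:
  fixes B :: "'n::finite \<Rightarrow> 'n \<Rightarrow> complex" and u :: "'n \<Rightarrow> int"
  assumes n: "CARD('n) \<ge> 3" and gen: "generic c" and cskew: "transpose c = - c"
    and skew: "\<And>a b. B b a = - B a b" and nn: "\<And>a b i. B a b \<noteq> 0 \<Longrightarrow> 0 \<le> u i + (unit_weight a i + unit_weight b i)"
    and deg: "\<And>a b. B a b \<noteq> 0 \<Longrightarrow> (\<Sum>i\<in>UNIV. u i) \<le> 1"
    and top: "\<And>a b m. (\<Sum>i\<in>UNIV. u i) = 1 \<Longrightarrow> B a b = B m b + B a m"
    and tangent: "\<And>i j m. contract c u i * B j m + contract c u j * B m i + contract c u m * B i j = 0"
    and nz: "u \<noteq> (\<lambda>_. 0)" and Bnz: "B a0 b0 \<noteq> 0"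
  shows "\<exists>a d \<kappa>. a \<noteq> d \<and> u = root_weight a d \<and>
    (\<forall>i j. B i j = \<kappa> * (contract c u i * log_vector a j - contract c u j * log_vector a i))"
proof -
  let ?v = "contract c u"
  have diag: "B a a = 0" for a
  proof -
    have "B a a = - B a a" by (rule skew)
    then show ?thesis by simp
  qed
  have adm: "u \<in> admissible_weights" by (rule bivector_weight_admissible[where B = B and u = u, OF skew nn deg Bnz])
  have ge: "u i \<ge> -1" for i using adm by (simp add: admissible_weights_def)
  have le: "(\<Sum>i\<in>UNIV. u i) \<le> 1" by (rule deg[OF Bnz])
  have R1: "B j l = 0" if "u i = -1" "j \<noteq> i" "l \<noteq> i" for i j l
    using nn[of j l i] that by (auto simp: unit_weight_def)
  have v0: "?v l \<noteq> 0" if "u i = -1" "l \<noteq> i" for i l using gen adm that unfolding generic_def by simp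
  have v1: "?v l \<noteq> ?v l'" if "u i = -1" "l \<noteq> i" "l' \<noteq> i" "l' \<noteq> l" for i l l' using gen adm that unfolding generic_def by simp
  have third: "\<exists>l. l \<noteq> i \<and> l \<noteq> j" for i j :: 'n
  proof -
    have "card {i, j} \<le> 2" by (cases "i = j") simp_all
    then have "{i, j} \<noteq> UNIV" using n by (intro notI) simp
    then show ?thesis by auto
  qed
  from weight_cases[OF ge le nz] show ?thesis
  proof (elim disjE exE conjE)
    fix i j assume two: "i \<noteq> j" "u i = -1" "u j = -1"
    obtain l where l: "l \<noteq> i" "l \<noteq> j" using third by blast
    have "B j l = 0" "B l i = 0" using R1[OF two(2), of j l] R1[OF two(3), of l i] two l by auto
    then have "?v l * B i j = 0" using tangent[of i j l] by simp
    then have ij: "B i j = 0" using v0[OF two(2) l(1)] by simp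
    have "B p q = 0" for p q
    proof (cases "(p = i \<and> q = j) \<or> (p = j \<and> q = i)")
      case True
      then show ?thesis using ij skew[of i j] by auto
    next
      case False
      then show ?thesis using R1[OF two(2), of p q] R1[OF two(3), of p q] diag[of p] two(1) by (cases "p = q") auto
    qed
    then show ?thesis using Bnz by simp
  next
    fix i assume inf: "u i = -1" "(\<Sum>i\<in>UNIV. u i) = 1"
    have const: "B i p = B i q" if "p \<noteq> i" "q \<noteq> i" for p q
    proof -
      have "B p q = 0" by (rule R1[OF inf(1) that])
      then show ?thesis using top[OF inf(2), of p q i] skew[of p i] by simp
    qed
    obtain p where p: "p \<noteq> i" using third by blast
    obtain q where q: "q \<noteq> i" "q \<noteq> p" using third by blast
    have "?v p * B q i + ?v q * B i p = 0" using tangent[of i p q] R1[OF inf(1) p q(1)] by simp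
    then have "(?v q - ?v p) * B i p = 0" using const[OF p q(1)] skew[of i q] by (simp add: algebra_simps)
    then have ip: "B i p = 0" using v1[OF inf(1) p q] by auto
    have "B r s = 0" for r s
    proof (cases "r = i")
      case True
      then show ?thesis using const[OF p, of s] ip diag by (cases "s = i") auto
    next
      case False
      then show ?thesis using R1[OF inf(1), of r s] const[OF p, of r] ip skew[of i r] by (cases "s = i") auto
    qed
    then show ?thesis using Bnz by simp
  next
    fix a d assume root: "a \<noteq> d" "u = root_weight a d"
    show ?thesis
    proof (cases a)
      case (Some i)
      then have ui: "u i = -1" using root by (auto simp: root_weight_def coord_weight_apply)
      obtain l where l: "l \<noteq> i" using third by blast
      have factor: "B i j = B i l / ?v l * ?v j" if "j \<noteq> i" for j
      proof -
        have "?v j * B l i + ?v l * B i j = 0" using tangent[of i j l] R1[OF ui that l] by simp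
        then have "?v l * B i j = ?v j * B i l" using skew[of i l] by (simp add: add_eq_0_iff)
        then show ?thesis using v0[OF ui l] by (simp add: field_simps)
      qed
      have "B p q = - (B i l / ?v l) * (?v p * log_vector a q - ?v q * log_vector a p)" for p q
      proof (cases "p = i")
        case True
        then show ?thesis using factor[of q] diag Some by (cases "q = i") (auto simp: log_vector_def)
      next
        case False
        then show ?thesis
          by (cases "q = i") (simp_all add: log_vector_def skew[of p i] factor[of p] R1[OF ui False] Some)
      qed
      then show ?thesis using root by (intro exI conjI allI)
    next
      case None
      then obtain d' where d: "d = Some d'" using root(1) by (cases d) auto
      have u: "u = unit_weight d'" using root None d by (auto simp: root_weight_def coord_weight_def fun_eq_iff)
      have s1: "(\<Sum>i\<in>UNIV. u i) = 1" unfolding u by (rule sum_unit_weight)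
      have vc: "?v l = c $ l $ d'" for l unfolding contract_def u by (simp add: unit_weight_def if_distrib cong: if_cong)
      have vd: "?v d' = 0" using skew_entry[OF cskew, of d' d'] by (simp add: vc)
      have vl: "?v l \<noteq> 0" if "l \<noteq> d'" for l
      proof -
        have "(\<lambda>i. - unit_weight d' i) \<in> admissible_weights" by (auto simp: admissible_weights_def unit_weight_def)
        then have "contract c (\<lambda>i. - unit_weight d' i) l \<noteq> 0"
          using gen that unfolding generic_def by (auto simp: unit_weight_def)
        moreover have "contract c (\<lambda>i. - unit_weight d' i) l = - ?v l" by (simp add: contract_def u sum_negf)
        ultimately show ?thesis by simp
      qed
      obtain l where l: "l \<noteq> d'" using third by blast
      have factor: "B d' j = B d' l / ?v l * ?v j" for j
      proof -
        have "?v j * B l d' + ?v l * B d' j = 0" using tangent[of d' j l] vd by simp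
        then have "?v l * B d' j = ?v j * B d' l" using skew[of d' l] by (simp add: add_eq_0_iff)
        then show ?thesis using vl[OF l] by (simp add: field_simps)
      qed
      have "B p q = (B d' l / ?v l) * (?v p * log_vector a q - ?v q * log_vector a p)" for p q
        using top[OF s1, of p q d'] factor[of q] factor[of p] skew[of p d'] None
        by (simp add: log_vector_def algebra_simps)
      then show ?thesis using root by (intro exI conjI allI)
    qed
  qed
qed

subsection \<open>The Schouten bracket on the torus\<close>

lemma laurent_monomial_partial:
  assumes x: "x \<in> torus"
  shows "((\<lambda>t. laurent_monomial w (x + t *s axis l 1)) has_field_derivative
    of_int (w l) * laurent_monomial w x / x $ l) (at 0)"
proof -
  have xl: "x $ l \<noteq> 0" using x by (simp add: torus_def)
  let ?r = "\<Prod>i\<in>UNIV - {l}. x $ i powi w i"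
  have split: "laurent_monomial w (x + t *s axis l 1) = (x $ l + t) powi w l * ?r" for t
  proof -
    have "laurent_monomial w (x + t *s axis l 1) = (x + t *s axis l 1) $ l powi w l * (\<Prod>i\<in>UNIV - {l}. (x + t *s axis l 1) $ i powi w i)"
      unfolding laurent_monomial_def by (rule prod.remove) auto
    also have "(\<Prod>i\<in>UNIV - {l}. (x + t *s axis l 1) $ i powi w i) = ?r"
      by (rule prod.cong) (auto simp: axis_def)
    finally show ?thesis by (simp add: axis_def)
  qed
  have "((\<lambda>t. (x $ l + t) powi w l * ?r) has_field_derivative of_int (w l) * (x $ l + 0) powi (w l - 1) * ?r) (at 0)"
    by (auto intro!: derivative_eq_intros simp: xl)
  moreover have "of_int (w l) * (x $ l + 0) powi (w l - 1) * ?r = of_int (w l) * laurent_monomial w x / x $ l"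
    using split[of 0] xl by (simp add: power_int_diff)
  ultimately show ?thesis unfolding split by simp
qed

lemma bivector_log_derivative:
  fixes U :: "('n::finite \<Rightarrow> int) set"
  assumes ex: "\<And>x. x \<in> torus \<Longrightarrow> f x = x $ j * x $ m * (\<Sum>u\<in>U. B u * laurent_monomial u x)" and x: "x \<in> torus"
  shows "x $ l * partial_deriv l f x = x $ j * x $ m *
    (\<Sum>u\<in>U. (of_int (u l) + of_int (unit_weight j l) + of_int (unit_weight m l)) * B u * laurent_monomial u x)"
proof -
  have xl: "x $ l \<noteq> 0" using x by (simp add: torus_def)
  let ?w = "\<lambda>u i. unit_weight j i + unit_weight m i + u i"
  have ex': "f y = (\<Sum>u\<in>U. B u * laurent_monomial (?w u) y)" if "y \<in> torus" for y
    unfolding ex[OF that] by (simp add: laurent_monomial_add[OF that] laurent_monomial_unit sum_distrib_left mult_ac)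
  have "((\<lambda>t. \<Sum>u\<in>U. B u * laurent_monomial (?w u) (x + t *s axis l 1)) has_field_derivative
      (\<Sum>u\<in>U. B u * (of_int (?w u l) * laurent_monomial (?w u) x / x $ l))) (at 0)"
    by (intro DERIV_sum DERIV_cmult laurent_monomial_partial x)
  then have "((\<lambda>t. f (x + t *s axis l 1)) has_field_derivative
      (\<Sum>u\<in>U. B u * (of_int (?w u l) * laurent_monomial (?w u) x / x $ l))) (at 0)"
  proof (rule has_field_derivative_transform_within_open[where S = "- {- x $ l}"])
    fix t assume "t \<in> - {- x $ l}"
    then have "x + t *s axis l 1 \<in> torus"
      using x unfolding torus_def by (auto simp: axis_def eq_neg_iff_add_eq_0 add.commute)
    then show "(\<Sum>u\<in>U. B u * laurent_monomial (?w u) (x + t *s axis l 1)) = f (x + t *s axis l 1)"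
      using ex' by simp
  qed (use xl in auto)
  then have "partial_deriv l f x = (\<Sum>u\<in>U. B u * (of_int (?w u l) * laurent_monomial (?w u) x / x $ l))"
    unfolding partial_deriv_def by (rule DERIV_imp_deriv)
  then have "x $ l * partial_deriv l f x = (\<Sum>u\<in>U. B u * (of_int (?w u l) * laurent_monomial (?w u) x))"
    using xl by (simp add: sum_distrib_left)
  also have "\<dots> = (\<Sum>u\<in>U. x $ j * x $ m *
      ((of_int (u l) + of_int (unit_weight j l) + of_int (unit_weight m l)) * B u * laurent_monomial u x))"
    by (intro sum.cong refl)
      (simp add: laurent_monomial_add[OF x] laurent_monomial_unit algebra_simps)
  finally show ?thesis by (simp add: sum_distrib_left)
qed

text \<open>In the frame \<open>x\<^sub>i \<partial>\<^sub>i\<close>, whose members commute, the field \<open>x\<^sub>l \<partial>\<^sub>l\<close> multiplies \<open>x\<^sup>u\<close> by \<open>u l\<close>.  All terms in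
  which the derivatives hit the frame cancel by skew-symmetry.\<close>

theorem schouten_diagonal:
  fixes U :: "('n::finite \<Rightarrow> int) set" and P Q :: "complex ^ 'n \<Rightarrow> complex ^ 'n ^ 'n"
  assumes U: "finite U" and c: "transpose c = - c" and P: "\<And>x. P x = (\<chi> i j. c $ i $ j * x $ i * x $ j)"
    and Q: "\<And>x i j. x \<in> torus \<Longrightarrow> Q x $ i $ j = x $ i * x $ j * (\<Sum>u\<in>U. B u i j * laurent_monomial u x)"
    and skew: "\<And>u a b. B u b a = - B u a b" and x: "x \<in> torus"
  shows "schouten P Q x i j m = x $ i * x $ j * x $ m *
    (\<Sum>u\<in>U. (contract c u i * B u j m + contract c u j * B u m i + contract c u m * B u i j) * laurent_monomial u x)"
proof -
  let ?lm = "\<lambda>u. laurent_monomial u x"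
  have cs: "c $ b $ a = - c $ a $ b" for a b by (rule skew_entry[OF c])
  have sdel: "(\<Sum>l\<in>UNIV. g l * of_int (unit_weight k l)) = g k" for g :: "'n \<Rightarrow> complex" and k
    by (simp add: unit_weight_def if_distrib cong: if_cong)
  have PQ: "(\<Sum>l\<in>UNIV. P x $ i $ l * partial_deriv l (\<lambda>y. Q y $ j $ m) x) = x $ i * x $ j * x $ m *
      (\<Sum>u\<in>U. (contract c u i + c $ i $ j + c $ i $ m) * B u j m * ?lm u)" for i j m
  proof -
    have "(\<Sum>l\<in>UNIV. P x $ i $ l * partial_deriv l (\<lambda>y. Q y $ j $ m) x) =
        (\<Sum>l\<in>UNIV. c $ i $ l * x $ i * (x $ l * partial_deriv l (\<lambda>y. Q y $ j $ m) x))"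
      by (simp add: P mult_ac)
    also have "\<dots> = (\<Sum>l\<in>UNIV. c $ i $ l * x $ i * (x $ j * x $ m *
        (\<Sum>u\<in>U. (of_int (u l) + of_int (unit_weight j l) + of_int (unit_weight m l)) * B u j m * ?lm u)))"
      by (subst bivector_log_derivative[where f = "\<lambda>y. Q y $ j $ m" and B = "\<lambda>u. B u j m", OF Q x]) simp_all
    also have "\<dots> = x $ i * x $ j * x $ m * (\<Sum>l\<in>UNIV. \<Sum>u\<in>U. (c $ i $ l * of_int (u l) +
        c $ i $ l * of_int (unit_weight j l) + c $ i $ l * of_int (unit_weight m l)) * (B u j m * ?lm u))"
      by (simp add: sum_distrib_left algebra_simps)
    also have "(\<Sum>l\<in>UNIV. \<Sum>u\<in>U. (c $ i $ l * of_int (u l) +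
        c $ i $ l * of_int (unit_weight j l) + c $ i $ l * of_int (unit_weight m l)) * (B u j m * ?lm u)) =
      (\<Sum>u\<in>U. (\<Sum>l\<in>UNIV. c $ i $ l * of_int (u l) + c $ i $ l * of_int (unit_weight j l) + c $ i $ l * of_int (unit_weight m l)) * (B u j m * ?lm u))"
      by (subst sum.swap) (simp add: sum_distrib_right)
    finally show ?thesis by (simp add: sum.distrib sdel contract_def mult.assoc)
  qed
  have P': "P y $ j $ m = y $ j * y $ m * (\<Sum>u\<in>{\<lambda>_. 0}. c $ j $ m * laurent_monomial u y)" for y j m
    by (simp add: P laurent_monomial_def)
  have QP: "(\<Sum>l\<in>UNIV. Q x $ i $ l * partial_deriv l (\<lambda>y. P y $ j $ m) x) = x $ i * x $ j * x $ m *
      (\<Sum>u\<in>U. c $ j $ m * (B u i j + B u i m) * ?lm u)" for i j m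
  proof -
    have "(\<Sum>l\<in>UNIV. Q x $ i $ l * partial_deriv l (\<lambda>y. P y $ j $ m) x) =
        (\<Sum>l\<in>UNIV. x $ i * (\<Sum>u\<in>U. B u i l * ?lm u) * (x $ l * partial_deriv l (\<lambda>y. P y $ j $ m) x))"
      by (simp add: Q[OF x] mult_ac)
    also have "\<dots> = (\<Sum>l\<in>UNIV. x $ i * (\<Sum>u\<in>U. B u i l * ?lm u) *
        (x $ j * x $ m * ((of_int (unit_weight j l) + of_int (unit_weight m l)) * c $ j $ m)))"
      by (subst bivector_log_derivative[where f = "\<lambda>y. P y $ j $ m" and B = "\<lambda>u. c $ j $ m", OF P' x]) (simp add: laurent_monomial_def)
    also have "\<dots> = x $ i * x $ j * x $ m * c $ j $ m * (\<Sum>l\<in>UNIV. (\<Sum>u\<in>U. B u i l * ?lm u) * of_int (unit_weight j l) + (\<Sum>u\<in>U. B u i l * ?lm u) * of_int (unit_weight m l))"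
      by (simp add: sum_distrib_left algebra_simps)
    also have "\<dots> = x $ i * x $ j * x $ m * c $ j $ m * ((\<Sum>u\<in>U. B u i j * ?lm u) + (\<Sum>u\<in>U. B u i m * ?lm u))"
      by (simp only: sum.distrib sdel)
    finally show ?thesis by (simp add: sum_distrib_left sum.distrib algebra_simps)
  qed
  have "schouten P Q x i j m = x $ i * x $ j * x $ m *
    (\<Sum>u\<in>U. ((contract c u i + c $ i $ j + c $ i $ m) * B u j m + c $ j $ m * (B u i j + B u i m)
      + (contract c u j + c $ j $ m + c $ j $ i) * B u m i + c $ m $ i * (B u j m + B u j i)
      + (contract c u m + c $ m $ i + c $ m $ j) * B u i j + c $ i $ j * (B u m i + B u m j)) * ?lm u)"
    unfolding schouten_def sum.distrib PQ QP by (simp add: sum.distrib sum_distrib_left algebra_simps)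
  also have "\<dots> = x $ i * x $ j * x $ m *
    (\<Sum>u\<in>U. (contract c u i * B u j m + contract c u j * B u m i + contract c u m * B u i j) * ?lm u)"
  proof -
    have "(contract c u i + c $ i $ j + c $ i $ m) * B u j m + c $ j $ m * (B u i j + B u i m)
      + (contract c u j + c $ j $ m + c $ j $ i) * B u m i + c $ m $ i * (B u j m + B u j i)
      + (contract c u m + c $ m $ i + c $ m $ j) * B u i j + c $ i $ j * (B u m i + B u m j) =
      contract c u i * B u j m + contract c u j * B u m i + contract c u m * B u i j" for u
      using cs[of j i] cs[of m i] cs[of m j] skew[of u j i] skew[of u m i] skew[of u m j] by (simp add: algebra_simps)
    then show ?thesis by simp
  qed
  finally show ?thesis .
qed

section \<open>The projective variety of Poisson structures\<close>

lemma bivector_fields_holomorphic: "\<sigma> \<in> bivector_fields \<Longrightarrow> holomorphic_at (\<lambda>y. \<sigma> k y $ i $ j) x"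
  by (simp add: bivector_fields_def)

lemma bivector_scale_apply: "bivector_scale c \<sigma> k x $ i $ j = c * \<sigma> k x $ i $ j"
  by (simp add: bivector_scale_def)

lemma bivector_fields_zero: "(0 :: 'n::finite bivector) \<in> bivector_fields"
proof -
  have "transpose (0 :: complex ^ 'n ^ 'n) = - 0" by (simp add: transpose_def vec_eq_iff)
  from bivector_fields_diff[OF field_bivector_in_bivector_fields[OF this] field_bivector_in_bivector_fields[OF this],
      of "\<lambda>_. 0" "\<lambda>_. 0"]
  show ?thesis by simp
qed

lemma bivector_fields_add: "\<sigma> \<in> bivector_fields \<Longrightarrow> \<tau> \<in> bivector_fields \<Longrightarrow> \<sigma> + \<tau> \<in> bivector_fields"
  using bivector_fields_diff[OF _ bivector_fields_diff[OF bivector_fields_zero], of \<sigma> \<tau>] by simp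

lemma bivector_fields_scale:
  assumes "\<sigma> \<in> bivector_fields"
  shows "bivector_scale c \<sigma> \<in> bivector_fields"
proof -
  have m: "M ** (\<chi> i j. c * A $ i $ j) ** N = (\<chi> i j. c * (M ** A ** N) $ i $ j)" for M A N :: "complex ^ 'a ^ 'a"
    by (simp add: matrix_matrix_mult_def vec_eq_iff algebra_simps sum_distrib_left sum_distrib_right)
  have t: "transpose (\<chi> i j. c * A $ i $ j) = - (\<chi> i j. c * A $ i $ j)" if "transpose A = - A" for A :: "complex ^ 'a ^ 'a"
    unfolding vec_eq_iff
  proof (intro allI)
    fix i j
    have "A $ j $ i = - (A $ i $ j)" by (rule skew_entry[OF that])
    then show "transpose (\<chi> i j. c * A $ i $ j) $ i $ j = (- (\<chi> i j. c * A $ i $ j)) $ i $ j"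
      by (simp add: transpose_def)
  qed
  show ?thesis
    unfolding bivector_fields_def mem_Collect_eq
  proof (intro conjI allI)
    show "transpose (bivector_scale c \<sigma> k x) = - bivector_scale c \<sigma> k x" for k x
      unfolding bivector_scale_def by (rule t) (use assms in \<open>simp add: bivector_fields_def\<close>)
    show "holomorphic_at (\<lambda>y. bivector_scale c \<sigma> k y $ i $ j) x" for k i j x
      unfolding bivector_scale_apply by (rule holomorphic_at_cmult[OF bivector_fields_holomorphic[OF assms]])
    show "pushes_forward id (bivector_scale c \<sigma>) (bivector_scale c \<sigma>)"
      using assms unfolding bivector_fields_def pushes_forward_def bivector_scale_def by (simp add: m)
  qed
qed

text \<open>The affine points at which the components of a global bivector field determine it.\<close>

definition grid_points :: "(complex ^ 'n::finite) set" where
  "grid_points = {x. \<forall>i. x $ i \<in> of_nat ` {1..4}}"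

lemma finite_grid_points: "finite (grid_points :: (complex ^ 'n::finite) set)"
proof (rule finite_subset)
  show "grid_points \<subseteq> (\<lambda>f. \<chi> i. f i) ` (PiE (UNIV :: 'n set) (\<lambda>_. of_nat ` {1..4}) :: ('n \<Rightarrow> complex) set)"
  proof
    fix x :: "complex ^ 'n"
    assume "x \<in> grid_points"
    then have 1: "(\<lambda>i. x $ i) \<in> PiE UNIV (\<lambda>_. of_nat ` {1..4})" by (simp add: grid_points_def PiE_iff)
    have 2: "x = (\<chi> i. x $ i)" by (simp add: vec_eq_iff)
    show "x \<in> (\<lambda>f. \<chi> i. f i) ` (PiE (UNIV :: 'n set) (\<lambda>_. of_nat ` {1..4}))"
      by (rule image_eqI[where f = vec_lambda and x = "\<lambda>i. x $ i", OF 2 1])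
  qed
  show "finite ((\<lambda>f. \<chi> i. f i) ` (PiE (UNIV :: 'n set) (\<lambda>_. of_nat ` {1..4})) :: (complex ^ 'n) set)"
    by (intro finite_imageI finite_PiE) simp_all
qed

lemma grid_points_torus: "grid_points \<subseteq> torus"
proof
  fix x :: "complex ^ 'n" assume x: "x \<in> grid_points"
  have "x $ i \<noteq> 0" for i
  proof -
    have "x $ i \<in> of_nat ` {1..4}" using x by (simp add: grid_points_def)
    then show ?thesis by auto
  qed
  then show "x \<in> torus" by (simp add: torus_def)
qed

definition bivector_coord :: "(complex ^ 'n) \<times> 'n \<times> 'n \<Rightarrow> 'n::finite bivector \<Rightarrow> complex" where
  "bivector_coord = (\<lambda>(x, a, b) \<sigma>. \<sigma> None x $ a $ b)"

lemma coordinatized_bivectors: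
  "coordinatized bivector_scale bivector_fields bivector_coord (grid_points \<times> (UNIV :: ('n::finite \<times> 'n) set))"
proof (intro coordinatized.intro coordinatized_axioms.intro)
  show "vector_space (bivector_scale :: complex \<Rightarrow> 'n bivector \<Rightarrow> 'n bivector)" by (rule vector_space_bivector_scale)
  show "finite (grid_points \<times> (UNIV :: ('n \<times> 'n) set))" by (simp add: finite_grid_points)
  show "bivector_coord i (u + v) = bivector_coord i u + bivector_coord i v" for i and u v :: "'n bivector"
    by (simp add: bivector_coord_def case_prod_beta)
  show "bivector_coord i (bivector_scale c v) = c * bivector_coord i v" for i c and v :: "'n bivector"
    by (simp add: bivector_coord_def case_prod_beta bivector_scale_apply)
  fix v :: "'n bivector"
  assume v: "v \<in> bivector_fields" and z: "\<And>i. i \<in> grid_points \<times> UNIV \<Longrightarrow> bivector_coord i v = 0"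
  show "v = 0"
  proof (rule bivector_zeroI[OF v])
    fix x :: "complex ^ 'n" and a b :: 'n
    assume "\<And>i. x $ i \<in> of_nat ` {1..4}"
    then have "(x, a, b) \<in> grid_points \<times> UNIV" by (simp add: grid_points_def)
    from z[OF this] show "v None x $ a $ b = 0" by (simp add: bivector_coord_def)
  qed
qed (rule bivector_fields_zero bivector_fields_add bivector_fields_scale; assumption)+

subsection \<open>The polarization of the Poisson condition\<close>

lemma schouten_commute: "schouten P Q x i j m = schouten Q P x i j m"
  unfolding schouten_def by (intro sum.cong refl) (simp add: algebra_simps)

lemma schouten_add:
  assumes "\<sigma> \<in> bivector_fields" "\<tau> \<in> bivector_fields"
  shows "schouten P ((\<sigma> + \<tau>) k) x i j m = schouten P (\<sigma> k) x i j m + schouten P (\<tau> k) x i j m"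
proof -
  have "partial_deriv l (\<lambda>y. (\<sigma> + \<tau>) k y $ a $ b) x =
      partial_deriv l (\<lambda>y. \<sigma> k y $ a $ b) x + partial_deriv l (\<lambda>y. \<tau> k y $ a $ b) x" for l a b
    by (simp add: partial_deriv_add(1) bivector_fields_holomorphic assms)
  then show ?thesis
    unfolding schouten_def sum.distrib[symmetric] by (intro sum.cong refl) (simp add: algebra_simps)
qed

lemma partial_deriv_bivector_scale:
  assumes "\<tau> \<in> bivector_fields"
  shows "partial_deriv l (\<lambda>y. bivector_scale c \<tau> k y $ a $ b) x = c * partial_deriv l (\<lambda>y. \<tau> k y $ a $ b) x"
  unfolding bivector_scale_apply
  by (rule partial_deriv_add(2)[OF bivector_fields_holomorphic[OF assms] bivector_fields_holomorphic[OF assms]])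

lemma schouten_scale:
  assumes "\<tau> \<in> bivector_fields"
  shows "schouten P (bivector_scale c \<tau> k) x i j m = c * schouten P (\<tau> k) x i j m"
proof -
  show ?thesis
    unfolding schouten_def partial_deriv_bivector_scale[OF assms] unfolding bivector_scale_apply sum_distrib_left
    by (intro sum.cong refl) (simp add: algebra_simps)
qed

lemma polynomial_functions_sum:
  "finite J \<Longrightarrow> (\<And>l. l \<in> J \<Longrightarrow> f l \<in> polynomial_functions sc V) \<Longrightarrow> (\<lambda>v. \<Sum>l\<in>J. f l v) \<in> polynomial_functions sc V"
proof (induction J rule: finite_induct)
  case empty
  show ?case using polynomial_functions.const[of 0 sc V] by simp
next
  case (insert l J)
  have "(\<lambda>v. f l v + (\<Sum>l\<in>J. f l v)) \<in> polynomial_functions sc V"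
    by (rule polynomial_functions.add) (use insert in simp_all)
  then show ?case using insert.hyps by simp
qed

lemma schouten_square_homogeneous:
  "(\<lambda>\<sigma>. schouten (\<sigma> k) (\<sigma> k) x i j m) \<in> homogeneous_polynomials bivector_scale bivector_fields"
proof -
  let ?F = "polynomial_functions bivector_scale bivector_fields"
  have ev: "(\<lambda>\<sigma>. \<sigma> k x $ a $ b) \<in> ?F" for a b
    by (rule polynomial_functions.linear) (simp_all add: bivector_scale_apply)
  have pd: "(\<lambda>\<sigma>. partial_deriv l (\<lambda>y. \<sigma> k y $ a $ b) x) \<in> ?F" for l a b
  proof (rule polynomial_functions.linear)
    fix u v :: "'a bivector" assume "u \<in> bivector_fields" "v \<in> bivector_fields"
    then show "partial_deriv l (\<lambda>y. (u + v) k y $ a $ b) x =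
        partial_deriv l (\<lambda>y. u k y $ a $ b) x + partial_deriv l (\<lambda>y. v k y $ a $ b) x"
      by (simp add: partial_deriv_add(1) bivector_fields_holomorphic)
  next
    fix c and v :: "'a bivector" assume "v \<in> bivector_fields"
    then show "partial_deriv l (\<lambda>y. bivector_scale c v k y $ a $ b) x = c * partial_deriv l (\<lambda>y. v k y $ a $ b) x"
      by (rule partial_deriv_bivector_scale)
  qed
  have "(\<lambda>\<sigma>. schouten (\<sigma> k) (\<sigma> k) x i j m) \<in> ?F"
    unfolding schouten_def
    by (intro polynomial_functions_sum polynomial_functions.add polynomial_functions.mult ev pd finite)
  moreover have "schouten (bivector_scale c v k) (bivector_scale c v k) x i j m = c ^ 2 * schouten (v k) (v k) x i j m"
    if "v \<in> bivector_fields" for c v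
    by (subst schouten_scale[OF that], subst schouten_commute, subst schouten_scale[OF that]) (simp add: power2_eq_square)
  ultimately show ?thesis unfolding homogeneous_polynomials_def by blast
qed

lemma poisson_space_zero_locus:
  "(poisson_space :: 'n::finite bivector set set) = zero_locus bivector_scale bivector_fields
     (range (\<lambda>(k, x, i, j, m) \<sigma>. schouten (\<sigma> k) (\<sigma> k) x i j m))"
proof -
  have "(\<sigma> \<noteq> 0 \<and> is_poisson \<sigma>) \<longleftrightarrow> (\<sigma> \<in> bivector_fields - {0} \<and>
     (\<forall>p\<in>range (\<lambda>(k, x, i, j, m) \<sigma>. schouten (\<sigma> k) (\<sigma> k) x i j m). p \<sigma> = 0))" for \<sigma> :: "'n bivector"
    by (auto simp: is_poisson_def)
  then show ?thesis unfolding poisson_space_def zero_locus_def by simp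
qed

lemma closedin_poisson_space: "closedin bivector_zariski poisson_space"
  unfolding bivector_zariski_def poisson_space_zero_locus closedin_zariski[OF vector_space_bivector_scale]
  by (intro exI conjI refl) (auto simp: schouten_square_homogeneous)

section \<open>Diagonal structures along a line of coordinate systems\<close>

definition polynomial_along :: "(complex \<Rightarrow> complex) \<Rightarrow> bool" where
  "polynomial_along f \<longleftrightarrow> (\<exists>q. \<forall>s. f s = poly q s)"

lemma polynomial_along_const: "polynomial_along (\<lambda>s. c)"
  unfolding polynomial_along_def by (intro exI[of _ "[:c:]"]) simp

lemma polynomial_along_id: "polynomial_along (\<lambda>s. s)"
  unfolding polynomial_along_def by (intro exI[of _ "[:0, 1:]"]) simp

lemma polynomial_along_add: "polynomial_along f \<Longrightarrow> polynomial_along g \<Longrightarrow> polynomial_along (\<lambda>s. f s + g s)"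
  unfolding polynomial_along_def by (metis poly_add)

lemma polynomial_along_diff: "polynomial_along f \<Longrightarrow> polynomial_along g \<Longrightarrow> polynomial_along (\<lambda>s. f s - g s)"
  unfolding polynomial_along_def by (metis poly_diff)

lemma polynomial_along_mult: "polynomial_along f \<Longrightarrow> polynomial_along g \<Longrightarrow> polynomial_along (\<lambda>s. f s * g s)"
  unfolding polynomial_along_def by (metis poly_mult)

lemma polynomial_along_sum: "(\<And>j. polynomial_along (f j)) \<Longrightarrow> polynomial_along (\<lambda>s. \<Sum>j\<in>J. f j s)"
proof (induction J rule: infinite_finite_induct)
  case (insert j J)
  have "polynomial_along (\<lambda>s. f j s + (\<Sum>j\<in>J. f j s))"
    by (rule polynomial_along_add) (use insert in simp_all)
  then show ?case using insert.hyps by simp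
qed (simp_all add: polynomial_along_const)

lemma polynomial_along_prod: "(\<And>j. polynomial_along (f j)) \<Longrightarrow> polynomial_along (\<lambda>s. \<Prod>j\<in>J. f j s)"
proof (induction J rule: infinite_finite_induct)
  case (insert j J)
  have "polynomial_along (\<lambda>s. f j s * (\<Prod>j\<in>J. f j s))"
    by (rule polynomial_along_mult) (use insert in simp_all)
  then show ?case using insert.hyps by simp
qed (simp_all add: polynomial_along_const)

lemmas polynomial_along_intros = polynomial_along_const polynomial_along_id polynomial_along_add
  polynomial_along_diff polynomial_along_mult polynomial_along_sum polynomial_along_prod

lemma polynomial_along_det:
  "(\<And>i j. polynomial_along (\<lambda>s. g s $ i $ j)) \<Longrightarrow> polynomial_along (\<lambda>s. det (g s :: complex ^ 'm ^ 'm))"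
  unfolding det_def by (intro polynomial_along_intros)

lemma polynomial_along_continuous: "polynomial_along f \<Longrightarrow> isCont f s"
proof -
  assume "polynomial_along f"
  then obtain q where "\<forall>s. f s = poly q s" unfolding polynomial_along_def by (rule exE)
  then have "f = poly q" by (simp add: fun_eq_iff)
  then show ?thesis by simp
qed

text \<open>Irreducibility of the affine line.\<close>

lemma polynomial_along_product_nonzero:
  assumes "polynomial_along f" "polynomial_along g" "f a \<noteq> 0" "g b \<noteq> 0"
  shows "\<exists>s. f s * g s \<noteq> 0"
proof -
  obtain p where p: "\<forall>s. f s = poly p s" using assms(1) unfolding polynomial_along_def by (rule exE)
  obtain q where q: "\<forall>s. g s = poly q s" using assms(2) unfolding polynomial_along_def by (rule exE)
  have "p \<noteq> 0" "q \<noteq> 0" using assms(3,4) p q by auto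
  then have "p * q \<noteq> 0" by simp
  then have "\<exists>s. poly (p * q) s \<noteq> 0" using poly_all_0_iff_0[of "p * q"] by blast
  then show ?thesis using p q by simp
qed

text \<open>Cramer's rule; the entries are polynomials in those of \<open>g\<close>, also where \<open>g\<close> is singular.\<close>

definition adjugate :: "complex ^ 'm ^ 'm \<Rightarrow> complex ^ 'm ^ 'm::finite" where
  "adjugate g = (\<chi> k j. det (\<chi> i l. if l = k then axis j 1 $ i else g $ i $ l))"

lemma polynomial_along_adjugate:
  assumes "\<And>i j. polynomial_along (\<lambda>s. g s $ i $ j)"
  shows "polynomial_along (\<lambda>s. adjugate (g s :: complex ^ 'm ^ 'm) $ k $ j)"
proof -
  have "polynomial_along (\<lambda>s. if l = k then axis j 1 $ i else g s $ i $ l)" for i l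
    by (cases "l = k") (simp_all add: assms polynomial_along_const)
  then show ?thesis unfolding adjugate_def by (simp add: polynomial_along_det)
qed

lemma adjugate_inverse:
  fixes g :: "complex ^ 'm ^ 'm::finite"
  assumes d: "det g \<noteq> 0"
  shows "g ** (\<chi> k j. adjugate g $ k $ j / det g) = mat 1"
proof (rule vec_eq_iff[THEN iffD2], rule allI, rule vec_eq_iff[THEN iffD2], rule allI)
  fix i j
  let ?x = "\<chi> k. adjugate g $ k $ j / det g"
  have "g *v ?x = axis j 1"
    by (subst cramer[OF d]) (simp add: adjugate_def)
  then have "(g *v ?x) $ i = axis j 1 $ i" by simp
  then show "(g ** (\<chi> k j. adjugate g $ k $ j / det g)) $ i $ j = mat 1 $ i $ j"
    by (simp add: matrix_matrix_mult_def matrix_vector_mult_def mat_def axis_def)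
qed

lemma linear_field_scale: "linear_field (\<chi> i j. r * M $ i $ j) k x $ i = r * linear_field M k x $ i"
  by (simp add: linear_field_def matrix_vector_mult_def sum_distrib_left algebra_simps)

lemma diagonal_bivector_adjugate:
  assumes d: "det g \<noteq> 0"
  shows "diagonal_bivector g (adjugate g) c =
    bivector_scale ((det g)\<^sup>2) (diagonal_bivector g (\<chi> k j. adjugate g $ k $ j / det g) c)"
proof -
  let ?h = "\<chi> k j. adjugate g $ k $ j / det g"
  have m: "M ** adjugate g = (\<chi> i j. det g * (M ** ?h) $ i $ j)" for M
    using d by (simp add: matrix_matrix_mult_def vec_eq_iff sum_distrib_left)
  have "linear_field (M ** adjugate g) k x $ i = det g * linear_field (M ** ?h) k x $ i" for M k x i
    unfolding m by (rule linear_field_scale)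
  then show ?thesis
    unfolding diagonal_bivector_def field_bivector_def bivector_scale_def
    by (simp add: fun_eq_iff vec_eq_iff sum_distrib_left power2_eq_square mult_ac)
qed

lemma inverse_eq_adjugate:
  assumes "h ** g = mat 1"
  shows "det g \<noteq> 0" "h = (\<chi> k j. adjugate g $ k $ j / det g)"
proof -
  have "det h * det g = 1" using arg_cong[OF assms, of det] by (simp add: det_mul)
  then show d: "det g \<noteq> 0" by auto
  have "h = h ** (g ** (\<chi> k j. adjugate g $ k $ j / det g))" by (simp add: adjugate_inverse[OF d])
  also have "\<dots> = (\<chi> k j. adjugate g $ k $ j / det g)" by (simp add: matrix_mul_assoc assms)
  finally show "h = (\<chi> k j. adjugate g $ k $ j / det g)" .
qed

lemma proj_class_bivector_scale:
  assumes "r \<noteq> 0"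
  shows "proj_class bivector_scale (bivector_scale r \<sigma>) = proj_class bivector_scale \<sigma>"
proof -
  interpret vector_space bivector_scale by (rule vector_space_bivector_scale)
  show ?thesis
    unfolding proj_class_def
  proof (intro equalityI subsetI)
    fix \<tau> assume "\<tau> \<in> {bivector_scale c (bivector_scale r \<sigma>) |c. c \<noteq> 0}"
    then obtain c where "\<tau> = bivector_scale c (bivector_scale r \<sigma>)" "c \<noteq> 0" by blast
    then have "\<tau> = bivector_scale (c * r) \<sigma> \<and> c * r \<noteq> 0" using assms by simp
    then show "\<tau> \<in> {bivector_scale c \<sigma> |c. c \<noteq> 0}" by blast
  next
    fix \<tau> assume "\<tau> \<in> {bivector_scale c \<sigma> |c. c \<noteq> 0}"
    then obtain c where "\<tau> = bivector_scale c \<sigma>" "c \<noteq> 0" by blast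
    then have "\<tau> = bivector_scale (c / r) (bivector_scale r \<sigma>) \<and> c / r \<noteq> 0" using assms by simp
    then show "\<tau> \<in> {bivector_scale c (bivector_scale r \<sigma>) |c. c \<noteq> 0}" by blast
  qed
qed

lemma diagonal_in_diagonal_poisson_space:
  assumes "det g \<noteq> 0" "transpose c = - c" "diagonal_bivector g (adjugate g) c \<noteq> 0"
  shows "proj_class bivector_scale (diagonal_bivector g (adjugate g) c) \<in> diagonal_poisson_space"
proof -
  let ?h = "\<chi> k j. adjugate g $ k $ j / det g"
  interpret vector_space bivector_scale by (rule vector_space_bivector_scale)
  have gh: "g ** ?h = mat 1" by (rule adjugate_inverse[OF assms(1)])
  then have hg: "?h ** g = mat 1" by (simp add: matrix_left_right_inverse)
  have "is_diagonal_poisson (diagonal_bivector g ?h c)"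
    by (rule is_diagonal_poisson_diagonal_bivector[OF hg gh assms(2)])
  moreover have "diagonal_bivector g ?h c \<noteq> 0"
    using assms(3) unfolding diagonal_bivector_adjugate[OF assms(1)] by auto
  moreover have "proj_class bivector_scale (diagonal_bivector g (adjugate g) c) = proj_class bivector_scale (diagonal_bivector g ?h c)"
    unfolding diagonal_bivector_adjugate[OF assms(1)] by (rule proj_class_bivector_scale) (simp add: assms(1))
  ultimately show ?thesis unfolding diagonal_poisson_space_def by blast
qed

lemma polynomial_along_linear_field:
  assumes "\<And>i j. polynomial_along (\<lambda>s. M s $ i $ j)"
  shows "polynomial_along (\<lambda>s. linear_field (M s) k x $ i)"
  unfolding linear_field_def matrix_vector_mult_def vec_lambda_beta
  by (intro polynomial_along_intros assms)

lemma polynomial_along_matrix_mult: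
  assumes "\<And>i j. polynomial_along (\<lambda>s. M s $ i $ j)" "\<And>i j. polynomial_along (\<lambda>s. N s $ i $ j)"
  shows "polynomial_along (\<lambda>s. (M s ** N s) $ i $ j)"
  unfolding matrix_matrix_mult_def vec_lambda_beta by (intro polynomial_along_intros assms)

lemma polynomial_along_diagonal_bivector:
  assumes g: "\<And>i j. polynomial_along (\<lambda>s. g s $ i $ j)" and c: "\<And>a b. polynomial_along (\<lambda>s. c s $ a $ b)"
  shows "polynomial_along (\<lambda>s. diagonal_bivector (g s) (adjugate (g s)) (c s) k x $ i $ j)"
  unfolding diagonal_bivector_def field_bivector_def vec_lambda_beta
  by (intro polynomial_along_sum polynomial_along_mult polynomial_along_linear_field polynomial_along_matrix_mult
      polynomial_along_adjugate polynomial_along_const g c)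

context coordinatized
begin

lemma polynomial_along_polynomial_function:
  assumes "p \<in> polynomial_functions sc V" and T: "\<And>s. T s \<in> V" "\<And>i. i \<in> I \<Longrightarrow> polynomial_along (\<lambda>s. e i (T s))"
  shows "polynomial_along (\<lambda>s. p (T s))"
  using assms(1)
proof induction
  case (linear l)
  then have "lin l" unfolding lin_def by simp
  from lin_expansion[OF this] obtain \<alpha> where \<alpha>: "\<forall>v\<in>V. l v = (\<Sum>i\<in>I. \<alpha> i * e i v)" by (rule exE)
  have "polynomial_along (\<lambda>s. \<Sum>i\<in>I. if i \<in> I then \<alpha> i * e i (T s) else 0)"
  proof (rule polynomial_along_sum)
    show "polynomial_along (\<lambda>s. if i \<in> I then \<alpha> i * e i (T s) else 0)" for i
      by (cases "i \<in> I") (simp_all add: T polynomial_along_mult polynomial_along_const)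
  qed
  moreover have "l (T s) = (\<Sum>i\<in>I. if i \<in> I then \<alpha> i * e i (T s) else 0)" for s
    using \<alpha> T(1) by simp
  ultimately show ?case by simp
qed (intro polynomial_along_intros; assumption?)+

end

text \<open>Two homogeneous polynomials that do not vanish at the structures with the parameters \<open>(g1, c1)\<close> and
  \<open>(g2, c2)\<close> are polynomials in \<open>s\<close> along the line through these parameters, once the inverse of the
  coordinate change is replaced by the adjugate.  Neither is zero, so at some point of the line both are
  nonzero and the structure is a diagonal one.\<close>

theorem irreducible_diagonal_closure:
  assumes n: "CARD('n::finite) \<ge> 2" and ne: "(diagonal_poisson_space :: 'n bivector set set) \<noteq> {}"
  shows "irreducible_space (subtopology bivector_zariski
    (bivector_zariski closure_of (diagonal_poisson_space :: 'n bivector set set)))"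
proof -
  let ?X = "bivector_zariski :: 'n bivector set topology" and ?D = "diagonal_poisson_space :: 'n bivector set set"
  let ?V = "bivector_fields :: 'n bivector set" and ?pc = "proj_class bivector_scale :: 'n bivector \<Rightarrow> _"
  interpret coordinatized bivector_scale ?V bivector_coord "grid_points \<times> (UNIV :: ('n \<times> 'n) set)"
    by (rule coordinatized_bivectors)
  let ?C = "?X closure_of ?D"
  have top: "topspace ?X = projectivization bivector_scale ?V" by (simp add: bivector_zariski_def topspace_zariski)
  have Dsub: "?D \<subseteq> topspace ?X"
    unfolding top diagonal_poisson_space_def projectivization_def by (auto simp: is_diagonal_poisson_def is_poisson_def)
  have DC: "?D \<subseteq> ?C" by (rule closure_of_subset[OF Dsub])
  have Csub: "?C \<subseteq> topspace ?X" by (rule closure_of_subset_topspace)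
  have tC: "topspace (subtopology ?X ?C) = ?C" using Csub by (simp add: topspace_subtopology Int_absorb1)
  have Ccl: "closedin ?X ?C" by (rule closedin_closure_of)
  have separating: "\<exists>p v. p \<in> homogeneous_polynomials bivector_scale ?V \<and> v \<noteq> 0 \<and> is_diagonal_poisson v \<and> p v \<noteq> 0 \<and>
      (\<forall>w\<in>?V - {0}. ?pc w \<in> S \<longrightarrow> p w = 0)"
    if S: "closedin (subtopology ?X ?C) S" "S \<noteq> ?C" for S
  proof -
    have cl: "closedin ?X S" by (rule closedin_trans_full[OF S(1) Ccl])
    have "S \<subseteq> ?C" using closedin_subset[OF S(1)] tC by simp
    have "\<not> ?D \<subseteq> S"
    proof
      assume "?D \<subseteq> S"
      then have "?C \<subseteq> S" by (rule closure_of_minimal[OF _ cl])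
      then show False using S(2) \<open>S \<subseteq> ?C\<close> by blast
    qed
    then obtain d where d: "d \<in> ?D" "d \<notin> S" by blast
    then obtain v where v: "d = ?pc v" "v \<noteq> 0" "is_diagonal_poisson v" unfolding diagonal_poisson_space_def by blast
    have vV: "v \<in> ?V - {0}" using v by (simp add: is_diagonal_poisson_def is_poisson_def)
    obtain F where F: "F \<subseteq> homogeneous_polynomials bivector_scale ?V" "S = zero_locus bivector_scale ?V F"
      using cl unfolding bivector_zariski_def closedin_zariski[OF vector_space_bivector_scale] by blast
    have "\<not> (\<forall>p\<in>F. p v = 0)"
      using d(2) unfolding v(1) F(2) proj_class_in_zero_locus[OF vector_space_bivector_scale F(1) vV] .
    then obtain p where p: "p \<in> F" "p v \<noteq> 0" by blast
    have "p w = 0" if "w \<in> ?V - {0}" "?pc w \<in> S" for w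
      using that(2) p(1) unfolding F(2) proj_class_in_zero_locus[OF vector_space_bivector_scale F(1) that(1)] by simp
    then show ?thesis using p F(1) v by (intro exI[of _ p] exI[of _ v]) auto
  qed
  show ?thesis
    unfolding irreducible_space_def tC
  proof (intro conjI allI impI)
    show "?C \<noteq> {}" using ne DC by auto
    fix S1 S2 assume S: "closedin (subtopology ?X ?C) S1 \<and> closedin (subtopology ?X ?C) S2 \<and> S1 \<union> S2 = ?C"
    show "S1 = ?C \<or> S2 = ?C"
    proof (rule ccontr)
      assume no: "\<not> (S1 = ?C \<or> S2 = ?C)"
      have "\<exists>p v. p \<in> homogeneous_polynomials bivector_scale ?V \<and> v \<noteq> 0 \<and> is_diagonal_poisson v \<and> p v \<noteq> 0 \<and>
          (\<forall>w\<in>?V - {0}. ?pc w \<in> S1 \<longrightarrow> p w = 0)" by (rule separating) (use S no in simp_all)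
      then obtain p1 v1 where p1: "p1 \<in> homogeneous_polynomials bivector_scale ?V" "v1 \<noteq> 0" "is_diagonal_poisson v1" "p1 v1 \<noteq> 0"
          "\<forall>w\<in>?V - {0}. ?pc w \<in> S1 \<longrightarrow> p1 w = 0" by (elim exE conjE)
      have "\<exists>p v. p \<in> homogeneous_polynomials bivector_scale ?V \<and> v \<noteq> 0 \<and> is_diagonal_poisson v \<and> p v \<noteq> 0 \<and>
          (\<forall>w\<in>?V - {0}. ?pc w \<in> S2 \<longrightarrow> p w = 0)" by (rule separating) (use S no in simp_all)
      then obtain p2 v2 where p2: "p2 \<in> homogeneous_polynomials bivector_scale ?V" "v2 \<noteq> 0" "is_diagonal_poisson v2" "p2 v2 \<noteq> 0"
          "\<forall>w\<in>?V - {0}. ?pc w \<in> S2 \<longrightarrow> p2 w = 0" by (elim exE conjE)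
      have "\<exists>g h c. h ** g = mat 1 \<and> g ** h = mat 1 \<and> transpose c = - c \<and> v1 = diagonal_bivector g h c"
        using p1(3) unfolding diagonal_poisson_iff[OF n] .
      then obtain g1 h1 c1 where 1: "h1 ** g1 = mat 1" "g1 ** h1 = mat 1" "transpose c1 = - c1" "v1 = diagonal_bivector g1 h1 c1"
        by (elim exE conjE)
      have "\<exists>g h c. h ** g = mat 1 \<and> g ** h = mat 1 \<and> transpose c = - c \<and> v2 = diagonal_bivector g h c"
        using p2(3) unfolding diagonal_poisson_iff[OF n] .
      then obtain g2 h2 c2 where 2: "h2 ** g2 = mat 1" "g2 ** h2 = mat 1" "transpose c2 = - c2" "v2 = diagonal_bivector g2 h2 c2"
        by (elim exE conjE)
      define g where "g s = (\<chi> i j. g1 $ i $ j + s * (g2 $ i $ j - g1 $ i $ j))" for s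
      define c where "c s = (\<chi> i j. c1 $ i $ j + s * (c2 $ i $ j - c1 $ i $ j))" for s
      define T where "T s = diagonal_bivector (g s) (adjugate (g s)) (c s)" for s
      have g01: "g 0 = g1" "g 1 = g2" "c 0 = c1" "c 1 = c2" by (simp_all add: g_def c_def vec_eq_iff)
      have cskew: "transpose (c s) = - c s" for s
        unfolding vec_eq_iff
      proof (intro allI)
        fix i j
        have "c1 $ j $ i = - (c1 $ i $ j)" "c2 $ j $ i = - (c2 $ i $ j)" by (rule skew_entry[OF 1(3)], rule skew_entry[OF 2(3)])
        then show "transpose (c s) $ i $ j = (- c s) $ i $ j" by (simp add: c_def transpose_def algebra_simps)
      qed
      have TV: "T s \<in> ?V" for s
        unfolding T_def diagonal_bivector_def by (rule field_bivector_in_bivector_fields[OF cskew])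
      have gpoly: "polynomial_along (\<lambda>s. g s $ i $ j)" for i j
        unfolding g_def vec_lambda_beta by (intro polynomial_along_intros)
      have cpoly: "polynomial_along (\<lambda>s. c s $ i $ j)" for i j
        unfolding c_def vec_lambda_beta by (intro polynomial_along_intros)
      have epoly: "polynomial_along (\<lambda>s. bivector_coord i (T s))" for i
        unfolding bivector_coord_def case_prod_beta T_def by (rule polynomial_along_diagonal_bivector[OF gpoly cpoly])
      have ppoly: "polynomial_along (\<lambda>s. p (T s))" if "p \<in> homogeneous_polynomials bivector_scale ?V" for p
        by (rule polynomial_along_polynomial_function[OF _ TV epoly]) (use that in \<open>simp add: homogeneous_polynomials_def\<close>)
      have d0: "det (g 0) \<noteq> 0" "det (g 1) \<noteq> 0"
        unfolding g01 by (rule inverse_eq_adjugate(1)[OF 1(1)], rule inverse_eq_adjugate(1)[OF 2(1)])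
      have T0: "T 0 = bivector_scale ((det (g 0))\<^sup>2) v1"
        unfolding T_def diagonal_bivector_adjugate[OF d0(1)] unfolding g01 1(4) inverse_eq_adjugate(2)[OF 1(1), symmetric] ..
      have T1: "T 1 = bivector_scale ((det (g 1))\<^sup>2) v2"
        unfolding T_def diagonal_bivector_adjugate[OF d0(2)] unfolding g01 2(4) inverse_eq_adjugate(2)[OF 2(1), symmetric] ..
      have vV: "v1 \<in> ?V" "v2 \<in> ?V" using p1(3) p2(3) by (simp_all add: is_diagonal_poisson_def is_poisson_def)
      have nz: "p (bivector_scale r v) \<noteq> 0" if "p \<in> homogeneous_polynomials bivector_scale ?V" "v \<in> ?V" "p v \<noteq> 0" "r \<noteq> 0" for p r v
      proof -
        have "\<exists>d. \<forall>c. \<forall>v\<in>?V. p (bivector_scale c v) = c ^ d * p v"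
          using that(1) unfolding homogeneous_polynomials_def by simp
        then obtain d where "\<forall>c. \<forall>v\<in>?V. p (bivector_scale c v) = c ^ d * p v" by (rule exE)
        then show ?thesis using that by simp
      qed
      have a1: "p1 (T 0) \<noteq> 0" unfolding T0 by (rule nz[OF p1(1) vV(1) p1(4)]) (simp add: d0)
      have a2: "p2 (T 1) \<noteq> 0" unfolding T1 by (rule nz[OF p2(1) vV(2) p2(4)]) (simp add: d0)
      have "T 0 \<noteq> 0" unfolding T0 using d0(1) p1(2) by simp
      then have "\<exists>i\<in>grid_points \<times> UNIV. bivector_coord i (T 0) \<noteq> 0" using e_separates[OF TV] by blast
      then obtain i where i: "bivector_coord i (T 0) \<noteq> 0" by (elim bexE)
      have dpoly: "polynomial_along (\<lambda>s. det (g s))" by (rule polynomial_along_det[OF gpoly])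
      (* The two additional factors make \<open>T s\<close> a nonzero bivector field and \<open>g s\<close> invertible. *)
      have "\<exists>s. (bivector_coord i (T s) * det (g s) * p1 (T s)) * p2 (T s) \<noteq> 0"
        by (rule polynomial_along_product_nonzero[where a = 0 and b = 1])
          (use i d0 a1 a2 in \<open>simp_all add: polynomial_along_mult epoly dpoly ppoly p1(1) p2(1)\<close>)
      then obtain s where "(bivector_coord i (T s) * det (g s) * p1 (T s)) * p2 (T s) \<noteq> 0" by (rule exE)
      then have s: "bivector_coord i (T s) \<noteq> 0" "det (g s) \<noteq> 0" "p1 (T s) \<noteq> 0" "p2 (T s) \<noteq> 0" by simp_all
      have Ts: "T s \<noteq> 0" using s(1) by (auto simp: bivector_coord_def case_prod_beta)
      have "?pc (T s) \<in> ?D"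
        unfolding T_def by (rule diagonal_in_diagonal_poisson_space[OF s(2) cskew]) (use Ts in \<open>simp add: T_def\<close>)
      then have "?pc (T s) \<in> S1 \<or> ?pc (T s) \<in> S2" using DC S by blast
      then show False using p1(5) p2(5) TV Ts s(3,4) by blast
    qed
  qed
qed

section \<open>Tangent vectors at a generic diagonal structure\<close>

lemma laurent_root_weight:
  assumes "x \<in> torus"
  shows "laurent_monomial (root_weight a d) x = affine_lift None x $ d / affine_lift None x $ a"
proof -
  have nz: "affine_lift None x $ a \<noteq> 0"
    using assms by (cases a) (simp_all add: affine_lift_None affine_lift_None_None torus_def)
  have "laurent_monomial (\<lambda>i. root_weight a d i + coord_weight a i) x =
      laurent_monomial (root_weight a d) x * laurent_monomial (coord_weight a) x"
    by (rule laurent_monomial_add[OF assms])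
  moreover have "(\<lambda>i. root_weight a d i + coord_weight a i) = coord_weight d" by (simp add: root_weight_def)
  ultimately show ?thesis using nz by (simp add: laurent_monomial_coord_weight nonzero_eq_divide_eq)
qed

text \<open>The field of the elementary matrix with entry at \<open>(a, d)\<close> is \<open>z\<^sub>d / z\<^sub>a\<close> times the logarithmic field of
  \<open>z\<^sub>a\<close>, that is, a weight vector for the root \<open>root_weight a d\<close>.\<close>

lemma linear_field_log_vector:
  fixes x :: "complex ^ 'n::finite"
  assumes x: "x \<in> torus"
  shows "linear_field M None x $ j =
    x $ j * (\<Sum>q\<in>UNIV. M $ fst q $ snd q * (log_vector (fst q) j * laurent_monomial (root_weight (fst q) (snd q)) x))"
proof -
  let ?z = "affine_lift None x"
  have xj: "x $ j \<noteq> 0" using x by (simp add: torus_def)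
  have t: "log_vector (Some i) j * (M *v ?z) $ Some i / ?z $ Some i = (if j = i then (M *v ?z) $ Some i / x $ i else 0)" for i
    by (simp add: log_vector_def affine_lift_None)
  have "(\<Sum>q\<in>UNIV. M $ fst q $ snd q * (log_vector (fst q) j * laurent_monomial (root_weight (fst q) (snd q)) x)) =
      (\<Sum>a\<in>UNIV. \<Sum>d\<in>UNIV. M $ a $ d * (log_vector a j * laurent_monomial (root_weight a d) x))"
    by (simp add: sum.cartesian_product case_prod_beta)
  also have "\<dots> = (\<Sum>a\<in>UNIV. log_vector a j * (M *v ?z) $ a / ?z $ a)"
    by (intro sum.cong refl)
      (simp add: laurent_root_weight[OF x] matrix_vector_mult_def sum_distrib_left sum_divide_distrib mult_ac)
  also have "\<dots> = - (M *v ?z) $ None + (M *v ?z) $ Some j / x $ j"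
    unfolding sum_option t by (simp add: log_vector_def affine_lift_None_None)
  finally have eq: "(\<Sum>q\<in>UNIV. M $ fst q $ snd q * (log_vector (fst q) j * laurent_monomial (root_weight (fst q) (snd q)) x)) =
      - (M *v ?z) $ None + (M *v ?z) $ Some j / x $ j" .
  show ?thesis unfolding eq using xj by (simp add: linear_field_def right_diff_distrib)
qed

text \<open>The matrix units are weight vectors for the diagonal matrices.\<close>

lemma commutator_entry:
  "(X ** diag_unit (Some p) - diag_unit (Some p) ** X) $ a $ d = X $ a $ d * of_int (root_weight a d p)"
proof -
  have "(X ** diag_unit q) $ a $ d = (if d = q then X $ a $ d else 0)" for q
    by (cases "d = q") (simp_all add: matrix_matrix_mult_def diag_unit_def if_distrib cong: if_cong)
  moreover have "(diag_unit q ** X) $ a $ d = (if a = q then X $ a $ d else 0)" for q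
    by (cases "a = q") (simp_all add: matrix_matrix_mult_def diag_unit_def if_distribR if_distrib cong: if_cong)
  ultimately show ?thesis by (simp add: root_weight_def coord_weight_apply)
qed

text \<open>Finitely many points of the torus suffice to separate the admissible weights, so that the bracket has
  to vanish weight by weight.  The weight 0 contributes \<open>c'\<close>, the roots contribute \<open>X\<close>.\<close>

theorem tangent_vector_shape:
  fixes \<tau> :: "'n::finite bivector" and c :: "complex ^ 'n ^ 'n"
  assumes n: "CARD('n) \<ge> 3" and gen: "generic c" and c: "transpose c = - c" and \<tau>: "\<tau> \<in> bivector_fields"
    and G: "G \<subseteq> torus" "\<And>f u. (\<forall>x\<in>G. (\<Sum>u\<in>admissible_weights. f u * laurent_monomial u x) = 0) \<Longrightarrow>
      u \<in> admissible_weights \<Longrightarrow> f u = 0"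
    and tangent: "\<And>x i j m. x \<in> G \<Longrightarrow>
      schouten (diagonal_bivector (mat 1) (mat 1) c None) (\<tau> None) x i j m = 0"
  shows "\<exists>X c'. transpose c' = - c' \<and> (\<forall>x\<in>torus. \<forall>i j. \<tau> None x $ i $ j = x $ i * x $ j * (c' $ i $ j +
    (\<Sum>q\<in>UNIV. X $ fst q $ snd q * (contract c (root_weight (fst q) (snd q)) i * log_vector (fst q) j -
       contract c (root_weight (fst q) (snd q)) j * log_vector (fst q) i) * laurent_monomial (root_weight (fst q) (snd q)) x)))"
proof -
  let ?W = "admissible_weights :: ('n \<Rightarrow> int) set"
  obtain U B where UB: "finite U \<and> (\<forall>u a b. u \<notin> U \<longrightarrow> B u a b = 0) \<and>
    (\<forall>x\<in>torus. \<forall>a b. \<tau> None x $ a $ b = x $ a * x $ b * (\<Sum>u\<in>U. B u a b * laurent_monomial u x)) \<and>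
    (\<forall>u a b. B u b a = - B u a b) \<and>
    (\<forall>u a b i. B u a b \<noteq> 0 \<longrightarrow> 0 \<le> u i + (unit_weight a i + unit_weight b i)) \<and>
    (\<forall>u a b. B u a b \<noteq> 0 \<longrightarrow> (\<Sum>i\<in>UNIV. u i) \<le> 1) \<and>
    (\<forall>u a b m. (\<Sum>i\<in>UNIV. u i) = 1 \<longrightarrow> B u a b = B u m b + B u a m)"
    using bivector_structure[OF \<tau>] by (elim exE)
  have U: "finite U" by (rule conjunct1[OF UB])
  note UB1 = conjunct2[OF UB]
  note UB2 = conjunct2[OF UB1]
  note UB3 = conjunct2[OF UB2]
  note UB4 = conjunct2[OF UB3]
  note UB5 = conjunct2[OF UB4]
  have BU: "B u a b = 0" if "u \<notin> U" for u a b
    by (rule conjunct1[OF UB1, rule_format, OF that])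
  have ex: "\<tau> None x $ a $ b = x $ a * x $ b * (\<Sum>u\<in>U. B u a b * laurent_monomial u x)" if "x \<in> torus" for x a b
    by (rule conjunct1[OF UB2, rule_format, OF that])
  have skew: "B u b a = - B u a b" for u a b
    by (rule conjunct1[OF UB3, rule_format])
  have nn: "0 \<le> u i + (unit_weight a i + unit_weight b i)" if "B u a b \<noteq> 0" for u a b i
    by (rule conjunct1[OF UB4, rule_format, OF that])
  have deg: "(\<Sum>i\<in>UNIV. u i) \<le> 1" if "B u a b \<noteq> 0" for u a b
    by (rule conjunct1[OF UB5, rule_format, OF that])
  have top: "B u a b = B u m b + B u a m" if "(\<Sum>i\<in>UNIV. u i) = 1" for u a b m
    by (rule conjunct2[OF UB5, rule_format, OF that])
  have adm: "u \<in> ?W" if "B u a b \<noteq> 0" for u a b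
    by (rule bivector_weight_admissible[where B = "B u" and u = u, OF skew[of u] nn[of u] deg[of u] that])
  have adm': "B u a b = 0" if "u \<notin> ?W" for u a b using adm[of u a b] that by blast
  have exW: "\<tau> None x $ a $ b = x $ a * x $ b * (\<Sum>u\<in>?W. B u a b * laurent_monomial u x)" if "x \<in> torus" for x a b
  proof -
    have "(\<Sum>u\<in>U. B u a b * laurent_monomial u x) = (\<Sum>u\<in>?W. B u a b * laurent_monomial u x)"
      by (rule sum.mono_neutral_cong[OF finite_admissible_weights U]) (use BU adm' in auto)
    then show ?thesis unfolding ex[OF that] by simp
  qed
  have id: "contract c u i * B u j m + contract c u j * B u m i + contract c u m * B u i j = 0" for u i j m
  proof (cases "u \<in> ?W")
    case True
    show ?thesis
    proof (rule G(2)[where f = "\<lambda>u. contract c u i * B u j m + contract c u j * B u m i + contract c u m * B u i j", OF _ True], rule ballI)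
      fix x assume xG: "x \<in> G"
      then have x: "x \<in> torus" using G(1) by auto
      have "x $ i * x $ j * x $ m * (\<Sum>u\<in>?W. (contract c u i * B u j m + contract c u j * B u m i + contract c u m * B u i j)
          * laurent_monomial u x) = 0"
        by (rule trans[OF sym[OF schouten_diagonal[where U = ?W and P = "diagonal_bivector (mat 1) (mat 1) c None"
            and Q = "\<tau> None" and B = B and c = c]] tangent[OF xG]])
          (rule finite_admissible_weights c diagonal_bivector_one_None exW skew x; assumption?)+
      then show "(\<Sum>u\<in>?W. (contract c u i * B u j m + contract c u j * B u m i + contract c u m * B u i j) * laurent_monomial u x) = 0"
        using x by (simp add: torus_def)
    qed
  next
    case False
    then have "B u a b = 0" for a b using adm[of u a b] by blast
    then show ?thesis by simp
  qed
  have shape: "\<exists>a d \<kappa>. a \<noteq> d \<and> u = root_weight a d \<and>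
      (\<forall>i j. B u i j = \<kappa> * (contract c u i * log_vector a j - contract c u j * log_vector a i))"
    if "u \<noteq> (\<lambda>_. 0)" "B u a0 b0 \<noteq> 0" for u a0 b0
    by (rule tangent_weight[where B = "B u" and u = u and c = c, OF n gen c skew[of u] nn[of u] deg[of u] top[of u] id[of u] that])
  have scalar: "\<exists>\<kappa>. \<forall>i j. B (root_weight a d) i j = \<kappa> *
      (contract c (root_weight a d) i * log_vector a j - contract c (root_weight a d) j * log_vector a i)" if ad: "a \<noteq> d" for a d
  proof (cases "\<exists>i j. B (root_weight a d) i j \<noteq> 0")
    case True
    then obtain i j where ij: "B (root_weight a d) i j \<noteq> 0" by (elim exE)
    have "root_weight a d \<noteq> (\<lambda>_. 0)"
    proof
      assume "root_weight a d = (\<lambda>_. 0)"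
      then have "coord_weight d i = coord_weight a i" for i by (simp add: root_weight_def fun_eq_iff)
      then have "coord_weight d = coord_weight a" by (rule HOL.ext)
      then show False using coord_weight_inj[of d a] ad by simp
    qed
    from shape[OF this ij] obtain a' d' \<kappa> where *: "a' \<noteq> d'" "root_weight a d = root_weight a' d'"
      "\<forall>i j. B (root_weight a d) i j = \<kappa> * (contract c (root_weight a d) i * log_vector a' j - contract c (root_weight a d) j * log_vector a' i)"
      by (elim exE conjE)
    have "a = a'" using root_weight_inj[OF ad *(2,1)] by simp
    then show ?thesis using *(3) by (intro exI[of _ \<kappa>]) simp
  next
    case False
    then show ?thesis by (intro exI[of _ 0]) simp
  qed
  define \<kappa> where "\<kappa> a d = (SOME \<kappa>. \<forall>i j. B (root_weight a d) i j = \<kappa> *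
      (contract c (root_weight a d) i * log_vector a j - contract c (root_weight a d) j * log_vector a i))" for a d
  have \<kappa>: "B (root_weight a d) i j = \<kappa> a d *
      (contract c (root_weight a d) i * log_vector a j - contract c (root_weight a d) j * log_vector a i)" if "a \<noteq> d" for a d i j
  proof -
    have all: "\<forall>i j. B (root_weight a d) i j = \<kappa> a d *
        (contract c (root_weight a d) i * log_vector a j - contract c (root_weight a d) j * log_vector a i)"
      unfolding \<kappa>_def by (rule someI_ex[OF scalar[OF that]])
    show ?thesis by (rule all[rule_format])
  qed
  define X :: "complex ^ 'n option ^ 'n option" where "X = (\<chi> a d. if a = d then 0 else \<kappa> a d)"
  define c' :: "complex ^ 'n ^ 'n" where "c' = (\<chi> i j. B (\<lambda>_. 0) i j)"
  let ?P = "{q :: 'n option \<times> 'n option. fst q \<noteq> snd q}"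
  let ?rw = "\<lambda>q :: 'n option \<times> 'n option. root_weight (fst q) (snd q)"
  have inj: "inj_on ?rw ?P"
  proof (rule inj_onI)
    fix q r :: "'n option \<times> 'n option" assume "q \<in> ?P" "r \<in> ?P" "?rw q = ?rw r"
    then have "fst q = fst r \<and> snd q = snd r" by (intro root_weight_inj) simp_all
    then show "q = r" by (simp add: prod_eq_iff)
  qed
  have zero: "(\<lambda>_. 0) \<notin> ?rw ` ?P"
  proof
    assume "(\<lambda>_. 0) \<in> ?rw ` ?P"
    then obtain q where q: "(\<lambda>_. 0) = ?rw q" "q \<in> ?P" by (rule imageE)
    have "coord_weight (snd q) i = coord_weight (fst q) i" for i
      using fun_cong[OF q(1), of i] by (simp add: root_weight_def)
    then have "coord_weight (snd q) = coord_weight (fst q)" by (rule HOL.ext)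
    then show False using coord_weight_inj[of "snd q" "fst q"] q(2) by simp
  qed
  have zeroW: "(\<lambda>_. 0) \<in> ?W" by (simp add: admissible_weights_def)
  have "\<tau> None x $ i $ j = x $ i * x $ j * (c' $ i $ j + (\<Sum>q\<in>UNIV. X $ fst q $ snd q * (contract c (?rw q) i * log_vector (fst q) j -
       contract c (?rw q) j * log_vector (fst q) i) * laurent_monomial (?rw q) x))" if x: "x \<in> torus" for x i j
  proof -
    have "(\<Sum>u\<in>?W. B u i j * laurent_monomial u x) = (\<Sum>u\<in>insert (\<lambda>_. 0) (?rw ` ?P). B u i j * laurent_monomial u x)"
    proof (rule sum.mono_neutral_right[OF finite_admissible_weights])
      show "insert (\<lambda>_. 0) (?rw ` ?P) \<subseteq> ?W" using zeroW root_weight_admissible by auto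
      show "\<forall>u\<in>?W - insert (\<lambda>_. 0) (?rw ` ?P). B u i j * laurent_monomial u x = 0"
      proof
        fix u assume u: "u \<in> ?W - insert (\<lambda>_. 0) (?rw ` ?P)"
        have "B u i j = 0"
        proof (rule ccontr)
          assume nz: "B u i j \<noteq> 0"
          have "u \<noteq> (\<lambda>_. 0)" using u by simp
          from shape[OF this nz] obtain a d \<mu> where ad: "a \<noteq> d" "u = root_weight a d" by (elim exE conjE)
          then have "u \<in> ?rw ` ?P" by (intro image_eqI[of _ _ "(a, d)"]) simp_all
          then show False using u by simp
        qed
        then show "B u i j * laurent_monomial u x = 0" by simp
      qed
    qed
    also have "\<dots> = c' $ i $ j + (\<Sum>u\<in>?rw ` ?P. B u i j * laurent_monomial u x)"
      using zero by (simp add: c'_def laurent_monomial_def)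
    also have "(\<Sum>u\<in>?rw ` ?P. B u i j * laurent_monomial u x) = (\<Sum>q\<in>?P. B (?rw q) i j * laurent_monomial (?rw q) x)"
      by (simp add: sum.reindex[OF inj])
    also have "\<dots> = (\<Sum>q\<in>?P. X $ fst q $ snd q * (contract c (?rw q) i * log_vector (fst q) j -
        contract c (?rw q) j * log_vector (fst q) i) * laurent_monomial (?rw q) x)"
      by (rule sum.cong) (simp_all add: \<kappa> X_def)
    also have "\<dots> = (\<Sum>q\<in>UNIV. X $ fst q $ snd q * (contract c (?rw q) i * log_vector (fst q) j -
        contract c (?rw q) j * log_vector (fst q) i) * laurent_monomial (?rw q) x)"
      by (rule sum.mono_neutral_left) (simp_all add: X_def)
    finally show ?thesis unfolding exW[OF x] by simp
  qed
  moreover have "transpose c' = - c'"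
    unfolding vec_eq_iff
  proof (intro allI)
    fix i j
    have "B (\<lambda>_. 0) j i = - B (\<lambda>_. 0) i j" by (rule skew)
    then show "transpose c' $ i $ j = (- c') $ i $ j" by (simp add: c'_def transpose_def)
  qed
  ultimately show ?thesis by (intro exI[of _ X] exI[of _ c'] conjI ballI allI)
qed

section \<open>Arcs of diagonal structures\<close>

lemma linear_field_add: "linear_field (A + B) k x $ i = linear_field A k x $ i + linear_field B k x $ i"
  by (simp add: linear_field_def matrix_vector_mult_def sum.distrib algebra_simps)

text \<open>The exact form of the first-order expansion of the conjugation of \<open>E\<close> with \<open>1 + t X\<close>.\<close>

lemma conjugation_expansion:
  fixes X E h :: "complex ^ 'm ^ 'm::finite"
  assumes g: "g = mat 1 + (\<chi> i j. t * X $ i $ j)" and gh: "g ** h = mat 1"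
  shows "g ** E ** h = E + (\<chi> i j. t * ((X ** E - E ** X) ** h) $ i $ j)"
proof -
  let ?S = "\<chi> i j. t * X $ i $ j"
  have s1: "(\<chi> i j. t * D $ i $ j) ** A = (\<chi> i j. t * (D ** A) $ i $ j)" for A D :: "complex ^ 'm ^ 'm"
    by (simp add: matrix_matrix_mult_def vec_eq_iff sum_distrib_left mult_ac)
  have s2: "A ** (\<chi> i j. t * D $ i $ j) = (\<chi> i j. t * (A ** D) $ i $ j)" for A D :: "complex ^ 'm ^ 'm"
    by (simp add: matrix_matrix_mult_def vec_eq_iff sum_distrib_left mult_ac)
  have s3: "(A - D) ** h = A ** h - D ** h" for A D :: "complex ^ 'm ^ 'm"
    by (simp add: matrix_matrix_mult_def vec_eq_iff sum_subtractf algebra_simps)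
  have a1: "(A + D) ** F = A ** F + D ** F" for A D F :: "complex ^ 'm ^ 'm"
    by (simp add: matrix_matrix_mult_def vec_eq_iff sum.distrib algebra_simps)
  have a2: "F ** (A + D) = F ** A + F ** D" for A D F :: "complex ^ 'm ^ 'm"
    by (simp add: matrix_matrix_mult_def vec_eq_iff sum.distrib algebra_simps)
  have 1: "g ** E ** h = E ** h + (\<chi> i j. t * (X ** E ** h) $ i $ j)"
    by (simp add: g a1 s1)
  have "E = E ** (g ** h)" by (simp add: gh)
  also have "\<dots> = E ** (h + ?S ** h)" unfolding g a1 by simp
  also have "\<dots> = E ** h + (\<chi> i j. t * (E ** X ** h) $ i $ j)"
    unfolding a2 s1 s2 by (simp add: matrix_mul_assoc)
  finally have 2: "E $ i $ j = (E ** h) $ i $ j + t * (E ** X ** h) $ i $ j" for i j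
    by (metis (no_types, lifting) vec_lambda_beta vector_add_component)
  show ?thesis unfolding 1 s3 by (simp add: vec_eq_iff 2 algebra_simps)
qed

lemma tendsto_linear_field_mult:
  assumes "\<And>k j. (\<lambda>n. H n $ k $ j) \<longlonglongrightarrow> H0 $ k $ j"
  shows "(\<lambda>n. linear_field (M ** H n) k x $ i) \<longlonglongrightarrow> linear_field (M ** H0) k x $ i"
  unfolding linear_field_def matrix_vector_mult_def matrix_matrix_mult_def vec_lambda_beta
  by (intro tendsto_intros assms)

text \<open>The arc consists of the images of the structures with matrix \<open>c + t c'\<close> under \<open>1 + t X\<close>.  Its derivative
  at \<open>t = 0\<close> is the diagonal structure of \<open>c'\<close> plus the derivative of conjugating the diagonal matrix units by
  \<open>1 + t X\<close>, which gives the commutators with \<open>X\<close>; by \<open>commutator_entry\<close> these contract \<open>c\<close> with the roots.\<close>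

theorem tangent_arc:
  fixes c c' :: "complex ^ 'n::finite ^ 'n" and \<tau> :: "'n bivector"
  assumes c: "transpose c = - c" and c': "transpose c' = - c'"
    and nz: "diagonal_bivector (mat 1) (mat 1) c \<noteq> 0"
    and \<tau>: "\<And>x i j. x \<in> torus \<Longrightarrow> \<tau> None x $ i $ j = x $ i * x $ j * (c' $ i $ j +
    (\<Sum>q\<in>UNIV. X $ fst q $ snd q * (contract c (root_weight (fst q) (snd q)) i * log_vector (fst q) j -
       contract c (root_weight (fst q) (snd q)) j * log_vector (fst q) i) * laurent_monomial (root_weight (fst q) (snd q)) x))"
  shows "\<exists>\<gamma> s. (\<forall>n. \<gamma> n \<in> bivector_fields - {0} \<and> proj_class bivector_scale (\<gamma> n) \<in> diagonal_poisson_space \<and> s n \<noteq> 0) \<and>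
    s \<longlonglongrightarrow> 0 \<and> (\<forall>i\<in>grid_points \<times> UNIV. (\<lambda>n::nat. (bivector_coord i (\<gamma> n) -
      bivector_coord i (diagonal_bivector (mat 1) (mat 1) c)) / s n) \<longlonglongrightarrow> bivector_coord i \<tau>)"
proof -
  interpret coordinatized bivector_scale "bivector_fields :: 'n bivector set" bivector_coord "grid_points \<times> (UNIV :: ('n \<times> 'n) set)"
    by (rule coordinatized_bivectors)
  let ?v0 = "diagonal_bivector (mat 1) (mat 1) c"
  (* The value at index 0 is 0; the arc starts later, where moreover the matrices are invertible and the
     bivector fields are nonzero. *)
  define s0 :: "nat \<Rightarrow> complex" where "s0 n = 1 / of_nat n" for n
  have s0: "s0 \<longlonglongrightarrow> 0" unfolding s0_def by (rule lim_1_over_n)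
  define g where "g t = mat 1 + (\<chi> i j. t * X $ i $ j)" for t
  define h where "h t = (\<chi> k j. adjugate (g t) $ k $ j / det (g t))" for t
  define ct where "ct t = (\<chi> a b. c $ a $ b + t * c' $ a $ b)" for t
  define \<sigma> where "\<sigma> t = diagonal_bivector (g t) (h t) (ct t)" for t
  have g0: "g 0 = mat 1" by (simp add: g_def vec_eq_iff)
  have d0: "det (g 0) \<noteq> 0" by (simp add: g0)
  have gpoly: "polynomial_along (\<lambda>t. g t $ i $ j)" for i j
    unfolding g_def vector_add_component vec_lambda_beta by (intro polynomial_along_intros)
  have lim: "(\<lambda>n. f (s0 n)) \<longlonglongrightarrow> f 0" if "polynomial_along f" for f
    by (rule isCont_tendsto_compose[OF polynomial_along_continuous[OF that] s0])
  have dlim: "(\<lambda>n. det (g (s0 n))) \<longlonglongrightarrow> det (g 0)" by (rule lim[OF polynomial_along_det[OF gpoly]])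
  have gh: "g t ** h t = mat 1" if "det (g t) \<noteq> 0" for t unfolding h_def by (rule adjugate_inverse[OF that])
  have h0: "h 0 = mat 1" using gh[OF d0] by (simp add: g0)
  have hlim: "(\<lambda>n. h (s0 n) $ k $ j) \<longlonglongrightarrow> mat 1 $ k $ j" for k j
  proof -
    have "(\<lambda>n. adjugate (g (s0 n)) $ k $ j / det (g (s0 n))) \<longlonglongrightarrow> adjugate (g 0) $ k $ j / det (g 0)"
      by (rule tendsto_divide[OF lim[OF polynomial_along_adjugate[OF gpoly]] dlim d0])
    moreover have "adjugate (g 0) $ k $ j / det (g 0) = mat 1 $ k $ j" using h0 unfolding h_def by (simp add: vec_eq_iff)
    ultimately show ?thesis by (simp add: h_def)
  qed
  have ctskew: "transpose (ct t) = - ct t" for t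
    unfolding vec_eq_iff
  proof (intro allI)
    fix i j
    have "c $ j $ i = - (c $ i $ j)" "c' $ j $ i = - (c' $ i $ j)" by (rule skew_entry[OF c], rule skew_entry[OF c'])
    then show "transpose (ct t) $ i $ j = (- ct t) $ i $ j" by (simp add: ct_def transpose_def algebra_simps)
  qed
  have \<sigma>V: "\<sigma> t \<in> bivector_fields" for t
    unfolding \<sigma>_def diagonal_bivector_def by (rule field_bivector_in_bivector_fields[OF ctskew])
  have quotient: "\<exists>Q. Q \<longlonglongrightarrow> bivector_coord k \<tau> \<and>
      (\<forall>n. det (g (s0 n)) \<noteq> 0 \<longrightarrow> bivector_coord k (\<sigma> (s0 n)) = bivector_coord k ?v0 + s0 n * Q n)"
    if "k \<in> grid_points \<times> UNIV" for k
  proof -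
    obtain x i j where k: "k = (x, i, j)" by (rule prod_cases3)
    have x: "x \<in> torus" using that grid_points_torus unfolding k by auto
    define E where "E a i = linear_field (diag_unit (Some a)) None x $ i" for a i
    define Z where "Z a n i = linear_field ((X ** diag_unit (Some a) - diag_unit (Some a) ** X) ** h (s0 n)) None x $ i" for a n i
    define Z0 where "Z0 a i = linear_field (X ** diag_unit (Some a) - diag_unit (Some a) ** X) None x $ i" for a i
    define Q where "Q n = (\<Sum>a\<in>UNIV. \<Sum>b\<in>UNIV. c' $ a $ b * ((E a i + s0 n * Z a n i) * (E b j + s0 n * Z b n j)) +
        c $ a $ b * (Z a n i * (E b j + s0 n * Z b n j) + E a i * Z b n j))" for n
    have Zlim: "(\<lambda>n. Z a n i) \<longlonglongrightarrow> Z0 a i" for a i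
      using tendsto_linear_field_mult[OF hlim, of "X ** diag_unit (Some a) - diag_unit (Some a) ** X" None x i]
      by (simp add: Z_def Z0_def)
    have "Q \<longlonglongrightarrow> (\<Sum>a\<in>UNIV. \<Sum>b\<in>UNIV. c' $ a $ b * ((E a i + 0 * Z0 a i) * (E b j + 0 * Z0 b j)) +
        c $ a $ b * (Z0 a i * (E b j + 0 * Z0 b j) + E a i * Z0 b j))"
      unfolding Q_def by (intro tendsto_intros s0 Zlim)
    moreover have "(\<Sum>a\<in>UNIV. \<Sum>b\<in>UNIV. c' $ a $ b * ((E a i + 0 * Z0 a i) * (E b j + 0 * Z0 b j)) +
        c $ a $ b * (Z0 a i * (E b j + 0 * Z0 b j) + E a i * Z0 b j)) = \<tau> None x $ i $ j"
    proof -
      let ?rw = "\<lambda>q :: 'n option \<times> 'n option. root_weight (fst q) (snd q)"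
      let ?lm = "\<lambda>q. laurent_monomial (?rw q) x"
      have E: "E a i = (if i = a then x $ i else 0)" for a i
        by (simp add: E_def linear_field_def diag_unit_mult affine_lift_None)
      have Z0: "Z0 b i = x $ i * (\<Sum>q\<in>UNIV. X $ fst q $ snd q * of_int (?rw q b) * (log_vector (fst q) i * ?lm q))" for b i
        unfolding Z0_def linear_field_log_vector[OF x] commutator_entry ..
      have Zc: "(\<Sum>b\<in>UNIV. c $ m $ b * Z0 b i) =
          x $ i * (\<Sum>q\<in>UNIV. X $ fst q $ snd q * contract c (?rw q) m * (log_vector (fst q) i * ?lm q))" for m i
      proof -
        have "(\<Sum>b\<in>UNIV. c $ m $ b * Z0 b i) = (\<Sum>b\<in>UNIV. \<Sum>q\<in>UNIV. x $ i * (X $ fst q $ snd q *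
            (c $ m $ b * of_int (?rw q b)) * (log_vector (fst q) i * ?lm q)))"
          by (simp add: Z0 sum_distrib_left mult_ac)
        also have "\<dots> = (\<Sum>q\<in>UNIV. \<Sum>b\<in>UNIV. x $ i * (X $ fst q $ snd q *
            (c $ m $ b * of_int (?rw q b)) * (log_vector (fst q) i * ?lm q)))"
          by (rule sum.swap)
        also have "\<dots> = (\<Sum>q\<in>UNIV. x $ i * (X $ fst q $ snd q *
            contract c (?rw q) m * (log_vector (fst q) i * ?lm q)))"
          unfolding contract_def sum_distrib_left sum_distrib_right ..
        finally show ?thesis unfolding sum_distrib_left .
      qed
      have 1: "(\<Sum>a\<in>UNIV. \<Sum>b\<in>UNIV. c' $ a $ b * (E a i * E b j)) = c' $ i $ j * (x $ i * x $ j)"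
        unfolding E by (rule sum_sum_delta)
      have 2: "(\<Sum>a\<in>UNIV. \<Sum>b\<in>UNIV. c $ a $ b * (Z0 a i * E b j)) = - (x $ j * (\<Sum>a\<in>UNIV. c $ j $ a * Z0 a i))"
      proof -
        have "(\<Sum>b\<in>UNIV. c $ a $ b * (Z0 a i * E b j)) = - (x $ j * (c $ j $ a * Z0 a i))" for a
        proof -
          have "(\<Sum>b\<in>UNIV. c $ a $ b * (Z0 a i * E b j)) = (\<Sum>b\<in>UNIV. if j = b then c $ a $ b * (Z0 a i * x $ j) else 0)"
            by (rule sum.cong) (simp_all add: E)
          then show ?thesis using skew_entry[OF c, of j a] by (simp add: mult_ac)
        qed
        then show ?thesis by (simp add: sum_distrib_left sum_negf)
      qed
      have 3: "(\<Sum>a\<in>UNIV. \<Sum>b\<in>UNIV. c $ a $ b * (E a i * Z0 b j)) = x $ i * (\<Sum>b\<in>UNIV. c $ i $ b * Z0 b j)"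
      proof -
        have "(\<Sum>a\<in>UNIV. c $ a $ b * (E a i * Z0 b j)) = x $ i * (c $ i $ b * Z0 b j)" for b
        proof -
          have "(\<Sum>a\<in>UNIV. c $ a $ b * (E a i * Z0 b j)) = (\<Sum>a\<in>UNIV. if i = a then c $ a $ b * (x $ i * Z0 b j) else 0)"
            by (rule sum.cong) (simp_all add: E)
          then show ?thesis by (simp add: mult_ac)
        qed
        then show ?thesis by (subst sum.swap) (simp add: sum_distrib_left)
      qed
      have "(\<Sum>a\<in>UNIV. \<Sum>b\<in>UNIV. c' $ a $ b * ((E a i + 0 * Z0 a i) * (E b j + 0 * Z0 b j)) +
          c $ a $ b * (Z0 a i * (E b j + 0 * Z0 b j) + E a i * Z0 b j)) =
          (\<Sum>a\<in>UNIV. \<Sum>b\<in>UNIV. c' $ a $ b * (E a i * E b j)) + ((\<Sum>a\<in>UNIV. \<Sum>b\<in>UNIV. c $ a $ b * (Z0 a i * E b j)) +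
          (\<Sum>a\<in>UNIV. \<Sum>b\<in>UNIV. c $ a $ b * (E a i * Z0 b j)))"
        by (simp add: sum.distrib distrib_left)
      also have "\<dots> = x $ i * x $ j * (c' $ i $ j +
          ((\<Sum>q\<in>UNIV. X $ fst q $ snd q * contract c (?rw q) i * (log_vector (fst q) j * ?lm q)) -
          (\<Sum>q\<in>UNIV. X $ fst q $ snd q * contract c (?rw q) j * (log_vector (fst q) i * ?lm q))))"
        unfolding 1 2 3 Zc by (simp add: distrib_left right_diff_distrib mult_ac)
      also have "\<dots> = \<tau> None x $ i $ j"
        unfolding \<tau>[OF x] sum_subtractf[symmetric] by (simp add: right_diff_distrib left_diff_distrib mult_ac)
      finally show ?thesis .
    qed
    ultimately have "Q \<longlonglongrightarrow> bivector_coord k \<tau>" by (simp add: k bivector_coord_def)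
    moreover have "bivector_coord k (\<sigma> (s0 n)) = bivector_coord k ?v0 + s0 n * Q n" if d: "det (g (s0 n)) \<noteq> 0" for n
    proof -
      have Y: "linear_field (g (s0 n) ** diag_unit (Some a) ** h (s0 n)) None x $ i = E a i + s0 n * Z a n i" for a i
        unfolding conjugation_expansion[OF g_def gh[OF d]] linear_field_add linear_field_scale E_def Z_def ..
      have "bivector_coord k (\<sigma> (s0 n)) = (\<Sum>a\<in>UNIV. \<Sum>b\<in>UNIV. (c $ a $ b + s0 n * c' $ a $ b) *
          ((E a i + s0 n * Z a n i) * (E b j + s0 n * Z b n j)))"
        unfolding k bivector_coord_def \<sigma>_def diagonal_bivector_def field_bivector_def prod.case vec_lambda_beta Y ct_def ..
      also have "\<dots> = (\<Sum>a\<in>UNIV. \<Sum>b\<in>UNIV. c $ a $ b * (E a i * E b j)) + s0 n * Q n"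
        unfolding Q_def sum_distrib_left sum.distrib[symmetric] by (intro sum.cong refl) (simp add: algebra_simps)
      also have "(\<Sum>a\<in>UNIV. \<Sum>b\<in>UNIV. c $ a $ b * (E a i * E b j)) = bivector_coord k ?v0"
        by (simp add: k bivector_coord_def diagonal_bivector_def field_bivector_def E_def)
      finally show ?thesis .
    qed
    ultimately show ?thesis by (intro exI[of _ Q] conjI allI impI)
  qed
  have v0V: "?v0 \<in> bivector_fields" unfolding diagonal_bivector_def by (rule field_bivector_in_bivector_fields[OF c])
  have "\<exists>k\<in>grid_points \<times> UNIV. bivector_coord k ?v0 \<noteq> 0" using e_separates[OF v0V] nz by blast
  then obtain k0 where k0: "k0 \<in> grid_points \<times> UNIV" "bivector_coord k0 ?v0 \<noteq> 0" by (elim bexE)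
  from quotient[OF k0(1)] obtain Q0 where Q0: "Q0 \<longlonglongrightarrow> bivector_coord k0 \<tau>"
    "\<forall>n. det (g (s0 n)) \<noteq> 0 \<longrightarrow> bivector_coord k0 (\<sigma> (s0 n)) = bivector_coord k0 ?v0 + s0 n * Q0 n"
    by (elim exE conjE)
  have "(\<lambda>n. bivector_coord k0 ?v0 + s0 n * Q0 n) \<longlonglongrightarrow> bivector_coord k0 ?v0 + 0 * bivector_coord k0 \<tau>"
    by (intro tendsto_intros s0 Q0(1))
  then have "\<forall>\<^sub>F n in sequentially. bivector_coord k0 ?v0 + s0 n * Q0 n \<noteq> 0"
    by (rule tendsto_imp_eventually_ne) (use k0(2) in simp)
  moreover have "\<forall>\<^sub>F n in sequentially. det (g (s0 n)) \<noteq> 0"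
    by (rule tendsto_imp_eventually_ne[OF dlim d0])
  moreover have "\<forall>\<^sub>F n in sequentially. n \<ge> 1" by (rule eventually_ge_at_top)
  ultimately have "\<forall>\<^sub>F n in sequentially. bivector_coord k0 ?v0 + s0 n * Q0 n \<noteq> 0 \<and> det (g (s0 n)) \<noteq> 0 \<and> n \<ge> 1"
    by (intro eventually_conj)
  then obtain N where N: "\<forall>n\<ge>N. bivector_coord k0 ?v0 + s0 n * Q0 n \<noteq> 0 \<and> det (g (s0 n)) \<noteq> 0 \<and> n \<ge> 1"
    unfolding eventually_sequentially by (rule exE)
  have N1: "bivector_coord k0 ?v0 + s0 (n + N) * Q0 (n + N) \<noteq> 0" and N2: "det (g (s0 (n + N))) \<noteq> 0" and N3: "n + N \<ge> 1" for n
    using N[rule_format, of "n + N"] by simp_all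
  have sn: "s0 (n + N) \<noteq> 0" for n 
  proof -
    have "s0 k \<noteq> 0" if "k \<noteq> 0" for k using that by (simp add: s0_def)
    moreover have "n + N \<noteq> 0" using N3[of n] by linarith
    ultimately show ?thesis by simp
  qed
  have \<sigma>nz: "\<sigma> (s0 (n + N)) \<noteq> 0" for n
  proof
    assume "\<sigma> (s0 (n + N)) = 0"
    then have "bivector_coord k0 (\<sigma> (s0 (n + N))) = 0" by (simp add: bivector_coord_def case_prod_beta)
    then show False using Q0(2) N1[of n] N2[of n] by simp
  qed
  show ?thesis
  proof (intro exI[of _ "\<lambda>n. \<sigma> (s0 (n + N))"] exI[of _ "\<lambda>n. s0 (n + N)"] conjI allI ballI)
    fix n
    show "\<sigma> (s0 (n + N)) \<in> bivector_fields - {0}" using \<sigma>V \<sigma>nz by simp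
    have "h (s0 (n + N)) ** g (s0 (n + N)) = mat 1" using gh[OF N2[of n]] by (simp add: matrix_left_right_inverse)
    then have "is_diagonal_poisson (\<sigma> (s0 (n + N)))"
      unfolding \<sigma>_def by (rule is_diagonal_poisson_diagonal_bivector[OF _ gh[OF N2] ctskew])
    then show "proj_class bivector_scale (\<sigma> (s0 (n + N))) \<in> diagonal_poisson_space"
      using \<sigma>nz[of n] unfolding diagonal_poisson_space_def by blast
    show "s0 (n + N) \<noteq> 0" by (rule sn)
  next
    show "(\<lambda>n. s0 (n + N)) \<longlonglongrightarrow> 0" by (rule LIMSEQ_ignore_initial_segment[OF s0])
  next
    fix k :: "(complex ^ 'n) \<times> 'n \<times> 'n" assume k: "k \<in> grid_points \<times> UNIV"
    from quotient[OF k] obtain Q where Q: "Q \<longlonglongrightarrow> bivector_coord k \<tau>"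
      "\<forall>n. det (g (s0 n)) \<noteq> 0 \<longrightarrow> bivector_coord k (\<sigma> (s0 n)) = bivector_coord k ?v0 + s0 n * Q n"
      by (elim exE conjE)
    have "(bivector_coord k (\<sigma> (s0 (n + N))) - bivector_coord k ?v0) / s0 (n + N) = Q (n + N)" for n
      using Q(2) N2[of n] sn[of n] by simp
    then show "(\<lambda>n. (bivector_coord k (\<sigma> (s0 (n + N))) - bivector_coord k ?v0) / s0 (n + N)) \<longlonglongrightarrow> bivector_coord k \<tau>"
      using LIMSEQ_ignore_initial_segment[OF Q(1)] by simp
  qed
qed

lemma generic_diagonal_nonzero:
  fixes c :: "complex ^ 'n::finite ^ 'n"
  assumes n: "CARD('n) \<ge> 2" and gen: "generic c"
  shows "diagonal_bivector (mat 1) (mat 1) c \<noteq> 0"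
proof
  assume z: "diagonal_bivector (mat 1) (mat 1) c = 0"
  have "c $ i $ j = 0" for i j
  proof -
    have "diagonal_bivector (mat 1) (mat 1) c None (\<chi> i. 1) $ i $ j = 0" unfolding z by simp
    then show ?thesis unfolding diagonal_bivector_one_None by simp
  qed
  then have 0: "contract c u l = 0" for u l by (simp add: contract_def)
  obtain i l :: 'n where "l \<noteq> i"
  proof -
    have "\<exists>i l :: 'n. l \<noteq> i"
    proof (rule ccontr)
      assume "\<not> (\<exists>i l :: 'n. l \<noteq> i)"
      then have "UNIV \<subseteq> {undefined :: 'n}" by auto
      then have "CARD('n) \<le> card {undefined :: 'n}" by (rule card_mono[rotated]) simp
      then show False using n by simp
    qed
    then show thesis using that by blast
  qed
  moreover have "(\<lambda>k. if k = i then -1 else 0) \<in> (admissible_weights :: ('n \<Rightarrow> int) set)" by (simp add: admissible_weights_def)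
  ultimately have "contract c (\<lambda>k. if k = i then -1 else 0) l \<noteq> 0" using gen unfolding generic_def by auto
  then show False using 0 by simp
qed

theorem theorem2:
  assumes "CARD('n::finite) \<ge> 3"
  shows "irreducible_component
           (subtopology bivector_zariski (poisson_space :: 'n bivector set set))
           (bivector_zariski closure_of diagonal_poisson_space)"
proof -
  let ?X = "bivector_zariski :: 'n bivector set topology" and ?D = "diagonal_poisson_space :: 'n bivector set set"
  let ?V = "bivector_fields :: 'n bivector set"
  interpret coordinatized bivector_scale ?V bivector_coord "grid_points \<times> (UNIV :: ('n \<times> 'n) set)"
    by (rule coordinatized_bivectors)
  have n2: "CARD('n) \<ge> 2" using assms by simp
  have "\<exists>c :: complex ^ 'n ^ 'n. transpose c = - c \<and> generic c" by (rule generic_exists)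
  then obtain c :: "complex ^ 'n ^ 'n" where c: "transpose c = - c" "generic c" by (elim exE conjE)
  let ?v0 = "diagonal_bivector (mat 1) (mat 1) c"
  have v0nz: "?v0 \<noteq> 0" by (rule generic_diagonal_nonzero[OF n2 c(2)])
  have v0V: "?v0 \<in> ?V" unfolding diagonal_bivector_def by (rule field_bivector_in_bivector_fields[OF c(1)])
  have "is_diagonal_poisson ?v0" by (rule is_diagonal_poisson_diagonal_bivector[OF _ _ c(1)]) simp_all
  then have v0D: "proj_class bivector_scale ?v0 \<in> ?D" using v0nz unfolding diagonal_poisson_space_def by blast
  obtain G :: "(complex ^ 'n) set" where G: "finite G \<and> G \<subseteq> torus \<and>
    (\<forall>c u. (\<forall>x\<in>G. (\<Sum>u\<in>admissible_weights. c u * laurent_monomial u x) = 0) \<longrightarrow> u \<in> admissible_weights \<longrightarrow> c u = (0::complex))"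
    using laurent_monomials_test_set[OF finite_admissible_weights] by (rule exE)
  have Gt: "G \<subseteq> torus" and Gf: "finite G" using G by simp_all
  have Gz: "f u = 0" if "\<forall>x\<in>G. (\<Sum>u\<in>admissible_weights. f u * laurent_monomial u x) = 0" "u \<in> admissible_weights" for f u
    using conjunct2[OF conjunct2[OF G], rule_format, of f u] that by simp
  have Dsub: "?D \<subseteq> poisson_space"
    unfolding diagonal_poisson_space_def poisson_space_def by (auto simp: is_diagonal_poisson_def)
  have Psub: "poisson_space \<subseteq> projectivization bivector_scale ?V"
    unfolding poisson_space_def projectivization_def by (auto simp: is_poisson_def)
  have DC: "?D \<subseteq> ?X closure_of ?D"
    by (rule closure_of_subset) (use Dsub Psub in \<open>simp add: bivector_zariski_def topspace_zariski\<close>)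
  define b where "b = (\<lambda>(x, i, j, m) (\<sigma> :: 'n bivector) (\<tau> :: 'n bivector). schouten (\<sigma> None) (\<tau> None) x i j m)"
  show ?thesis
    unfolding bivector_zariski_def
  proof (rule irreducible_component_criterion[where b = b and A = "G \<times> (UNIV :: ('n \<times> 'n \<times> 'n) set)" and ?v0.0 = ?v0], unfold bivector_zariski_def[symmetric])
    show "poisson_space \<subseteq> projectivization bivector_scale ?V" by (rule Psub)
    show "?X closure_of ?D \<subseteq> poisson_space" by (rule closure_of_minimal[OF Dsub closedin_poisson_space])
    show "closedin ?X (?X closure_of ?D)" by (rule closedin_closure_of)
    show "irreducible_space (subtopology ?X (?X closure_of ?D))"
      by (rule irreducible_diagonal_closure[OF n2]) (use v0D in auto)
    show "finite (G \<times> (UNIV :: ('n \<times> 'n \<times> 'n) set))" using Gf by simp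
    show "lin (b a u)" for a u
      unfolding lin_def b_def case_prod_beta by (simp add: schouten_add schouten_scale del: plus_fun_apply)
    show "b a u v = b a v u" for a u v unfolding b_def case_prod_beta by (rule schouten_commute)
    show "?v0 \<in> ?V - {0}" using v0V v0nz by simp
    show "proj_class bivector_scale ?v0 \<in> ?X closure_of ?D" using v0D DC by auto
    show "b a v v = 0" if "v \<in> ?V - {0}" "proj_class bivector_scale v \<in> poisson_space" for a v
    proof -
      let ?F = "range (\<lambda>(k, x, i, j, m) (\<sigma> :: 'n bivector). schouten (\<sigma> k) (\<sigma> k) x i j m)"
      have F: "?F \<subseteq> homogeneous_polynomials bivector_scale ?V" by (auto simp: schouten_square_homogeneous)
      have "\<forall>p\<in>?F. p v = 0"
        using that(2) unfolding poisson_space_zero_locus proj_class_in_zero_locus[OF vector_space_bivector_scale F that(1)] .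
      then show ?thesis unfolding b_def case_prod_beta by auto
    qed
    fix w assume w: "w \<in> ?V" "\<forall>a\<in>G \<times> UNIV. b a ?v0 w = 0"
    have t: "schouten (?v0 None) (w None) x i j m = 0" if "x \<in> G" for x i j m
      using w(2)[rule_format, of "(x, i, j, m)"] that by (simp add: b_def)
    have shape: "\<exists>X c'. transpose c' = - c' \<and> (\<forall>x\<in>torus. \<forall>i j. w None x $ i $ j = x $ i * x $ j * (c' $ i $ j +
    (\<Sum>q\<in>UNIV. X $ fst q $ snd q * (contract c (root_weight (fst q) (snd q)) i * log_vector (fst q) j -
       contract c (root_weight (fst q) (snd q)) j * log_vector (fst q) i) * laurent_monomial (root_weight (fst q) (snd q)) x)))"
    proof (rule tangent_vector_shape[where G = G, OF assms c(2,1) w(1) Gt])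
      fix f and u :: "'n \<Rightarrow> int" assume "\<forall>x\<in>G. (\<Sum>u\<in>admissible_weights. f u * laurent_monomial u x) = 0" "u \<in> admissible_weights"
      then show "f u = 0" by (rule Gz)
    next
      fix x i j m assume "x \<in> G"
      then show "schouten (?v0 None) (w None) x i j m = 0" by (rule t)
    qed
    from shape obtain X c' where Xc: "transpose c' = - c'"
      "\<forall>x\<in>torus. \<forall>i j. w None x $ i $ j = x $ i * x $ j * (c' $ i $ j +
    (\<Sum>q\<in>UNIV. X $ fst q $ snd q * (contract c (root_weight (fst q) (snd q)) i * log_vector (fst q) j -
       contract c (root_weight (fst q) (snd q)) j * log_vector (fst q) i) * laurent_monomial (root_weight (fst q) (snd q)) x))"
      by (elim exE conjE)
    have "\<exists>\<gamma> s. (\<forall>n. \<gamma> n \<in> ?V - {0} \<and> proj_class bivector_scale (\<gamma> n) \<in> ?D \<and> s n \<noteq> 0) \<and>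
      s \<longlonglongrightarrow> 0 \<and> (\<forall>i\<in>grid_points \<times> UNIV. (\<lambda>n::nat. (bivector_coord i (\<gamma> n) - bivector_coord i ?v0) / s n) \<longlonglongrightarrow> bivector_coord i w)"
    proof (rule tangent_arc[where X = X and c' = c' and \<tau> = w, OF c(1) Xc(1) v0nz])
      fix x :: "complex ^ 'n" and i j assume "x \<in> torus"
      then show "w None x $ i $ j = x $ i * x $ j * (c' $ i $ j +
        (\<Sum>q\<in>UNIV. X $ fst q $ snd q * (contract c (root_weight (fst q) (snd q)) i * log_vector (fst q) j -
           contract c (root_weight (fst q) (snd q)) j * log_vector (fst q) i) * laurent_monomial (root_weight (fst q) (snd q)) x))"
        by (rule Xc(2)[THEN bspec, THEN spec, THEN spec])
    qed
    then obtain \<gamma> s where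
      "(\<forall>n. \<gamma> n \<in> ?V - {0} \<and> proj_class bivector_scale (\<gamma> n) \<in> ?D \<and> s n \<noteq> 0) \<and>
      s \<longlonglongrightarrow> 0 \<and> (\<forall>i\<in>grid_points \<times> UNIV. (\<lambda>n::nat. (bivector_coord i (\<gamma> n) - bivector_coord i ?v0) / s n) \<longlonglongrightarrow> bivector_coord i w)"
      by (elim exE)
    then show "\<exists>\<gamma> s. (\<forall>n. \<gamma> n \<in> ?V - {0} \<and> proj_class bivector_scale (\<gamma> n) \<in> ?X closure_of ?D \<and> s n \<noteq> 0) \<and>
      s \<longlonglongrightarrow> 0 \<and> (\<forall>i\<in>grid_points \<times> UNIV. (\<lambda>n::nat. (bivector_coord i (\<gamma> n) - bivector_coord i ?v0) / s n) \<longlonglongrightarrow> bivector_coord i w)"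
      using DC by (intro exI[of _ \<gamma>] exI[of _ s]) auto
  qed
qed

end
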